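(* Assume $\mathsf{ZF}$. Let $\lambda$ be a limit ordinal and $j:V_\lambda\to V_\lambda$ be $\Sigma_1$-elementary. Then the set $\widetilde{j}=\{j\restriction V_\alpha:\alpha<\lambda\}$ is not $\Sigma_1$-definable from parameters over $\mathcal{J}(V_\lambda)$.
   Context: $\mathcal{J}(V_\lambda)$ is the rudimentary closure of $V_\lambda\cup\{V_\lambda\}$ (the first level of Jensen's hierarchy over $V_\lambda$); its subsets of $V_\lambda$ are exactly those definable from parameters over $V_\lambda$.
   Formalization: The embedding j is additionally assumed not to be the identity; for j = id the set {id↾V_α : α<λ} is definable over V_λ, hence an element of J(V_λ) and Σ1-definable from itself, so the claim fails there. *)

theory Defs
  imports Main
begin

text \<open>
  Choice must not be assumed, but in HOL a set-theoretic universe satisfying Replacement for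
  arbitrary HOL functions satisfies AC, because of Hilbert's choice operator.
  Hence "Assume ZF" is rendered as: let \<open>mem\<close> be an arbitrary model, on an arbitrary type, of
  first-order ZF, with the Separation and Replacement schemas restricted to first-order formulas
  with parameters. All further notions are those of the model: they quantify over its elements
  only, and formulas of the set structures occurring in the theorem are coded by elements of the
  model, so that the omega of the model need not be standard.
\<close>

datatype fm = FMem nat nat | FEq nat nat | FNeg fm | FConj fm fm | FEx nat fm

primrec fm_sat :: "('a \<Rightarrow> 'a \<Rightarrow> bool) \<Rightarrow> fm \<Rightarrow> (nat \<Rightarrow> 'a) \<Rightarrow> bool" where
  "fm_sat mem (FMem i j) s = mem (s i) (s j)"
| "fm_sat mem (FEq i j) s = (s i = s j)"
| "fm_sat mem (FNeg \<phi>) s = (\<not> fm_sat mem \<phi> s)"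
| "fm_sat mem (FConj \<phi> \<psi>) s = (fm_sat mem \<phi> s \<and> fm_sat mem \<psi> s)"
| "fm_sat mem (FEx n \<phi>) s = (\<exists>x. fm_sat mem \<phi> (s(n := x)))"

locale ZF =
  fixes mem :: "'a \<Rightarrow> 'a \<Rightarrow> bool" (infix "\<epsilon>" 50)
  assumes extensionality: "(\<And>z. z \<epsilon> x \<longleftrightarrow> z \<epsilon> y) \<Longrightarrow> x = y"
    and foundation: "y \<epsilon> x \<Longrightarrow> \<exists>m. m \<epsilon> x \<and> \<not> (\<exists>z. z \<epsilon> x \<and> z \<epsilon> m)"
    and pairing: "\<exists>z. \<forall>w. w \<epsilon> z \<longleftrightarrow> w = x \<or> w = y"
    and union: "\<exists>z. \<forall>w. w \<epsilon> z \<longleftrightarrow> (\<exists>y. y \<epsilon> x \<and> w \<epsilon> y)"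
    and power_set: "\<exists>z. \<forall>w. w \<epsilon> z \<longleftrightarrow> (\<forall>v. v \<epsilon> w \<longrightarrow> v \<epsilon> x)"
    and infinity: "\<exists>I. (\<exists>e. e \<epsilon> I \<and> (\<forall>x. \<not> x \<epsilon> e)) \<and>
      (\<forall>x. x \<epsilon> I \<longrightarrow> (\<exists>y. y \<epsilon> I \<and> (\<forall>z. z \<epsilon> y \<longleftrightarrow> z \<epsilon> x \<or> z = x)))"
    and separation: "\<exists>z. \<forall>x. x \<epsilon> z \<longleftrightarrow> x \<epsilon> a \<and> fm_sat mem \<phi> (s(0 := x))"
    and replacement: "(\<And>x. x \<epsilon> a \<Longrightarrow> \<exists>!y. fm_sat mem \<phi> (s(0 := x, 1 := y))) \<Longrightarrow>
      \<exists>z. \<forall>y. y \<epsilon> z \<longleftrightarrow> (\<exists>x. x \<epsilon> a \<and> fm_sat mem \<phi> (s(0 := x, 1 := y)))"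

context
  fixes mem :: "'a \<Rightarrow> 'a \<Rightarrow> bool" (infix "\<epsilon>" 50)
begin

subsection \<open>Basic set theory\<close>

text \<open>\<open>coll P\<close> is only meaningful if the class \<open>P\<close> is a set of the model; ZF ensures this in all
  uses below.\<close>

definition coll :: "('a \<Rightarrow> bool) \<Rightarrow> 'a" where
  "coll P = (THE z. \<forall>x. x \<epsilon> z \<longleftrightarrow> P x)"

definition subset :: "'a \<Rightarrow> 'a \<Rightarrow> bool" where
  "subset x y \<longleftrightarrow> (\<forall>z. z \<epsilon> x \<longrightarrow> z \<epsilon> y)"

definition empty :: 'a where
  "empty = coll (\<lambda>x. False)"

definition upair :: "'a \<Rightarrow> 'a \<Rightarrow> 'a" where
  "upair x y = coll (\<lambda>z. z = x \<or> z = y)"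

definition kpair :: "'a \<Rightarrow> 'a \<Rightarrow> 'a" where
  "kpair x y = upair (upair x x) (upair x y)"

definition diff :: "'a \<Rightarrow> 'a \<Rightarrow> 'a" where
  "diff x y = coll (\<lambda>z. z \<epsilon> x \<and> \<not> z \<epsilon> y)"

definition succ :: "'a \<Rightarrow> 'a" where
  "succ x = coll (\<lambda>z. z \<epsilon> x \<or> z = x)"

definition maps :: "'a \<Rightarrow> 'a \<Rightarrow> 'a \<Rightarrow> bool" where
  "maps f a b \<longleftrightarrow>
    (\<forall>p. p \<epsilon> f \<longrightarrow> (\<exists>x y. x \<epsilon> a \<and> y \<epsilon> b \<and> p = kpair x y)) \<and>
    (\<forall>x. x \<epsilon> a \<longrightarrow> (\<exists>!y. kpair x y \<epsilon> f))"

definition app :: "'a \<Rightarrow> 'a \<Rightarrow> 'a" where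
  "app f x = (THE y. kpair x y \<epsilon> f)"

definition restr :: "'a \<Rightarrow> 'a \<Rightarrow> 'a" where
  "restr f a = coll (\<lambda>p. p \<epsilon> f \<and> (\<exists>x y. x \<epsilon> a \<and> p = kpair x y))"

definition compose :: "'a \<Rightarrow> 'a \<Rightarrow> 'a" where
  "compose g f = coll (\<lambda>p. \<exists>x y. kpair x y \<epsilon> f \<and> p = kpair x (app g y))"

definition update :: "'a \<Rightarrow> 'a \<Rightarrow> 'a \<Rightarrow> 'a" where
  "update f x y = coll (\<lambda>p. (p \<epsilon> f \<and> (\<forall>z. p \<noteq> kpair x z)) \<or> p = kpair x y)"


subsection \<open>Ordinals and the cumulative hierarchy\<close>

definition transitive :: "'a \<Rightarrow> bool" where
  "transitive x \<longleftrightarrow> (\<forall>y. y \<epsilon> x \<longrightarrow> subset y x)"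

definition ordinal :: "'a \<Rightarrow> bool" where
  "ordinal x \<longleftrightarrow> transitive x \<and> (\<forall>y. y \<epsilon> x \<longrightarrow> transitive y)"

definition limit_ordinal :: "'a \<Rightarrow> bool" where
  "limit_ordinal x \<longleftrightarrow> ordinal x \<and> empty \<epsilon> x \<and> (\<forall>y. y \<epsilon> x \<longrightarrow> succ y \<epsilon> x)"

definition omega :: 'a where
  "omega = coll (\<lambda>n. \<forall>I. empty \<epsilon> I \<and> (\<forall>x. x \<epsilon> I \<longrightarrow> succ x \<epsilon> I) \<longrightarrow> n \<epsilon> I)"

primrec numeral_set :: "nat \<Rightarrow> 'a" where
  "numeral_set 0 = empty"
| "numeral_set (Suc n) = succ (numeral_set n)"

text \<open>\<open>V\<^sub>\<alpha>\<close> is the union of the power sets of the \<open>V\<^sub>\<beta>\<close> for \<open>\<beta> < \<alpha>\<close>; here \<open>f\<close> is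
  the function \<open>\<beta> \<mapsto> V\<^sub>\<beta>\<close> on \<open>\<alpha> + 1\<close>.\<close>

definition vset :: "'a \<Rightarrow> 'a" where
  "vset \<alpha> = (THE v. \<exists>f b. maps f (succ \<alpha>) b \<and>
     (\<forall>\<beta>. \<beta> \<epsilon> succ \<alpha> \<longrightarrow>
       (\<forall>x. x \<epsilon> app f \<beta> \<longleftrightarrow> (\<exists>\<gamma>. \<gamma> \<epsilon> \<beta> \<and> subset x (app f \<gamma>)))) \<and>
     v = app f \<alpha>)"


subsection \<open>Coded formulas and satisfaction in set structures\<close>

text \<open>The variables are \<open>v\<^sub>i\<close> with \<open>i \<in> \<omega>\<close>, both taken in the model.\<close>

definition code_Mem :: "'a \<Rightarrow> 'a \<Rightarrow> 'a" where
  "code_Mem i j = kpair (numeral_set 0) (kpair i j)"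

definition code_Eq :: "'a \<Rightarrow> 'a \<Rightarrow> 'a" where
  "code_Eq i j = kpair (numeral_set 1) (kpair i j)"

definition code_Neg :: "'a \<Rightarrow> 'a" where
  "code_Neg p = kpair (numeral_set 2) p"

definition code_Conj :: "'a \<Rightarrow> 'a \<Rightarrow> 'a" where
  "code_Conj p q = kpair (numeral_set 3) (kpair p q)"

definition code_Ex :: "'a \<Rightarrow> 'a \<Rightarrow> 'a" where
  "code_Ex i p = kpair (numeral_set 4) (kpair i p)"

text \<open>Inductively generated sets of codes are intersections of all sets of the model having the
  relevant closure properties; an inductive definition in HOL would only yield the codes of
  standard formulas.\<close>

definition formula :: "'a \<Rightarrow> bool" where
  "formula p \<longleftrightarrow> (\<forall>X.
     (\<forall>i k. i \<epsilon> omega \<and> k \<epsilon> omega \<longrightarrow> code_Mem i k \<epsilon> X \<and> code_Eq i k \<epsilon> X) \<and>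
     (\<forall>q. q \<epsilon> X \<longrightarrow> code_Neg q \<epsilon> X) \<and>
     (\<forall>q r. q \<epsilon> X \<and> r \<epsilon> X \<longrightarrow> code_Conj q r \<epsilon> X) \<and>
     (\<forall>i q. i \<epsilon> omega \<and> q \<epsilon> X \<longrightarrow> code_Ex i q \<epsilon> X)
     \<longrightarrow> p \<epsilon> X)"

definition Delta0_formula :: "'a \<Rightarrow> bool" where
  "Delta0_formula p \<longleftrightarrow> (\<forall>X.
     (\<forall>i k. i \<epsilon> omega \<and> k \<epsilon> omega \<longrightarrow> code_Mem i k \<epsilon> X \<and> code_Eq i k \<epsilon> X) \<and>
     (\<forall>q. q \<epsilon> X \<longrightarrow> code_Neg q \<epsilon> X) \<and>
     (\<forall>q r. q \<epsilon> X \<and> r \<epsilon> X \<longrightarrow> code_Conj q r \<epsilon> X) \<and>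
     (\<forall>i k q. i \<epsilon> omega \<and> k \<epsilon> omega \<and> i \<noteq> k \<and> q \<epsilon> X \<longrightarrow>
        code_Ex i (code_Conj (code_Mem i k) q) \<epsilon> X)
     \<longrightarrow> p \<epsilon> X)"

definition Sigma1_formula :: "'a \<Rightarrow> bool" where
  "Sigma1_formula p \<longleftrightarrow> (\<forall>X.
     (\<forall>q. Delta0_formula q \<longrightarrow> q \<epsilon> X) \<and>
     (\<forall>i q. i \<epsilon> omega \<and> q \<epsilon> X \<longrightarrow> code_Ex i q \<epsilon> X)
     \<longrightarrow> p \<epsilon> X)"

text \<open>\<open>S\<close> is a Tarskian satisfaction relation, consisting of pairs of formulas and assignments,
  for the structure on the set \<open>A\<close> whose relation is true membership. Assignments are total
  functions from \<open>\<omega>\<close> to \<open>A\<close> in the model.\<close>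

definition satisfaction_rel :: "'a \<Rightarrow> 'a \<Rightarrow> bool" where
  "satisfaction_rel A S \<longleftrightarrow> (\<forall>s. maps s omega A \<longrightarrow>
     (\<forall>i k. i \<epsilon> omega \<and> k \<epsilon> omega \<longrightarrow>
        (kpair (code_Mem i k) s \<epsilon> S \<longleftrightarrow> app s i \<epsilon> app s k) \<and>
        (kpair (code_Eq i k) s \<epsilon> S \<longleftrightarrow> app s i = app s k)) \<and>
     (\<forall>p. formula p \<longrightarrow> (kpair (code_Neg p) s \<epsilon> S \<longleftrightarrow> \<not> kpair p s \<epsilon> S)) \<and>
     (\<forall>p q. formula p \<and> formula q \<longrightarrow>
        (kpair (code_Conj p q) s \<epsilon> S \<longleftrightarrow> kpair p s \<epsilon> S \<and> kpair q s \<epsilon> S)) \<and>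
     (\<forall>i p. i \<epsilon> omega \<and> formula p \<longrightarrow>
        (kpair (code_Ex i p) s \<epsilon> S \<longleftrightarrow> (\<exists>a. a \<epsilon> A \<and> kpair p (update s i a) \<epsilon> S))))"

definition satisfies :: "'a \<Rightarrow> 'a \<Rightarrow> 'a \<Rightarrow> bool" where
  "satisfies A p s \<longleftrightarrow> (\<exists>S. satisfaction_rel A S \<and> kpair p s \<epsilon> S)"

definition Sigma1_elementary :: "'a \<Rightarrow> 'a \<Rightarrow> 'a \<Rightarrow> bool" where
  "Sigma1_elementary A B j \<longleftrightarrow> maps j A B \<and>
     (\<forall>p s. Sigma1_formula p \<and> maps s omega A \<longrightarrow>
        (satisfies A p s \<longleftrightarrow> satisfies B p (compose j s)))"

text \<open>The defined set is given by the variable \<open>v\<^sub>0\<close>; the assignment \<open>s\<close> supplies the parameters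
  for the other (finitely many) free variables of the formula.\<close>

definition Sigma1_definable_from_parameters :: "'a \<Rightarrow> 'a \<Rightarrow> bool" where
  "Sigma1_definable_from_parameters N X \<longleftrightarrow> (\<exists>p s. Sigma1_formula p \<and> maps s omega N \<and>
     (\<forall>x. x \<epsilon> X \<longleftrightarrow> x \<epsilon> N \<and> satisfies N p (update s empty x)))"


subsection \<open>Rudimentary functions\<close>

text \<open>Rudimentary functions are class functions, hence they form a schema over the (standard)
  natural numbers. An \<open>n\<close>-ary function is represented on lists of length \<open>n\<close>.\<close>

inductive rudimentary :: "nat \<Rightarrow> ('a list \<Rightarrow> 'a) \<Rightarrow> bool" where
  proj: "i < n \<Longrightarrow> rudimentary n (\<lambda>xs. xs ! i)"
| diff: "i < n \<Longrightarrow> k < n \<Longrightarrow> rudimentary n (\<lambda>xs. diff (xs ! i) (xs ! k))"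
| upair: "i < n \<Longrightarrow> k < n \<Longrightarrow> rudimentary n (\<lambda>xs. upair (xs ! i) (xs ! k))"
| comp: "rudimentary (length Hs) G \<Longrightarrow> (\<And>H. H \<in> set Hs \<Longrightarrow> rudimentary n H) \<Longrightarrow>
    rudimentary n (\<lambda>xs. G (map (\<lambda>H. H xs) Hs))"
| union: "rudimentary (Suc n) G \<Longrightarrow>
    rudimentary (Suc n) (\<lambda>xs. coll (\<lambda>w. \<exists>z. z \<epsilon> hd xs \<and> w \<epsilon> G (z # tl xs)))"

definition rud_closed :: "'a \<Rightarrow> bool" where
  "rud_closed Y \<longleftrightarrow> (\<forall>n F xs. rudimentary n F \<and> length xs = n \<and> (\<forall>x \<in> set xs. x \<epsilon> Y)
     \<longrightarrow> F xs \<epsilon> Y)"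

definition rud_closure :: "'a \<Rightarrow> 'a" where
  "rud_closure U = (THE Y. subset U Y \<and> rud_closed Y \<and>
     (\<forall>Z. subset U Z \<and> rud_closed Z \<longrightarrow> subset Y Z))"

text \<open>Note that \<open>succ x\<close> is \<open>x \<union> {x}\<close> for every set \<open>x\<close>.\<close>

definition J :: "'a \<Rightarrow> 'a" where
  "J x = rud_closure (succ x)"

definition restrictions :: "'a \<Rightarrow> 'a \<Rightarrow> 'a" where
  "restrictions l j = coll (\<lambda>y. \<exists>\<alpha>. \<alpha> \<epsilon> l \<and> y = restr j (vset \<alpha>))"

end

end

theory Submission
  imports Defs
begin

text \<open>
  Let \<open>V = V\<^sub>\<lambda>\<close>. An embedding is a map \<open>V \<rightarrow> V\<close> that preserves membership, power sets and finitely many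
  basic operations; \<open>\<Sigma>\<^sub>1\<close>-elementary maps are embeddings. An embedding \<open>k\<close> acts on the subclasses of
  \<open>V\<close> by \<open>k \<cdot> B = \<Union>{k(b) : b \<in> V, b \<subseteq> B}\<close>. Call \<open>k\<close> good if this action commutes with projections; then
  \<open>k\<close> is fully elementary from \<open>(V, B)\<close> to \<open>(V, k \<cdot> B)\<close> for all \<open>B\<close>. Call \<open>B\<close> invariant if \<open>k \<cdot> B = B\<close> for
  all good \<open>k\<close>. The finite levels of \<open>J(V)\<close> are coded by invariant relations on \<open>V\<close>, and their
  satisfaction relations are the unique solutions of Tarski's clauses, hence invariant. So every
  subset of \<open>V\<close> that is \<open>\<Sigma>\<^sub>1\<close>-definable over \<open>J(V)\<close> is a section \<open>C\<^sub>q\<close> of an invariant \<open>C\<close>.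

  If the set of restrictions of \<open>j\<close> were definable, then \<open>j\<close> and all its iterates \<open>j\<^sub>0 = j\<close>,
  \<open>j\<^sub>n\<^sub>+\<^sub>1 = j \<cdot> j\<^sub>n\<close> would be such sections. Some iterate is good: goodness follows from fixing the
  rank of one point of one well-founded relation in \<open>V\<close>, and each such rank is fixed by some \<open>j\<^sub>n\<close>.
  Fix such an iterate \<open>j\<^sub>n = C\<^sub>q\<close> and let \<open>Z\<close> be the set of all \<open>z \<in> V\<close> that are moved by some embedding
  \<open>C\<^sub>p\<close> fixing that rank. As \<open>Z\<close> is first-order definable over \<open>(V, C)\<close>, it is preserved by all these
  \<open>C\<^sub>p\<close>. If \<open>z\<close> is \<open>\<in>\<close>-minimal in \<open>Z\<close> and moved by \<open>C\<^sub>p\<close>, then neither \<open>z\<close> nor \<open>C\<^sub>p(z)\<close> has an element in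
  \<open>Z\<close>, so \<open>C\<^sub>p\<close> fixes all these elements and \<open>C\<^sub>p(z) = z\<close>, a contradiction.
\<close>

text \<open>The obstacle is that a Sigma_1-elementary map need not be elementary for
  (\<open>V\<close>, B). Only projections can go wrong: the witnesses for the elements of one set c
  may have ranks unbounded in l, so that no element of \<open>V\<close> collects them. This can
  happen only if some map f from an element a of \<open>V\<close> to l is unbounded. The
  well-founded relation of the overview then is a, ordered by the values of f, with one point on
  top. If k fixes the rank of that point, the points k(w) with w in a remain cofinal in k(a), and
  witnesses for the elements of k(c) are found in the images of the levels f(w). Invariance takes
  the place of definability because formulas of the model may be non-standard: satisfaction over a
  level is then not given by any first-order formula of HOL, yet every good embedding respects it.
  For the same reason inductions along the natural numbers and the formulas of the model are
  restricted to definable properties.\<close>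

named_theorems fo_intros
named_theorems D_intros

context ZF
begin

notation mem (infix "\<E>" 50)

abbreviation sub :: "'a \<Rightarrow> 'a \<Rightarrow> bool" (infix "\<sqsubseteq>" 50) where "x \<sqsubseteq> y \<equiv> subset mem x y"
abbreviation pair :: "'a \<Rightarrow> 'a \<Rightarrow> 'a" ("\<langle>_,/ _\<rangle>") where "\<langle>x, y\<rangle> \<equiv> kpair mem x y"
abbreviation "Coll \<equiv> coll mem"
abbreviation "emp \<equiv> empty mem"
abbreviation "up \<equiv> upair mem"
abbreviation "dif \<equiv> diff mem"
abbreviation "suc \<equiv> succ mem"

lemma subD: "x \<sqsubseteq> y \<Longrightarrow> z \<E> x \<Longrightarrow> z \<E> y"
  by (auto simp: subset_def)

lemma subI: "(\<And>z. z \<E> x \<Longrightarrow> z \<E> y) \<Longrightarrow> x \<sqsubseteq> y"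
  by (auto simp: subset_def)

lemma sub_refl [simp]: "x \<sqsubseteq> x"
  by (simp add: subset_def)

lemma sub_trans: "x \<sqsubseteq> y \<Longrightarrow> y \<sqsubseteq> z \<Longrightarrow> x \<sqsubseteq> z"
  by (auto simp: subset_def)

lemma sub_antisym: "x \<sqsubseteq> y \<Longrightarrow> y \<sqsubseteq> x \<Longrightarrow> x = y"
  by (rule extensionality) (auto simp: subset_def)

text \<open>Predicates of assignments that are first-order over the class \<open>A\<close>, with de Bruijn
  indices: the argument of a quantifier is pushed in front of the assignment. The second predicate
  of a pair results from the first one by changing the domain \<open>A\<close> into \<open>A'\<close> and the unary
  predicates \<open>u\<close> into \<open>u'\<close>.\<close>

inductive fo :: "('a \<Rightarrow> bool) \<Rightarrow> ('a \<Rightarrow> bool) \<Rightarrow> ('a \<Rightarrow> 'a \<Rightarrow> bool) \<Rightarrow>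
    ((nat \<Rightarrow> 'a) \<Rightarrow> bool) \<Rightarrow> ((nat \<Rightarrow> 'a) \<Rightarrow> bool) \<Rightarrow> bool" for A A' U where
  fo_mem: "fo A A' U (\<lambda>e. e i \<E> e k) (\<lambda>e. e i \<E> e k)"
| fo_pred: "U u u' \<Longrightarrow> fo A A' U (\<lambda>e. e i \<E> u) (\<lambda>e. e i \<E> u')"
| fo_neg: "fo A A' U P P' \<Longrightarrow> fo A A' U (\<lambda>e. \<not> P e) (\<lambda>e. \<not> P' e)"
| fo_conj: "fo A A' U P P' \<Longrightarrow> fo A A' U Q Q' \<Longrightarrow> fo A A' U (\<lambda>e. P e \<and> Q e) (\<lambda>e. P' e \<and> Q' e)"
| fo_ex0: "fo A A' U P P' \<Longrightarrow> fo A A' U (\<lambda>e. \<exists>x. A x \<and> P (case_nat x e)) (\<lambda>e. \<exists>x. A' x \<and> P' (case_nat x e))"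
| fo_cong: "fo A A' U P P' \<Longrightarrow> (\<And>e. (\<And>i. A (e i)) \<Longrightarrow> P e = Q e) \<Longrightarrow>
    (\<And>e. (\<And>i. A' (e i)) \<Longrightarrow> P' e = Q' e) \<Longrightarrow> fo A A' U Q Q'"

lemma fo_rename: "fo A A' U P P' \<Longrightarrow> fo A A' U (\<lambda>e. P (\<lambda>i. e (s i))) (\<lambda>e. P' (\<lambda>i. e (s i)))"
proof (induction arbitrary: s rule: fo.induct)
  case (fo_ex0 P P')
  have *: "(\<lambda>i. case_nat x e (case_nat 0 (\<lambda>n. Suc (s n)) i)) = case_nat x (\<lambda>i. e (s i))" for x and e :: "nat \<Rightarrow> 'a"
    by (auto split: nat.split)
  show ?case
    using fo.fo_ex0[OF fo_ex0.IH[of "case_nat 0 (\<lambda>n. Suc (s n))"]] unfolding * .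
next
  case (fo_cong P P' Q Q')
  show ?case by (rule fo.fo_cong[OF fo_cong.IH[of s]]) (simp_all add: fo_cong.hyps)
qed (auto intro: fo.intros)

lemma case_nat_tail [simp]: "case_nat (e 0) (\<lambda>n. e (Suc n)) = e"
  by (auto split: nat.split)

lemma fo_ex:
  assumes "fo A A' U (\<lambda>e. P (\<lambda>n. e (Suc n)) (e 0)) (\<lambda>e. P' (\<lambda>n. e (Suc n)) (e 0))"
  shows "fo A A' U (\<lambda>e. \<exists>x. A x \<and> P e x) (\<lambda>e. \<exists>x. A' x \<and> P' e x)"
  using fo_ex0[OF assms] by simp

lemma fo_all:
  assumes "fo A A' U (\<lambda>e. P (\<lambda>n. e (Suc n)) (e 0)) (\<lambda>e. P' (\<lambda>n. e (Suc n)) (e 0))"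
  shows "fo A A' U (\<lambda>e. \<forall>x. A x \<longrightarrow> P e x) (\<lambda>e. \<forall>x. A' x \<longrightarrow> P' e x)"
  by (rule fo_cong[OF fo_neg[OF fo_ex[OF fo_neg[OF assms]]]]) auto

lemma fo_disj:
  assumes "fo A A' U P P'" "fo A A' U Q Q'"
  shows "fo A A' U (\<lambda>e. P e \<or> Q e) (\<lambda>e. P' e \<or> Q' e)"
  by (rule fo_cong[OF fo_neg[OF fo_conj[OF fo_neg[OF assms(1)] fo_neg[OF assms(2)]]]]) blast+

lemma fo_imp:
  assumes "fo A A' U P P'" "fo A A' U Q Q'"
  shows "fo A A' U (\<lambda>e. P e \<longrightarrow> Q e) (\<lambda>e. P' e \<longrightarrow> Q' e)"
  by (rule fo_cong[OF fo_neg[OF fo_conj[OF assms(1) fo_neg[OF assms(2)]]]]) blast+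

lemma fo_iff:
  assumes "fo A A' U P P'" "fo A A' U Q Q'"
  shows "fo A A' U (\<lambda>e. P e \<longleftrightarrow> Q e) (\<lambda>e. P' e \<longleftrightarrow> Q' e)"
  by (rule fo_cong[OF fo_conj[OF fo_imp[OF assms] fo_imp[OF assms(2,1)]]]) blast+

lemma fo_const: "fo A A' U (\<lambda>e. b) (\<lambda>e. b)"
proof -
  have "fo A A' U (\<lambda>e. e 0 \<E> e 0 \<and> \<not> e 0 \<E> e 0) (\<lambda>e. e 0 \<E> e 0 \<and> \<not> e 0 \<E> e 0)"
    by (intro fo_neg fo_conj fo_mem)
  then have 1: "fo A A' U (\<lambda>e. False) (\<lambda>e. False)" by (rule fo_cong) auto
  show ?thesis
  proof (cases b)
    case True
    show ?thesis by (rule fo_cong[OF fo_neg[OF 1]]) (auto simp: True)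
  next
    case False
    show ?thesis by (rule fo_cong[OF 1]) (auto simp: False)
  qed
qed

text \<open>For conjunctions indexed by a finite set of HOL objects, such as \<open>ops\<close>,
  over which the quantifiers of \<open>fo\<close> cannot range.\<close>

lemma fo_Ball: "finite F \<Longrightarrow> (\<And>f. f \<in> F \<Longrightarrow> fo A A' U (P f) (P' f)) \<Longrightarrow>
  fo A A' U (\<lambda>e. \<forall>f\<in>F. P f e) (\<lambda>e. \<forall>f\<in>F. P' f e)"
proof (induction F rule: finite_induct)
  case empty
  show ?case by (rule fo_cong[OF fo_const[where b=True]]) auto
next
  case (insert x F)
  have "fo A A' U (\<lambda>e. P x e \<and> (\<forall>f\<in>F. P f e)) (\<lambda>e. P' x e \<and> (\<forall>f\<in>F. P' f e))"
    using insert by (intro fo_conj) auto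
  then show ?case by (rule fo_cong) auto
qed

lemmas fo_logic = fo_neg fo_conj fo_ex fo_all fo_disj fo_imp fo_iff
declare fo_logic [fo_intros]

definition tra :: "('a \<Rightarrow> bool) \<Rightarrow> bool" where
  "tra A \<longleftrightarrow> (\<forall>x y. A y \<longrightarrow> x \<E> y \<longrightarrow> A x)"

text \<open>Equality is not an atomic case of \<open>fo\<close>. Over a transitive class it is
  extensionality with a quantifier restricted to the class, because elements of elements belong to
  the class.\<close>

lemma fo_eq:
  assumes "tra A" "tra A'"
  shows "fo A A' U (\<lambda>e. e i = e k) (\<lambda>e. e i = e k)"
proof -
  have "fo A A' U (\<lambda>e. \<forall>x. A x \<longrightarrow> (x \<E> e i \<longleftrightarrow> x \<E> e k)) (\<lambda>e. \<forall>x. A' x \<longrightarrow> (x \<E> e i \<longleftrightarrow> x \<E> e k))"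
    by (intro fo_all fo_iff fo_mem)
  then show ?thesis
    by (rule fo_cong; use assms in \<open>unfold tra_def, metis extensionality\<close>)
qed

text \<open>A term counts as definable if it preserves the class and its graph is in
  \<open>fo\<close>. In this way composite terms can occur although the atomic cases of
  \<open>fo\<close> only know variables.\<close>

definition foT :: "('a \<Rightarrow> bool) \<Rightarrow> ('a \<Rightarrow> bool) \<Rightarrow> ('a \<Rightarrow> 'a \<Rightarrow> bool) \<Rightarrow>
    ((nat \<Rightarrow> 'a) \<Rightarrow> 'a) \<Rightarrow> ((nat \<Rightarrow> 'a) \<Rightarrow> 'a) \<Rightarrow> bool" where
  "foT A A' U t t' \<longleftrightarrow> (\<forall>e. (\<forall>i. A (e i)) \<longrightarrow> A (t e)) \<and> (\<forall>e. (\<forall>i. A' (e i)) \<longrightarrow> A' (t' e)) \<and>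
     fo A A' U (\<lambda>e. e 0 = t (\<lambda>n. e (Suc n))) (\<lambda>e. e 0 = t' (\<lambda>n. e (Suc n)))"

lemma foT_var: "tra A \<Longrightarrow> tra A' \<Longrightarrow> foT A A' U (\<lambda>e. e i) (\<lambda>e. e i)"
  by (auto simp: foT_def intro: fo_eq)

text \<open>The value of the term is bound by an existential quantifier and described by its
  graph.\<close>

lemma fo_subst:
  assumes t: "foT A A' U t t'"
    and Q: "fo A A' U (\<lambda>e. Q (\<lambda>n. e (Suc n)) (e 0)) (\<lambda>e. Q' (\<lambda>n. e (Suc n)) (e 0))"
  shows "fo A A' U (\<lambda>e. Q e (t e)) (\<lambda>e. Q' e (t' e))"
proof -
  have "fo A A' U (\<lambda>e. \<exists>x. A x \<and> (x = t e \<and> Q e x)) (\<lambda>e. \<exists>x. A' x \<and> (x = t' e \<and> Q' e x))"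
    using t Q by (intro fo_ex fo_conj) (auto simp: foT_def)
  then show ?thesis
    by (rule fo_cong) (use t in \<open>auto simp: foT_def\<close>)
qed

lemma foT_weaken: "foT A A' U t t' \<Longrightarrow> foT A A' U (\<lambda>e. t (\<lambda>n. e (s n))) (\<lambda>e. t' (\<lambda>n. e (s n)))"
  using fo_rename[of A A' U "\<lambda>e. e 0 = t (\<lambda>n. e (Suc n))" "\<lambda>e. e 0 = t' (\<lambda>n. e (Suc n))" "case_nat 0 (\<lambda>n. Suc (s n))"]
  by (auto simp: foT_def)

lemma fo_subst2:
  assumes t: "foT A A' U t t'" and u: "foT A A' U u u'"
    and Q: "fo A A' U (\<lambda>e. Q (e 1) (e 0)) (\<lambda>e. Q' (e 1) (e 0))"
  shows "fo A A' U (\<lambda>e. Q (t e) (u e)) (\<lambda>e. Q' (t' e) (u' e))"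
  by (rule fo_subst[OF t], rule fo_subst[OF foT_weaken[OF u]])
    (use fo_rename[OF Q, of "id"] in simp)

lemma fo_subst1:
  assumes t: "foT A A' U t t'"
    and Q: "fo A A' U (\<lambda>e. Q (e 0)) (\<lambda>e. Q' (e 0))"
  shows "fo A A' U (\<lambda>e. Q (t e)) (\<lambda>e. Q' (t' e))"
  by (rule fo_subst[OF t]) (use Q in simp)

lemma fo_memT [fo_intros]: "foT A A' U x x' \<Longrightarrow> foT A A' U y y' \<Longrightarrow> fo A A' U (\<lambda>e. x e \<E> y e) (\<lambda>e. x' e \<E> y' e)"
  by (erule (1) fo_subst2) (rule fo_mem)

lemma fo_predT: "foT A A' U x x' \<Longrightarrow> U u u' \<Longrightarrow> fo A A' U (\<lambda>e. x e \<E> u) (\<lambda>e. x' e \<E> u')"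
  by (erule fo_subst1) (rule fo_pred)

lemma fo_eqT [fo_intros]:
  assumes x: "foT A A' U x x'" and y: "foT A A' U y y'" and "tra A" "tra A'"
  shows "fo A A' U (\<lambda>e. x e = y e) (\<lambda>e. x' e = y' e)"
  by (rule fo_subst2[OF x y]) (rule fo_eq[OF assms(3,4)])

lemma foT_graph2:
  assumes x: "foT A A' U x x'" and y: "foT A A' U y y'"
    and cl: "\<And>u v. A u \<Longrightarrow> A v \<Longrightarrow> A (f u v)" and cl': "\<And>u v. A' u \<Longrightarrow> A' v \<Longrightarrow> A' (f' u v)"
    and g: "fo A A' U (\<lambda>e. e 2 = f (e 1) (e 0)) (\<lambda>e. e 2 = f' (e 1) (e 0))"
  shows "foT A A' U (\<lambda>e. f (x e) (y e)) (\<lambda>e. f' (x' e) (y' e))"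
proof -
  have "fo A A' U (\<lambda>e. e 0 = f (x (\<lambda>n. e (Suc n))) (y (\<lambda>n. e (Suc n)))) (\<lambda>e. e 0 = f' (x' (\<lambda>n. e (Suc n))) (y' (\<lambda>n. e (Suc n))))"
    by (rule fo_subst[OF foT_weaken[OF x]], rule fo_subst[OF foT_weaken[OF foT_weaken[OF y]]])
      (use g in \<open>simp add: numeral_2_eq_2\<close>)
  then show ?thesis using x y cl cl' by (auto simp: foT_def)
qed

subsection \<open>Definability over the model\<close>

text \<open>With the whole model as domain and equality as \<open>U\<close>, every element of the
  model may serve as a parameter. So \<open>fo\<close> becomes first-order definability with
  parameters, as required by Separation and Replacement.\<close>

abbreviation "D P \<equiv> fo (\<lambda>_. True) (\<lambda>_. True) (=) P P"
abbreviation "DT t \<equiv> foT (\<lambda>_. True) (\<lambda>_. True) (=) t t"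

text \<open>Translation from de Bruijn indices to the named variables of \<open>fm\<close>. Names
  below \<open>N\<close> are in use; those from \<open>N\<close> on hold the parameters
  \<open>p\<close> and the bound variables, a quantifier binding the fresh name \<open>N\<close>. A
  conjunction stacks the parameters of its two parts, which is why \<open>N\<close> is
  arbitrary.\<close>

lemma fo_to_fm:
  assumes "fo (\<lambda>_. True) (\<lambda>_. True) (=) P P'"
  shows "P = P' \<and> (\<forall>s N. (\<forall>i. s i < N) \<longrightarrow> (\<exists>\<phi> M p. N \<le> M \<and>
    (\<forall>e. (\<forall>i. N \<le> i \<and> i < M \<longrightarrow> e i = p i) \<longrightarrow> fm_sat mem \<phi> e = P (\<lambda>i. e (s i)))))"
  using assms
proof (induction rule: fo.induct)
  case (fo_mem i k)
  show ?case
  proof (intro conjI refl allI impI)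
    fix s :: "nat \<Rightarrow> nat" and N
    show "\<exists>\<phi> M p. N \<le> M \<and> (\<forall>e. (\<forall>i. N \<le> i \<and> i < M \<longrightarrow> e i = p i) \<longrightarrow> fm_sat mem \<phi> e = (e (s i) \<E> e (s k)))"
      by (rule exI[of _ "FMem (s i) (s k)"]) auto
  qed
next
  case (fo_pred u u' i)
  show ?case
  proof (intro conjI allI impI)
    fix s :: "nat \<Rightarrow> nat" and N
    show "\<exists>\<phi> M p. N \<le> M \<and> (\<forall>e. (\<forall>i. N \<le> i \<and> i < M \<longrightarrow> e i = p i) \<longrightarrow> fm_sat mem \<phi> e = (e (s i) \<E> u))"
      by (rule exI[of _ "FMem (s i) N"], rule exI[of _ "Suc N"], rule exI[of _ "\<lambda>_. u"]) auto
  qed (use fo_pred in auto)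
next
  case (fo_neg P P')
  show ?case
  proof (intro conjI allI impI)
    fix s :: "nat \<Rightarrow> nat" and N
    assume "\<forall>i. s i < N"
    then obtain \<phi> M p where "N \<le> M" "\<forall>e. (\<forall>i. N \<le> i \<and> i < M \<longrightarrow> e i = p i) \<longrightarrow> fm_sat mem \<phi> e = P (\<lambda>i. e (s i))"
      using fo_neg.IH by blast
    then show "\<exists>\<phi> M p. N \<le> M \<and> (\<forall>e. (\<forall>i. N \<le> i \<and> i < M \<longrightarrow> e i = p i) \<longrightarrow> fm_sat mem \<phi> e = (\<not> P (\<lambda>i. e (s i))))"
      by (intro exI[of _ "FNeg \<phi>"] exI[of _ M] exI[of _ p]) auto
  qed (use fo_neg in auto)
next
  case (fo_conj P P' Q Q')
  show ?case
  proof (intro conjI allI impI)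
    fix s :: "nat \<Rightarrow> nat" and N
    assume s: "\<forall>i. s i < N"
    then obtain \<phi> M p where 1: "N \<le> M" "\<And>e. (\<forall>i. N \<le> i \<and> i < M \<longrightarrow> e i = p i) \<Longrightarrow> fm_sat mem \<phi> e = P (\<lambda>i. e (s i))"
      using fo_conj.IH(1) by blast
    have "\<forall>i. s i < M" using s 1(1) order_less_le_trans by blast
    then obtain \<psi> M' p' where 2: "M \<le> M'" "\<And>e. (\<forall>i. M \<le> i \<and> i < M' \<longrightarrow> e i = p' i) \<Longrightarrow> fm_sat mem \<psi> e = Q (\<lambda>i. e (s i))"
      using fo_conj.IH(2) by blast
    have "fm_sat mem (FConj \<phi> \<psi>) e = (P (\<lambda>i. e (s i)) \<and> Q (\<lambda>i. e (s i)))"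
      if "\<forall>i. N \<le> i \<and> i < M' \<longrightarrow> e i = (if i < M then p i else p' i)" for e
      using that 1 2(1) by (auto simp: 2(2))
    then show "\<exists>\<phi> M p. N \<le> M \<and> (\<forall>e. (\<forall>i. N \<le> i \<and> i < M \<longrightarrow> e i = p i) \<longrightarrow> fm_sat mem \<phi> e = (P (\<lambda>i. e (s i)) \<and> Q (\<lambda>i. e (s i))))"
      using 1(1) 2(1) by (intro exI[of _ "FConj \<phi> \<psi>"] exI[of _ M'] exI[of _ "\<lambda>i. if i < M then p i else p' i"]) auto
  qed (use fo_conj in auto)
next
  case (fo_ex0 P P')
  show ?case
  proof (intro conjI allI impI)
    fix s :: "nat \<Rightarrow> nat" and N
    assume s: "\<forall>i. s i < N"
    let ?s = "case_nat N s"
    have "\<forall>i. ?s i < Suc N" using s by (auto split: nat.split intro: less_SucI)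
    then obtain \<phi> M p where 1: "Suc N \<le> M" "\<And>e. (\<forall>i. Suc N \<le> i \<and> i < M \<longrightarrow> e i = p i) \<Longrightarrow> fm_sat mem \<phi> e = P (\<lambda>i. e (?s i))"
      using fo_ex0.IH by blast
    have *: "(\<lambda>i. (e(N := x)) (?s i)) = case_nat x (\<lambda>i. e (s i))" for e :: "nat \<Rightarrow> 'a" and x
      using s by (auto split: nat.split simp: less_imp_neq)
    have **: "fm_sat mem \<phi> (e(N := x)) = P (case_nat x (\<lambda>i. e (s i)))" if "\<forall>i. N \<le> i \<and> i < M \<longrightarrow> e i = p i" for e x
      using 1(2)[of "e(N := x)"] that unfolding * by auto
    have "fm_sat mem (FEx N \<phi>) e = (\<exists>x. True \<and> P (case_nat x (\<lambda>i. e (s i))))"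
      if "\<forall>i. N \<le> i \<and> i < M \<longrightarrow> e i = p i" for e
      using **[OF that] by simp
    then show "\<exists>\<phi> M p. N \<le> M \<and> (\<forall>e. (\<forall>i. N \<le> i \<and> i < M \<longrightarrow> e i = p i) \<longrightarrow> fm_sat mem \<phi> e = (\<exists>x. True \<and> P (case_nat x (\<lambda>i. e (s i)))))"
      using 1(1) by (intro exI[of _ "FEx N \<phi>"] exI[of _ M] exI[of _ p]) auto
  qed (use fo_ex0 in auto)
next
  case (fo_cong P P' Q Q')
  then have "P = Q" "P' = Q'" by auto
  with fo_cong.IH show ?case by (elim subst)
qed

lemma D_sep:
  assumes "D (\<lambda>e. P (e 0))"
  shows "\<exists>z. \<forall>x. x \<E> z \<longleftrightarrow> x \<E> a \<and> P x"
proof -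
  obtain \<phi> M p where 1: "\<And>e. (\<forall>i. 1 \<le> i \<and> i < M \<longrightarrow> e i = p i) \<Longrightarrow> fm_sat mem \<phi> e = P (e 0)"
    using fo_to_fm[OF assms, THEN conjunct2, rule_format, of "\<lambda>_. 0" 1] by auto
  then have "fm_sat mem \<phi> (p(0 := x)) = P x" for x by (auto simp: 1)
  with separation[of a \<phi> p] show ?thesis by simp
qed

lemma D_sepE:
  assumes "D (\<lambda>e. P (e 0))"
  obtains z where "\<And>x. x \<E> z \<longleftrightarrow> x \<E> a \<and> P x"
  using D_sep[OF assms, of a] by blast

lemma D_repl:
  assumes "D (\<lambda>e. P (e 0) (e 1))" and ex1: "\<And>x. x \<E> a \<Longrightarrow> \<exists>!y. P x y"
  shows "\<exists>z. \<forall>y. y \<E> z \<longleftrightarrow> (\<exists>x. x \<E> a \<and> P x y)"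
proof -
  have "\<forall>i. case_nat 0 (\<lambda>_. 1) i < (2::nat)" by (auto split: nat.split)
  then obtain \<phi> M p where 1: "\<And>e. (\<forall>i. 2 \<le> i \<and> i < M \<longrightarrow> e i = p i) \<Longrightarrow> fm_sat mem \<phi> e = P (e 0) (e 1)"
    using fo_to_fm[OF assms(1), THEN conjunct2, rule_format, of "case_nat 0 (\<lambda>_. 1)" 2] by auto
  have "fm_sat mem \<phi> (p(0 := x, 1 := y)) = P x y" for x y
    by (subst 1) auto
  with replacement[of a \<phi> p] ex1 show ?thesis by simp
qed

lemma mem_coll: "(\<exists>z. \<forall>x. x \<E> z \<longleftrightarrow> P x) \<Longrightarrow> x \<E> Coll P \<longleftrightarrow> P x"
proof -
  assume "\<exists>z. \<forall>x. x \<E> z \<longleftrightarrow> P x"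
  then obtain z where z: "\<forall>x. x \<E> z \<longleftrightarrow> P x" ..
  have "Coll P = z" unfolding coll_def
    by (rule the_equality) (use z in \<open>auto intro: extensionality\<close>)
  with z show ?thesis by simp
qed

lemma coll_eq: "(\<And>x. x \<E> z \<longleftrightarrow> P x) \<Longrightarrow> Coll P = z"
  by (rule extensionality) (subst mem_coll, auto)

lemma D_ex [D_intros]: "D (\<lambda>e. P (\<lambda>n. e (Suc n)) (e 0)) \<Longrightarrow> D (\<lambda>e. \<exists>x. P e x)"
  using fo_ex[of "\<lambda>_. True" "\<lambda>_. True" "(=)" P P] by simp

lemma D_all [D_intros]: "D (\<lambda>e. P (\<lambda>n. e (Suc n)) (e 0)) \<Longrightarrow> D (\<lambda>e. \<forall>x. P e x)"
  using fo_all[of "\<lambda>_. True" "\<lambda>_. True" "(=)" P P] by simp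

lemma D_ex1 [D_intros]: "D (\<lambda>e. \<exists>x. P e x \<and> (\<forall>y. P e y \<longrightarrow> y = x)) \<Longrightarrow> D (\<lambda>e. \<exists>!x. P e x)"
  unfolding Ex1_def .

lemma tra_True [simp]: "tra (\<lambda>_. True)"
  by (simp add: tra_def)

lemmas D_logic [D_intros] = fo_neg fo_conj fo_disj fo_imp fo_iff

lemma D_mem [D_intros]: "DT x \<Longrightarrow> DT y \<Longrightarrow> D (\<lambda>e. x e \<E> y e)"
  by (rule fo_memT)

lemma D_eq [D_intros]: "DT x \<Longrightarrow> DT y \<Longrightarrow> D (\<lambda>e. x e = y e)"
  by (rule fo_eqT) auto

lemma DT_var [D_intros]: "DT (\<lambda>e. e i)"
  by (rule foT_var) auto

text \<open>Definability of a comprehension term without first showing that the class is a set of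
  the model.\<close>

lemma DT_coll [D_intros]:
  assumes "D (\<lambda>e. P (\<lambda>n. e (Suc n)) (e 0))"
  shows "DT (\<lambda>e. Coll (P e))"
proof -
  \<comment> \<open>By the definition with \<open>THE\<close>, all classes that are not sets yield
    this same element, which is used as a parameter.\<close>
  define c0 where "c0 = (THE z::'a. False)"
  have none: "Coll Q = c0" if "\<not> (\<exists>z. \<forall>x. x \<E> z \<longleftrightarrow> Q x)" for Q
    using that unfolding coll_def c0_def by (metis (no_types, lifting))
  have c0: "(e i = c0) = (\<forall>x. x \<E> e i \<longleftrightarrow> x \<E> c0)" for e :: "nat \<Rightarrow> 'a" and i
    by (auto intro: extensionality)
  have P: "D (\<lambda>e. P (\<lambda>n. e (Suc (Suc n))) (e 0))"
    using fo_rename[OF assms, of "case_nat 0 (\<lambda>n. Suc (Suc n))"] by simp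
  have "D (\<lambda>e. (\<forall>x. x \<E> e 0 \<longleftrightarrow> P (\<lambda>n. e (Suc n)) x) \<or> \<not> (\<exists>z. \<forall>x. x \<E> z \<longleftrightarrow> P (\<lambda>n. e (Suc n)) x) \<and> (\<forall>x. x \<E> e 0 \<longleftrightarrow> x \<E> c0))"
    by (intro D_intros P fo_pred refl fo_rename[OF P, of "case_nat 0 (\<lambda>n. Suc (Suc n))", simplified]) 
  moreover have "((\<forall>x. x \<E> y \<longleftrightarrow> Q x) \<or> \<not> (\<exists>z. \<forall>x. x \<E> z \<longleftrightarrow> Q x) \<and> (\<forall>x. x \<E> y \<longleftrightarrow> x \<E> c0)) = (y = Coll Q)" for y Q
    using none[of Q] mem_coll[of Q] by (metis extensionality)
  ultimately show ?thesis by (simp add: foT_def)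
qed

lemma mem_collI: "D (\<lambda>e. P (e 0)) \<Longrightarrow> (\<And>x. P x \<Longrightarrow> x \<E> a) \<Longrightarrow> x \<E> Coll P \<longleftrightarrow> P x"
  by (rule mem_coll) (use D_sep[of P a] in \<open>auto; metis\<close>)

lemma mem_sep: "D (\<lambda>e. P (e 0)) \<Longrightarrow> x \<E> Coll (\<lambda>x. x \<E> a \<and> P x) \<longleftrightarrow> x \<E> a \<and> P x"
  by (rule mem_coll) (rule D_sep)

lemma mem_empty [simp]: "\<not> x \<E> emp"
proof -
  have "\<exists>z. \<forall>x. \<not> x \<E> z" using infinity by blast
  then show ?thesis unfolding empty_def by (subst mem_coll) auto
qed

lemma mem_up [simp]: "z \<E> up x y \<longleftrightarrow> z = x \<or> z = y"
  unfolding upair_def by (rule mem_coll) (rule pairing)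

lemma DT_const [D_intros]: "DT (\<lambda>e. c)"
proof -
  have "D (\<lambda>e. e 0 \<E> up c c)" by (rule fo_pred) simp
  then show ?thesis by (simp add: foT_def)
qed

lemma eq_emp: "x = emp \<longleftrightarrow> (\<forall>y. \<not> y \<E> x)"
  by (metis extensionality mem_empty)

lemma up_eq: "up x y = up u v \<longleftrightarrow> (x = u \<and> y = v) \<or> (x = v \<and> y = u)"
proof
  assume *: "up x y = up u v"
  then have "x \<E> up u v" "y \<E> up u v" "u \<E> up x y" "v \<E> up x y" by (metis mem_up)+
  then show "x = u \<and> y = v \<or> x = v \<and> y = u" by auto
qed (auto intro: extensionality)

lemma pair_eq [simp]: "\<langle>x, y\<rangle> = \<langle>u, v\<rangle> \<longleftrightarrow> x = u \<and> y = v"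
  by (auto simp: kpair_def up_eq)

section \<open>Elementary set operations and functions of the model\<close>

definition Pow :: "'a \<Rightarrow> 'a" where "Pow x = Coll (\<lambda>z. z \<sqsubseteq> x)"
definition bigU :: "'a \<Rightarrow> ('a \<Rightarrow> 'a) \<Rightarrow> 'a" where "bigU x g = Coll (\<lambda>w. \<exists>z. z \<E> x \<and> w \<E> g z)"
abbreviation "Uni x \<equiv> bigU x (\<lambda>z. z)"
abbreviation "cup x y \<equiv> Uni (up x y)"
abbreviation "sing x \<equiv> up x x"

lemmas D_subst1 = fo_subst1[where A="\<lambda>_. True" and A'="\<lambda>_. True" and U="(=)"]
lemmas D_subst2 = fo_subst2[where A="\<lambda>_. True" and A'="\<lambda>_. True" and U="(=)"]

lemma D_subst3:
  assumes "DT x" "DT y" "DT z" "D (\<lambda>e. Q (e 2) (e 1) (e 0))"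
  shows "D (\<lambda>e. Q (x e) (y e) (z e))"
  by (rule fo_subst[OF assms(1)], rule fo_subst[OF foT_weaken[OF assms(2)]],
      rule fo_subst[OF foT_weaken[OF foT_weaken[OF assms(3)]]])
    (use assms(4) in \<open>simp add: numeral_2_eq_2\<close>)

lemma D_subst4:
  assumes "DT x" "DT y" "DT z" "DT w" "D (\<lambda>e. Q (e 3) (e 2) (e 1) (e 0))"
  shows "D (\<lambda>e. Q (x e) (y e) (z e) (w e))"
  by (rule fo_subst[OF assms(1)], rule fo_subst[OF foT_weaken[OF assms(2)]],
      rule fo_subst[OF foT_weaken[OF foT_weaken[OF assms(3)]]],
      rule fo_subst[OF foT_weaken[OF foT_weaken[OF foT_weaken[OF assms(4)]]]])
    (use assms(5) in \<open>simp add: numeral_2_eq_2 numeral_3_eq_3\<close>)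

lemma DT_iff: "DT t \<longleftrightarrow> D (\<lambda>e. e 0 = t (\<lambda>n. e (Suc n)))"
  by (simp add: foT_def)

lemma DT_subst1:
  assumes "DT x" "DT (\<lambda>e. f (e 0))"
  shows "DT (\<lambda>e. f (x e))"
  unfolding DT_iff
  by (rule fo_subst[OF foT_weaken[OF assms(1)]])
    (intro D_eq DT_var foT_weaken[OF assms(2), of "\<lambda>_. 0"])

lemma DT_subst2:
  assumes "DT x" "DT y" "DT (\<lambda>e. f (e 1) (e 0))"
  shows "DT (\<lambda>e. f (x e) (y e))"
  unfolding DT_iff
  by (rule fo_subst[OF foT_weaken[OF assms(1)]], rule fo_subst[OF foT_weaken[OF foT_weaken[OF assms(2)]]])
    (use D_eq[OF DT_var assms(3)] in \<open>simp add: numeral_2_eq_2\<close>)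

lemma DT_subst3:
  assumes "DT x" "DT y" "DT z" "DT (\<lambda>e. f (e 2) (e 1) (e 0))"
  shows "DT (\<lambda>e. f (x e) (y e) (z e))"
  unfolding DT_iff
  by (rule fo_subst[OF foT_weaken[OF assms(1)]], rule fo_subst[OF foT_weaken[OF foT_weaken[OF assms(2)]]],
      rule fo_subst[OF foT_weaken[OF foT_weaken[OF foT_weaken[OF assms(3)]]]])
    (use D_eq[OF DT_var assms(4)] in \<open>simp add: numeral_2_eq_2\<close>)

lemma DT_up [D_intros]: "DT x \<Longrightarrow> DT y \<Longrightarrow> DT (\<lambda>e. up (x e) (y e))"
  by (erule (1) DT_subst2) (unfold upair_def, intro D_intros)

lemma DT_pair [D_intros]: "DT x \<Longrightarrow> DT y \<Longrightarrow> DT (\<lambda>e. \<langle>x e, y e\<rangle>)"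
  unfolding kpair_def by (intro D_intros)

lemma DT_dif [D_intros]: "DT x \<Longrightarrow> DT y \<Longrightarrow> DT (\<lambda>e. dif (x e) (y e))"
  by (erule (1) DT_subst2) (unfold diff_def, intro D_intros)

lemma DT_suc [D_intros]: "DT x \<Longrightarrow> DT (\<lambda>e. suc (x e))"
  by (erule DT_subst1) (unfold succ_def, intro D_intros)

lemma D_sub [D_intros]: "DT x \<Longrightarrow> DT y \<Longrightarrow> D (\<lambda>e. x e \<sqsubseteq> y e)"
  by (erule (1) D_subst2) (unfold subset_def, intro D_intros)

lemma DT_Pow [D_intros]: "DT x \<Longrightarrow> DT (\<lambda>e. Pow (x e))"
  by (erule DT_subst1) (unfold Pow_def, intro D_intros)

lemma DT_bigU [D_intros]:
  assumes "DT x" and g: "DT (\<lambda>e. g (\<lambda>n. e (Suc n)) (e 0))"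
  shows "DT (\<lambda>e. bigU (x e) (g e))"
  unfolding bigU_def
  by (intro D_intros foT_weaken[OF assms(1)] foT_weaken[OF g, of "case_nat 0 (\<lambda>n. Suc (Suc n))", simplified])

lemma mem_dif [simp]: "z \<E> dif x y \<longleftrightarrow> z \<E> x \<and> \<not> z \<E> y"
  unfolding diff_def by (rule mem_sep) (intro D_intros)

lemma mem_Pow [simp]: "z \<E> Pow x \<longleftrightarrow> z \<sqsubseteq> x"
  unfolding Pow_def by (rule mem_coll) (use power_set[of x] in \<open>simp add: subset_def\<close>)

lemma mem_Uni [simp]: "z \<E> Uni x \<longleftrightarrow> (\<exists>y. y \<E> x \<and> z \<E> y)"
  unfolding bigU_def by (rule mem_coll) (rule union)

lemma mem_suc [simp]: "z \<E> suc x \<longleftrightarrow> z \<E> x \<or> z = x"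
proof -
  have "z \<E> cup x (sing x) \<longleftrightarrow> z \<E> x \<or> z = x" for z by auto
  then have "suc x = cup x (sing x)" unfolding succ_def by (intro coll_eq)
  then show ?thesis by auto
qed

lemma image_ex:
  assumes "DT (\<lambda>e. g (e 0))"
  shows "\<exists>z. \<forall>y. y \<E> z \<longleftrightarrow> (\<exists>x. x \<E> a \<and> y = g x)"
  by (rule D_repl[where P="\<lambda>x y. y = g x"]) (intro D_intros foT_weaken[OF assms, of "\<lambda>_. 0"], auto)

lemma mem_bigU:
  assumes "DT (\<lambda>e. g (e 0))"
  shows "w \<E> bigU x g \<longleftrightarrow> (\<exists>z. z \<E> x \<and> w \<E> g z)"
  unfolding bigU_def
proof (rule mem_coll)
  obtain z where "\<forall>y. y \<E> z \<longleftrightarrow> (\<exists>u. u \<E> x \<and> y = g u)" using image_ex[OF assms] by blast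
  then show "\<exists>z. \<forall>w. w \<E> z \<longleftrightarrow> (\<exists>z. z \<E> x \<and> w \<E> g z)" by (intro exI[of _ "Uni z"]) auto
qed

lemma pair_mem_Uni: "\<langle>x, y\<rangle> \<E> f \<Longrightarrow> x \<E> Uni (Uni f) \<and> y \<E> Uni (Uni f)"
  unfolding mem_Uni by (metis kpair_def mem_up)

text \<open>The union of all values at \<open>x\<close>, which for a function is the value. As a
  comprehension term it falls under \<open>DT_coll\<close>; \<open>app_ap\<close> relates it to
  \<open>app\<close>.\<close>

definition ap :: "'a \<Rightarrow> 'a \<Rightarrow> 'a" (infixl "$" 90) where
  "f $ x = Coll (\<lambda>z. \<exists>y. \<langle>x, y\<rangle> \<E> f \<and> z \<E> y)"

definition fn :: "'a \<Rightarrow> 'a \<Rightarrow> bool" where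
  "fn f a \<longleftrightarrow> (\<forall>p. p \<E> f \<longrightarrow> (\<exists>x y. x \<E> a \<and> p = \<langle>x, y\<rangle>)) \<and> (\<forall>x. x \<E> a \<longrightarrow> (\<exists>!y. \<langle>x, y\<rangle> \<E> f))"

definition lam :: "'a \<Rightarrow> ('a \<Rightarrow> 'a) \<Rightarrow> 'a" where
  "lam a F = Coll (\<lambda>p. \<exists>x. x \<E> a \<and> p = \<langle>x, F x\<rangle>)"

abbreviation "Maps \<equiv> maps mem"

lemma DT_ap [D_intros]: "DT x \<Longrightarrow> DT y \<Longrightarrow> DT (\<lambda>e. x e $ y e)"
  by (erule (1) DT_subst2) (unfold ap_def, intro D_intros)

lemma D_fn [D_intros]: "DT x \<Longrightarrow> DT y \<Longrightarrow> D (\<lambda>e. fn (x e) (y e))"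
  by (erule (1) D_subst2) (unfold fn_def, intro D_intros)

lemma D_Maps [D_intros]: "DT x \<Longrightarrow> DT y \<Longrightarrow> DT z \<Longrightarrow> D (\<lambda>e. Maps (x e) (y e) (z e))"
  by (erule (2) D_subst3) (unfold maps_def, intro D_intros)

lemma DT_lam [D_intros]:
  assumes "DT x" and g: "DT (\<lambda>e. g (\<lambda>n. e (Suc n)) (e 0))"
  shows "DT (\<lambda>e. lam (x e) (g e))"
  unfolding lam_def
  by (intro D_intros foT_weaken[OF assms(1)] foT_weaken[OF g, of "case_nat 0 (\<lambda>n. Suc (Suc n))", simplified])

lemma ap_eq:
  assumes "\<langle>x, y\<rangle> \<E> f" "\<And>y'. \<langle>x, y'\<rangle> \<E> f \<Longrightarrow> y' = y"
  shows "f $ x = y"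
  unfolding ap_def by (rule coll_eq) (use assms in blast)

lemma fn_mem: "fn f a \<Longrightarrow> \<langle>x, y\<rangle> \<E> f \<longleftrightarrow> x \<E> a \<and> y = f $ x"
  unfolding fn_def by (metis ap_eq pair_eq)

lemma fnI:
  assumes "\<And>p. p \<E> f \<Longrightarrow> \<exists>x. x \<E> a \<and> p = \<langle>x, F x\<rangle>" "\<And>x. x \<E> a \<Longrightarrow> \<langle>x, F x\<rangle> \<E> f"
  shows "fn f a"
proof -
  have "\<exists>!y. \<langle>x, y\<rangle> \<E> f" if "x \<E> a" for x
    using assms(2)[OF that] by (rule ex1I) (use assms(1) in fastforce)
  then show ?thesis unfolding fn_def using assms by blast
qed

lemma fn_ap: "fn f a \<Longrightarrow> x \<E> a \<Longrightarrow> \<langle>x, f $ x\<rangle> \<E> f"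
  by (simp add: fn_mem)

lemma fn_memE: "fn f a \<Longrightarrow> p \<E> f \<Longrightarrow> (\<And>x. x \<E> a \<Longrightarrow> p = \<langle>x, f $ x\<rangle> \<Longrightarrow> thesis) \<Longrightarrow> thesis"
  using fn_mem[of f a] unfolding fn_def by blast

lemma fn_ext: "fn f a \<Longrightarrow> fn g a \<Longrightarrow> (\<And>x. x \<E> a \<Longrightarrow> f $ x = g $ x) \<Longrightarrow> f = g"
  by (rule extensionality) (metis fn_memE fn_ap)

lemma app_ap: "fn f a \<Longrightarrow> x \<E> a \<Longrightarrow> app mem f x = f $ x"
  unfolding app_def by (rule the_equality) (auto simp: fn_mem)

lemma Maps_fn: "Maps f a b \<longleftrightarrow> fn f a \<and> (\<forall>x. x \<E> a \<longrightarrow> f $ x \<E> b)"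
proof
  assume *: "Maps f a b"
  then have "fn f a" unfolding maps_def fn_def by blast
  with * show "fn f a \<and> (\<forall>x. x \<E> a \<longrightarrow> f $ x \<E> b)"
    unfolding maps_def using fn_ap[of f a] by fastforce
next
  assume *: "fn f a \<and> (\<forall>x. x \<E> a \<longrightarrow> f $ x \<E> b)"
  then show "Maps f a b" unfolding maps_def
    by (intro conjI) (blast elim: fn_memE, simp add: fn_def)
qed

lemma mem_lam:
  assumes "DT (\<lambda>e. F (e 0))"
  shows "p \<E> lam a F \<longleftrightarrow> (\<exists>x. x \<E> a \<and> p = \<langle>x, F x\<rangle>)"
  unfolding lam_def
  by (rule mem_coll) (rule image_ex, intro D_intros assms)

lemma fn_lam: "DT (\<lambda>e. F (e 0)) \<Longrightarrow> fn (lam a F) a"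
  unfolding fn_def by (auto simp: mem_lam)

lemma lam_ap: "DT (\<lambda>e. F (e 0)) \<Longrightarrow> x \<E> a \<Longrightarrow> lam a F $ x = F x"
  by (rule ap_eq) (auto simp: mem_lam)

lemma lam_cong: "(\<And>x. x \<E> a \<Longrightarrow> F x = G x) \<Longrightarrow> lam a F = lam a G"
  unfolding lam_def by (rule arg_cong[of _ _ Coll]) (auto intro!: ext)

subsection \<open>Well-founded recursion\<close>

definition wfr :: "'a \<Rightarrow> 'a \<Rightarrow> bool" where
  "wfr a W \<longleftrightarrow> (\<forall>b. b \<sqsubseteq> a \<and> b \<noteq> emp \<longrightarrow> (\<exists>m. m \<E> b \<and> (\<forall>y. y \<E> b \<longrightarrow> \<not> \<langle>y, m\<rangle> \<E> W)))"

definition prd :: "'a \<Rightarrow> 'a \<Rightarrow> 'a \<Rightarrow> 'a" where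
  "prd a W x = Coll (\<lambda>y. y \<E> a \<and> \<langle>y, x\<rangle> \<E> W)"

lemma DT_prd [D_intros]: "DT x \<Longrightarrow> DT y \<Longrightarrow> DT z \<Longrightarrow> DT (\<lambda>e. prd (x e) (y e) (z e))"
  by (erule (2) DT_subst3) (unfold prd_def, intro D_intros)

lemma mem_prd [simp]: "y \<E> prd a W x \<longleftrightarrow> y \<E> a \<and> \<langle>y, x\<rangle> \<E> W"
  unfolding prd_def by (rule mem_sep) (intro D_intros)

lemma wfr_induct:
  assumes "wfr a W" "D (\<lambda>e. P (e 0))"
    and step: "\<And>x. x \<E> a \<Longrightarrow> (\<And>y. y \<E> a \<Longrightarrow> \<langle>y, x\<rangle> \<E> W \<Longrightarrow> P y) \<Longrightarrow> P x" and "x \<E> a"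
  shows "P x"
proof (rule ccontr)
  assume "\<not> P x"
  obtain b where b: "\<And>x. x \<E> b \<longleftrightarrow> x \<E> a \<and> \<not> P x" using D_sep[OF fo_neg[OF assms(2)], of a] by auto
  then have "b \<sqsubseteq> a" "b \<noteq> emp" using \<open>\<not> P x\<close> assms(4) by (auto intro: subI)
  then obtain m where "m \<E> b" "\<forall>y. y \<E> b \<longrightarrow> \<not> \<langle>y, m\<rangle> \<E> W" using assms(1) unfolding wfr_def by blast
  then show False using step[of m] b by blast
qed

text \<open>The function is the union of all approximations on predecessor-closed subsets of
  \<open>a\<close>; that approximations agree and that their domains exhaust \<open>a\<close> is
  shown by induction along \<open>W\<close>.\<close>

lemma wf_recursion:
  assumes wf: "wfr a W" and G: "DT (\<lambda>e. G (e 1) (e 0))"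
  obtains f where "fn f a" "\<And>x. x \<E> a \<Longrightarrow> f $ x = G x (lam (prd a W x) (\<lambda>y. f $ y))"
proof -
  define approx where "approx g b \<longleftrightarrow> b \<sqsubseteq> a \<and> (\<forall>x. x \<E> b \<longrightarrow> prd a W x \<sqsubseteq> b) \<and> fn g b \<and>
     (\<forall>x. x \<E> b \<longrightarrow> g $ x = G x (lam (prd a W x) (\<lambda>y. g $ y)))" for g b
  have G2: "DT x \<Longrightarrow> DT y \<Longrightarrow> DT (\<lambda>e. G (x e) (y e))" for x y
    by (rule DT_subst2[OF _ _ G])
  have Da: "DT x \<Longrightarrow> DT y \<Longrightarrow> D (\<lambda>e. approx (x e) (y e))" for x y
    by (erule (1) D_subst2) (unfold approx_def, intro D_intros G2)
  have lap: "lam c (\<lambda>y. g $ y) = lam c (\<lambda>y. g' $ y)" if "\<And>y. y \<E> c \<Longrightarrow> g $ y = g' $ y" for c g g'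
    using that by (rule lam_cong)
  have agree: "g $ x = g' $ x" if a: "approx g b" "approx g' b'" and x: "x \<E> b" "x \<E> b'" for g b g' b' x
  proof -
    have "x \<E> b \<and> x \<E> b' \<longrightarrow> g $ x = g' $ x"
    proof (rule wfr_induct[OF wf, where P="\<lambda>x. x \<E> b \<and> x \<E> b' \<longrightarrow> g $ x = g' $ x"])
      show "D (\<lambda>e. e 0 \<E> b \<and> e 0 \<E> b' \<longrightarrow> g $ e 0 = g' $ e 0)" by (intro D_intros)
      show "x \<E> a" using a x unfolding approx_def by (blast dest: subD)
      fix x assume IH: "\<And>y. y \<E> a \<Longrightarrow> \<langle>y, x\<rangle> \<E> W \<Longrightarrow> y \<E> b \<and> y \<E> b' \<longrightarrow> g $ y = g' $ y"
      show "x \<E> b \<and> x \<E> b' \<longrightarrow> g $ x = g' $ x"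
      proof
        assume x: "x \<E> b \<and> x \<E> b'"
        have "lam (prd a W x) (\<lambda>y. g $ y) = lam (prd a W x) (\<lambda>y. g' $ y)"
        proof (rule lap)
          fix y assume "y \<E> prd a W x"
          moreover from this have "y \<E> b" "y \<E> b'"
            using x a unfolding approx_def by (meson subD)+
          ultimately show "g $ y = g' $ y" using IH by simp
        qed
        then show "g $ x = g' $ x" using x a unfolding approx_def by metis
      qed
    qed
    then show ?thesis using x by blast
  qed
  obtain c where c: "\<And>x. x \<E> c \<longleftrightarrow> x \<E> a \<and> (\<exists>g b. approx g b \<and> x \<E> b)"
    by (rule D_sepE[where P="\<lambda>x. \<exists>g b. approx g b \<and> x \<E> b" and a=a], intro D_intros Da) blast
  have "\<exists>f. \<forall>p. p \<E> f \<longleftrightarrow> (\<exists>x. x \<E> c \<and> (\<exists>g b. approx g b \<and> x \<E> b \<and> p = \<langle>x, g $ x\<rangle>))"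
  proof (rule D_repl)
    show "D (\<lambda>e. \<exists>g b. approx g b \<and> e 0 \<E> b \<and> e 1 = \<langle>e 0, g $ e 0\<rangle>)" by (intro D_intros Da)
    show "\<exists>!p. \<exists>g b. approx g b \<and> x \<E> b \<and> p = \<langle>x, g $ x\<rangle>" if "x \<E> c" for x
      using that c agree by (metis pair_eq)
  qed
  then obtain f where f: "\<And>p. p \<E> f \<longleftrightarrow> (\<exists>x. x \<E> c \<and> (\<exists>g b. approx g b \<and> x \<E> b \<and> p = \<langle>x, g $ x\<rangle>))" by blast
  \<comment> \<open>\<open>f\<close> has already been obtained from Replacement. \<open>F\<close>
    merely names its values in HOL in order to apply \<open>fnI\<close>, so no choice enters the
    model.\<close>
  define F where "F x = (SOME v. \<exists>g b. approx g b \<and> x \<E> b \<and> v = g $ x)" for x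
  have F: "F x = g $ x" if "approx g b" "x \<E> b" for x g b
  proof -
    have "\<exists>g b. approx g b \<and> x \<E> b \<and> F x = g $ x" unfolding F_def
      by (rule someI_ex) (use that in blast)
    then show ?thesis using agree that by metis
  qed
  have fnf: "fn f c" by (rule fnI[where F=F]) (metis f F, metis f F c)
  have fg: "f $ x = g $ x" if "approx g b" "x \<E> b" for x g b
  proof -
    have "x \<E> c" using that c unfolding approx_def by (blast dest: subD)
    then have "\<langle>x, g $ x\<rangle> \<E> f" using that f by blast
    then show ?thesis using fnf by (simp add: fn_mem)
  qed
  have fa: "approx f c" unfolding approx_def
  proof (intro conjI allI impI fnf)
    show "c \<sqsubseteq> a" using c by (auto intro: subI)
    fix x assume "x \<E> c"
    then obtain g b where gb: "approx g b" "x \<E> b" using c by blast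
    then have p: "prd a W x \<sqsubseteq> b" unfolding approx_def by blast
    then show "prd a W x \<sqsubseteq> c" using gb c by (meson mem_prd subD subI)
    have "lam (prd a W x) (\<lambda>y. f $ y) = lam (prd a W x) (\<lambda>y. g $ y)"
      using fg[OF gb(1)] p by (intro lap) (blast dest: subD)
    then show "f $ x = G x (lam (prd a W x) (\<lambda>y. f $ y))"
      using gb fg[OF gb] unfolding approx_def by metis
  qed
  have "x \<E> c" if "x \<E> a" for x
  proof (rule wfr_induct[OF wf _ _ that, where P="\<lambda>x. x \<E> c"])
    show "D (\<lambda>e. e 0 \<E> c)" by (intro D_intros)
    fix x assume x: "x \<E> a" and IH: "\<And>y. y \<E> a \<Longrightarrow> \<langle>y, x\<rangle> \<E> W \<Longrightarrow> y \<E> c"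
    show "x \<E> c"
    proof (rule ccontr)
      assume nx: "\<not> x \<E> c"
      let ?v = "G x (lam (prd a W x) (\<lambda>y. f $ y))"
      let ?g = "cup f (sing \<langle>x, ?v\<rangle>)"
      let ?b = "cup c (sing x)"
      have mg: "p \<E> ?g \<longleftrightarrow> p \<E> f \<or> p = \<langle>x, ?v\<rangle>" for p by auto
      have mb: "p \<E> ?b \<longleftrightarrow> p \<E> c \<or> p = x" for p by auto
      have fng: "fn ?g ?b"
        by (rule fnI[where F="\<lambda>z. if z = x then ?v else f $ z"])
          (unfold mg mb, use fnf nx in \<open>auto elim: fn_memE simp: fn_mem\<close>)
      have gx: "?g $ x = ?v" using fn_mem[OF fng, of x ?v] mg mb by metis
      have gy: "?g $ y = f $ y" if "y \<E> c" for y
        using fn_mem[OF fng, of y "f $ y"] fn_ap[OF fnf that] mg by metis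
      have px: "prd a W z \<sqsubseteq> c" if "z \<E> ?b" for z
        using that IH fa unfolding approx_def mb by (metis subI mem_prd)
      have "approx ?g ?b" unfolding approx_def
      proof (intro conjI allI impI fng)
        show "?b \<sqsubseteq> a" using c x by (auto intro!: subI)
        fix z assume z: "z \<E> ?b"
        show "prd a W z \<sqsubseteq> ?b" by (rule sub_trans[OF px[OF z]], rule subI) (unfold mb, blast)
        have *: "lam (prd a W z) (\<lambda>y. ?g $ y) = lam (prd a W z) (\<lambda>y. f $ y)"
          using px[OF z] gy by (intro lap) (blast dest: subD)
        show "?g $ z = G z (lam (prd a W z) (\<lambda>y. ?g $ y))"
        proof (cases "z = x")
          case True
          then show ?thesis using gx * by simp
        next
          case False
          then have "z \<E> c" using z unfolding mb by blast
          then show ?thesis using gy * fa unfolding approx_def by metis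
        qed
      qed
      then have "x \<E> c" unfolding c using x mb by blast
      with nx show False ..
    qed
  qed
  then have "c = a" using c by (metis extensionality)
  with fa show thesis using that unfolding approx_def by blast
qed

end

context ZF
begin

subsection \<open>Ordinals\<close>

abbreviation "Tran \<equiv> transitive mem"
abbreviation "Ord \<equiv> ordinal mem"

lemma D_Tran [D_intros]: "DT x \<Longrightarrow> D (\<lambda>e. Tran (x e))"
  by (erule D_subst1) (unfold transitive_def, intro D_intros)

lemma D_Ord [D_intros]: "DT x \<Longrightarrow> D (\<lambda>e. Ord (x e))"
  by (erule D_subst1) (unfold ordinal_def, intro D_intros)

lemma TranD: "Tran x \<Longrightarrow> y \<E> x \<Longrightarrow> z \<E> y \<Longrightarrow> z \<E> x"
  unfolding transitive_def by (blast dest: subD)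

lemma TranI: "(\<And>y z. y \<E> x \<Longrightarrow> z \<E> y \<Longrightarrow> z \<E> x) \<Longrightarrow> Tran x"
  unfolding transitive_def by (blast intro: subI)

lemma mem_irrefl [simp]: "\<not> x \<E> x"
  using foundation[of x "sing x"] by auto

lemma mem_asym: "x \<E> y \<Longrightarrow> \<not> y \<E> x"
  using foundation[of x "up x y"] by auto

lemma Ord_mem: "Ord x \<Longrightarrow> y \<E> x \<Longrightarrow> Ord y"
  unfolding ordinal_def transitive_def by (blast dest: subD)

lemma OrdI: "Tran x \<Longrightarrow> (\<And>y. y \<E> x \<Longrightarrow> Ord y) \<Longrightarrow> Ord x"
  unfolding ordinal_def by blast

lemma Ord_TranD: "Ord x \<Longrightarrow> y \<E> x \<Longrightarrow> z \<E> y \<Longrightarrow> z \<E> x"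
  unfolding ordinal_def by (blast dest: TranD)

lemma Ord_suc: assumes "Ord x" shows "Ord (suc x)"
proof (rule OrdI[OF TranI])
  show "z \<E> suc x" if "y \<E> suc x" "z \<E> y" for y z using that Ord_TranD[OF assms] by auto
  show "Ord y" if "y \<E> suc x" for y using that Ord_mem[OF assms] assms by auto
qed

lemma Ord_induct:
  assumes "D (\<lambda>e. P (e 0))" "\<And>x. Ord x \<Longrightarrow> (\<And>y. y \<E> x \<Longrightarrow> P y) \<Longrightarrow> P x" "Ord x"
  shows "P x"
proof (rule ccontr)
  assume n: "\<not> P x"
  obtain z where z: "\<And>u. u \<E> z \<longleftrightarrow> u \<E> suc x \<and> \<not> P u"
    by (rule D_sepE[where P="\<lambda>u. \<not> P u" and a="suc x"], rule fo_neg[OF assms(1)]) blast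
  then have "x \<E> z" using n by simp
  then obtain m where m: "m \<E> z" "\<not> (\<exists>u. u \<E> z \<and> u \<E> m)" using foundation by blast
  then have "m \<E> suc x" using z by blast
  then have "Ord m" "\<And>y. y \<E> m \<Longrightarrow> y \<E> suc x"
    using Ord_suc[OF assms(3)] by (blast intro: Ord_mem Ord_TranD)+
  then show False using assms(2)[of m] m z by blast
qed

lemma Ord_linear:
  assumes "Ord x" "Ord y" shows "x \<E> y \<or> x = y \<or> y \<E> x"
proof -
  have "\<forall>y. Ord y \<longrightarrow> x \<E> y \<or> x = y \<or> y \<E> x"
  proof (rule Ord_induct[where P="\<lambda>x. \<forall>y. Ord y \<longrightarrow> x \<E> y \<or> x = y \<or> y \<E> x"])
    show "D (\<lambda>e. \<forall>y. Ord y \<longrightarrow> e 0 \<E> y \<or> e 0 = y \<or> y \<E> e 0)" by (intro D_intros)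
    fix x assume x: "Ord x" and IH: "\<And>x'. x' \<E> x \<Longrightarrow> \<forall>y. Ord y \<longrightarrow> x' \<E> y \<or> x' = y \<or> y \<E> x'"
    show "\<forall>y. Ord y \<longrightarrow> x \<E> y \<or> x = y \<or> y \<E> x"
    proof (intro allI impI)
      fix y assume "Ord y"
      then show "x \<E> y \<or> x = y \<or> y \<E> x"
      proof (rule Ord_induct[where P="\<lambda>y. x \<E> y \<or> x = y \<or> y \<E> x", rotated 2])
        show "D (\<lambda>e. x \<E> e 0 \<or> x = e 0 \<or> e 0 \<E> x)" by (intro D_intros)
        fix y assume y: "Ord y" and IH2: "\<And>y'. y' \<E> y \<Longrightarrow> x \<E> y' \<or> x = y' \<or> y' \<E> x"
        show "x \<E> y \<or> x = y \<or> y \<E> x"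
        proof (rule ccontr)
          assume n: "\<not> ?thesis"
          have "y' \<E> x" if "y' \<E> y" for y' using IH2[OF that] n that Ord_TranD[OF y that] by blast
          moreover have "x' \<E> y" if "x' \<E> x" for x' using IH[OF that] y n that Ord_TranD[OF x that] by blast
          ultimately have "x = y" by (blast intro: extensionality)
          then show False using n by blast
        qed
      qed
    qed
  qed (rule assms)
  then show ?thesis using assms by blast
qed

lemma Ord_sub: "Ord x \<Longrightarrow> Ord y \<Longrightarrow> x \<sqsubseteq> y \<longleftrightarrow> x \<E> y \<or> x = y"
  using Ord_linear[of x y] by (auto intro: subI dest: Ord_TranD subD)

subsection \<open>Natural numbers\<close>

abbreviation "om \<equiv> omega mem"

lemma mem_om: "n \<E> om \<longleftrightarrow> (\<forall>I. emp \<E> I \<and> (\<forall>x. x \<E> I \<longrightarrow> suc x \<E> I) \<longrightarrow> n \<E> I)"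
proof -
  obtain I where I: "\<exists>e. e \<E> I \<and> (\<forall>x. \<not> x \<E> e)" "\<forall>x. x \<E> I \<longrightarrow> (\<exists>y. y \<E> I \<and> (\<forall>z. z \<E> y \<longleftrightarrow> z \<E> x \<or> z = x))"
    using infinity by blast
  have "emp \<E> I" using I(1) by (metis eq_emp)
  moreover have "\<forall>x. x \<E> I \<longrightarrow> suc x \<E> I" using I(2) by (metis extensionality mem_suc)
  ultimately show ?thesis unfolding omega_def by (intro mem_collI[where a=I] D_intros) blast
qed

lemma om_0 [simp]: "emp \<E> om" by (simp add: mem_om)
lemma om_suc [simp]: "n \<E> om \<Longrightarrow> suc n \<E> om" by (auto simp: mem_om)

lemma om_induct:
  assumes "D (\<lambda>e. P (e 0))" "P emp" "\<And>n. n \<E> om \<Longrightarrow> P n \<Longrightarrow> P (suc n)" "n \<E> om"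
  shows "P n"
proof -
  obtain z where z: "\<And>u. u \<E> z \<longleftrightarrow> u \<E> om \<and> P u"
    by (rule D_sepE[OF assms(1), of om]) blast
  then have "emp \<E> z \<and> (\<forall>x. x \<E> z \<longrightarrow> suc x \<E> z)" using assms(2,3) by simp
  then have "n \<E> z" using assms(4) mem_om[of n] by blast
  then show ?thesis using z by blast
qed

lemma Ord_emp [simp]: "Ord emp" by (simp add: ordinal_def transitive_def)

lemma om_Ord: "n \<E> om \<Longrightarrow> Ord n"
  by (rule om_induct[where P=Ord]) (intro D_intros, auto intro: Ord_suc)

lemma Ord_om [simp]: "Ord om"
proof (rule OrdI[OF TranI om_Ord])
  fix n y assume "n \<E> om" "y \<E> n"
  moreover have "\<forall>y. y \<E> n \<longrightarrow> y \<E> om" if "n \<E> om" for n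
    by (rule om_induct[where P="\<lambda>n. \<forall>y. y \<E> n \<longrightarrow> y \<E> om"]) (intro D_intros, use that in auto)
  ultimately show "y \<E> om" by blast
qed

lemma suc_inj: "suc x = suc y \<Longrightarrow> x = y"
  by (metis mem_asym mem_suc)

lemma om_cases: "n \<E> om \<Longrightarrow> n = emp \<or> (\<exists>m. m \<E> om \<and> n = suc m)"
  by (rule om_induct[where P="\<lambda>n. n = emp \<or> (\<exists>m. m \<E> om \<and> n = suc m)"]) (intro D_intros, auto)

lemma limit_om: "limit_ordinal mem om"
  by (simp add: limit_ordinal_def)

subsection \<open>The cumulative hierarchy\<close>

definition vfun :: "'a \<Rightarrow> 'a \<Rightarrow> bool" where
  "vfun f \<alpha> \<longleftrightarrow> fn f (suc \<alpha>) \<and> (\<forall>\<beta>. \<beta> \<E> suc \<alpha> \<longrightarrow> (\<forall>x. x \<E> f $ \<beta> \<longleftrightarrow> (\<exists>\<gamma>. \<gamma> \<E> \<beta> \<and> x \<sqsubseteq> f $ \<gamma>)))"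

text \<open>A union over all hierarchies up to \<alpha> instead of a use of \<open>THE\<close>, so
  that \<open>Vs\<close> is a definable term. By \<open>vset_Vs\<close> it agrees with
  \<open>vset\<close> at ordinals.\<close>

definition Vs :: "'a \<Rightarrow> 'a" where
  "Vs \<alpha> = Coll (\<lambda>x. \<exists>f. vfun f \<alpha> \<and> x \<E> f $ \<alpha>)"

lemma D_vfun [D_intros]: "DT x \<Longrightarrow> DT y \<Longrightarrow> D (\<lambda>e. vfun (x e) (y e))"
  by (erule (1) D_subst2) (unfold vfun_def, intro D_intros)

lemma DT_Vs [D_intros]: "DT x \<Longrightarrow> DT (\<lambda>e. Vs (x e))"
  by (erule DT_subst1) (unfold Vs_def, intro D_intros)

lemma fn_range_ex: "\<exists>b. Maps f a b" if "fn f a"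
proof -
  have "x \<E> a \<Longrightarrow> f $ x \<E> Uni (Uni f)" for x
    using pair_mem_Uni fn_ap[OF that] by blast
  then show ?thesis using that Maps_fn by blast
qed

lemma vfun_ex:
  assumes "Ord \<alpha>"
  shows "\<exists>f. vfun f \<alpha>"
proof -
  \<comment> \<open>Membership on \<open>suc \<alpha>\<close> as a set of pairs. Such pairs are sets
    of subsets of \<open>suc \<alpha>\<close>, whence the bound for Separation.\<close>
  obtain W where W: "\<And>p. p \<E> W \<longleftrightarrow> p \<E> Pow (Pow (suc \<alpha>)) \<and> (\<exists>x y. p = \<langle>x, y\<rangle> \<and> x \<E> y)"
    by (rule D_sepE[where P="\<lambda>p. \<exists>x y. p = \<langle>x, y\<rangle> \<and> x \<E> y" and a="Pow (Pow (suc \<alpha>))"], intro D_intros) blast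
  have W': "\<langle>x, y\<rangle> \<E> W \<longleftrightarrow> x \<E> y" if "x \<E> suc \<alpha>" "y \<E> suc \<alpha>" for x y
    using that unfolding W by (auto simp: kpair_def up_eq subset_def)
  have wf: "wfr (suc \<alpha>) W" unfolding wfr_def
  proof (intro allI impI)
    fix b assume b: "b \<sqsubseteq> suc \<alpha> \<and> b \<noteq> emp"
    then obtain y where "y \<E> b" by (metis eq_emp)
    then obtain m where "m \<E> b" "\<not> (\<exists>z. z \<E> b \<and> z \<E> m)" using foundation by blast
    then show "\<exists>m. m \<E> b \<and> (\<forall>y. y \<E> b \<longrightarrow> \<not> \<langle>y, m\<rangle> \<E> W)" using b W' by (metis subD)
  qed
  obtain f where f: "fn f (suc \<alpha>)" "\<And>x. x \<E> suc \<alpha> \<Longrightarrow> f $ x = bigU x (\<lambda>y. Pow (lam (prd (suc \<alpha>) W x) (\<lambda>y. f $ y) $ y))"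
    by (rule wf_recursion[OF wf, where G="\<lambda>x g. bigU x (\<lambda>y. Pow (g $ y))"], intro D_intros) blast
  have "y \<E> prd (suc \<alpha>) W x" if "x \<E> suc \<alpha>" "y \<E> x" for x y
    using that W' Ord_TranD[OF Ord_suc[OF assms]] by (metis mem_prd)
  then have l: "lam (prd (suc \<alpha>) W x) (\<lambda>y. f $ y) $ y = f $ y" if "x \<E> suc \<alpha>" "y \<E> x" for x y
    using that by (intro lam_ap D_intros) auto
  have "z \<E> f $ x \<longleftrightarrow> (\<exists>y. y \<E> x \<and> z \<sqsubseteq> f $ y)" if "x \<E> suc \<alpha>" for x z
  proof -
    have "z \<E> f $ x \<longleftrightarrow> (\<exists>y. y \<E> x \<and> z \<E> Pow (lam (prd (suc \<alpha>) W x) (\<lambda>y. f $ y) $ y))"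
      unfolding f(2)[OF that] by (rule mem_bigU) (intro D_intros)
    then show ?thesis using l[OF that] by auto
  qed
  then show ?thesis using f(1) unfolding vfun_def by blast
qed

lemma vfun_unique:
  assumes "vfun f \<alpha>" "vfun g \<beta>" "Ord \<alpha>" "Ord \<beta>" "x \<E> suc \<alpha>" "x \<E> suc \<beta>"
  shows "f $ x = g $ x"
proof -
  have "x \<E> suc \<alpha> \<and> x \<E> suc \<beta> \<longrightarrow> f $ x = g $ x"
  proof (rule Ord_induct[where P="\<lambda>x. x \<E> suc \<alpha> \<and> x \<E> suc \<beta> \<longrightarrow> f $ x = g $ x"])
    show "D (\<lambda>e. e 0 \<E> suc \<alpha> \<and> e 0 \<E> suc \<beta> \<longrightarrow> f $ e 0 = g $ e 0)" by (intro D_intros)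
    show "Ord x" using assms Ord_suc Ord_mem by blast
    fix x assume IH: "\<And>y. y \<E> x \<Longrightarrow> y \<E> suc \<alpha> \<and> y \<E> suc \<beta> \<longrightarrow> f $ y = g $ y"
    show "x \<E> suc \<alpha> \<and> x \<E> suc \<beta> \<longrightarrow> f $ x = g $ x"
    proof
      assume x: "x \<E> suc \<alpha> \<and> x \<E> suc \<beta>"
      have eq: "f $ y = g $ y" if "y \<E> x" for y
        using IH[OF that] x that Ord_TranD[OF Ord_suc] assms(3,4) by blast
      show "f $ x = g $ x"
      proof (rule extensionality)
        fix z
        have "z \<E> f $ x \<longleftrightarrow> (\<exists>y. y \<E> x \<and> z \<sqsubseteq> f $ y)" "z \<E> g $ x \<longleftrightarrow> (\<exists>y. y \<E> x \<and> z \<sqsubseteq> g $ y)"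
          using x assms(1,2) unfolding vfun_def by blast+
        then show "z \<E> f $ x \<longleftrightarrow> z \<E> g $ x" using eq by auto
      qed
    qed
  qed
  then show ?thesis using assms by blast
qed

lemma Vs_eq: assumes "vfun f \<alpha>" "Ord \<alpha>" shows "Vs \<alpha> = f $ \<alpha>"
proof -
  have "g $ \<alpha> = f $ \<alpha>" if "vfun g \<alpha>" for g using vfun_unique[OF that assms(1,2,2)] by simp
  then show ?thesis unfolding Vs_def using assms(1) by (intro coll_eq) metis
qed

lemma vset_Vs: assumes "Ord \<alpha>" shows "vset mem \<alpha> = Vs \<alpha>"
proof -
  obtain f where f: "vfun f \<alpha>" using vfun_ex[OF assms] by blast
  have iff: "(\<exists>b. Maps g (suc \<alpha>) b \<and> (\<forall>\<beta>. \<beta> \<E> suc \<alpha> \<longrightarrow>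
       (\<forall>x. x \<E> app mem g \<beta> \<longleftrightarrow> (\<exists>\<gamma>. \<gamma> \<E> \<beta> \<and> x \<sqsubseteq> app mem g \<gamma>))) \<and> v = app mem g \<alpha>) \<longleftrightarrow> vfun g \<alpha> \<and> v = g $ \<alpha>" for g v
  proof (cases "fn g (suc \<alpha>)")
    case True
    have "\<beta> \<E> suc \<alpha> \<Longrightarrow> \<gamma> \<E> \<beta> \<Longrightarrow> \<gamma> \<E> suc \<alpha>" for \<beta> \<gamma> using Ord_TranD[OF Ord_suc[OF assms]] by blast
    then have 1: "(\<forall>\<beta>. \<beta> \<E> suc \<alpha> \<longrightarrow> (\<forall>x. x \<E> app mem g \<beta> \<longleftrightarrow> (\<exists>\<gamma>. \<gamma> \<E> \<beta> \<and> x \<sqsubseteq> app mem g \<gamma>)))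
       \<longleftrightarrow> (\<forall>\<beta>. \<beta> \<E> suc \<alpha> \<longrightarrow> (\<forall>x. x \<E> g $ \<beta> \<longleftrightarrow> (\<exists>\<gamma>. \<gamma> \<E> \<beta> \<and> x \<sqsubseteq> g $ \<gamma>)))"
      using app_ap[OF True] by (intro all_cong1 imp_cong refl arg_cong2[of _ _ _ _ "(=)"] ex_cong1 conj_cong) (simp_all del: mem_suc)
    have 2: "app mem g \<alpha> = g $ \<alpha>" using app_ap[OF True] by simp
    show ?thesis unfolding 1 2 vfun_def using True fn_range_ex[OF True] by blast
  qed (auto simp: Maps_fn vfun_def)
  show ?thesis unfolding vset_def iff
    by (rule the_equality) (use f Vs_eq assms in metis)+
qed

lemma mem_Vs:
  assumes "Ord \<alpha>"
  shows "x \<E> Vs \<alpha> \<longleftrightarrow> (\<exists>\<beta>. \<beta> \<E> \<alpha> \<and> x \<sqsubseteq> Vs \<beta>)"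
proof -
  obtain f where f: "vfun f \<alpha>" using vfun_ex[OF assms] by blast
  have "Vs \<beta> = f $ \<beta>" if b: "\<beta> \<E> \<alpha>" for \<beta>
  proof -
    have o: "Ord \<beta>" using assms b Ord_mem by blast
    then obtain g where "vfun g \<beta>" using vfun_ex by blast
    then show ?thesis using vfun_unique[OF _ f o assms, of g \<beta>] Vs_eq[of g \<beta>] o b by (metis mem_suc)
  qed
  then show ?thesis using f Vs_eq[OF f assms] unfolding vfun_def by auto
qed

lemma Vs_sub: "Ord \<alpha> \<Longrightarrow> x \<E> Vs \<alpha> \<Longrightarrow> y \<sqsubseteq> x \<Longrightarrow> y \<E> Vs \<alpha>"
  using mem_Vs sub_trans by blast

lemma Vs_mono: "Ord \<alpha> \<Longrightarrow> \<beta> \<E> \<alpha> \<Longrightarrow> Vs \<beta> \<sqsubseteq> Vs \<alpha>"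
  by (rule subI) (meson mem_Vs Ord_TranD Ord_mem)

lemma Vs_mem: "Ord \<alpha> \<Longrightarrow> \<beta> \<E> \<alpha> \<Longrightarrow> Vs \<beta> \<E> Vs \<alpha>"
  using mem_Vs by auto

lemma Vs_Tran: "Ord \<alpha> \<Longrightarrow> Tran (Vs \<alpha>)"
  by (rule TranI) (meson mem_Vs Vs_mono subD)

lemma Vs_suc: "Ord \<alpha> \<Longrightarrow> Vs (suc \<alpha>) = Pow (Vs \<alpha>)"
  by (rule extensionality) (use mem_Vs[OF Ord_suc] Vs_mono sub_trans in auto)

lemma Vs_emp: "Vs emp = emp"
  by (simp add: eq_emp mem_Vs)

lemma Ord_sub_Vs: "Ord \<alpha> \<Longrightarrow> \<alpha> \<sqsubseteq> Vs \<alpha>"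
  by (rule Ord_induct[where P="\<lambda>\<alpha>. \<alpha> \<sqsubseteq> Vs \<alpha>"])
    (intro D_intros, rule subI, metis mem_Vs)

lemma limitD: "limit_ordinal mem l \<Longrightarrow> Ord l \<and> emp \<E> l \<and> (\<forall>x. x \<E> l \<longrightarrow> suc x \<E> l)"
  by (simp add: limit_ordinal_def)

lemma limit_om_sub:
  assumes "limit_ordinal mem l" shows "om \<sqsubseteq> l"
proof (rule subI)
  fix n assume "n \<E> om"
  then show "n \<E> l"
    by (rule om_induct[where P="\<lambda>n. n \<E> l", rotated 3]) (intro D_intros, use limitD[OF assms] in auto)
qed

end

section \<open>Closure properties of the rank \<open>V\<close> at a limit ordinal\<close>

locale limit_rank = ZF +
  fixes l :: 'a
  assumes lim: "limit_ordinal mem l"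
begin

abbreviation V :: 'a where "V \<equiv> Vs l"

lemma Ord_l: "Ord l" and l_0: "emp \<E> l" and l_suc: "x \<E> l \<Longrightarrow> suc x \<E> l"
  using limitD[OF lim] by auto

lemma V_ord: "x \<E> l \<Longrightarrow> Ord x"
  using Ord_l Ord_mem by blast

lemma l_linear: "x \<E> l \<Longrightarrow> y \<E> l \<Longrightarrow> \<exists>z. z \<E> l \<and> x \<sqsubseteq> z \<and> y \<sqsubseteq> z"
  using Ord_linear[of x y] V_ord Ord_sub sub_refl by metis

lemma mem_V: "x \<E> V \<longleftrightarrow> (\<exists>\<alpha>. \<alpha> \<E> l \<and> x \<E> Vs \<alpha>)"
  using mem_Vs[OF Ord_l, of x] Vs_suc[OF V_ord] l_suc Vs_mono[OF Ord_l] by (metis mem_Pow subD)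

lemma V_tran: "x \<E> V \<Longrightarrow> y \<E> x \<Longrightarrow> y \<E> V"
  using Vs_Tran[OF Ord_l] TranD by blast

lemma V_sub: "x \<E> V \<Longrightarrow> y \<sqsubseteq> x \<Longrightarrow> y \<E> V"
  using Vs_sub[OF Ord_l] by blast

lemma V_subV: "x \<E> V \<Longrightarrow> x \<sqsubseteq> V"
  using V_tran by (blast intro: subI)

lemma Vs_V: "\<alpha> \<E> l \<Longrightarrow> Vs \<alpha> \<E> V"
  using Vs_mem[OF Ord_l] .

lemma V_Pow: assumes "x \<E> V" shows "Pow x \<E> V"
proof -
  obtain \<alpha> where a: "\<alpha> \<E> l" "x \<E> Vs \<alpha>" using assms mem_V by blast
  then have "Pow x \<sqsubseteq> Vs \<alpha>" using Vs_sub[OF V_ord] by (auto intro!: subI)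
  then show ?thesis using mem_Vs[OF Ord_l] a(1) by blast
qed

lemma Vs_mono2: "\<beta> \<E> l \<Longrightarrow> \<alpha> \<E> l \<Longrightarrow> \<alpha> \<sqsubseteq> \<beta> \<Longrightarrow> Vs \<alpha> \<sqsubseteq> Vs \<beta>"
  using Ord_sub[of \<alpha> \<beta>] V_ord Vs_mono by auto

lemma V_directed:
  assumes "x \<E> V" "y \<E> V"
  shows "\<exists>\<alpha>. \<alpha> \<E> l \<and> x \<E> Vs \<alpha> \<and> y \<E> Vs \<alpha>"
proof -
  obtain \<alpha> \<beta> where a: "\<alpha> \<E> l" "x \<E> Vs \<alpha>" "\<beta> \<E> l" "y \<E> Vs \<beta>" using assms mem_V by blast
  then obtain \<gamma> where "\<gamma> \<E> l" "\<alpha> \<sqsubseteq> \<gamma>" "\<beta> \<sqsubseteq> \<gamma>" using l_linear by blast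
  then show ?thesis using a Vs_mono2 by (metis subD)
qed

lemma V_up [simp]: assumes "x \<E> V" "y \<E> V" shows "up x y \<E> V"
proof -
  obtain \<alpha> where "\<alpha> \<E> l" "x \<E> Vs \<alpha>" "y \<E> Vs \<alpha>" using V_directed[OF assms] by blast
  then show ?thesis by (intro V_sub[OF Vs_V[of \<alpha>]] subI) auto
qed

lemma V_pair [simp]: "\<langle>x, y\<rangle> \<E> V \<longleftrightarrow> x \<E> V \<and> y \<E> V"
  by (metis V_up V_tran kpair_def mem_up)

lemma V_emp [simp]: "emp \<E> V" using mem_Vs[OF Ord_l] l_0 by (auto simp: subset_def)

lemma V_Uni [simp]: assumes "x \<E> V" shows "Uni x \<E> V"
proof -
  obtain \<alpha> where a: "\<alpha> \<E> l" "x \<E> Vs \<alpha>" using assms mem_V by blast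
  then show ?thesis using Vs_Tran[OF V_ord[OF a(1)]]
    by (intro V_sub[OF Vs_V[OF a(1)]] subI) (auto dest: TranD)
qed

lemma V_l: "x \<E> l \<Longrightarrow> x \<E> V"
  using Ord_sub_Vs[OF Ord_l] subD by blast

end

named_theorems bfo_intros

context ZF
begin

subsection \<open>Bounded formulas\<close>

text \<open>All quantifiers are bounded by a variable. Hence such a predicate is first-order over
  every transitive class (\<open>bfo_fo\<close>), and in the absence of predicates it is coded by a
  Delta_0 formula of the model (\<open>bfo_code\<close>).\<close>

inductive bfo :: "('a \<Rightarrow> 'a \<Rightarrow> bool) \<Rightarrow> ((nat \<Rightarrow> 'a) \<Rightarrow> bool) \<Rightarrow> ((nat \<Rightarrow> 'a) \<Rightarrow> bool) \<Rightarrow> bool" for U where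
  bfo_mem: "bfo U (\<lambda>e. e i \<E> e k) (\<lambda>e. e i \<E> e k)"
| bfo_pred: "U u u' \<Longrightarrow> bfo U (\<lambda>e. e i \<E> u) (\<lambda>e. e i \<E> u')"
| bfo_neg: "bfo U P P' \<Longrightarrow> bfo U (\<lambda>e. \<not> P e) (\<lambda>e. \<not> P' e)"
| bfo_conj: "bfo U P P' \<Longrightarrow> bfo U Q Q' \<Longrightarrow> bfo U (\<lambda>e. P e \<and> Q e) (\<lambda>e. P' e \<and> Q' e)"
| bfo_bex0: "bfo U P P' \<Longrightarrow> bfo U (\<lambda>e. \<exists>x. x \<E> e k \<and> P (case_nat x e)) (\<lambda>e. \<exists>x. x \<E> e k \<and> P' (case_nat x e))"

lemma bfo_bex:
  assumes "bfo U (\<lambda>e. P (\<lambda>n. e (Suc n)) (e 0)) (\<lambda>e. P' (\<lambda>n. e (Suc n)) (e 0))"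
  shows "bfo U (\<lambda>e. \<exists>x. x \<E> e k \<and> P e x) (\<lambda>e. \<exists>x. x \<E> e k \<and> P' e x)"
  using bfo_bex0[OF assms, of k] by simp

lemma bfo_imp:
  assumes "bfo U P P'" "bfo U Q Q'"
  shows "bfo U (\<lambda>e. P e \<longrightarrow> Q e) (\<lambda>e. P' e \<longrightarrow> Q' e)"
  using bfo_neg[OF bfo_conj[OF assms(1) bfo_neg[OF assms(2)]]] by simp

lemma bfo_disj:
  assumes "bfo U P P'" "bfo U Q Q'"
  shows "bfo U (\<lambda>e. P e \<or> Q e) (\<lambda>e. P' e \<or> Q' e)"
  using bfo_neg[OF bfo_conj[OF bfo_neg[OF assms(1)] bfo_neg[OF assms(2)]]] by simp

lemma bfo_ball:
  assumes "bfo U (\<lambda>e. P (\<lambda>n. e (Suc n)) (e 0)) (\<lambda>e. P' (\<lambda>n. e (Suc n)) (e 0))"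
  shows "bfo U (\<lambda>e. \<forall>x. x \<E> e k \<longrightarrow> P e x) (\<lambda>e. \<forall>x. x \<E> e k \<longrightarrow> P' e x)"
  using bfo_neg[OF bfo_bex[OF bfo_neg[OF assms], of k]] by simp

lemma bfo_eq: "bfo U (\<lambda>e. e i = e k) (\<lambda>e. e i = e k)"
proof -
  have "bfo U (\<lambda>e. (\<forall>x. x \<E> e i \<longrightarrow> x \<E> e k) \<and> (\<forall>x. x \<E> e k \<longrightarrow> x \<E> e i)) (\<lambda>e. (\<forall>x. x \<E> e i \<longrightarrow> x \<E> e k) \<and> (\<forall>x. x \<E> e k \<longrightarrow> x \<E> e i))"
    by (intro bfo_conj bfo_ball bfo_mem)
  moreover have "((\<forall>x. x \<E> y \<longrightarrow> x \<E> z) \<and> (\<forall>x. x \<E> z \<longrightarrow> x \<E> y)) = (y = z)" for y z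
    using extensionality by blast
  ultimately show ?thesis by simp
qed

declare bfo_mem [bfo_intros] bfo_neg [bfo_intros] bfo_conj [bfo_intros] bfo_bex [bfo_intros]
  bfo_imp [bfo_intros] bfo_disj [bfo_intros] bfo_ball [bfo_intros] bfo_eq [bfo_intros]

lemma bfo_fo:
  assumes "bfo U P P'" "tra A" "tra A'"
    and "\<And>u u'. U u u' \<Longrightarrow> \<exists>w w'. U' w w' \<and> (\<forall>x. A x \<longrightarrow> (x \<E> u \<longleftrightarrow> x \<E> w)) \<and> (\<forall>x. A' x \<longrightarrow> (x \<E> u' \<longleftrightarrow> x \<E> w'))"
  shows "fo A A' U' P P'"
  using assms(1)
proof induction
  case (bfo_pred u u' i)
  then obtain w w' where "U' w w'" "\<forall>x. A x \<longrightarrow> (x \<E> u \<longleftrightarrow> x \<E> w)" "\<forall>x. A' x \<longrightarrow> (x \<E> u' \<longleftrightarrow> x \<E> w')"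
    using assms(4) by blast
  then show ?case by (intro fo_cong[OF fo_pred[of U' w w' A A' i]]) auto
next
  case (bfo_bex0 P P' k)
  have "fo A A' U' (\<lambda>e. \<exists>x. A x \<and> (case_nat x e 0 \<E> case_nat x e (Suc k) \<and> P (case_nat x e)))
    (\<lambda>e. \<exists>x. A' x \<and> (case_nat x e 0 \<E> case_nat x e (Suc k) \<and> P' (case_nat x e)))"
    by (rule fo_ex0[OF fo_conj[OF fo_mem bfo_bex0.IH]])
  then show ?case by (rule fo_cong) (use assms(2,3) in \<open>simp add: tra_def; blast\<close>)+
qed (auto intro: fo_mem fo_neg fo_conj)

lemma bfo_fo0: "bfo U P P' \<Longrightarrow> tra A \<Longrightarrow> tra A' \<Longrightarrow> fo A A' U P P'"
  using bfo_fo[of U P P' A A' U] by blast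

lemma bfo_up [bfo_intros]: "bfo U (\<lambda>e. e a = up (e b) (e c)) (\<lambda>e. e a = up (e b) (e c))"
proof -
  have "bfo U (\<lambda>e. (e b \<E> e a \<and> e c \<E> e a) \<and> (\<forall>x. x \<E> e a \<longrightarrow> x = e b \<or> x = e c)) (\<lambda>e. (e b \<E> e a \<and> e c \<E> e a) \<and> (\<forall>x. x \<E> e a \<longrightarrow> x = e b \<or> x = e c))"
    by (intro bfo_intros)
  moreover have "((y \<E> x \<and> z \<E> x) \<and> (\<forall>w. w \<E> x \<longrightarrow> w = y \<or> w = z)) = (x = up y z)" for x y z
    using extensionality[of x "up y z"] by auto
  ultimately show ?thesis by simp
qed

lemma bfo_pair [bfo_intros]: "bfo U (\<lambda>e. e a = \<langle>e b, e c\<rangle>) (\<lambda>e. e a = \<langle>e b, e c\<rangle>)"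
proof -
  have "bfo U (\<lambda>e. \<exists>s. s \<E> e a \<and> (\<exists>t. t \<E> e a \<and> (s = up (e b) (e b) \<and> t = up (e b) (e c) \<and> e a = up s t)))
    (\<lambda>e. \<exists>s. s \<E> e a \<and> (\<exists>t. t \<E> e a \<and> (s = up (e b) (e b) \<and> t = up (e b) (e c) \<and> e a = up s t)))"
    by (intro bfo_intros)
  moreover have "(\<exists>s. s \<E> x \<and> (\<exists>t. t \<E> x \<and> (s = up y y \<and> t = up y z \<and> x = up s t))) = (x = \<langle>y, z\<rangle>)" for x y z
    by (auto simp: kpair_def)
  ultimately show ?thesis by simp
qed

subsection \<open>Operations on relations\<close>

text \<open>This is \<open>x\<close> if \<open>p\<close> is in \<open>R\<close>, and the empty set
  otherwise: a conditional written as a union over the intersection of \<open>sing p\<close> and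
  \<open>R\<close>, so that it is rudimentary.\<close>

definition ifin :: "'a \<Rightarrow> 'a \<Rightarrow> 'a \<Rightarrow> 'a" where
  "ifin p R x = bigU (dif (sing p) (dif (sing p) R)) (\<lambda>_. x)"

abbreviation "UU x \<equiv> Uni (Uni x)"

text \<open>These operations are nested unions in order to be visibly rudimentary. On sets of
  tuples, \<open>ran\<close> drops the first coordinate and thereby expresses an existential
  quantifier, \<open>memx\<close> is membership between the first two coordinates,
  \<open>ins\<close> inserts a free second coordinate, and \<open>img\<close> takes a
  section.\<close>

definition prod :: "'a \<Rightarrow> 'a \<Rightarrow> 'a" where
  "prod x y = bigU x (\<lambda>u. bigU y (\<lambda>v. sing \<langle>u, v\<rangle>))"

definition ran :: "'a \<Rightarrow> 'a" where
  "ran x = bigU (UU x) (\<lambda>t. bigU (UU x) (\<lambda>u. ifin \<langle>u, t\<rangle> x (sing t)))"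

definition memx :: "'a \<Rightarrow> 'a \<Rightarrow> 'a" where
  "memx x y = bigU x (\<lambda>u. bigU x (\<lambda>v. bigU y (\<lambda>t. ifin u v (sing \<langle>u, \<langle>v, t\<rangle>\<rangle>))))"

definition ins :: "'a \<Rightarrow> 'a \<Rightarrow> 'a" where
  "ins x y = bigU (UU x) (\<lambda>u. bigU (UU x) (\<lambda>t. bigU y (\<lambda>z. ifin \<langle>u, t\<rangle> x (sing \<langle>u, \<langle>z, t\<rangle>\<rangle>))))"

definition img :: "'a \<Rightarrow> 'a \<Rightarrow> 'a" where
  "img x y = bigU (UU x) (\<lambda>u. ifin \<langle>u, y\<rangle> x (sing u))"

definition imgs :: "'a \<Rightarrow> 'a \<Rightarrow> 'a" where
  "imgs x y = bigU y (\<lambda>z. sing (img x z))"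

lemma DT_ifin [D_intros]: "DT x \<Longrightarrow> DT y \<Longrightarrow> DT z \<Longrightarrow> DT (\<lambda>e. ifin (x e) (y e) (z e))"
  by (erule (2) DT_subst3) (unfold ifin_def, intro D_intros)

lemma DT_ops [D_intros]:
  "DT x \<Longrightarrow> DT y \<Longrightarrow> DT (\<lambda>e. prod (x e) (y e))"
  "DT x \<Longrightarrow> DT (\<lambda>e. ran (x e))"
  "DT x \<Longrightarrow> DT y \<Longrightarrow> DT (\<lambda>e. memx (x e) (y e))"
  "DT x \<Longrightarrow> DT y \<Longrightarrow> DT (\<lambda>e. ins (x e) (y e))"
  "DT x \<Longrightarrow> DT y \<Longrightarrow> DT (\<lambda>e. img (x e) (y e))"
  subgoal by (erule (1) DT_subst2) (unfold prod_def, intro D_intros)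
  subgoal by (erule DT_subst1) (unfold ran_def, intro D_intros)
  subgoal by (erule (1) DT_subst2) (unfold memx_def, intro D_intros)
  subgoal by (erule (1) DT_subst2) (unfold ins_def, intro D_intros)
  subgoal by (erule (1) DT_subst2) (unfold img_def, intro D_intros)
  done

lemma DT_imgs [D_intros]: "DT x \<Longrightarrow> DT y \<Longrightarrow> DT (\<lambda>e. imgs (x e) (y e))"
  by (erule (1) DT_subst2) (unfold imgs_def, intro D_intros)

lemma mem_ifin [simp]: "z \<E> ifin p R x \<longleftrightarrow> p \<E> R \<and> z \<E> x"
proof -
  have "z \<E> ifin p R x \<longleftrightarrow> (\<exists>w. w \<E> dif (sing p) (dif (sing p) R) \<and> z \<E> x)"
    unfolding ifin_def by (rule mem_bigU) (intro D_intros)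
  then show ?thesis by auto
qed

lemma mem_prod [simp]: "z \<E> prod x y \<longleftrightarrow> (\<exists>u v. u \<E> x \<and> v \<E> y \<and> z = \<langle>u, v\<rangle>)"
proof -
  have "z \<E> bigU y (\<lambda>v. sing \<langle>u, v\<rangle>) \<longleftrightarrow> (\<exists>v. v \<E> y \<and> z \<E> sing \<langle>u, v\<rangle>)" for u
    by (rule mem_bigU) (intro D_intros)
  moreover have "z \<E> prod x y \<longleftrightarrow> (\<exists>u. u \<E> x \<and> z \<E> bigU y (\<lambda>v. sing \<langle>u, v\<rangle>))"
    unfolding prod_def by (rule mem_bigU) (intro D_intros)
  ultimately show ?thesis by auto
qed

lemma mem_ran [simp]: "t \<E> ran x \<longleftrightarrow> (\<exists>u. \<langle>u, t\<rangle> \<E> x)"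
proof -
  have "z \<E> bigU (UU x) (\<lambda>u. ifin \<langle>u, t\<rangle> x (sing t)) \<longleftrightarrow> (\<exists>u. u \<E> UU x \<and> z \<E> ifin \<langle>u, t\<rangle> x (sing t))" for z t
    by (rule mem_bigU) (intro D_intros)
  moreover have "t \<E> ran x \<longleftrightarrow> (\<exists>s. s \<E> UU x \<and> t \<E> bigU (UU x) (\<lambda>u. ifin \<langle>u, s\<rangle> x (sing s)))"
    unfolding ran_def by (rule mem_bigU) (intro D_intros)
  ultimately show ?thesis using pair_mem_Uni[of _ t x] by (simp del: mem_Uni) blast
qed

lemma mem_memx [simp]: "p \<E> memx x y \<longleftrightarrow> (\<exists>u v t. u \<E> x \<and> v \<E> x \<and> t \<E> y \<and> u \<E> v \<and> p = \<langle>u, \<langle>v, t\<rangle>\<rangle>)"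
proof -
  let ?h = "\<lambda>u v t. ifin u v (sing \<langle>u, \<langle>v, t\<rangle>\<rangle>)"
  have "p \<E> bigU y (?h u v) \<longleftrightarrow> (\<exists>t. t \<E> y \<and> p \<E> ?h u v t)" for u v
    by (rule mem_bigU) (intro D_intros)
  moreover have "p \<E> bigU x (\<lambda>v. bigU y (?h u v)) \<longleftrightarrow> (\<exists>v. v \<E> x \<and> p \<E> bigU y (?h u v))" for u
    by (rule mem_bigU) (intro D_intros)
  moreover have "p \<E> memx x y \<longleftrightarrow> (\<exists>u. u \<E> x \<and> p \<E> bigU x (\<lambda>v. bigU y (?h u v)))"
    unfolding memx_def by (rule mem_bigU) (intro D_intros)
  ultimately show ?thesis by (auto simp del: mem_Uni)
qed

lemma mem_ins [simp]: "p \<E> ins x y \<longleftrightarrow> (\<exists>u t z. \<langle>u, t\<rangle> \<E> x \<and> z \<E> y \<and> p = \<langle>u, \<langle>z, t\<rangle>\<rangle>)"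
proof -
  let ?h = "\<lambda>u t z. ifin \<langle>u, t\<rangle> x (sing \<langle>u, \<langle>z, t\<rangle>\<rangle>)"
  have "p \<E> bigU y (?h u v) \<longleftrightarrow> (\<exists>t. t \<E> y \<and> p \<E> ?h u v t)" for u v
    by (rule mem_bigU) (intro D_intros)
  moreover have "p \<E> bigU (UU x) (\<lambda>v. bigU y (?h u v)) \<longleftrightarrow> (\<exists>v. v \<E> UU x \<and> p \<E> bigU y (?h u v))" for u
    by (rule mem_bigU) (intro D_intros)
  moreover have "p \<E> ins x y \<longleftrightarrow> (\<exists>u. u \<E> UU x \<and> p \<E> bigU (UU x) (\<lambda>v. bigU y (?h u v)))"
    unfolding ins_def by (rule mem_bigU) (intro D_intros)
  ultimately show ?thesis using pair_mem_Uni[of _ _ x] by (simp del: mem_Uni) blast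
qed

lemma mem_img [simp]: "u \<E> img x y \<longleftrightarrow> \<langle>u, y\<rangle> \<E> x"
proof -
  have "u \<E> img x y \<longleftrightarrow> (\<exists>w. w \<E> UU x \<and> u \<E> ifin \<langle>w, y\<rangle> x (sing w))"
    unfolding img_def by (rule mem_bigU) (intro D_intros)
  then show ?thesis using pair_mem_Uni[of _ _ x] by (auto simp del: mem_Uni)
qed

lemma mem_imgs [simp]: "w \<E> imgs x y \<longleftrightarrow> (\<exists>z. z \<E> y \<and> w = img x z)"
  unfolding imgs_def by (subst mem_bigU) (intro D_intros, auto)

text \<open>Every first-order definable relation is obtained from its predicates by these operations, see
  \<open>relalg.fo_Rel\<close>.\<close>

definition ops :: "('a \<Rightarrow> 'a \<Rightarrow> 'a) set" where
  "ops = {dif, up, prod, \<lambda>x y. ran x, memx, ins}"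

lemma finite_ops: "finite ops" by (simp add: ops_def)

lemma bfo_pair3 [bfo_intros]: "bfo U (\<lambda>e. e a = \<langle>e b, \<langle>e c, e d\<rangle>\<rangle>) (\<lambda>e. e a = \<langle>e b, \<langle>e c, e d\<rangle>\<rangle>)"
proof -
  have "bfo U (\<lambda>e. \<exists>q. q \<E> e a \<and> (\<exists>r. r \<E> q \<and> (r = \<langle>e c, e d\<rangle> \<and> e a = \<langle>e b, r\<rangle>)))
    (\<lambda>e. \<exists>q. q \<E> e a \<and> (\<exists>r. r \<E> q \<and> (r = \<langle>e c, e d\<rangle> \<and> e a = \<langle>e b, r\<rangle>)))"
    by (intro bfo_intros)
  moreover have "(\<exists>q. q \<E> x \<and> (\<exists>r. r \<E> q \<and> (r = \<langle>z, w\<rangle> \<and> x = \<langle>y, r\<rangle>))) = (x = \<langle>y, \<langle>z, w\<rangle>\<rangle>)" for x y z w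
    by (metis kpair_def mem_up)
  ultimately show ?thesis by simp
qed

lemma bfo_rename: "bfo U P P' \<Longrightarrow> bfo U (\<lambda>e. P (\<lambda>i. e (s i))) (\<lambda>e. P' (\<lambda>i. e (s i)))"
proof (induction arbitrary: s rule: bfo.induct)
  case (bfo_bex0 P P' k)
  have *: "(\<lambda>i. case_nat x e (case_nat 0 (\<lambda>n. Suc (s n)) i)) = case_nat x (\<lambda>i. e (s i))" for x and e :: "nat \<Rightarrow> 'a"
    by (auto split: nat.split)
  show ?case
    using bfo.bfo_bex0[OF bfo_bex0.IH[of "case_nat 0 (\<lambda>n. Suc (s n))"]] unfolding * .
qed (auto intro: bfo.intros)

text \<open>The components of a pair are elements of its elements, so both quantifiers are
  bounded.\<close>

lemma bfo_pair_bex [bfo_intros]: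
  assumes "bfo U (\<lambda>e. P (\<lambda>n. e (Suc (Suc n))) (e 1) (e 0)) (\<lambda>e. P' (\<lambda>n. e (Suc (Suc n))) (e 1) (e 0))"
  shows "bfo U (\<lambda>e. \<exists>u t. e k = \<langle>u, t\<rangle> \<and> P e u t) (\<lambda>e. \<exists>u t. e k = \<langle>u, t\<rangle> \<and> P' e u t)"
proof -
  let ?s = "case_nat 0 (case_nat 1 (\<lambda>n. Suc (Suc (Suc n))))"
  have 1: "bfo U (\<lambda>e. P (\<lambda>n. e (Suc (Suc (Suc n)))) (e 1) (e 0)) (\<lambda>e. P' (\<lambda>n. e (Suc (Suc (Suc n)))) (e 1) (e 0))"
    using bfo_rename[OF assms, of ?s] by simp
  have "bfo U (\<lambda>e. \<exists>r. r \<E> e k \<and> (\<exists>u. u \<E> r \<and> (\<exists>t. t \<E> r \<and> (e k = \<langle>u, t\<rangle> \<and> P e u t))))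
    (\<lambda>e. \<exists>r. r \<E> e k \<and> (\<exists>u. u \<E> r \<and> (\<exists>t. t \<E> r \<and> (e k = \<langle>u, t\<rangle> \<and> P' e u t))))"
    using 1 by (intro bfo_intros) simp
  moreover have "(\<exists>r. r \<E> x \<and> (\<exists>u. u \<E> r \<and> (\<exists>t. t \<E> r \<and> (x = \<langle>u, t\<rangle> \<and> Q u t)))) = (\<exists>u t. x = \<langle>u, t\<rangle> \<and> Q u t)" for x Q
    by (metis kpair_def mem_up)
  ultimately show ?thesis by simp
qed

lemma bfo_op:
  assumes "f \<in> ops"
  shows "bfo U (\<lambda>e. e c = f (e a) (e b)) (\<lambda>e. e c = f (e a) (e b))"
proof -
  have ext: "x = y \<longleftrightarrow> (\<forall>z. z \<E> x \<longrightarrow> z \<E> y) \<and> (\<forall>z. z \<E> y \<longrightarrow> z \<E> x)" for x y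
    using extensionality by blast
  consider "f = dif" | "f = up" | "f = prod" | "f = (\<lambda>x y. ran x)" | "f = memx" | "f = ins"
    using assms unfolding ops_def by blast
  then show ?thesis
  proof cases
    case 1
    have *: "x = dif y z \<longleftrightarrow> (\<forall>w. w \<E> x \<longrightarrow> w \<E> y \<and> \<not> w \<E> z) \<and> (\<forall>w. w \<E> y \<longrightarrow> (\<not> w \<E> z \<longrightarrow> w \<E> x))" for x y z
      unfolding ext[of x] by simp blast
    show ?thesis unfolding 1 * by (intro bfo_intros)
  next
    case 2
    show ?thesis unfolding 2 by (intro bfo_intros)
  next
    case 3
    have *: "x = prod y z \<longleftrightarrow> (\<forall>w. w \<E> x \<longrightarrow> (\<exists>u. u \<E> y \<and> (\<exists>v. v \<E> z \<and> w = \<langle>u, v\<rangle>))) \<and> (\<forall>u. u \<E> y \<longrightarrow> (\<forall>v. v \<E> z \<longrightarrow> (\<exists>w. w \<E> x \<and> w = \<langle>u, v\<rangle>)))" for x y z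
      unfolding ext[of x] by simp blast
    show ?thesis unfolding 3 * by (intro bfo_intros)
  next
    case 4
    have *: "x = ran y \<longleftrightarrow> (\<forall>t. t \<E> x \<longrightarrow> (\<exists>w. w \<E> y \<and> (\<exists>u v. w = \<langle>u, v\<rangle> \<and> v = t))) \<and> (\<forall>w. w \<E> y \<longrightarrow> \<not> (\<exists>u v. w = \<langle>u, v\<rangle> \<and> \<not> v \<E> x))" for x y
      unfolding ext[of x] by simp blast
    show ?thesis unfolding 4 * by (intro bfo_intros)
  next
    case 5
    have *: "x = memx y z \<longleftrightarrow> (\<forall>w. w \<E> x \<longrightarrow> (\<exists>u. u \<E> y \<and> (\<exists>v. v \<E> y \<and> (\<exists>t. t \<E> z \<and> (u \<E> v \<and> w = \<langle>u, \<langle>v, t\<rangle>\<rangle>))))) \<and>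
      (\<forall>u. u \<E> y \<longrightarrow> (\<forall>v. v \<E> y \<longrightarrow> (\<forall>t. t \<E> z \<longrightarrow> (u \<E> v \<longrightarrow> (\<exists>w. w \<E> x \<and> w = \<langle>u, \<langle>v, t\<rangle>\<rangle>)))))" for x y z
      unfolding ext[of x] by simp blast
    show ?thesis unfolding 5 * by (intro bfo_intros)
  next
    case 6
    have *: "x = ins y z \<longleftrightarrow> (\<forall>w. w \<E> x \<longrightarrow> (\<exists>q. q \<E> y \<and> (\<exists>v. v \<E> z \<and> (\<exists>u t. q = \<langle>u, t\<rangle> \<and> w = \<langle>u, \<langle>v, t\<rangle>\<rangle>)))) \<and>
      (\<forall>q. q \<E> y \<longrightarrow> (\<forall>v. v \<E> z \<longrightarrow> \<not> (\<exists>u t. q = \<langle>u, t\<rangle> \<and> \<not> (\<exists>w. w \<E> x \<and> w = \<langle>u, \<langle>v, t\<rangle>\<rangle>))))" for x y z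
      unfolding ext[of x] by simp blast
    show ?thesis unfolding 6 * by (intro bfo_intros)
  qed
qed

subsection \<open>Relation algebra and first-order definability\<close>

text \<open>Because of the end marker \<open>emp\<close>, a unary relation is a set of pairs with
  second component \<open>emp\<close>. Products with \<open>sing emp\<close> in later statements
  turn a class into such a relation.\<close>

primrec tup :: "'a list \<Rightarrow> 'a" where
  "tup [] = emp"
| "tup (x # xs) = \<langle>x, tup xs\<rangle>"

lemma tup_inj: "length xs = length ys \<Longrightarrow> tup xs = tup ys \<longleftrightarrow> xs = ys"
  by (induction xs ys rule: list_induct2) auto

primrec pw :: "'a \<Rightarrow> nat \<Rightarrow> 'a" where
  "pw A 0 = sing emp"
| "pw A (Suc n) = prod A (pw A n)"

lemma mem_pw: "t \<E> pw A n \<longleftrightarrow> (\<exists>xs. length xs = n \<and> (\<forall>x\<in>set xs. x \<E> A) \<and> t = tup xs)"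
proof (induction n arbitrary: t)
  case (Suc n)
  show ?case
  proof
    assume "t \<E> pw A (Suc n)"
    then obtain u v where uv: "u \<E> A" "v \<E> pw A n" "t = \<langle>u, v\<rangle>" by auto
    then obtain xs where "length xs = n" "\<forall>x\<in>set xs. x \<E> A" "v = tup xs" using Suc by blast
    with uv show "\<exists>xs. length xs = Suc n \<and> (\<forall>x\<in>set xs. x \<E> A) \<and> t = tup xs"
      by (intro exI[of _ "u # xs"]) auto
  next
    assume "\<exists>xs. length xs = Suc n \<and> (\<forall>x\<in>set xs. x \<E> A) \<and> t = tup xs"
    then obtain x xs where "length xs = n" "\<forall>y\<in>set (x # xs). y \<E> A" "t = tup (x # xs)"
      by (metis length_Suc_conv)
    then show "t \<E> pw A (Suc n)" using Suc by auto
  qed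
qed auto

definition isrel :: "'a \<Rightarrow> nat \<Rightarrow> ('a list \<Rightarrow> bool) \<Rightarrow> 'a \<Rightarrow> bool" where
  "isrel A n P R \<longleftrightarrow> (\<forall>t. t \<E> R \<longleftrightarrow> (\<exists>xs. length xs = n \<and> (\<forall>x\<in>set xs. x \<E> A) \<and> t = tup xs \<and> P xs))"

lemma isrel_dif: "isrel A n P R \<Longrightarrow> isrel A n (\<lambda>xs. \<not> P xs) (dif (pw A n) R)"
  unfolding isrel_def by (auto simp: mem_pw tup_inj)

lemma isrel_dif2: "isrel A n P R \<Longrightarrow> isrel A n Q S \<Longrightarrow> isrel A n (\<lambda>xs. P xs \<and> \<not> Q xs) (dif R S)"
  unfolding isrel_def by (auto simp: tup_inj)

lemma list_Suc_ex: "(\<exists>xs. length xs = Suc n \<and> P xs) \<longleftrightarrow> (\<exists>x xs. length xs = n \<and> P (x # xs))"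
  by (metis length_Suc_conv length_Cons)

lemma isrel_prod: "isrel A n P R \<Longrightarrow> isrel A (Suc n) (\<lambda>xs. hd xs \<E> B \<and> P (tl xs)) (prod (dif A (dif A B)) R)"
  unfolding isrel_def list_Suc_ex by auto

lemma isrel_ran: "isrel A (Suc n) P R \<Longrightarrow> isrel A n (\<lambda>xs. \<exists>x. x \<E> A \<and> P (x # xs)) (ran R)"
  unfolding isrel_def list_Suc_ex by auto

lemma isrel_memx: "isrel A (Suc (Suc n)) (\<lambda>xs. xs ! 0 \<E> xs ! 1) (memx A (pw A n))"
  unfolding isrel_def list_Suc_ex by (auto simp: mem_pw; blast)

lemma isrel_ins: "isrel A (Suc n) P R \<Longrightarrow> isrel A (Suc (Suc n)) (\<lambda>xs. P (hd xs # tl (tl xs))) (ins R A)"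
  unfolding isrel_def list_Suc_ex by auto

end

text \<open>Three instances of \<open>F R R'\<close> occur: \<open>R'\<close> is the image of \<open>R \<E> V\<close> under an embedding; \<open>R'\<close> is the
  image of a subclass \<open>R\<close> of \<open>V\<close> under the action of a good embedding; \<open>R = R'\<close> belongs to the
  rudimentary closure.\<close>

locale relalg = ZF +
  fixes A A' :: 'a and F :: "'a \<Rightarrow> 'a \<Rightarrow> bool"
  assumes TA: "Tran A" and TA': "Tran A'" and F_A: "F A A'" and F_one: "F (sing emp) (sing emp)"
    and F_dif: "F R R' \<Longrightarrow> F S S' \<Longrightarrow> F (dif R S) (dif R' S')"
    and F_prod: "F R R' \<Longrightarrow> F S S' \<Longrightarrow> F (prod R S) (prod R' S')"
    and F_ran: "F R R' \<Longrightarrow> F (ran R) (ran R')"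
    and F_memx: "F R R' \<Longrightarrow> F S S' \<Longrightarrow> F (memx R S) (memx R' S')"
    and F_ins: "F R R' \<Longrightarrow> F S S' \<Longrightarrow> F (ins R S) (ins R' S')"
begin

lemma F_pw: "F (pw A n) (pw A' n)"
  by (induction n) (auto intro: F_one F_prod F_A)

definition Rel :: "nat \<Rightarrow> ('a list \<Rightarrow> bool) \<Rightarrow> ('a list \<Rightarrow> bool) \<Rightarrow> bool" where
  "Rel n P P' \<longleftrightarrow> (\<exists>R R'. F R R' \<and> isrel A n P R \<and> isrel A' n P' R')"

lemma RelI: "F R R' \<Longrightarrow> isrel A n P R \<Longrightarrow> isrel A' n P' R' \<Longrightarrow> Rel n P P'"
  unfolding Rel_def by blast

lemma RelE: "Rel n P P' \<Longrightarrow> (\<And>R R'. F R R' \<Longrightarrow> isrel A n P R \<Longrightarrow> isrel A' n P' R' \<Longrightarrow> thesis) \<Longrightarrow> thesis"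
  unfolding Rel_def by blast

lemma Rel_neg: "Rel n P P' \<Longrightarrow> Rel n (\<lambda>xs. \<not> P xs) (\<lambda>xs. \<not> P' xs)"
  by (erule RelE, rule RelI[OF F_dif[OF F_pw] isrel_dif isrel_dif])

lemma Rel_conj: assumes "Rel n P P'" "Rel n Q Q'" shows "Rel n (\<lambda>xs. P xs \<and> Q xs) (\<lambda>xs. P' xs \<and> Q' xs)"
proof -
  have "Rel n (\<lambda>xs. P xs \<and> \<not> \<not> Q xs) (\<lambda>xs. P' xs \<and> \<not> \<not> Q' xs)"
    by (rule RelE[OF assms(1)], rule RelE[OF Rel_neg[OF assms(2)]], rule RelI[OF F_dif isrel_dif2 isrel_dif2])
  then show ?thesis by simp
qed

lemma Rel_ex: "Rel (Suc n) P P' \<Longrightarrow> Rel n (\<lambda>xs. \<exists>x. x \<E> A \<and> P (x # xs)) (\<lambda>xs. \<exists>x. x \<E> A' \<and> P' (x # xs))"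
  by (erule RelE, rule RelI[OF F_ran isrel_ran isrel_ran])

lemma Rel_cong:
  assumes "Rel n P P'" "\<And>xs. length xs = n \<Longrightarrow> (\<And>x. x \<in> set xs \<Longrightarrow> x \<E> A) \<Longrightarrow> P xs = Q xs"
    "\<And>xs. length xs = n \<Longrightarrow> (\<And>x. x \<in> set xs \<Longrightarrow> x \<E> A') \<Longrightarrow> P' xs = Q' xs"
  shows "Rel n Q Q'"
proof -
  have eq: "length xs = n \<and> (\<forall>x\<in>set xs. x \<E> A) \<and> t = tup xs \<and> P xs \<longleftrightarrow> length xs = n \<and> (\<forall>x\<in>set xs. x \<E> A) \<and> t = tup xs \<and> Q xs"
    "length xs = n \<and> (\<forall>x\<in>set xs. x \<E> A') \<and> t = tup xs \<and> P' xs \<longleftrightarrow> length xs = n \<and> (\<forall>x\<in>set xs. x \<E> A') \<and> t = tup xs \<and> Q' xs" for xs t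
    using assms(2,3)[of xs] by auto
  have "isrel A n P R \<longleftrightarrow> isrel A n Q R" "isrel A' n P' R \<longleftrightarrow> isrel A' n Q' R" for R
    unfolding isrel_def eq by (rule refl)+
  then show ?thesis using assms(1) unfolding Rel_def by simp
qed

lemma Rel_hd: assumes "Rel n P P'" "F B B'"
  shows "Rel (Suc n) (\<lambda>xs. hd xs \<E> B \<and> P (tl xs)) (\<lambda>xs. hd xs \<E> B' \<and> P' (tl xs))"
  by (rule RelE[OF assms(1)], rule RelI[OF F_prod[OF F_dif[OF F_A F_dif[OF F_A assms(2)]]] isrel_prod isrel_prod])

lemma Rel_tl: assumes "Rel n P P'"
  shows "Rel (Suc n) (\<lambda>xs. P (tl xs)) (\<lambda>xs. P' (tl xs))"
  by (rule Rel_cong[OF Rel_hd[OF assms F_A]]) (auto simp: length_Suc_conv)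

lemma Rel_True: "Rel n (\<lambda>xs. True) (\<lambda>xs. True)"
  unfolding Rel_def by (intro exI[of _ "pw A n"] exI[of _ "pw A' n"]) (auto simp: F_pw isrel_def mem_pw)

lemma Rel_pred: "F u u' \<Longrightarrow> i < n \<Longrightarrow> Rel n (\<lambda>xs. xs ! i \<E> u) (\<lambda>xs. xs ! i \<E> u')"
proof (induction n arbitrary: i)
  case (Suc n)
  show ?case
  proof (cases i)
    case 0
    show ?thesis by (rule Rel_cong[OF Rel_hd[OF Rel_True Suc.prems(1)]]) (auto simp: 0 length_Suc_conv)
  next
    case (Suc k)
    then have "Rel n (\<lambda>xs. xs ! k \<E> u) (\<lambda>xs. xs ! k \<E> u')" using Suc.IH Suc.prems by simp
    from Rel_tl[OF this] show ?thesis by (rule Rel_cong) (auto simp: Suc length_Suc_conv)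
  qed
qed simp

text \<open>\<open>memx\<close> provides membership of coordinate 0 in coordinate 1; each
  application of \<open>ins\<close> shifts the latter one place to the right.\<close>

lemma Rel_mem0: "Rel (Suc (Suc (k + n))) (\<lambda>xs. xs ! 0 \<E> xs ! Suc k) (\<lambda>xs. xs ! 0 \<E> xs ! Suc k)"
proof (induction k)
  case 0
  show ?case using RelI[OF F_memx[OF F_A F_pw] isrel_memx isrel_memx, of n] by simp
next
  case (Suc k)
  then have "Rel (Suc (Suc (Suc (k + n)))) (\<lambda>xs. (hd xs # tl (tl xs)) ! 0 \<E> (hd xs # tl (tl xs)) ! Suc k) (\<lambda>xs. (hd xs # tl (tl xs)) ! 0 \<E> (hd xs # tl (tl xs)) ! Suc k)"
    by (elim RelE) (rule RelI[OF F_ins[OF _ F_A] isrel_ins isrel_ins])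
  then show ?case unfolding add_Suc by (rule Rel_cong) (auto simp: length_Suc_conv)
qed

lemma Rel_mem1: "i < k \<Longrightarrow> k < n \<Longrightarrow> Rel n (\<lambda>xs. xs ! i \<E> xs ! k) (\<lambda>xs. xs ! i \<E> xs ! k)"
proof (induction i arbitrary: k n)
  case 0
  then obtain k' m where "k = Suc k'" "n = Suc (Suc (k' + m))"
    by (metis add_Suc less_imp_Suc_add not_gr_zero gr0_implies_Suc)
  then show ?case using Rel_mem0[of k' m] by simp
next
  case (Suc i)
  then obtain k' m where km: "k = Suc k'" "n = Suc m" by (metis Suc_lessE less_imp_Suc_add)
  then have "Rel m (\<lambda>xs. xs ! i \<E> xs ! k') (\<lambda>xs. xs ! i \<E> xs ! k')" using Suc by auto
  from Rel_tl[OF this] show ?case unfolding km by (rule Rel_cong) (auto simp: length_Suc_conv)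
qed

lemma Rel_eq:
  assumes "i < n" "k < n"
  shows "Rel n (\<lambda>xs. xs ! i = xs ! k) (\<lambda>xs. xs ! i = xs ! k)"
proof -
  have 1: "Rel (Suc n) (\<lambda>xs. xs ! 0 \<E> xs ! Suc a \<and> \<not> xs ! 0 \<E> xs ! Suc b) (\<lambda>xs. xs ! 0 \<E> xs ! Suc a \<and> \<not> xs ! 0 \<E> xs ! Suc b)"
    if "a < n" "b < n" for a b
    by (intro Rel_conj Rel_neg Rel_mem1) (use that in auto)
  have e: "x = y \<longleftrightarrow> \<not> (\<exists>z. z \<E> B \<and> z \<E> x \<and> \<not> z \<E> y) \<and> \<not> (\<exists>z. z \<E> B \<and> z \<E> y \<and> \<not> z \<E> x)"
    if "Tran B" "x \<E> B" "y \<E> B" for x y B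
    using extensionality[of x y] TranD[OF that(1)] that(2,3) by blast
  show ?thesis
    by (rule Rel_cong[OF Rel_conj[OF Rel_neg[OF Rel_ex[OF 1[OF assms]]] Rel_neg[OF Rel_ex[OF 1[OF assms(2,1)]]]]])
      (use e[OF TA] e[OF TA'] assms in auto)
qed

text \<open>In \<open>Rel_mem1\<close> the element has to stand before the set. In general a fresh
  coordinate in front is set equal to coordinate \<open>i\<close>.\<close>

lemma Rel_mem:
  assumes "i < n" "k < n"
  shows "Rel n (\<lambda>xs. xs ! i \<E> xs ! k) (\<lambda>xs. xs ! i \<E> xs ! k)"
proof -
  have "Rel n (\<lambda>xs. \<exists>x. x \<E> A \<and> ((x # xs) ! 0 = (x # xs) ! Suc i \<and> (x # xs) ! 0 \<E> (x # xs) ! Suc k))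
     (\<lambda>xs. \<exists>x. x \<E> A' \<and> ((x # xs) ! 0 = (x # xs) ! Suc i \<and> (x # xs) ! 0 \<E> (x # xs) ! Suc k))"
    by (intro Rel_ex Rel_conj Rel_eq Rel_mem1) (use assms in auto)
  then show ?thesis by (rule Rel_cong) (use assms in auto)
qed

text \<open>\<open>s\<close> tells which coordinates of the tuple are read at the de Bruijn places.
  Under a quantifier the new value is put in front, which is the coordinate that \<open>ran\<close>
  removes.\<close>

lemma fo_Rel:
  assumes "fo (\<lambda>x. x \<E> A) (\<lambda>x. x \<E> A') F P P'" "\<And>i. s i < n"
  shows "Rel n (\<lambda>xs. P (\<lambda>i. xs ! s i)) (\<lambda>xs. P' (\<lambda>i. xs ! s i))"
  using assms
proof (induction arbitrary: n s rule: fo.induct)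
  case (fo_ex0 P P')
  have "Rel n (\<lambda>xs. \<exists>x. x \<E> A \<and> P (\<lambda>i. (x # xs) ! case_nat 0 (\<lambda>n. Suc (s n)) i))
     (\<lambda>xs. \<exists>x. x \<E> A' \<and> P' (\<lambda>i. (x # xs) ! case_nat 0 (\<lambda>n. Suc (s n)) i))"
    by (rule Rel_ex, rule fo_ex0.IH) (use fo_ex0.prems in \<open>auto split: nat.split\<close>)
  moreover have "(\<lambda>i. (x # xs) ! case_nat 0 (\<lambda>n. Suc (s n)) i) = case_nat x (\<lambda>i. xs ! s i)" for x :: 'a and xs
    by (auto split: nat.split)
  ultimately show ?case by simp
next
  case (fo_cong P P' Q Q')
  show ?case
    by (rule Rel_cong[OF fo_cong.IH[OF fo_cong.prems]]) (use fo_cong.hyps fo_cong.prems in auto)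
qed (auto intro: Rel_mem Rel_pred Rel_neg Rel_conj)

text \<open>The section at \<open>emp\<close> removes the end marker, so that a class can be read
  off from the unary relation.\<close>

lemma fo_unary:
  assumes "fo (\<lambda>x. x \<E> A) (\<lambda>x. x \<E> A') F P P'"
  obtains B B' where "\<And>x. x \<E> B \<longleftrightarrow> x \<E> A \<and> P (\<lambda>_. x)" "\<And>x. x \<E> B' \<longleftrightarrow> x \<E> A' \<and> P' (\<lambda>_. x)"
    "F (prod B (sing emp)) (prod B' (sing emp))"
proof -
  obtain R R' where R: "F R R'" "isrel A 1 (\<lambda>xs. P (\<lambda>i. xs ! 0)) R" "isrel A' 1 (\<lambda>xs. P' (\<lambda>i. xs ! 0)) R'"
    using fo_Rel[OF assms, of "\<lambda>_. 0" 1] unfolding Rel_def by auto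
  have *: "isrel C 1 (\<lambda>xs. Q (\<lambda>i. xs ! 0)) S \<Longrightarrow> t \<E> S \<longleftrightarrow> (\<exists>x. x \<E> C \<and> Q (\<lambda>_. x) \<and> t = \<langle>x, emp\<rangle>)" for C Q S t
    unfolding isrel_def One_nat_def list_Suc_ex by auto
  have **: "t \<E> R \<longleftrightarrow> (\<exists>x. x \<E> A \<and> P (\<lambda>_. x) \<and> t = \<langle>x, emp\<rangle>)" "t \<E> R' \<longleftrightarrow> (\<exists>x. x \<E> A' \<and> P' (\<lambda>_. x) \<and> t = \<langle>x, emp\<rangle>)" for t
    using *[OF R(2)] *[OF R(3)] by auto
  show thesis
  proof (rule that[of "img R emp" "img R' emp"])
    show 1: "x \<E> img R emp \<longleftrightarrow> x \<E> A \<and> P (\<lambda>_. x)" for x using ** by auto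
    show 2: "x \<E> img R' emp \<longleftrightarrow> x \<E> A' \<and> P' (\<lambda>_. x)" for x using ** by auto
    have "prod (img R emp) (sing emp) = R" "prod (img R' emp) (sing emp) = R'"
      by (rule extensionality; use ** in auto)+
    then show "F (prod (img R emp) (sing emp)) (prod (img R' emp) (sing emp))" using R by simp
  qed
qed

end

section \<open>Finite support of first-order predicates, and elementarity\<close>

context ZF
begin

text \<open>Assignments are infinite while relations have finite arity. This is the bridge between
  the two that \<open>fo_elem\<close> uses.\<close>

lemma fo_support:
  assumes "fo A A' U P P'"
  shows "\<exists>n. (\<forall>e e'. (\<forall>i. A (e i)) \<and> (\<forall>i. A (e' i)) \<and> (\<forall>i<n. e i = e' i) \<longrightarrow> P e = P e') \<and>
    (\<forall>e e'. (\<forall>i. A' (e i)) \<and> (\<forall>i. A' (e' i)) \<and> (\<forall>i<n. e i = e' i) \<longrightarrow> P' e = P' e')"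
  using assms
proof induction
  case (fo_mem i k)
  show ?case by (rule exI[of _ "Suc (i + k)"]) auto
next
  case (fo_pred u u' i)
  show ?case by (rule exI[of _ "Suc i"]) auto
next
  case (fo_conj P P' Q Q')
  then obtain n m where 1: "\<forall>e e'. (\<forall>i. A (e i)) \<and> (\<forall>i. A (e' i)) \<and> (\<forall>i<n. e i = e' i) \<longrightarrow> P e = P e'"
    "\<forall>e e'. (\<forall>i. A' (e i)) \<and> (\<forall>i. A' (e' i)) \<and> (\<forall>i<n. e i = e' i) \<longrightarrow> P' e = P' e'"
    and 2: "\<forall>e e'. (\<forall>i. A (e i)) \<and> (\<forall>i. A (e' i)) \<and> (\<forall>i<m. e i = e' i) \<longrightarrow> Q e = Q e'"
    "\<forall>e e'. (\<forall>i. A' (e i)) \<and> (\<forall>i. A' (e' i)) \<and> (\<forall>i<m. e i = e' i) \<longrightarrow> Q' e = Q' e'"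
    by blast
  show ?case
  proof (rule exI[of _ "n + m"], intro conjI allI impI)
    fix e e' assume *: "(\<forall>i. A (e i)) \<and> (\<forall>i. A (e' i)) \<and> (\<forall>i<n+m. e i = e' i)"
    then have "P e = P e'" "Q e = Q e'" using 1(1) 2(1) by auto
    then show "(P e \<and> Q e) = (P e' \<and> Q e')" by simp
  next
    fix e e' assume *: "(\<forall>i. A' (e i)) \<and> (\<forall>i. A' (e' i)) \<and> (\<forall>i<n+m. e i = e' i)"
    then have "P' e = P' e'" "Q' e = Q' e'" using 1(2) 2(2) by auto
    then show "(P' e \<and> Q' e) = (P' e' \<and> Q' e')" by simp
  qed
next
  case (fo_ex0 P P')
  then obtain n where n: "\<forall>e e'. (\<forall>i. A (e i)) \<and> (\<forall>i. A (e' i)) \<and> (\<forall>i<n. e i = e' i) \<longrightarrow> P e = P e'"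
    "\<forall>e e'. (\<forall>i. A' (e i)) \<and> (\<forall>i. A' (e' i)) \<and> (\<forall>i<n. e i = e' i) \<longrightarrow> P' e = P' e'"
    by blast
  have *: "\<forall>i. B (case_nat x e i)" if "B x" "\<forall>i. B (e i)" for B x and e :: "nat \<Rightarrow> 'a"
    using that by (auto split: nat.split)
  have **: "\<forall>i<n. case_nat x e i = case_nat x e' i" if "\<forall>i<n. e i = e' i" for x and e e' :: "nat \<Rightarrow> 'a"
    using that by (auto split: nat.split)
  show ?case
  proof (rule exI[of _ n], intro conjI allI impI)
    fix e e' assume h: "(\<forall>i. A (e i)) \<and> (\<forall>i. A (e' i)) \<and> (\<forall>i<n. e i = e' i)"
    have "P (case_nat x e) = P (case_nat x e')" if "A x" for x
      by (rule n(1)[rule_format], intro conjI; use h that *[of A] **[of e e'] in blast)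
    then show "(\<exists>x. A x \<and> P (case_nat x e)) = (\<exists>x. A x \<and> P (case_nat x e'))" by auto
  next
    fix e e' assume h: "(\<forall>i. A' (e i)) \<and> (\<forall>i. A' (e' i)) \<and> (\<forall>i<n. e i = e' i)"
    have "P' (case_nat x e) = P' (case_nat x e')" if "A' x" for x
      by (rule n(2)[rule_format], intro conjI; use h that *[of A'] **[of e e'] in blast)
    then show "(\<exists>x. A' x \<and> P' (case_nat x e)) = (\<exists>x. A' x \<and> P' (case_nat x e'))" by auto
  qed
next
  case (fo_cong P P' Q Q')
  from fo_cong.IH obtain n where n: "\<And>e e'. (\<forall>i. A (e i)) \<and> (\<forall>i. A (e' i)) \<and> (\<forall>i<n. e i = e' i) \<Longrightarrow> P e = P e'"
    "\<And>e e'. (\<forall>i. A' (e i)) \<and> (\<forall>i. A' (e' i)) \<and> (\<forall>i<n. e i = e' i) \<Longrightarrow> P' e = P' e'"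
    by blast
  show ?case
  proof (rule exI[of _ n], intro conjI allI impI)
    fix e e' assume h: "(\<forall>i. A (e i)) \<and> (\<forall>i. A (e' i)) \<and> (\<forall>i<n. e i = e' i)"
    have "P e = Q e" by (rule fo_cong.hyps) (use h in blast)
    moreover have "P e' = Q e'" by (rule fo_cong.hyps) (use h in blast)
    ultimately show "Q e = Q e'" using n(1)[OF h] by blast
  next
    fix e e' assume h: "(\<forall>i. A' (e i)) \<and> (\<forall>i. A' (e' i)) \<and> (\<forall>i<n. e i = e' i)"
    have "P' e = Q' e" by (rule fo_cong.hyps) (use h in blast)
    moreover have "P' e' = Q' e'" by (rule fo_cong.hyps) (use h in blast)
    ultimately show "Q' e = Q' e'" using n(2)[OF h] by blast
  qed
qed auto

lemma tup_map_mem: "\<forall>x\<in>set xs. x \<E> A \<Longrightarrow> length xs = n \<Longrightarrow> isrel A n P R \<Longrightarrow> tup xs \<E> R \<longleftrightarrow> P xs"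
  unfolding isrel_def using tup_inj by metis

end

context relalg
begin

lemma fo_elem:
  assumes fo: "fo (\<lambda>x. x \<E> A) (\<lambda>x. x \<E> A') F P P'"
    and h: "\<And>R R' xs. F R R' \<Longrightarrow> \<forall>x\<in>set xs. x \<E> A \<Longrightarrow> tup xs \<E> R \<longleftrightarrow> tup (map h xs) \<E> R'"
    and h': "\<And>x. x \<E> A \<Longrightarrow> h x \<E> A'" and e: "\<And>i. e i \<E> A"
  shows "P e \<longleftrightarrow> P' (\<lambda>i. h (e i))"
proof -
  obtain n where n: "\<And>e e'. (\<forall>i. e i \<E> A) \<Longrightarrow> (\<forall>i. e' i \<E> A) \<Longrightarrow> (\<forall>i<n. e i = e' i) \<Longrightarrow> P e = P e'"
    "\<And>e e'. (\<forall>i. e i \<E> A') \<Longrightarrow> (\<forall>i. e' i \<E> A') \<Longrightarrow> (\<forall>i<n. e i = e' i) \<Longrightarrow> P' e = P' e'"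
    using fo_support[OF fo] by (elim exE conjE) blast
  \<comment> \<open>All places from \<open>n\<close> on are sent to place \<open>n\<close>, so that
    tuples of length \<open>Suc n\<close> suffice; the truth of \<open>P\<close> and
    \<open>P'\<close> does not depend on these places.\<close>
  let ?s = "\<lambda>i. min i n" and ?xs = "map e [0..<Suc n]"
  have "Rel (Suc n) (\<lambda>xs. P (\<lambda>i. xs ! ?s i)) (\<lambda>xs. P' (\<lambda>i. xs ! ?s i))"
    by (rule fo_Rel[OF fo]) auto
  then obtain R R' where R: "F R R'" "isrel A (Suc n) (\<lambda>xs. P (\<lambda>i. xs ! ?s i)) R" "isrel A' (Suc n) (\<lambda>xs. P' (\<lambda>i. xs ! ?s i)) R'"
    by (rule RelE)
  have 1: "?xs ! ?s i = e (?s i)" "map h ?xs ! ?s i = h (e (?s i))" for i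
    using nth_map_upt[of "?s i" "Suc n" 0] by (auto simp del: upt_Suc)
  have "P e = P (\<lambda>i. ?xs ! ?s i)" unfolding 1 by (rule n(1)) (use e in auto)
  also have "\<dots> \<longleftrightarrow> tup ?xs \<E> R"
    by (rule sym, rule tup_map_mem[OF _ _ R(2)]) (use e in auto)
  also have "\<dots> \<longleftrightarrow> tup (map h ?xs) \<E> R'" by (rule h[OF R(1)]) (use e in auto)
  also have "\<dots> \<longleftrightarrow> P' (\<lambda>i. map h ?xs ! ?s i)"
    by (rule tup_map_mem[OF _ _ R(3)]) (use e h' in auto)
  also have "\<dots> \<longleftrightarrow> P' (\<lambda>i. h (e i))" unfolding 1 by (rule n(2)) (use e h' in auto)
  finally show ?thesis .
qed

end

context limit_rank
begin

subsection \<open>Elementary embeddings\<close>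

text \<open>In contrast to \<open>\<Sigma>\<^sub>1\<close>-elementarity, this is a first-order property of \<open>(V, k)\<close>, and it passes to
  \<open>dot j k\<close>.\<close>

definition Emb :: "'a \<Rightarrow> bool" where
  "Emb k \<longleftrightarrow> Maps k V V \<and> (\<forall>x y. x \<E> V \<longrightarrow> y \<E> V \<longrightarrow> (x \<E> y \<longleftrightarrow> k $ x \<E> k $ y)) \<and>
     (\<forall>f\<in>ops. \<forall>x y. x \<E> V \<longrightarrow> y \<E> V \<longrightarrow> k $ f x y = f (k $ x) (k $ y)) \<and>
     (\<forall>x. x \<E> V \<longrightarrow> k $ Pow x = Pow (k $ x))"

lemma V_UU: "x \<E> V \<Longrightarrow> UU x \<E> V" by simp

lemma V_prod: assumes "x \<E> V" "y \<E> V" shows "prod x y \<E> V"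
proof -
  have "prod x y \<sqsubseteq> Pow (Pow (cup x y))"
    by (rule subI) (auto simp: kpair_def subset_def; blast)
  then show ?thesis using assms V_Pow V_Uni V_up V_sub by meson
qed

lemma V_op: assumes "f \<in> ops" "x \<E> V" "y \<E> V" shows "f x y \<E> V"
proof -
  have "dif x y \<E> V" using V_sub[OF assms(2)] by (simp add: subset_def)
  moreover have "ran x \<E> V"
    by (rule V_sub[OF V_UU[OF assms(2)]], rule subI) (use pair_mem_Uni in \<open>simp del: mem_Uni; blast\<close>)
  moreover have "memx x y \<E> V"
    by (rule V_sub[OF V_prod[OF assms(2) V_prod[OF assms(2,3)]]], rule subI) auto
  moreover have "ins x y \<E> V"
    by (rule V_sub[OF V_prod[OF V_UU[OF assms(2)] V_prod[OF assms(3) V_UU[OF assms(2)]]]], rule subI)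
      (use pair_mem_Uni[of _ _ x] in \<open>simp del: mem_Uni; blast\<close>)
  ultimately show ?thesis using assms V_prod V_up unfolding ops_def by auto
qed

lemma V_dif: "x \<E> V \<Longrightarrow> dif x y \<E> V"
  using V_sub[of x "dif x y"] by (simp add: subset_def)

lemma V_ran: "x \<E> V \<Longrightarrow> ran x \<E> V"
  using V_op[of "\<lambda>x y. ran x" x x] by (simp add: ops_def)

definition dot :: "'a \<Rightarrow> 'a \<Rightarrow> 'a" where
  "dot k B = Coll (\<lambda>z. z \<E> V \<and> (\<exists>b. b \<E> V \<and> b \<sqsubseteq> B \<and> z \<E> k $ b))"

lemma mem_dot: "z \<E> dot k B \<longleftrightarrow> z \<E> V \<and> (\<exists>b. b \<E> V \<and> b \<sqsubseteq> B \<and> z \<E> k $ b)"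
  unfolding dot_def by (rule mem_sep) (intro D_intros)

lemma DT_dot [D_intros]: "DT x \<Longrightarrow> DT y \<Longrightarrow> DT (\<lambda>e. dot (x e) (y e))"
  by (erule (1) DT_subst2) (unfold dot_def, intro D_intros)

lemma dot_sub: "dot k B \<sqsubseteq> V"
  by (rule subI) (simp add: mem_dot)

end

locale embedding = limit_rank +
  fixes k :: 'a
  assumes emb: "Emb k"
begin

lemma k_fn: "fn k V" and k_V [simp]: "x \<E> V \<Longrightarrow> k $ x \<E> V"
  using emb unfolding Emb_def Maps_fn by auto

lemma k_mem: "x \<E> V \<Longrightarrow> y \<E> V \<Longrightarrow> k $ x \<E> k $ y \<longleftrightarrow> x \<E> y"
  using emb unfolding Emb_def by blast

lemma k_op: "f \<in> ops \<Longrightarrow> x \<E> V \<Longrightarrow> y \<E> V \<Longrightarrow> k $ f x y = f (k $ x) (k $ y)"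
  using emb unfolding Emb_def by blast

lemma k_ops:
  assumes "x \<E> V" "y \<E> V"
  shows "k $ dif x y = dif (k $ x) (k $ y)" "k $ up x y = up (k $ x) (k $ y)"
    "k $ prod x y = prod (k $ x) (k $ y)" "k $ ran x = ran (k $ x)"
    "k $ memx x y = memx (k $ x) (k $ y)" "k $ ins x y = ins (k $ x) (k $ y)"
  using k_op[OF _ assms, of dif] k_op[OF _ assms, of up] k_op[OF _ assms, of prod]
    k_op[OF _ assms, of "\<lambda>x y. ran x"] k_op[OF _ assms, of memx] k_op[OF _ assms, of ins]
  by (auto simp: ops_def)

lemma k_Pow: "x \<E> V \<Longrightarrow> k $ Pow x = Pow (k $ x)"
  using emb unfolding Emb_def by blast

lemma k_emp [simp]: "k $ emp = emp"
proof -
  have "dif emp emp = emp" by (simp add: eq_emp)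
  then have "k $ emp = dif (k $ emp) (k $ emp)" using k_ops(1)[of emp emp] by simp
  then show ?thesis by (metis eq_emp mem_dif)
qed

lemma k_sub: assumes "x \<E> V" "y \<E> V" shows "k $ x \<sqsubseteq> k $ y \<longleftrightarrow> x \<sqsubseteq> y"
proof
  assume "x \<sqsubseteq> y"
  then have "dif x y = emp" by (auto simp: eq_emp dest: subD)
  then have "dif (k $ x) (k $ y) = emp" using k_ops(1)[OF assms] by simp
  then show "k $ x \<sqsubseteq> k $ y" by (metis eq_emp mem_dif subI)
next
  assume "k $ x \<sqsubseteq> k $ y"
  then show "x \<sqsubseteq> y" using assms k_mem V_tran by (meson subD subI)
qed

lemma k_inj: "x \<E> V \<Longrightarrow> y \<E> V \<Longrightarrow> k $ x = k $ y \<longleftrightarrow> x = y"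
  using k_sub[of x y] k_sub[of y x] sub_antisym[of x y] by auto

lemma k_pair: "x \<E> V \<Longrightarrow> y \<E> V \<Longrightarrow> k $ \<langle>x, y\<rangle> = \<langle>k $ x, k $ y\<rangle>"
  unfolding kpair_def by (simp add: k_ops)

text \<open>Transitivity is inclusion in the power set, and embeddings preserve inclusion and power
  sets.\<close>

lemma k_Tran: assumes "x \<E> V" "Tran x" shows "Tran (k $ x)"
proof -
  have "x \<sqsubseteq> Pow x" using assms(2) unfolding transitive_def by (auto intro: subI)
  then have "k $ x \<sqsubseteq> Pow (k $ x)" using k_sub[OF assms(1) V_Pow[OF assms(1)]] k_Pow assms(1) by simp
  then show ?thesis unfolding transitive_def by (auto dest: subD)
qed

text \<open>A subset of \<open>Vs y\<close> is, inductively, a subset of \<open>k $ Vs y\<close>,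
  hence an element of \<open>k $ Pow (Vs y)\<close>. It follows that the sets
  \<open>k $ Vs \<alpha>\<close> cover \<open>V\<close>, so that \<open>dot k\<close> can be
  computed piece by piece.\<close>

lemma Vs_sub_k: "\<alpha> \<E> l \<Longrightarrow> Vs \<alpha> \<sqsubseteq> k $ Vs \<alpha>"
proof -
  assume a: "\<alpha> \<E> l"
  have "\<alpha> \<E> l \<longrightarrow> Vs \<alpha> \<sqsubseteq> k $ Vs \<alpha>"
  proof (rule Ord_induct[where P="\<lambda>\<alpha>. \<alpha> \<E> l \<longrightarrow> Vs \<alpha> \<sqsubseteq> k $ Vs \<alpha>"])
    show "D (\<lambda>e. e 0 \<E> l \<longrightarrow> Vs (e 0) \<sqsubseteq> k $ Vs (e 0))" by (intro D_intros)
    show "Ord \<alpha>" using V_ord[OF a] .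
    fix x assume x: "Ord x" and IH: "\<And>y. y \<E> x \<Longrightarrow> y \<E> l \<longrightarrow> Vs y \<sqsubseteq> k $ Vs y"
    show "x \<E> l \<longrightarrow> Vs x \<sqsubseteq> k $ Vs x"
    proof (intro impI subI)
      fix z assume xl: "x \<E> l" and "z \<E> Vs x"
      then obtain y where y: "y \<E> x" "z \<sqsubseteq> Vs y" using mem_Vs[OF x] by blast
      then have yl: "y \<E> l" using Ord_TranD[OF Ord_l xl] by blast
      then have "z \<sqsubseteq> k $ Vs y" using IH[OF y(1)] y(2) sub_trans by blast
      then have "z \<E> k $ Pow (Vs y)" using k_Pow[OF Vs_V[OF yl]] by simp
      moreover have "Pow (Vs y) \<sqsubseteq> Vs x" using mem_Vs[OF x] y(1) by (auto intro!: subI)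
      ultimately show "z \<E> k $ Vs x"
        using k_sub[OF V_Pow[OF Vs_V[OF yl]] Vs_V[OF xl]] subD by blast
    qed
  qed
  with a show ?thesis by blast
qed

lemma k_cofinal: assumes "z \<E> V" shows "\<exists>\<alpha>. \<alpha> \<E> l \<and> z \<E> Vs \<alpha> \<and> z \<E> k $ Vs \<alpha>"
  using assms Vs_sub_k subD mem_V by blast

lemma k_tup: "\<forall>x\<in>set xs. x \<E> V \<Longrightarrow> tup xs \<E> V \<and> k $ tup xs = tup (map (\<lambda>x. k $ x) xs)"
  by (induction xs) (auto simp: k_pair)

lemma V_prod1: "prod B (sing emp) = prod C (sing emp) \<Longrightarrow> B = C"
proof (rule extensionality)
  fix z assume *: "prod B (sing emp) = prod C (sing emp)"
  have "\<langle>z, emp\<rangle> \<E> prod B (sing emp) \<longleftrightarrow> z \<E> B" "\<langle>z, emp\<rangle> \<E> prod C (sing emp) \<longleftrightarrow> z \<E> C" by auto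
  then show "z \<E> B \<longleftrightarrow> z \<E> C" using * by simp
qed

abbreviation FK :: "'a \<Rightarrow> 'a \<Rightarrow> bool" where "FK R R' \<equiv> R \<E> V \<and> R' = k $ R"

lemma relalg_set: assumes "v \<E> V" "Tran v" shows "relalg mem v (k $ v) FK"
proof unfold_locales
  show "Tran v" "Tran (k $ v)" using assms k_Tran by auto
qed (use assms V_op[of dif] V_op[of prod] V_op[of memx] V_op[of ins] V_ran in \<open>auto simp: k_ops ops_def\<close>)

text \<open>Finitely many values lie in one \<open>Vs \<alpha>\<close>. The operations preserved by
  \<open>k\<close> generate all relations that are first-order over \<open>Vs \<alpha>\<close> and,
  on the other side, over \<open>k $ Vs \<alpha>\<close>. Both sets are transitive, so bounded
  predicates have their true meaning there.\<close>

lemma k_bfo: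
  assumes "bfo (\<lambda>_ _. False) P P'" "\<And>i. e i \<E> V" "finite (range e)"
  shows "P e \<longleftrightarrow> P' (\<lambda>i. k $ e i)"
proof -
  have "finite S \<Longrightarrow> (\<forall>x\<in>S. x \<E> V) \<Longrightarrow> \<exists>\<alpha>. \<alpha> \<E> l \<and> (\<forall>x\<in>S. x \<E> Vs \<alpha>)" for S
  proof (induction S rule: finite_induct)
    case empty
    show ?case using l_0 by auto
  next
    case (insert y S)
    then obtain \<alpha> \<beta> where "\<alpha> \<E> l" "\<forall>x\<in>S. x \<E> Vs \<alpha>" "\<beta> \<E> l" "y \<E> Vs \<beta>" using mem_V by (meson insertI1 insertI2)
    moreover then obtain \<gamma> where "\<gamma> \<E> l" "\<alpha> \<sqsubseteq> \<gamma>" "\<beta> \<sqsubseteq> \<gamma>" using l_linear by blast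
    ultimately show ?case using Vs_mono2[of \<gamma> \<alpha>] Vs_mono2[of \<gamma> \<beta>] by (intro exI[of _ \<gamma>]) (auto dest: subD)
  qed
  from this[OF assms(3)] obtain \<alpha> where a: "\<alpha> \<E> l" "\<And>i. e i \<E> Vs \<alpha>" using assms(2) by auto
  have v: "Vs \<alpha> \<E> V" "Tran (Vs \<alpha>)" using a Vs_V Vs_Tran V_ord by auto
  interpret S: relalg mem "Vs \<alpha>" "k $ Vs \<alpha>" FK by (rule relalg_set[OF v])
  have "fo (\<lambda>x. x \<E> Vs \<alpha>) (\<lambda>x. x \<E> k $ Vs \<alpha>) FK P P'"
    by (rule bfo_fo[OF assms(1)]) (use S.TA S.TA' in \<open>auto simp: tra_def dest: TranD\<close>)
  then show ?thesis
  proof (rule S.fo_elem)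
    fix R R' xs assume R: "FK R R'" and xs: "\<forall>x\<in>set xs. x \<E> Vs \<alpha>"
    then have "tup xs \<E> V" "k $ tup xs = tup (map (\<lambda>x. k $ x) xs)" using k_tup[of xs] V_tran[OF v(1)] by auto
    then show "tup xs \<E> R \<longleftrightarrow> tup (map (\<lambda>x. k $ x) xs) \<E> R'" using R k_mem by metis
  qed (use a v k_mem V_tran[OF v(1)] in auto)
qed

lemma k_bfo_list:
  assumes "bfo (\<lambda>_ _. False) P P'" "\<forall>x\<in>set xs. x \<E> V"
  shows "P (\<lambda>i. if i < length xs then xs ! i else emp) \<longleftrightarrow> P' (\<lambda>i. if i < length xs then k $ (xs ! i) else emp)"
proof -
  \<comment> \<open>The padding \<open>emp\<close> is fixed by \<open>k\<close>.\<close>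
  let ?e = "\<lambda>i. if i < length xs then xs ! i else emp"
  have "range ?e \<subseteq> insert emp (set xs)" by auto
  then have "finite (range ?e)" by (rule finite_subset) simp
  then have "P ?e \<longleftrightarrow> P' (\<lambda>i. k $ ?e i)" by (intro k_bfo[OF assms(1)]) (use assms(2) in auto)
  moreover have "(\<lambda>i. k $ ?e i) = (\<lambda>i. if i < length xs then k $ (xs ! i) else emp)" by auto
  ultimately show ?thesis by simp
qed

lemma k_tr1:
  assumes "bfo (\<lambda>_ _. False) (\<lambda>e. Q (e 0)) (\<lambda>e. Q (e 0))" "x \<E> V"
  shows "Q x \<longleftrightarrow> Q (k $ x)"
  using k_bfo_list[OF assms(1), of "[x]"] assms(2-) by simp

lemma k_tr2:
  assumes "bfo (\<lambda>_ _. False) (\<lambda>e. Q (e 0) (e 1)) (\<lambda>e. Q (e 0) (e 1))" "x \<E> V" "y \<E> V"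
  shows "Q x y \<longleftrightarrow> Q (k $ x) (k $ y)"
  using k_bfo_list[OF assms(1), of "[x, y]"] assms(2-) by simp

lemma k_tr3:
  assumes "bfo (\<lambda>_ _. False) (\<lambda>e. Q (e 0) (e 1) (e 2)) (\<lambda>e. Q (e 0) (e 1) (e 2))" "x \<E> V" "y \<E> V" "z \<E> V"
  shows "Q x y z \<longleftrightarrow> Q (k $ x) (k $ y) (k $ z)"
  using k_bfo_list[OF assms(1), of "[x, y, z]"] assms(2-) by simp

lemma k_tr4:
  assumes "bfo (\<lambda>_ _. False) (\<lambda>e. Q (e 0) (e 1) (e 2) (e 3)) (\<lambda>e. Q (e 0) (e 1) (e 2) (e 3))" "x \<E> V" "y \<E> V" "z \<E> V" "u \<E> V"
  shows "Q x y z u \<longleftrightarrow> Q (k $ x) (k $ y) (k $ z) (k $ u)"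
  using k_bfo_list[OF assms(1), of "[x, y, z, u]"] assms(2-) by simp

lemma k_tr5:
  assumes "bfo (\<lambda>_ _. False) (\<lambda>e. Q (e 0) (e 1) (e 2) (e 3) (e 4)) (\<lambda>e. Q (e 0) (e 1) (e 2) (e 3) (e 4))" "x \<E> V" "y \<E> V" "z \<E> V" "u \<E> V" "w \<E> V"
  shows "Q x y z u w \<longleftrightarrow> Q (k $ x) (k $ y) (k $ z) (k $ u) (k $ w)"
  using k_bfo_list[OF assms(1), of "[x, y, z, u, w]"] assms(2-) by simp

subsection \<open>The action on subclasses\<close>

lemma k_inter: "x \<E> V \<Longrightarrow> y \<E> V \<Longrightarrow> k $ dif x (dif x y) = dif (k $ x) (dif (k $ x) (k $ y))"
  using V_dif by (simp add: k_ops)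

text \<open>Below \<open>k $ b\<close> the action depends only on the trace of \<open>B\<close> on
  \<open>b\<close>, which is an element of \<open>V\<close>. Thus identities for
  \<open>dot k\<close> reduce to identities for \<open>k\<close>.\<close>

lemma dot_local:
  assumes "b \<E> V" "z \<E> k $ b"
  shows "z \<E> dot k B \<longleftrightarrow> z \<E> k $ dif b (dif b B)"
proof
  assume "z \<E> dot k B"
  then obtain c where c: "c \<E> V" "c \<sqsubseteq> B" "z \<E> k $ c" unfolding mem_dot by blast
  then have "z \<E> k $ dif c (dif c b)" using k_inter[OF c(1) assms(1)] assms by simp
  moreover have "dif c (dif c b) \<sqsubseteq> dif b (dif b B)" using c by (auto intro!: subI dest: subD)
  ultimately show "z \<E> k $ dif b (dif b B)" using k_sub V_dif assms(1) c(1) subD by metis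
next
  assume *: "z \<E> k $ dif b (dif b B)"
  have "dif b (dif b B) \<E> V" "dif b (dif b B) \<sqsubseteq> B" using V_dif assms(1) by (auto intro!: subI)
  then show "z \<E> dot k B" unfolding mem_dot using * V_tran k_V by blast
qed

lemma dot_set: assumes "b \<E> V" shows "dot k b = k $ b"
proof (rule extensionality)
  fix z
  show "z \<E> dot k b \<longleftrightarrow> z \<E> k $ b"
    unfolding mem_dot using assms k_sub V_tran k_V sub_refl subD by metis
qed

lemma dot_V: "dot k V = V"
proof (rule extensionality)
  fix z
  show "z \<E> dot k V \<longleftrightarrow> z \<E> V" unfolding mem_dot
    using k_cofinal[of z] Vs_V V_subV by blast
qed

lemma dot_elem: assumes "x \<E> V" "B \<sqsubseteq> V" shows "k $ x \<E> dot k B \<longleftrightarrow> x \<E> B"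
proof -
  have "k $ x \<E> k $ sing x" using assms by (simp add: k_ops)
  then have "k $ x \<E> dot k B \<longleftrightarrow> k $ x \<E> k $ dif (sing x) (dif (sing x) B)"
    using dot_local[of "sing x"] assms by simp
  also have "\<dots> \<longleftrightarrow> x \<E> B" using k_mem[OF assms(1) V_dif] assms by simp
  finally show ?thesis .
qed

lemma dot_mono: "B \<sqsubseteq> C \<Longrightarrow> dot k B \<sqsubseteq> dot k C"
  by (rule subI) (unfold mem_dot, blast intro: sub_trans)

lemma dot_dif: "dot k (dif B C) = dif (dot k B) (dot k C)"
proof (rule extensionality)
  fix z
  show "z \<E> dot k (dif B C) \<longleftrightarrow> z \<E> dif (dot k B) (dot k C)"
  proof (cases "z \<E> V")
    case True
    then obtain \<alpha> where a: "\<alpha> \<E> l" "z \<E> k $ Vs \<alpha>" using k_cofinal by blast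
    let ?b = "Vs \<alpha>"
    have b: "?b \<E> V" using a Vs_V by blast
    have "dif ?b (dif ?b (dif B C)) = dif (dif ?b (dif ?b B)) (dif ?b (dif ?b C))"
      by (rule extensionality) auto
    then show ?thesis using dot_local[OF b a(2)] k_ops(1)[OF V_dif[OF b] V_dif[OF b]] by auto
  qed (auto simp: mem_dot)
qed

text \<open>The crucial hypothesis is \<open>loc\<close>: a set inside \<open>f B C\<close> already
  lies inside \<open>f b d\<close> for sets \<open>b\<close> and \<open>d\<close> from
  \<open>V\<close>. For \<open>ran\<close> it can fail, since witnesses for the elements of one set
  may occur at unboundedly high ranks; this gap is what \<open>good\<close> fills.\<close>

lemma dot_op2:
  assumes f: "f \<in> ops" and BC: "B \<sqsubseteq> V" "C \<sqsubseteq> V"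
    and mono: "\<And>x y x' y'. x \<sqsubseteq> x' \<Longrightarrow> y \<sqsubseteq> y' \<Longrightarrow> f x y \<sqsubseteq> f x' y'"
    and loc: "\<And>c. c \<E> V \<Longrightarrow> c \<sqsubseteq> f B C \<Longrightarrow> \<exists>b d. b \<E> V \<and> d \<E> V \<and> b \<sqsubseteq> B \<and> d \<sqsubseteq> C \<and> c \<sqsubseteq> f b d"
    and fin: "\<And>z. z \<E> f (dot k B) (dot k C) \<Longrightarrow> \<exists>b d. b \<E> V \<and> d \<E> V \<and> b \<sqsubseteq> B \<and> d \<sqsubseteq> C \<and> z \<E> f (k $ b) (k $ d)"
  shows "dot k (f B C) = f (dot k B) (dot k C)"
proof (rule sub_antisym; rule subI)
  fix z assume "z \<E> dot k (f B C)"
  then obtain c where c: "c \<E> V" "c \<sqsubseteq> f B C" "z \<E> k $ c" unfolding mem_dot by blast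
  then obtain b d where bd: "b \<E> V" "d \<E> V" "b \<sqsubseteq> B" "d \<sqsubseteq> C" "c \<sqsubseteq> f b d" using loc by blast
  have "z \<E> f (k $ b) (k $ d)" using k_sub[OF c(1) V_op[OF f bd(1,2)]] bd(5) c(3) k_op[OF f bd(1,2)] subD by metis
  moreover have "k $ b \<sqsubseteq> dot k B" "k $ d \<sqsubseteq> dot k C" using dot_mono[OF bd(3)] dot_mono[OF bd(4)] bd dot_set by auto
  ultimately show "z \<E> f (dot k B) (dot k C)" using mono subD by blast
next
  fix z assume "z \<E> f (dot k B) (dot k C)"
  then obtain b d where bd: "b \<E> V" "d \<E> V" "b \<sqsubseteq> B" "d \<sqsubseteq> C" "z \<E> f (k $ b) (k $ d)" using fin by blast
  then have "z \<E> k $ f b d" using k_op[OF f] by simp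
  then show "z \<E> dot k (f B C)" unfolding mem_dot
    using V_op[OF f bd(1,2)] mono[OF bd(3,4)] V_tran k_V by blast
qed

lemma inter_Vs:
  assumes "\<alpha> \<E> l" shows "dif (Vs \<alpha>) (dif (Vs \<alpha>) B) \<E> V" "dif (Vs \<alpha>) (dif (Vs \<alpha>) B) \<sqsubseteq> B"
  using V_dif[OF Vs_V[OF assms]] by (auto intro: subI)

lemma inter_sub: "dif b (dif b B) \<sqsubseteq> B"
  by (rule subI) (simp only: mem_dif, blast)

lemma Vs_pairD: "\<alpha> \<E> l \<Longrightarrow> \<langle>x, y\<rangle> \<E> Vs \<alpha> \<Longrightarrow> x \<E> Vs \<alpha> \<and> y \<E> Vs \<alpha>"
  using Vs_Tran[OF V_ord] by (metis TranD kpair_def mem_up)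

lemma Vs_pair3D: "\<langle>x, \<langle>y, z\<rangle>\<rangle> \<E> Vs \<alpha> \<Longrightarrow> \<alpha> \<E> l \<Longrightarrow> x \<E> Vs \<alpha> \<and> y \<E> Vs \<alpha> \<and> z \<E> Vs \<alpha>"
  using Vs_pairD by blast

lemma dot_ops:
  assumes BC: "B \<sqsubseteq> V" "C \<sqsubseteq> V"
  shows "dot k (prod B C) = prod (dot k B) (dot k C)"
    "dot k (memx B C) = memx (dot k B) (dot k C)"
    "dot k (ins B C) = ins (dot k B) (dot k C)"
proof -
  have loc: "\<exists>b d. b \<E> V \<and> d \<E> V \<and> b \<sqsubseteq> B \<and> d \<sqsubseteq> C \<and> c \<sqsubseteq> f b d"
    if c: "c \<E> V" "c \<sqsubseteq> f B C"
      and f: "\<And>\<alpha> z. \<alpha> \<E> l \<Longrightarrow> z \<E> Vs \<alpha> \<Longrightarrow> z \<E> f B C \<Longrightarrow> z \<E> f (dif (Vs \<alpha>) (dif (Vs \<alpha>) B)) (dif (Vs \<alpha>) (dif (Vs \<alpha>) C))" for f c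
  proof -
    obtain \<alpha> where a: "\<alpha> \<E> l" "c \<E> Vs \<alpha>" using c mem_V by blast
    have "c \<sqsubseteq> f (dif (Vs \<alpha>) (dif (Vs \<alpha>) B)) (dif (Vs \<alpha>) (dif (Vs \<alpha>) C))"
      by (rule subI) (use f a c(2) subD TranD[OF Vs_Tran[OF V_ord[OF a(1)]] a(2)] in blast)
    then show ?thesis using inter_Vs[OF a(1)] by blast
  qed
  have U: "\<exists>b. b \<E> V \<and> b \<sqsubseteq> B \<and> x \<E> k $ b \<and> y \<E> k $ b" if xy: "x \<E> dot k B" "y \<E> dot k B" for x y B
  proof -
    obtain b c where bc: "b \<E> V" "b \<sqsubseteq> B" "x \<E> k $ b" "c \<E> V" "c \<sqsubseteq> B" "y \<E> k $ c" using xy unfolding mem_dot by blast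
    have "cup b c \<sqsubseteq> B" "b \<sqsubseteq> cup b c" "c \<sqsubseteq> cup b c" "cup b c \<E> V" using bc by (auto intro!: subI dest: subD)
    then show ?thesis using bc k_sub subD by metis
  qed
  show "dot k (prod B C) = prod (dot k B) (dot k C)"
  proof (rule dot_op2[OF _ BC])
    show "prod \<in> ops" by (simp add: ops_def)
    show "prod x y \<sqsubseteq> prod x' y'" if "x \<sqsubseteq> x'" "y \<sqsubseteq> y'" for x y x' y'
      by (rule subI) (use that subD in \<open>auto; blast\<close>)
    show "\<exists>b d. b \<E> V \<and> d \<E> V \<and> b \<sqsubseteq> B \<and> d \<sqsubseteq> C \<and> c \<sqsubseteq> prod b d" if "c \<E> V" "c \<sqsubseteq> prod B C" for c
      using that by (rule loc) (auto dest: Vs_pairD)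
    show "\<exists>b d. b \<E> V \<and> d \<E> V \<and> b \<sqsubseteq> B \<and> d \<sqsubseteq> C \<and> z \<E> prod (k $ b) (k $ d)" if "z \<E> prod (dot k B) (dot k C)" for z
      using that by (simp add: mem_dot) blast
  qed
  show "dot k (memx B C) = memx (dot k B) (dot k C)"
  proof (rule dot_op2[OF _ BC])
    show "memx \<in> ops" by (simp add: ops_def)
    show "memx x y \<sqsubseteq> memx x' y'" if "x \<sqsubseteq> x'" "y \<sqsubseteq> y'" for x y x' y'
      by (rule subI) (use that subD in \<open>auto; blast\<close>)
    show "\<exists>b d. b \<E> V \<and> d \<E> V \<and> b \<sqsubseteq> B \<and> d \<sqsubseteq> C \<and> c \<sqsubseteq> memx b d" if "c \<E> V" "c \<sqsubseteq> memx B C" for c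
      using that by (rule loc) (auto dest: Vs_pairD dest!: Vs_pair3D)
    fix z assume "z \<E> memx (dot k B) (dot k C)"
    then obtain u v t where z: "u \<E> dot k B" "v \<E> dot k B" "t \<E> dot k C" "u \<E> v" "z = \<langle>u, \<langle>v, t\<rangle>\<rangle>" by auto
    then show "\<exists>b d. b \<E> V \<and> d \<E> V \<and> b \<sqsubseteq> B \<and> d \<sqsubseteq> C \<and> z \<E> memx (k $ b) (k $ d)"
      using U[OF z(1,2)] U[OF z(3,3)] by auto
  qed
  show "dot k (ins B C) = ins (dot k B) (dot k C)"
  proof (rule dot_op2[OF _ BC])
    show "ins \<in> ops" by (simp add: ops_def)
    show "ins x y \<sqsubseteq> ins x' y'" if "x \<sqsubseteq> x'" "y \<sqsubseteq> y'" for x y x' y'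
      by (rule subI) (use that subD in \<open>auto; blast\<close>)
    show "\<exists>b d. b \<E> V \<and> d \<E> V \<and> b \<sqsubseteq> B \<and> d \<sqsubseteq> C \<and> c \<sqsubseteq> ins b d" if c: "c \<E> V" "c \<sqsubseteq> ins B C" for c
    proof -
      obtain \<alpha> where a: "\<alpha> \<E> l" "c \<E> Vs \<alpha>" using c mem_V by blast
      \<comment> \<open>\<open>Vs \<alpha>\<close> contains the components of the pairs from
        \<open>B\<close> in question but perhaps not these pairs, so the trace of \<open>B\<close>
        is taken on a product.\<close>
      let ?d = "dif (Vs \<alpha>) (dif (Vs \<alpha>) C)" and ?p = "prod (Vs \<alpha>) (Vs \<alpha>)"
      let ?b = "dif ?p (dif ?p B)"
      have "c \<sqsubseteq> ins ?b ?d"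
      proof (rule subI)
        fix z assume z: "z \<E> c"
        then have "z \<E> ins B C" using c(2) subD by blast
        then obtain u t w where utw: "\<langle>u, t\<rangle> \<E> B" "w \<E> C" "z = \<langle>u, \<langle>w, t\<rangle>\<rangle>" unfolding mem_ins by blast
        have "z \<E> Vs \<alpha>" using z a TranD[OF Vs_Tran[OF V_ord[OF a(1)]]] by blast
        then have "u \<E> Vs \<alpha> \<and> w \<E> Vs \<alpha> \<and> t \<E> Vs \<alpha>" using Vs_pair3D a(1) utw(3) by blast
        then have "\<langle>u, t\<rangle> \<E> ?b" "w \<E> ?d" using utw by simp_all
        then show "z \<E> ins ?b ?d" unfolding mem_ins using utw(3) by blast
      qed
      moreover have "?b \<E> V" "?b \<sqsubseteq> B" using V_dif[OF V_prod[OF Vs_V[OF a(1)] Vs_V[OF a(1)]]] inter_sub by blast+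
      ultimately show ?thesis using inter_Vs[OF a(1), of C] by blast
    qed
    fix z assume "z \<E> ins (dot k B) (dot k C)"
    then show "\<exists>b d. b \<E> V \<and> d \<E> V \<and> b \<sqsubseteq> B \<and> d \<sqsubseteq> C \<and> z \<E> ins (k $ b) (k $ d)"
      by (simp add: mem_dot) blast
  qed
qed

end

context limit_rank
begin

abbreviation "Rst \<equiv> restr mem"

lemma mem_Rst: "p \<E> Rst f a \<longleftrightarrow> p \<E> f \<and> (\<exists>x y. x \<E> a \<and> p = \<langle>x, y\<rangle>)"
  unfolding restr_def by (rule mem_sep) (intro D_intros)

lemma Rst_pair: "\<langle>x, y\<rangle> \<E> Rst f a \<longleftrightarrow> \<langle>x, y\<rangle> \<E> f \<and> x \<E> a"
  by (auto simp: mem_Rst)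

lemma Rst_sub: "Rst f a \<sqsubseteq> f"
  by (rule subI) (simp add: mem_Rst)

text \<open>The restrictions to sets are the pieces of \<open>k\<close> to which another embedding
  can be applied.\<close>

lemma Rst_V: assumes "Emb k" "a \<E> V" shows "Rst k a \<E> V"
proof -
  interpret K: embedding mem l k by unfold_locales (rule assms(1))
  have "Rst k a \<sqsubseteq> prod a (k $ a)"
  proof (rule subI)
    fix p assume "p \<E> Rst k a"
    then obtain x y where *: "p \<E> k" "x \<E> a" "p = \<langle>x, y\<rangle>" unfolding mem_Rst by blast
    then have "y = k $ x" using fn_mem[OF K.k_fn] by blast
    then show "p \<E> prod a (k $ a)" using * K.k_mem V_tran[OF assms(2)] assms(2) by auto
  qed
  then show ?thesis using V_sub V_prod assms(2) K.k_V by blast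
qed

text \<open>Each clause for \<open>dot j k\<close> comes from a bounded statement about sets
  included in \<open>k\<close>, which \<open>j\<close> transfers. A clause that asserts a value of
  \<open>k\<close> also needs a restriction of \<open>k\<close> to some \<open>Vs \<alpha>\<close>
  that contains all arguments in question.\<close>

lemma Emb_dot:
  assumes "Emb j" "Emb k"
  shows "Emb (dot j k)"
proof -
  interpret J: embedding mem l j by unfold_locales (rule assms(1))
  interpret K: embedding mem l k by unfold_locales (rule assms(2))
  let ?K = "dot j k"
  have sub: "b \<E> V \<Longrightarrow> b \<sqsubseteq> k \<Longrightarrow> p \<E> j $ b \<Longrightarrow> p \<E> ?K" for b p
    unfolding mem_dot using V_tran J.k_V by blast
  have kE: "\<exists>x. x \<E> V \<and> p = \<langle>x, k $ x\<rangle>" if "p \<E> k" for p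
    using that K.k_fn by (blast elim: fn_memE)
  have kp: "\<langle>x, y\<rangle> \<E> k \<longleftrightarrow> x \<E> V \<and> y = k $ x" for x y using fn_mem[OF K.k_fn] .
  have pairs: "\<exists>x y. p = \<langle>x, y\<rangle>" if p: "p \<E> ?K" for p
  proof -
    obtain b where b: "b \<E> V" "b \<sqsubseteq> k" "p \<E> j $ b" using p unfolding mem_dot by blast
    define Q where "Q b \<longleftrightarrow> (\<forall>p. p \<E> b \<longrightarrow> (\<exists>x y. p = \<langle>x, y\<rangle> \<and> x = x))" for b
    have "bfo (\<lambda>_ _. False) (\<lambda>e. Q (e 0)) (\<lambda>e. Q (e 0))" unfolding Q_def by (intro bfo_intros)
    then have "Q b \<longleftrightarrow> Q (j $ b)" by (rule J.k_tr1[OF _ b(1)])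
    moreover have "Q b" unfolding Q_def using b(2) kE subD by blast
    ultimately show ?thesis using b(3) unfolding Q_def by blast
  qed
  have single: "y = y'" if p: "\<langle>x, y\<rangle> \<E> ?K" "\<langle>x, y'\<rangle> \<E> ?K" for x y y'
  proof -
    obtain b c where b: "b \<E> V" "b \<sqsubseteq> k" "\<langle>x, y\<rangle> \<E> j $ b" and c: "c \<E> V" "c \<sqsubseteq> k" "\<langle>x, y'\<rangle> \<E> j $ c"
      using p unfolding mem_dot by blast
    define Q where "Q b c \<longleftrightarrow> (\<forall>p. p \<E> b \<longrightarrow> (\<forall>q. q \<E> c \<longrightarrow> \<not> (\<exists>x y. p = \<langle>x, y\<rangle> \<and> (\<exists>x' y'. q = \<langle>x', y'\<rangle> \<and> (x = x' \<and> \<not> y = y')))))" for b c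
    have "bfo (\<lambda>_ _. False) (\<lambda>e. Q (e 0) (e 1)) (\<lambda>e. Q (e 0) (e 1))" unfolding Q_def by (intro bfo_intros)
    then have "Q b c \<longleftrightarrow> Q (j $ b) (j $ c)" by (rule J.k_tr2[OF _ b(1) c(1)])
    moreover have "Q b c" unfolding Q_def using kp subD[OF b(2)] subD[OF c(2)] by metis
    ultimately show ?thesis using b(3) c(3) unfolding Q_def by blast
  qed
  have total: "\<exists>y. \<langle>x, y\<rangle> \<E> ?K" if x: "x \<E> V" for x
  proof -
    obtain \<alpha> where a: "\<alpha> \<E> l" "x \<E> j $ Vs \<alpha>" using J.k_cofinal[OF x] by blast
    let ?a = "Vs \<alpha>" and ?f = "Rst k (Vs \<alpha>)"
    have av: "?a \<E> V" "?f \<E> V" using Vs_V[OF a(1)] Rst_V[OF assms(2)] by auto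
    define Q where "Q a f \<longleftrightarrow> (\<forall>x. x \<E> a \<longrightarrow> (\<exists>p. p \<E> f \<and> (\<exists>u y. p = \<langle>u, y\<rangle> \<and> u = x)))" for a f
    have "bfo (\<lambda>_ _. False) (\<lambda>e. Q (e 0) (e 1)) (\<lambda>e. Q (e 0) (e 1))" unfolding Q_def by (intro bfo_intros)
    then have "Q ?a ?f \<longleftrightarrow> Q (j $ ?a) (j $ ?f)" by (rule J.k_tr2[OF _ av])
    moreover have "Q ?a ?f" unfolding Q_def using kp Rst_pair V_tran[OF av(1)] by metis
    ultimately obtain y where "\<langle>x, y\<rangle> \<E> j $ ?f" using a(2) unfolding Q_def by blast
    then show ?thesis using sub[OF av(2) Rst_sub] by blast
  qed
  have fnK: "fn ?K V"
  proof -
    have "\<exists>x y. x \<E> V \<and> p = \<langle>x, y\<rangle>" if "p \<E> ?K" for p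
      using pairs[OF that] that dot_sub subD V_pair by metis
    moreover have "\<exists>!y. \<langle>x, y\<rangle> \<E> ?K" if "x \<E> V" for x using total[OF that] single by blast
    ultimately show ?thesis unfolding fn_def by blast
  qed
  have val: "?K $ x = y" if "\<langle>x, y\<rangle> \<E> ?K" for x y using fn_mem[OF fnK] that by simp
  have KE: "\<exists>b. b \<E> V \<and> b \<sqsubseteq> k \<and> \<langle>x, ?K $ x\<rangle> \<E> j $ b" if "x \<E> V" for x
    using fn_ap[OF fnK that] unfolding mem_dot by blast
  have mapsK: "Maps ?K V V" unfolding Maps_fn using fnK fn_ap[OF fnK] dot_sub subD V_pair by metis
  have memK: "x \<E> y \<longleftrightarrow> ?K $ x \<E> ?K $ y" if xy: "x \<E> V" "y \<E> V" for x y
  proof -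
    obtain b c where b: "b \<E> V" "b \<sqsubseteq> k" "\<langle>x, ?K $ x\<rangle> \<E> j $ b" and c: "c \<E> V" "c \<sqsubseteq> k" "\<langle>y, ?K $ y\<rangle> \<E> j $ c"
      using KE xy by blast
    define Q where "Q b c \<longleftrightarrow> (\<forall>p. p \<E> b \<longrightarrow> (\<forall>q. q \<E> c \<longrightarrow> \<not> (\<exists>x y. p = \<langle>x, y\<rangle> \<and> (\<exists>x' y'. q = \<langle>x', y'\<rangle> \<and> \<not> ((x \<E> x' \<longrightarrow> y \<E> y') \<and> (y \<E> y' \<longrightarrow> x \<E> x'))))))" for b c
    have "bfo (\<lambda>_ _. False) (\<lambda>e. Q (e 0) (e 1)) (\<lambda>e. Q (e 0) (e 1))" unfolding Q_def by (intro bfo_intros)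
    then have "Q b c \<longleftrightarrow> Q (j $ b) (j $ c)" by (rule J.k_tr2[OF _ b(1) c(1)])
    moreover have "Q b c" unfolding Q_def
    proof (intro allI impI notI, elim exE conjE)
      fix p q x y x' y' assume *: "p \<E> b" "q \<E> c" "p = \<langle>x, y\<rangle>" "q = \<langle>x', y'\<rangle>"
        "\<not> ((x \<E> x' \<longrightarrow> y \<E> y') \<and> (y \<E> y' \<longrightarrow> x \<E> x'))"
      then have "x \<E> V" "y = k $ x" "x' \<E> V" "y' = k $ x'" using subD[OF b(2)] subD[OF c(2)] kp by metis+
      then show False using *(5) K.k_mem by simp
    qed
    ultimately have "Q (j $ b) (j $ c)" by simp
    then have "u \<E> u' \<longleftrightarrow> w \<E> w'" if "\<langle>u, w\<rangle> \<E> j $ b" "\<langle>u', w'\<rangle> \<E> j $ c" for u w u' w'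
      using that unfolding Q_def by blast
    then show ?thesis using b(3) c(3) by blast
  qed
  \<comment> \<open>The values of \<open>f\<close> on one rank are contained in a single rank, so
    that one restriction of \<open>k\<close> is defined at all of them.\<close>
  have bound: "\<exists>\<alpha>. \<alpha> \<E> l \<and> (\<forall>x y. x \<E> d \<longrightarrow> y \<E> d \<longrightarrow> f x y \<E> Vs \<alpha>)" if f: "f \<in> ops" and d: "\<exists>\<beta>. \<beta> \<E> l \<and> d = Vs \<beta>" for f d
  proof -
    obtain \<beta> where b: "\<beta> \<E> l" "d = Vs \<beta>" using d by blast
    have s: "x \<sqsubseteq> d" if "x \<E> d" for x using that b Vs_Tran[OF V_ord] unfolding transitive_def by blast
    have 1: "prod d d \<E> V" "memx d d \<E> V" "ins d d \<E> V" "ran d \<E> V" "d \<E> V"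
      using V_op[of _ d d] b Vs_V by (auto simp: ops_def V_ran)
    obtain c where c: "c \<E> V" "\<And>x y. x \<E> d \<Longrightarrow> y \<E> d \<Longrightarrow> f x y \<sqsubseteq> c"
    proof -
      have "dif x y \<sqsubseteq> d" "up x y \<sqsubseteq> d" "prod x y \<sqsubseteq> prod d d" "ran x \<sqsubseteq> ran d" "memx x y \<sqsubseteq> memx d d" "ins x y \<sqsubseteq> ins d d"
        if "x \<E> d" "y \<E> d" for x y
        using that s[OF that(1)] s[OF that(2)] unfolding subset_def by (auto; blast)+
      then show thesis using f that 1 unfolding ops_def by blast
    qed
    obtain \<alpha> where a: "\<alpha> \<E> l" "c \<E> Vs \<alpha>" using c mem_V by blast
    then have "f x y \<E> Vs \<alpha>" if "x \<E> d" "y \<E> d" for x y using c(2)[OF that] Vs_sub V_ord by blast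
    then show ?thesis using a by blast
  qed
  have stage: "\<exists>\<gamma>. \<gamma> \<E> l \<and> b \<sqsubseteq> Vs \<gamma> \<and> c \<sqsubseteq> Vs \<gamma>" if "b \<E> V" "c \<E> V" for b c
    using V_directed[OF that] Vs_Tran[OF V_ord] unfolding transitive_def by blast
  have opK: "?K $ f x y = f (?K $ x) (?K $ y)" if f: "f \<in> ops" and xy: "x \<E> V" "y \<E> V" for f x y
  proof -
    obtain b c where b: "b \<E> V" "b \<sqsubseteq> k" "\<langle>x, ?K $ x\<rangle> \<E> j $ b" and c: "c \<E> V" "c \<sqsubseteq> k" "\<langle>y, ?K $ y\<rangle> \<E> j $ c"
      using KE xy by blast
    obtain \<gamma> where g: "\<gamma> \<E> l" "b \<sqsubseteq> Vs \<gamma>" "c \<sqsubseteq> Vs \<gamma>" using stage[OF b(1) c(1)] by blast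
    obtain \<alpha> where a: "\<alpha> \<E> l" "\<And>x y. x \<E> Vs \<gamma> \<Longrightarrow> y \<E> Vs \<gamma> \<Longrightarrow> f x y \<E> Vs \<alpha>" using bound[OF f, of "Vs \<gamma>"] g(1) by blast
    let ?d = "Rst k (Vs \<alpha>)"
    have d: "?d \<E> V" using Rst_V[OF assms(2)] Vs_V[OF a(1)] by auto
    define Q where "Q b c d \<longleftrightarrow> (\<forall>p. p \<E> b \<longrightarrow> (\<forall>q. q \<E> c \<longrightarrow> \<not> (\<exists>x y. p = \<langle>x, y\<rangle> \<and> (\<exists>x' y'. q = \<langle>x', y'\<rangle> \<and>
       \<not> (\<exists>r. r \<E> d \<and> (\<exists>z z'. r = \<langle>z, z'\<rangle> \<and> (z = f x x' \<and> z' = f y y')))))))" for b c d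
    have "bfo (\<lambda>_ _. False) (\<lambda>e. Q (e 0) (e 1) (e 2)) (\<lambda>e. Q (e 0) (e 1) (e 2))" unfolding Q_def by (intro bfo_intros bfo_op f)
    then have "Q b c ?d \<longleftrightarrow> Q (j $ b) (j $ c) (j $ ?d)" by (rule J.k_tr3[OF _ b(1) c(1) d])
    moreover have "Q b c ?d" unfolding Q_def
    proof (intro allI impI notI, elim exE conjE)
      fix p q x y x' y' assume *: "p \<E> b" "q \<E> c" "p = \<langle>x, y\<rangle>" "q = \<langle>x', y'\<rangle>"
        "\<not> (\<exists>r. r \<E> ?d \<and> (\<exists>z z'. r = \<langle>z, z'\<rangle> \<and> (z = f x x' \<and> z' = f y y')))"
      then have 1: "x \<E> V" "y = k $ x" "x' \<E> V" "y' = k $ x'" using subD[OF b(2)] subD[OF c(2)] kp by metis+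
      have "x \<E> Vs \<gamma>" "x' \<E> Vs \<gamma>" using * subD[OF g(2)] subD[OF g(3)] J.Vs_pairD[OF g(1)] by metis+
      then have "\<langle>f x x', f y y'\<rangle> \<E> ?d" unfolding Rst_pair kp using a(2) 1 V_op[OF f] K.k_op[OF f] by simp
      then show False using * by blast
    qed
    ultimately have "Q (j $ b) (j $ c) (j $ ?d)" by simp
    then have "\<langle>f u u', f w w'\<rangle> \<E> j $ ?d" if "\<langle>u, w\<rangle> \<E> j $ b" "\<langle>u', w'\<rangle> \<E> j $ c" for u w u' w'
      using that unfolding Q_def by blast
    then have "\<langle>f x y, f (?K $ x) (?K $ y)\<rangle> \<E> j $ ?d" using b(3) c(3) by blast
    then show ?thesis using sub[OF d Rst_sub] val by blast
  qed
  have PowK: "?K $ Pow x = Pow (?K $ x)" if x: "x \<E> V" for x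
  proof -
    obtain b where b: "b \<E> V" "b \<sqsubseteq> k" "\<langle>x, ?K $ x\<rangle> \<E> j $ b" using KE x by blast
    obtain \<gamma> where g: "\<gamma> \<E> l" "b \<sqsubseteq> Vs \<gamma>" using stage[OF b(1,1)] by blast
    let ?v = "Vs \<gamma>"
    let ?q = "Pow ?v"
    have v: "?v \<E> V" "Tran ?v" "?q \<E> V" using g Vs_V Vs_Tran V_ord V_Pow by auto
    obtain \<alpha> where a: "\<alpha> \<E> l" "Pow ?q \<E> Vs \<alpha>" using V_Pow[OF v(3)] mem_V by blast
    let ?d = "Rst k (Vs \<alpha>)"
    have d: "?d \<E> V" using Rst_V[OF assms(2)] Vs_V[OF a(1)] by auto
    \<comment> \<open>Being the power set of \<open>x\<close> becomes bounded through the parameter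
      \<open>q\<close>, the power set of a transitive set that has \<open>x\<close> as an element:
      all subsets of \<open>x\<close> belong to \<open>q\<close>.\<close>
    define isP where "isP q x z \<longleftrightarrow> (\<forall>t. t \<E> z \<longrightarrow> (\<forall>u. u \<E> t \<longrightarrow> u \<E> x)) \<and> (\<forall>t. t \<E> q \<longrightarrow> ((\<forall>u. u \<E> t \<longrightarrow> u \<E> x) \<longrightarrow> t \<E> z))" for q x z
    have isP: "isP (Pow v) x z \<longleftrightarrow> z = Pow x" if "Tran v" "x \<E> v" for v x z
    proof -
      have "t \<sqsubseteq> x \<Longrightarrow> t \<sqsubseteq> v" for t using that sub_trans unfolding transitive_def by blast
      then have "isP (Pow v) x z \<longleftrightarrow> (\<forall>t. t \<E> z \<longleftrightarrow> t \<E> Pow x)" unfolding isP_def mem_Pow unfolding subset_def by blast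
      then show ?thesis using extensionality[of z "Pow x"] by blast
    qed
    define Q where "Q b d q \<longleftrightarrow> (\<forall>p. p \<E> b \<longrightarrow> \<not> (\<exists>x y. p = \<langle>x, y\<rangle> \<and> \<not> (\<exists>r. r \<E> d \<and> (\<exists>z z'. r = \<langle>z, z'\<rangle> \<and> (isP q x z \<and> isP q y z')))))" for b d q
    have "bfo (\<lambda>_ _. False) (\<lambda>e. Q (e 0) (e 1) (e 2)) (\<lambda>e. Q (e 0) (e 1) (e 2))" unfolding Q_def isP_def by (intro bfo_intros)
    then have "Q b ?d ?q \<longleftrightarrow> Q (j $ b) (j $ ?d) (j $ ?q)" by (rule J.k_tr3[OF _ b(1) d v(3)])
    moreover have "Q b ?d ?q" unfolding Q_def
    proof (intro allI impI notI, elim exE conjE)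
      fix p x y assume *: "p \<E> b" "p = \<langle>x, y\<rangle>" "\<not> (\<exists>r. r \<E> ?d \<and> (\<exists>z z'. r = \<langle>z, z'\<rangle> \<and> (isP ?q x z \<and> isP ?q y z')))"
      then have 1: "x \<E> V" "y = k $ x" using subD[OF b(2)] kp by metis+
      have 2: "x \<E> ?v" "y \<E> ?v" using * subD[OF g(2)] J.Vs_pairD[OF g(1)] by metis+
      then have "Pow x \<sqsubseteq> ?q" using v(2) sub_trans unfolding transitive_def by (metis mem_Pow subI)
      then have "Pow x \<E> Vs \<alpha>" using a Vs_Tran[OF V_ord] TranD by (metis mem_Pow)
      then have "\<langle>Pow x, Pow y\<rangle> \<E> ?d" unfolding Rst_pair kp using 1 V_Pow K.k_Pow by simp
      then show False using * isP[OF v(2)] 2 by blast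
    qed
    ultimately have "Q (j $ b) (j $ ?d) (Pow (j $ ?v))" using J.k_Pow[OF v(1)] by simp
    then obtain z z' where z: "\<langle>z, z'\<rangle> \<E> j $ ?d" "isP (Pow (j $ ?v)) x z" "isP (Pow (j $ ?v)) (?K $ x) z'"
      using b(3) unfolding Q_def by blast
    have t: "Tran (j $ ?v)" using J.k_Tran v by blast
    have "j $ b \<sqsubseteq> j $ ?v" using J.k_sub b(1) v(1) g(2) by blast
    then have "\<langle>x, ?K $ x\<rangle> \<E> j $ ?v" using b(3) subD by blast
    then have "x \<E> j $ ?v" "?K $ x \<E> j $ ?v" using t by (metis TranD kpair_def mem_up)+
    then have "\<langle>Pow x, Pow (?K $ x)\<rangle> \<E> j $ ?d" using z isP[OF t] by simp
    then show ?thesis using sub[OF d Rst_sub] val by blast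
  qed
  show ?thesis unfolding Emb_def using mapsK memK opK PowK by blast
qed

end

section \<open>Embeddings on the finite ranks and at omega\<close>

context embedding
begin

lemma k_finite_rank: "n \<E> om \<Longrightarrow> k $ Vs n = Vs n \<and> (\<forall>x. x \<E> Vs n \<longrightarrow> k $ x = x)"
proof (rule om_induct[where P="\<lambda>n. k $ Vs n = Vs n \<and> (\<forall>x. x \<E> Vs n \<longrightarrow> k $ x = x)"])
  show "D (\<lambda>e. k $ Vs (e 0) = Vs (e 0) \<and> (\<forall>x. x \<E> Vs (e 0) \<longrightarrow> k $ x = x))" by (intro D_intros)
  show "k $ Vs emp = Vs emp \<and> (\<forall>x. x \<E> Vs emp \<longrightarrow> k $ x = x)" by (simp add: Vs_emp)
  fix n assume n: "n \<E> om" and IH: "k $ Vs n = Vs n \<and> (\<forall>x. x \<E> Vs n \<longrightarrow> k $ x = x)"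
  have nl: "n \<E> l" using n limit_om_sub[OF lim] subD by blast
  have v: "Vs n \<E> V" using Vs_V nl by blast
  have "k $ x = x" if x: "x \<sqsubseteq> Vs n" for x
  proof -
    have xV: "x \<E> V" using V_sub[OF v x] .
    have "k $ x \<sqsubseteq> Vs n" using k_sub[OF xV v] x IH by simp
    then have "z \<E> k $ x \<longleftrightarrow> z \<E> x" for z using k_mem[of z x] xV IH x V_tran[OF v] subD by metis
    then show ?thesis by (rule extensionality)
  qed
  then show "k $ Vs (suc n) = Vs (suc n) \<and> (\<forall>x. x \<E> Vs (suc n) \<longrightarrow> k $ x = x)"
    using IH k_Pow[OF v] by (simp add: Vs_suc om_Ord[OF n])
qed

text \<open>If \<open>l\<close> were \<open>om\<close>, every element of \<open>V\<close> would have
  finite rank and be fixed. The conclusion makes room in \<open>V\<close> for functions on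
  \<open>om\<close>, such as assignments.\<close>

lemma nontrivial_om: assumes "x \<E> V" "k $ x \<noteq> x" shows "om \<E> l"
proof (rule ccontr)
  assume "\<not> om \<E> l"
  then have "om = l" using limit_om_sub[OF lim] Ord_sub[OF Ord_om Ord_l] by blast
  then obtain n where "n \<E> om" "x \<E> Vs n" using assms(1) mem_V by auto
  then show False using k_finite_rank assms(2) by blast
qed

end

locale limit_rank_om = limit_rank +
  assumes oml: "mem om l"
begin

abbreviation "Vom \<equiv> Vs om"

lemma V_om [simp]: "om \<E> V" and V_Vom [simp]: "Vom \<E> V" and V_nat: "n \<E> om \<Longrightarrow> n \<E> V"
  using oml V_l Vs_V V_tran by blast+

lemma mem_Vom: "x \<E> Vom \<longleftrightarrow> (\<exists>n. n \<E> om \<and> x \<E> Vs n)"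
  using limit_rank.mem_V[of mem om x] limit_om ZF_axioms by (simp add: limit_rank_def limit_rank_axioms_def)

lemma Vom_pair: "x \<E> Vom \<Longrightarrow> y \<E> Vom \<Longrightarrow> \<langle>x, y\<rangle> \<E> Vom"
  using limit_rank.V_pair[of mem om x] limit_om ZF_axioms by (simp add: limit_rank_def limit_rank_axioms_def)

lemma om_Vom: "n \<E> om \<Longrightarrow> n \<E> Vom"
  using Ord_sub_Vs[OF Ord_om] subD by blast

end

locale embedding_om = embedding + limit_rank_om
begin

lemma k_nat: "n \<E> om \<Longrightarrow> k $ n = n"
  using k_finite_rank om_Vom mem_Vom by metis

lemma k_om: "k $ om = om"
proof -
  define Z where "Z x \<longleftrightarrow> (\<forall>y. y \<E> x \<longrightarrow> \<not> y \<E> x)" for x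
  define S where "S x y \<longleftrightarrow> x \<E> y \<and> (\<forall>z. z \<E> x \<longrightarrow> z \<E> y) \<and> (\<forall>z. z \<E> y \<longrightarrow> z \<E> x \<or> z = x)" for x y
  \<comment> \<open>By Foundation \<open>om\<close> is the only set that contains the empty set, is
    closed under successors, and has no elements other than the empty set and successors of its
    elements.\<close>
  define Q where "Q w \<longleftrightarrow> (\<exists>x. x \<E> w \<and> Z x) \<and> (\<forall>x. x \<E> w \<longrightarrow> (\<exists>y. y \<E> w \<and> S x y)) \<and>
    (\<forall>y. y \<E> w \<longrightarrow> Z y \<or> (\<exists>x. x \<E> w \<and> S x y))" for w
  have Z: "Z x \<longleftrightarrow> x = emp" for x unfolding Z_def eq_emp by blast
  have S: "S x y \<longleftrightarrow> y = suc x" for x y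
    unfolding S_def using extensionality[of y "suc x"] by auto
  have "bfo (\<lambda>_ _. False) (\<lambda>e. Q (e 0)) (\<lambda>e. Q (e 0))" unfolding Q_def Z_def S_def by (intro bfo_intros)
  then have "Q om \<longleftrightarrow> Q (k $ om)" by (rule k_tr1) simp
  moreover have "Q om" unfolding Q_def Z S using om_cases by auto
  moreover have "w = om" if Qw: "Q w" for w
  proof (rule sub_antisym)
    show "om \<sqsubseteq> w"
      using that unfolding Q_def Z S by (intro subI) (simp add: mem_om)
    show "w \<sqsubseteq> om"
    proof (rule subI, rule ccontr)
      fix x assume "x \<E> w" "\<not> x \<E> om"
      then have "x \<E> dif w om" by simp
      then obtain m where m: "m \<E> dif w om" "\<not> (\<exists>z. z \<E> dif w om \<and> z \<E> m)" using foundation by blast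
      then have "m \<noteq> emp" by auto
      then obtain y where "y \<E> w" "m = suc y" using m(1) Qw unfolding Q_def Z S mem_dif by blast
      then show False using m by auto
    qed
  qed
  ultimately show ?thesis by blast
qed

text \<open>The section of \<open>R\<close> at the first coordinate \<open>n\<close>, composed of
  operations that commute with \<open>k\<close>.\<close>

definition fib :: "'a \<Rightarrow> 'a \<Rightarrow> 'a" where
  "fib R n = (let p = prod (sing n) (ran R) in ran (dif p (dif p R)))"

lemma mem_fib: "y \<E> fib R n \<longleftrightarrow> \<langle>n, y\<rangle> \<E> R"
  by (auto simp: fib_def Let_def)

lemma k_fib: assumes "R \<E> V" "n \<E> om" shows "fib R n \<E> V" "k $ fib R n = fib (k $ R) n"
proof -
  have n: "n \<E> V" using assms V_nat by blast
  let ?p = "prod (sing n) (ran R)"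
  have p: "?p \<E> V" "ran R \<E> V" using V_prod V_ran assms n by auto
  then show "fib R n \<E> V" using V_ran V_dif by (simp add: fib_def Let_def)
  have "k $ dif ?p (dif ?p R) = dif (k $ ?p) (dif (k $ ?p) (k $ R))" using k_inter p assms by blast
  moreover have "k $ ?p = prod (sing n) (ran (k $ R))" using n p assms k_nat by (simp add: k_ops)
  ultimately show "k $ fib R n = fib (k $ R) n"
    unfolding fib_def Let_def using k_ops(4)[OF V_dif[OF p(1)] V_emp] by simp
qed

text \<open>\<open>ran R\<close> is the union of the fibres of \<open>R\<close>. Since
  \<open>k $ om = om\<close>, the image of \<open>R\<close> has no fibres at new indices, so
  \<open>k\<close> commutes with this union.\<close>

lemma k_om_union:
  assumes "R \<E> V" "\<And>p. p \<E> R \<Longrightarrow> \<exists>n y. n \<E> om \<and> p = \<langle>n, y\<rangle>" "y \<E> k $ ran R"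
  shows "\<exists>n. n \<E> om \<and> y \<E> k $ fib R n"
proof -
  have "R \<sqsubseteq> prod om (ran R)" using assms(2) by (intro subI) fastforce
  then have "k $ R \<sqsubseteq> prod om (k $ ran R)"
    using k_sub[OF assms(1) V_prod[OF V_om V_ran[OF assms(1)]]] k_om V_ran[OF assms(1)] by (simp add: k_ops)
  moreover obtain n where n: "\<langle>n, y\<rangle> \<E> k $ R" using assms(3) k_ops(4)[OF assms(1) V_emp] by auto
  ultimately have "n \<E> om" by (auto dest: subD)
  then show ?thesis using n k_fib[OF assms(1)] mem_fib by auto
qed

lemma k_Vom: "k $ Vom = Vom" and k_Vom_mem: "x \<E> Vom \<Longrightarrow> k $ x = x"
proof -
  show 1: "k $ x = x" if "x \<E> Vom" for x using k_finite_rank that mem_Vom by blast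
  obtain R where R: "\<And>p. p \<E> R \<longleftrightarrow> p \<E> prod om Vom \<and> (\<exists>n x. p = \<langle>n, x\<rangle> \<and> x \<E> Vs n)"
    by (rule D_sepE[where P="\<lambda>p. \<exists>n x. p = \<langle>n, x\<rangle> \<and> x \<E> Vs n" and a="prod om Vom"], intro D_intros) blast
  have RV: "R \<E> V" by (rule V_sub[OF V_prod[OF V_om V_Vom]], rule subI) (simp only: R)
  have ran: "ran R = Vom" by (rule extensionality) (auto simp: R mem_Vom)
  have fib: "fib R n = Vs n" if "n \<E> om" for n
    by (rule extensionality) (use that in \<open>auto simp: R mem_fib mem_Vom\<close>)
  show "k $ Vom = Vom"
  proof (rule extensionality)
    fix x
    show "x \<E> k $ Vom \<longleftrightarrow> x \<E> Vom"
    proof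
      assume "x \<E> k $ Vom"
      then obtain n where "n \<E> om" "x \<E> k $ fib R n" using k_om_union[OF RV, of x] R ran by auto
      then show "x \<E> Vom" using fib k_finite_rank mem_Vom by auto
    next
      assume "x \<E> Vom"
      then show "x \<E> k $ Vom" using 1 k_mem[of x Vom] V_tran[OF V_Vom] by auto
    qed
  qed
qed

lemma k_sub_Vom: assumes "x \<sqsubseteq> Vom" shows "k $ x = x"
proof (rule extensionality)
  fix z
  have x: "x \<E> V" using V_sub[OF V_Vom assms] .
  have "k $ x \<sqsubseteq> Vom" using k_sub[OF x V_Vom] assms k_Vom by simp
  then have "z \<E> Vom" if "z \<E> k $ x \<or> z \<E> x" using that assms subD by blast
  moreover have "z \<E> k $ x \<longleftrightarrow> z \<E> x" if "z \<E> Vom"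
    using k_mem[of z x] x k_Vom_mem[OF that] V_tran[OF V_Vom that] by simp
  ultimately show "z \<E> k $ x \<longleftrightarrow> z \<E> x" by blast
qed

end

context limit_rank
begin

subsection \<open>Good embeddings and invariant classes\<close>

definition good :: "'a \<Rightarrow> bool" where
  "good k \<longleftrightarrow> Emb k \<and> (\<forall>B. B \<sqsubseteq> V \<longrightarrow> dot k (ran B) = ran (dot k B))"

definition Inv :: "'a \<Rightarrow> bool" where
  "Inv B \<longleftrightarrow> B \<sqsubseteq> V \<and> (\<forall>k. good k \<longrightarrow> dot k B = B)"

abbreviation inV :: "'a \<Rightarrow> bool" where "inV x \<equiv> x \<E> V"
abbreviation DK :: "'a \<Rightarrow> 'a \<Rightarrow> 'a \<Rightarrow> bool" where "DK k R R' \<equiv> R \<sqsubseteq> V \<and> R' = dot k R"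
abbreviation IU :: "'a \<Rightarrow> 'a \<Rightarrow> bool" where "IU R R' \<equiv> Inv R \<and> R' = R"
abbreviation "foI P \<equiv> fo inV inV IU P P"

lemma DT_op: assumes "f \<in> ops" "DT x" "DT y" shows "DT (\<lambda>e. f (x e) (y e))"
proof -
  consider "f = dif" | "f = up" | "f = prod" | "f = (\<lambda>x y. ran x)" | "f = memx" | "f = ins"
    using assms unfolding ops_def by blast
  then show ?thesis by cases (use assms(2,3) in \<open>simp_all add: D_intros\<close>)
qed

lemma D_Emb [D_intros]: "DT x \<Longrightarrow> D (\<lambda>e. Emb (x e))"
proof (erule D_subst1)
  have "D (\<lambda>e. \<forall>f\<in>ops. \<forall>x y. x \<E> V \<longrightarrow> y \<E> V \<longrightarrow> e 0 $ f x y = f (e 0 $ x) (e 0 $ y))"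
  proof (rule fo_Ball[OF finite_ops])
    fix f assume f: "f \<in> ops"
    show "D (\<lambda>e. \<forall>x y. x \<E> V \<longrightarrow> y \<E> V \<longrightarrow> e 0 $ f x y = f (e 0 $ x) (e 0 $ y))"
      by (intro D_intros DT_op[OF f])
  qed
  then show "D (\<lambda>e. Emb (e 0))" unfolding Emb_def by (intro D_intros)
qed

lemma D_good [D_intros]: "DT x \<Longrightarrow> D (\<lambda>e. good (x e))"
  by (erule D_subst1) (unfold good_def, intro D_intros)

lemma D_Inv [D_intros]: "DT x \<Longrightarrow> D (\<lambda>e. Inv (x e))"
  by (erule D_subst1) (unfold Inv_def, intro D_intros)

lemma sub_ops:
  assumes "R \<sqsubseteq> V" "S \<sqsubseteq> V"
  shows "dif R S \<sqsubseteq> V" "prod R S \<sqsubseteq> V" "ran R \<sqsubseteq> V" "memx R S \<sqsubseteq> V" "ins R S \<sqsubseteq> V"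
proof -
  have 1: "x \<E> R \<Longrightarrow> x \<E> V" and 2: "x \<E> S \<Longrightarrow> x \<E> V" for x using assms subD by blast+
  show "dif R S \<sqsubseteq> V" "prod R S \<sqsubseteq> V" "memx R S \<sqsubseteq> V" by (rule subI; use 1 2 in auto)+
  have 3: "\<langle>x, y\<rangle> \<E> R \<Longrightarrow> x \<E> V \<and> y \<E> V" for x y using 1[of "\<langle>x, y\<rangle>"] by simp
  show "ran R \<sqsubseteq> V" "ins R S \<sqsubseteq> V" by (rule subI; use 2 3 in auto)+
qed

lemma V_sub_emp: "sing emp \<sqsubseteq> V"
  by (rule subI) simp

lemma Tran_V: "Tran V" using Vs_Tran Ord_l by blast

lemma relalg_dot: assumes "good k" shows "relalg mem V V (DK k)"
proof -
  interpret K: embedding mem l k by unfold_locales (use assms good_def in blast)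
  show ?thesis
    by unfold_locales
      (use Tran_V V_sub_emp sub_ops assms K.dot_set[of "sing emp"] in
        \<open>simp_all add: K.dot_V K.dot_dif K.dot_ops K.k_ops good_def\<close>)
qed

text \<open>\<open>P'\<close> is \<open>P\<close> with each predicate \<open>R\<close> replaced by
  \<open>dot k R\<close>. The action commutes with all the operations that generate first-order
  definitions; for projections this is the definition of \<open>good\<close>.\<close>

lemma good_fo:
  assumes "good k" "fo inV inV (DK k) P P'" "\<And>x. x \<E> B \<longleftrightarrow> x \<E> V \<and> P (\<lambda>_. x)"
  shows "x \<E> dot k B \<longleftrightarrow> x \<E> V \<and> P' (\<lambda>_. x)"
proof -
  interpret K: embedding mem l k by unfold_locales (use assms good_def in blast)
  interpret R: relalg mem V V "DK k" by (rule relalg_dot[OF assms(1)])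
  obtain C C' where C: "\<And>x. x \<E> C \<longleftrightarrow> x \<E> V \<and> P (\<lambda>_. x)" "\<And>x. x \<E> C' \<longleftrightarrow> x \<E> V \<and> P' (\<lambda>_. x)"
    "DK k (prod C (sing emp)) (prod C' (sing emp))"
    using R.fo_unary[OF assms(2)] by blast
  have "C = B" by (rule extensionality) (simp only: C(1) assms(3))
  moreover have "C \<sqsubseteq> V" by (rule subI) (simp add: C(1))
  ultimately have "prod C' (sing emp) = prod (dot k B) (sing emp)"
    using C(3) K.dot_ops(1)[OF _ V_sub_emp, of C] K.dot_set[of "sing emp"] by (simp add: K.k_ops)
  then have "C' = dot k B" by (rule K.V_prod1)
  then show ?thesis using C(2) by simp
qed

lemma good_elem:
  assumes "good k" "fo inV inV (DK k) P P'" "\<And>i. e i \<E> V"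
  shows "P e \<longleftrightarrow> P' (\<lambda>i. k $ e i)"
proof -
  interpret K: embedding mem l k by unfold_locales (use assms good_def in blast)
  interpret R: relalg mem V V "DK k" by (rule relalg_dot[OF assms(1)])
  show ?thesis
  proof (rule R.fo_elem[OF assms(2)])
    fix R R' xs assume "DK k R R'" "\<forall>x\<in>set xs. x \<E> V"
    then show "tup xs \<E> R \<longleftrightarrow> tup (map (\<lambda>x. k $ x) xs) \<E> R'"
      using K.k_tup[of xs] K.dot_elem by metis
  qed (use assms in auto)
qed

lemma fo_mono_U: "fo A A' U P P' \<Longrightarrow> (\<And>u u'. U u u' \<Longrightarrow> U' u u') \<Longrightarrow> fo A A' U' P P'"
  by (induction rule: fo.induct) (auto intro: fo.intros)

text \<open>Relativizing the quantifiers to \<open>a\<close> turns definability over a set into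
  definability over the model, so that Separation applies.\<close>

lemma fo_D: "fo (\<lambda>x. x \<E> a) A' U P P' \<Longrightarrow> \<exists>Q. D Q \<and> (\<forall>e. (\<forall>i. e i \<E> a) \<longrightarrow> P e = Q e)"
proof (induction rule: fo.induct)
  case (fo_mem i k)
  show ?case by (rule exI[of _ "\<lambda>e. e i \<E> e k"]) (auto intro: fo.fo_mem)
next
  case (fo_pred u u' i)
  show ?case by (rule exI[of _ "\<lambda>e. e i \<E> u"]) (auto intro: fo.fo_pred)
next
  case (fo_neg P P')
  then obtain Q where "D Q" "\<forall>e. (\<forall>i. e i \<E> a) \<longrightarrow> P e = Q e" by blast
  then show ?case by (intro exI[of _ "\<lambda>e. \<not> Q e"]) (auto intro: fo.fo_neg)
next
  case (fo_conj P P' R R')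
  then obtain Q Q' where "D Q" "\<forall>e. (\<forall>i. e i \<E> a) \<longrightarrow> P e = Q e" "D Q'" "\<forall>e. (\<forall>i. e i \<E> a) \<longrightarrow> R e = Q' e" by blast
  then show ?case by (intro exI[of _ "\<lambda>e. Q e \<and> Q' e"]) (auto intro: fo.fo_conj)
next
  case (fo_ex0 P P')
  then obtain Q where Q: "D Q" "\<And>e. (\<forall>i. e i \<E> a) \<Longrightarrow> P e = Q e" by blast
  show ?case
  proof (rule exI[of _ "\<lambda>e. \<exists>x. x \<E> a \<and> Q (case_nat x e)"], intro conjI allI impI)
    show "D (\<lambda>e. \<exists>x. x \<E> a \<and> Q (case_nat x e))" by (intro D_intros) (use Q(1) in simp)
    fix e :: "nat \<Rightarrow> 'a" assume e: "\<forall>i. e i \<E> a"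
    have "P (case_nat x e) = Q (case_nat x e)" if "x \<E> a" for x
      by (rule Q(2)) (use e that in \<open>auto split: nat.split\<close>)
    then show "(\<exists>x. x \<E> a \<and> P (case_nat x e)) = (\<exists>x. x \<E> a \<and> Q (case_nat x e))" by blast
  qed
next
  case (fo_cong P P' R R')
  then obtain Q where "D Q" "\<forall>e. (\<forall>i. e i \<E> a) \<longrightarrow> P e = Q e" by blast
  then show ?case by (intro exI[of _ Q]) (use fo_cong.hyps in auto)
qed

lemma Inv_sub: "Inv B \<Longrightarrow> B \<sqsubseteq> V" by (simp add: Inv_def)

lemma fo_coll: assumes "fo inV A' U P P'" shows "x \<E> Coll (\<lambda>x. x \<E> V \<and> P (\<lambda>_. x)) \<longleftrightarrow> x \<E> V \<and> P (\<lambda>_. x)"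
proof -
  obtain Q where Q: "D Q" "\<And>e. (\<forall>i. e i \<E> V) \<Longrightarrow> P e = Q e" using fo_D[OF assms] by blast
  have "D (\<lambda>e. Q (\<lambda>_. e 0))" by (rule fo_rename[OF Q(1), of "\<lambda>_. 0"])
  then obtain z where "\<And>x. x \<E> z \<longleftrightarrow> x \<E> V \<and> Q (\<lambda>_. x)" by (rule D_sepE) blast
  then have "\<forall>x. x \<E> z \<longleftrightarrow> x \<E> V \<and> P (\<lambda>_. x)" using Q(2) by auto
  then show ?thesis by (intro mem_coll) blast
qed

lemma Inv_fo:
  assumes "foI P" "\<And>x. x \<E> B \<longleftrightarrow> x \<E> V \<and> P (\<lambda>_. x)"
  shows "Inv B"
  unfolding Inv_def
proof (intro conjI allI impI)
  show "B \<sqsubseteq> V" by (rule subI) (simp add: assms(2))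
  fix k assume k: "good k"
  have "fo inV inV (DK k) P P" by (rule fo_mono_U[OF assms(1)]) (use k in \<open>auto simp: Inv_def\<close>)
  from good_fo[OF k this assms(2)] show "dot k B = B" by (intro extensionality) (simp add: assms(2))
qed

lemma Inv_fo_coll: "foI P \<Longrightarrow> Inv (Coll (\<lambda>x. x \<E> V \<and> P (\<lambda>_. x)))"
  by (rule Inv_fo) (auto simp: fo_coll)

text \<open>Membership in a predicate under a name of its own: with plain membership the
  introduction rules could not tell a predicate from a term.\<close>

definition inn :: "'a \<Rightarrow> 'a \<Rightarrow> bool" where "inn u x \<longleftrightarrow> x \<E> u"

lemma fo_inn [fo_intros]: "foT A A' U x x' \<Longrightarrow> U u u' \<Longrightarrow> fo A A' U (\<lambda>e. inn u (x e)) (\<lambda>e. inn u' (x' e))"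
  unfolding inn_def by (rule fo_predT)

lemma tra_V [fo_intros]: "tra inV" using V_tran unfolding tra_def by blast

lemma foT_V_var [fo_intros]: "foT inV inV U (\<lambda>e. e i) (\<lambda>e. e i)"
  by (rule foT_var) (rule tra_V)+

lemma foT_V_pair [fo_intros]: "foT inV inV U x x' \<Longrightarrow> foT inV inV U y y' \<Longrightarrow> foT inV inV U (\<lambda>e. \<langle>x e, y e\<rangle>) (\<lambda>e. \<langle>x' e, y' e\<rangle>)"
  by (erule (1) foT_graph2) (auto intro!: bfo_fo0 bfo_pair tra_V)

lemma foT_V_op:
  assumes "f \<in> ops" "foT inV inV U x x'" "foT inV inV U y y'"
  shows "foT inV inV U (\<lambda>e. f (x e) (y e)) (\<lambda>e. f (x' e) (y' e))"
  by (rule foT_graph2[OF assms(2,3), of f f])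
    (rule V_op[OF assms(1)] bfo_fo0[OF bfo_op[OF assms(1)] tra_V tra_V]; assumption)+

lemma foT_V_Pow [fo_intros]: assumes "foT inV inV U x x'" shows "foT inV inV U (\<lambda>e. Pow (x e)) (\<lambda>e. Pow (x' e))"
proof -
  have "fo inV inV U (\<lambda>e. \<forall>t. inV t \<longrightarrow> (t \<E> e 2 \<longleftrightarrow> (\<forall>u. inV u \<longrightarrow> (u \<E> t \<longrightarrow> u \<E> e 1)))) (\<lambda>e. \<forall>t. inV t \<longrightarrow> (t \<E> e 2 \<longleftrightarrow> (\<forall>u. inV u \<longrightarrow> (u \<E> t \<longrightarrow> u \<E> e 1))))"
    by (intro fo_intros)
  moreover have "(\<forall>t. inV t \<longrightarrow> (t \<E> z \<longleftrightarrow> (\<forall>u. inV u \<longrightarrow> (u \<E> t \<longrightarrow> u \<E> x)))) = (z = Pow x)" if "x \<E> V" "z \<E> V" for x z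
  proof -
    have "t \<E> V \<Longrightarrow> (\<forall>u. inV u \<longrightarrow> (u \<E> t \<longrightarrow> u \<E> x)) = (t \<sqsubseteq> x)" for t using V_tran unfolding subset_def by blast
    then have "(\<forall>t. inV t \<longrightarrow> (t \<E> z \<longleftrightarrow> (\<forall>u. inV u \<longrightarrow> (u \<E> t \<longrightarrow> u \<E> x)))) = (\<forall>t. inV t \<longrightarrow> (t \<E> z \<longleftrightarrow> t \<E> Pow x))" by auto
    also have "\<dots> = (z = Pow x)" using V_tran[OF that(2)] V_tran[OF V_Pow[OF that(1)]] extensionality[of z "Pow x"] by blast
    finally show ?thesis .
  qed
  ultimately have "fo inV inV U (\<lambda>e. e 2 = Pow (e 1)) (\<lambda>e. e 2 = Pow (e 1))" by (elim fo_cong) auto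
  then show ?thesis
    using foT_graph2[OF assms assms, of "\<lambda>u v. Pow u" "\<lambda>u v. Pow u"] V_Pow by simp
qed

lemma foT_V_const:
  assumes "U (sing c) (sing c')" "c \<E> V" "c' \<E> V"
  shows "foT inV inV U (\<lambda>e. c) (\<lambda>e. c')"
proof -
  have "fo inV inV U (\<lambda>e. e 0 \<E> sing c) (\<lambda>e. e 0 \<E> sing c')" by (rule fo_pred[of U, OF assms(1)])
  then show ?thesis using assms by (simp add: foT_def)
qed

end

context ZF
begin

lemma bfo_iff [bfo_intros]:
  assumes "bfo U P P'" "bfo U Q Q'"
  shows "bfo U (\<lambda>e. P e \<longleftrightarrow> Q e) (\<lambda>e. P' e \<longleftrightarrow> Q' e)"
proof -
  have "bfo U (\<lambda>e. (P e \<longrightarrow> Q e) \<and> (Q e \<longrightarrow> P e)) (\<lambda>e. (P' e \<longrightarrow> Q' e) \<and> (Q' e \<longrightarrow> P' e))"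
    using assms by (intro bfo_conj bfo_imp)
  moreover have "((p \<longrightarrow> q) \<and> (q \<longrightarrow> p)) = (p = q)" for p q by blast
  ultimately show ?thesis by simp
qed

lemma bfo_pmem [bfo_intros]: "bfo U (\<lambda>e. \<langle>e a, e b\<rangle> \<E> e c) (\<lambda>e. \<langle>e a, e b\<rangle> \<E> e c)"
proof -
  have "bfo U (\<lambda>e. \<exists>p. p \<E> e c \<and> p = \<langle>e a, e b\<rangle>) (\<lambda>e. \<exists>p. p \<E> e c \<and> p = \<langle>e a, e b\<rangle>)"
    by (intro bfo_intros)
  then show ?thesis by simp
qed

lemma ext_iff: "x = y \<longleftrightarrow> (\<forall>z. z \<E> x \<longrightarrow> z \<E> y) \<and> (\<forall>z. z \<E> y \<longrightarrow> z \<E> x)"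
  by (auto intro: extensionality)

text \<open>The left side is extensionality for two images, the right side the back-and-forth
  condition in the shape that occurs in \<open>bis\<close>.\<close>

lemma image_sub:
  "(\<forall>z. (\<exists>y. A y \<and> B y \<and> z = f y) \<longrightarrow> (\<exists>y. C y \<and> E y \<and> z = g y)) \<and>
    (\<forall>z. (\<exists>y. C y \<and> E y \<and> z = g y) \<longrightarrow> (\<exists>y. A y \<and> B y \<and> z = f y)) \<longleftrightarrow>
   (\<forall>x. A x \<longrightarrow> (B x \<longrightarrow> (\<exists>y. C y \<and> (E y \<and> f x = g y)))) \<and>
    (\<forall>y. C y \<longrightarrow> (E y \<longrightarrow> (\<exists>x. A x \<and> (B x \<and> f x = g y))))"
  (is "?L1 \<and> ?L2 \<longleftrightarrow> ?R1 \<and> ?R2")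
proof -
  have "?L1 \<longleftrightarrow> ?R1" by (metis (no_types, lifting))
  moreover have "?L2 \<longleftrightarrow> ?R2" by (metis (no_types, lifting))
  ultimately show ?thesis by blast
qed

subsection \<open>Collapses and bisimulations\<close>

text \<open>\<open>d\<close> is the Mostowski collapse of the relation \<open>W\<close> on \<open>a\<close>. In the case of ordinals its values need
  not belong to \<open>V\<close>, therefore they are compared by means of bisimulations \<open>E\<close>, which do.\<close>

definition isc :: "'a \<Rightarrow> 'a \<Rightarrow> 'a \<Rightarrow> bool" where
  "isc a W d \<longleftrightarrow> fn d a \<and> (\<forall>x. x \<E> a \<longrightarrow> (\<forall>z. z \<E> d $ x \<longleftrightarrow> (\<exists>y. y \<E> a \<and> \<langle>y, x\<rangle> \<E> W \<and> z = d $ y)))"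

lemma D_isc [D_intros]: "DT x \<Longrightarrow> DT y \<Longrightarrow> DT z \<Longrightarrow> D (\<lambda>e. isc (x e) (y e) (z e))"
  by (erule (2) D_subst3) (unfold isc_def, intro D_intros)

lemma isc_mem: "isc a W d \<Longrightarrow> x \<E> a \<Longrightarrow> z \<E> d $ x \<longleftrightarrow> (\<exists>y. y \<E> a \<and> \<langle>y, x\<rangle> \<E> W \<and> z = d $ y)"
  unfolding isc_def by blast

lemma isc_ex: assumes "wfr a W" shows "\<exists>d. isc a W d"
proof -
  obtain d where d: "fn d a" "\<And>x. x \<E> a \<Longrightarrow> d $ x = ran (lam (prd a W x) (\<lambda>y. d $ y))"
    \<comment> \<open>\<open>G\<close> takes the range of the function on the predecessors, that is,
      the set of the collapsed predecessors.\<close>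
    by (rule wf_recursion[OF assms, where G="\<lambda>x g. ran g"], intro D_intros) blast
  have "z \<E> d $ x \<longleftrightarrow> (\<exists>y. y \<E> a \<and> \<langle>y, x\<rangle> \<E> W \<and> z = d $ y)" if "x \<E> a" for x z
  proof -
    have "p \<E> lam (prd a W x) (\<lambda>y. d $ y) \<longleftrightarrow> (\<exists>y. y \<E> prd a W x \<and> p = \<langle>y, d $ y\<rangle>)" for p
      by (rule mem_lam) (intro D_intros)
    then show ?thesis unfolding d(2)[OF that] by auto
  qed
  then show ?thesis using d(1) unfolding isc_def by blast
qed

lemma image_coll:
  assumes "DT (\<lambda>e. g (e 0))"
  shows "y \<E> Coll (\<lambda>y. \<exists>x. x \<E> a \<and> y = g x) \<longleftrightarrow> (\<exists>x. x \<E> a \<and> y = g x)"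
  by (rule mem_coll[OF image_ex[OF assms]])

lemma isc_wfr: assumes "isc a W d" shows "wfr a W"
  unfolding wfr_def
proof (intro allI impI)
  fix b assume b: "b \<sqsubseteq> a \<and> b \<noteq> emp"
  then obtain x where x: "x \<E> b" by (auto simp: eq_emp)
  let ?i = "Coll (\<lambda>y. \<exists>x. x \<E> b \<and> y = d $ x)"
  have i: "y \<E> ?i \<longleftrightarrow> (\<exists>x. x \<E> b \<and> y = d $ x)" for y by (rule image_coll) (intro D_intros)
  then have "d $ x \<E> ?i" using x by blast
  then obtain m where m: "m \<E> ?i" "\<not> (\<exists>z. z \<E> ?i \<and> z \<E> m)" using foundation by blast
  then obtain w where w: "w \<E> b" "m = d $ w" using i by blast
  have "\<not> \<langle>y, w\<rangle> \<E> W" if "y \<E> b" for y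
  proof
    assume "\<langle>y, w\<rangle> \<E> W"
    then have "d $ y \<E> d $ w" using isc_mem[OF assms, of w] that w b subD by blast
    then show False using m(2) i that w by blast
  qed
  then show "\<exists>m. m \<E> b \<and> (\<forall>y. y \<E> b \<longrightarrow> \<not> \<langle>y, m\<rangle> \<E> W)" using w by blast
qed

text \<open>An equivalence instead of an implication: on \<open>a\<close> and \<open>a'\<close> the
  relation \<open>E\<close> is then determined as equality of the collapses
  (\<open>bis_unique\<close>). The formula is bounded, so embeddings preserve it.\<close>

definition bis :: "'a \<Rightarrow> 'a \<Rightarrow> 'a \<Rightarrow> 'a \<Rightarrow> 'a \<Rightarrow> bool" where
  "bis a W a' W' E \<longleftrightarrow> (\<forall>x. x \<E> a \<longrightarrow> (\<forall>y. y \<E> a' \<longrightarrow> (\<langle>x, y\<rangle> \<E> E \<longleftrightarrow>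
     (\<forall>x'. x' \<E> a \<longrightarrow> (\<langle>x', x\<rangle> \<E> W \<longrightarrow> (\<exists>y'. y' \<E> a' \<and> (\<langle>y', y\<rangle> \<E> W' \<and> \<langle>x', y'\<rangle> \<E> E)))) \<and>
     (\<forall>y'. y' \<E> a' \<longrightarrow> (\<langle>y', y\<rangle> \<E> W' \<longrightarrow> (\<exists>x'. x' \<E> a \<and> (\<langle>x', x\<rangle> \<E> W \<and> \<langle>x', y'\<rangle> \<E> E)))))))"

lemma bis_unique:
  assumes d: "isc a W d" "isc a' W' d'" and E: "bis a W a' W' E" and xy: "x \<E> a" "y \<E> a'"
  shows "\<langle>x, y\<rangle> \<E> E \<longleftrightarrow> d $ x = d' $ y"
proof -
  have "\<forall>y. y \<E> a' \<longrightarrow> (\<langle>x, y\<rangle> \<E> E \<longleftrightarrow> d $ x = d' $ y)"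
  proof (rule wfr_induct[OF isc_wfr[OF d(1)], where P="\<lambda>x. \<forall>y. y \<E> a' \<longrightarrow> (\<langle>x, y\<rangle> \<E> E \<longleftrightarrow> d $ x = d' $ y)"])
    show "D (\<lambda>e. \<forall>y. y \<E> a' \<longrightarrow> (\<langle>e 0, y\<rangle> \<E> E \<longleftrightarrow> d $ e 0 = d' $ y))" by (intro D_intros)
    fix x assume x: "x \<E> a" and IH: "\<And>x'. x' \<E> a \<Longrightarrow> \<langle>x', x\<rangle> \<E> W \<Longrightarrow> \<forall>y. y \<E> a' \<longrightarrow> (\<langle>x', y\<rangle> \<E> E \<longleftrightarrow> d $ x' = d' $ y)"
    show "\<forall>y. y \<E> a' \<longrightarrow> (\<langle>x, y\<rangle> \<E> E \<longleftrightarrow> d $ x = d' $ y)"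
    proof (intro allI impI)
      fix y assume y: "y \<E> a'"
      have "\<langle>x, y\<rangle> \<E> E \<longleftrightarrow>
         (\<forall>x'. x' \<E> a \<longrightarrow> (\<langle>x', x\<rangle> \<E> W \<longrightarrow> (\<exists>y'. y' \<E> a' \<and> (\<langle>y', y\<rangle> \<E> W' \<and> \<langle>x', y'\<rangle> \<E> E)))) \<and>
         (\<forall>y'. y' \<E> a' \<longrightarrow> (\<langle>y', y\<rangle> \<E> W' \<longrightarrow> (\<exists>x'. x' \<E> a \<and> (\<langle>x', x\<rangle> \<E> W \<and> \<langle>x', y'\<rangle> \<E> E))))"
        using E x y unfolding bis_def by blast
      also have "\<dots> \<longleftrightarrow>
         (\<forall>x'. x' \<E> a \<longrightarrow> (\<langle>x', x\<rangle> \<E> W \<longrightarrow> (\<exists>y'. y' \<E> a' \<and> (\<langle>y', y\<rangle> \<E> W' \<and> d $ x' = d' $ y')))) \<and>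
         (\<forall>y'. y' \<E> a' \<longrightarrow> (\<langle>y', y\<rangle> \<E> W' \<longrightarrow> (\<exists>x'. x' \<E> a \<and> (\<langle>x', x\<rangle> \<E> W \<and> d $ x' = d' $ y'))))"
        using IH by blast
      also have "\<dots> \<longleftrightarrow> (\<forall>z. z \<E> d $ x \<longrightarrow> z \<E> d' $ y) \<and> (\<forall>z. z \<E> d' $ y \<longrightarrow> z \<E> d $ x)"
        unfolding isc_mem[OF d(1) x] isc_mem[OF d(2) y] image_sub ..
      also have "\<dots> \<longleftrightarrow> d $ x = d' $ y" by (rule ext_iff[symmetric])
      finally show "\<langle>x, y\<rangle> \<E> E \<longleftrightarrow> d $ x = d' $ y" .
    qed
  qed (rule xy)
  then show ?thesis using xy by blast
qed

lemma bis_ex: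
  assumes d: "isc a W d" "isc a' W' d'" and E: "\<And>x y. x \<E> a \<Longrightarrow> y \<E> a' \<Longrightarrow> \<langle>x, y\<rangle> \<E> E \<longleftrightarrow> d $ x = d' $ y"
  shows "bis a W a' W' E"
  unfolding bis_def
proof (intro allI impI)
  fix x y assume x: "x \<E> a" and y: "y \<E> a'"
  have "d $ x = d' $ y \<longleftrightarrow> (\<forall>z. z \<E> d $ x \<longrightarrow> z \<E> d' $ y) \<and> (\<forall>z. z \<E> d' $ y \<longrightarrow> z \<E> d $ x)"
    by (rule ext_iff)
  also have "\<dots> \<longleftrightarrow>
         (\<forall>x'. x' \<E> a \<longrightarrow> (\<langle>x', x\<rangle> \<E> W \<longrightarrow> (\<exists>y'. y' \<E> a' \<and> (\<langle>y', y\<rangle> \<E> W' \<and> d $ x' = d' $ y')))) \<and>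
         (\<forall>y'. y' \<E> a' \<longrightarrow> (\<langle>y', y\<rangle> \<E> W' \<longrightarrow> (\<exists>x'. x' \<E> a \<and> (\<langle>x', x\<rangle> \<E> W \<and> d $ x' = d' $ y'))))"
    unfolding isc_mem[OF d(1) x] isc_mem[OF d(2) y] image_sub ..
  also have "\<dots> \<longleftrightarrow>
         (\<forall>x'. x' \<E> a \<longrightarrow> (\<langle>x', x\<rangle> \<E> W \<longrightarrow> (\<exists>y'. y' \<E> a' \<and> (\<langle>y', y\<rangle> \<E> W' \<and> \<langle>x', y'\<rangle> \<E> E)))) \<and>
         (\<forall>y'. y' \<E> a' \<longrightarrow> (\<langle>y', y\<rangle> \<E> W' \<longrightarrow> (\<exists>x'. x' \<E> a \<and> (\<langle>x', x\<rangle> \<E> W \<and> \<langle>x', y'\<rangle> \<E> E))))"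
    using E by blast
  finally show "\<langle>x, y\<rangle> \<E> E \<longleftrightarrow>
     (\<forall>x'. x' \<E> a \<longrightarrow> (\<langle>x', x\<rangle> \<E> W \<longrightarrow> (\<exists>y'. y' \<E> a' \<and> (\<langle>y', y\<rangle> \<E> W' \<and> \<langle>x', y'\<rangle> \<E> E)))) \<and>
     (\<forall>y'. y' \<E> a' \<longrightarrow> (\<langle>y', y\<rangle> \<E> W' \<longrightarrow> (\<exists>x'. x' \<E> a \<and> (\<langle>x', x\<rangle> \<E> W \<and> \<langle>x', y'\<rangle> \<E> E))))"
    using E[OF x y] by blast
qed

definition rk :: "'a \<Rightarrow> 'a \<Rightarrow> 'a \<Rightarrow> 'a" where
  "rk a W x = Coll (\<lambda>z. \<exists>d. isc a W d \<and> z \<E> d $ x)"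

lemma DT_rk [D_intros]: "DT x \<Longrightarrow> DT y \<Longrightarrow> DT z \<Longrightarrow> DT (\<lambda>e. rk (x e) (y e) (z e))"
  by (erule (2) DT_subst3) (unfold rk_def, intro D_intros)

lemma isc_eq: assumes "isc a W d" "isc a W d'" "x \<E> a" shows "d $ x = d' $ x"
proof (rule wfr_induct[OF isc_wfr[OF assms(1)] _ _ assms(3), where P="\<lambda>x. d $ x = d' $ x"])
  show "D (\<lambda>e. d $ e 0 = d' $ e 0)" by (intro D_intros)
  fix x assume x: "x \<E> a" and IH: "\<And>y. y \<E> a \<Longrightarrow> \<langle>y, x\<rangle> \<E> W \<Longrightarrow> d $ y = d' $ y"
  show "d $ x = d' $ x"
    by (rule extensionality) (unfold isc_mem[OF assms(1) x] isc_mem[OF assms(2) x], use IH in auto)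
qed

lemma rk_eq: assumes "isc a W d" "x \<E> a" shows "rk a W x = d $ x"
proof -
  have "d' $ x = d $ x" if "isc a W d'" for d' using isc_eq[OF that assms] .
  then show ?thesis unfolding rk_def using assms(1) by (intro coll_eq) metis
qed

lemma rk_mem: assumes "wfr a W" "x \<E> a" shows "z \<E> rk a W x \<longleftrightarrow> (\<exists>y. y \<E> a \<and> \<langle>y, x\<rangle> \<E> W \<and> z = rk a W y)"
proof -
  obtain d where d: "isc a W d" using isc_ex[OF assms(1)] by blast
  show ?thesis unfolding rk_eq[OF d assms(2)] isc_mem[OF d assms(2)] using rk_eq[OF d] by auto
qed

definition trw :: "'a \<Rightarrow> 'a \<Rightarrow> bool" where
  "trw a W \<longleftrightarrow> (\<forall>x. x \<E> a \<longrightarrow> (\<forall>y. y \<E> a \<longrightarrow> (\<forall>z. z \<E> a \<longrightarrow> (\<langle>x, y\<rangle> \<E> W \<longrightarrow> (\<langle>y, z\<rangle> \<E> W \<longrightarrow> \<langle>x, z\<rangle> \<E> W)))))"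

lemma rk_Ord: assumes "wfr a W" "trw a W" "x \<E> a" shows "Ord (rk a W x)"
proof (rule wfr_induct[OF assms(1) _ _ assms(3), where P="\<lambda>x. Ord (rk a W x)"])
  show "D (\<lambda>e. Ord (rk a W (e 0)))" by (intro D_intros)
  fix x assume x: "x \<E> a" and IH: "\<And>y. y \<E> a \<Longrightarrow> \<langle>y, x\<rangle> \<E> W \<Longrightarrow> Ord (rk a W y)"
  show "Ord (rk a W x)"
  proof (rule OrdI[OF TranI])
    fix u v assume "u \<E> rk a W x" "v \<E> u"
    then obtain y z where "y \<E> a" "\<langle>y, x\<rangle> \<E> W" "z \<E> a" "\<langle>z, y\<rangle> \<E> W" "v = rk a W z"
      using rk_mem[OF assms(1)] x by metis
    then show "v \<E> rk a W x" using assms(2) x unfolding trw_def rk_mem[OF assms(1) x] by blast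
  next
    fix u assume "u \<E> rk a W x"
    then show "Ord u" using IH unfolding rk_mem[OF assms(1) x] by blast
  qed
qed

lemma nat_rec:
  assumes H: "DT (\<lambda>e. H (e 0))"
  obtains f where "fn f om" "f $ emp = c" "\<And>n. n \<E> om \<Longrightarrow> f $ suc n = H (f $ n)"
proof -
  obtain W where W: "\<And>p. p \<E> W \<longleftrightarrow> p \<E> prod om om \<and> (\<exists>x y. p = \<langle>x, y\<rangle> \<and> x \<E> y)"
    by (rule D_sepE[where P="\<lambda>p. \<exists>x y. p = \<langle>x, y\<rangle> \<and> x \<E> y" and a="prod om om"], intro D_intros) blast
  have wf: "wfr om W" unfolding wfr_def
  proof (intro allI impI)
    fix b assume b: "b \<sqsubseteq> om \<and> b \<noteq> emp"
    then obtain y where "y \<E> b" by (auto simp: eq_emp)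
    then obtain m where "m \<E> b" "\<not> (\<exists>z. z \<E> b \<and> z \<E> m)" using foundation by blast
    then show "\<exists>m. m \<E> b \<and> (\<forall>y. y \<E> b \<longrightarrow> \<not> \<langle>y, m\<rangle> \<E> W)" by (auto simp: W)
  qed
  \<comment> \<open>\<open>Uni\<close> of a successor number is its predecessor; the disjunction
    inside \<open>Coll\<close> replaces a case distinction.\<close>
  define G where "G x g = Coll (\<lambda>z. (x = emp \<and> z \<E> c) \<or> (x \<noteq> emp \<and> z \<E> H (g $ Uni x)))" for x g
  have G: "DT (\<lambda>e. G (e 1) (e 0))" unfolding G_def by (intro D_intros DT_subst1[OF _ H])
  obtain f where f: "fn f om" "\<And>x. x \<E> om \<Longrightarrow> f $ x = G x (lam (prd om W x) (\<lambda>y. f $ y))"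
    by (rule wf_recursion[OF wf G]) blast
  have "f $ emp = c" unfolding f(2)[OF om_0] G_def by (rule coll_eq) simp
  moreover have "f $ suc n = H (f $ n)" if n: "n \<E> om" for n
  proof -
    have "Uni (suc n) = n"
      by (rule extensionality) (use Ord_TranD[OF om_Ord[OF n]] in auto)
    moreover have "n \<E> prd om W (suc n)" using n by (auto simp: W)
    then have "lam (prd om W (suc n)) (\<lambda>y. f $ y) $ n = f $ n" by (intro lam_ap D_intros)
    moreover have "suc n \<noteq> emp" by (auto simp: eq_emp)
    ultimately show ?thesis unfolding f(2)[OF om_suc[OF n]] G_def by (intro coll_eq) simp
  qed
  ultimately show thesis using that f(1) by blast
qed

end

section \<open>Ordinals represented by well-founded relations\<close>

context limit_rank
begin

text \<open>Transitivity makes all ranks ordinals (\<open>rk_Ord\<close>). A point of such a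
  relation thus represents an ordinal, possibly one outside \<open>V\<close>.\<close>

definition WO :: "'a \<Rightarrow> 'a \<Rightarrow> bool" where
  "WO a W \<longleftrightarrow> a \<E> V \<and> W \<E> V \<and> wfr a W \<and> trw a W"

text \<open>The embedding does not act on an ordinal outside \<open>V\<close> directly, but on its
  representations. By \<open>k_rk\<close> two representations of the same ordinal are mapped to
  representations of the same ordinal.\<close>

definition Fix :: "'a \<Rightarrow> 'a \<Rightarrow> 'a \<Rightarrow> 'a \<Rightarrow> bool" where
  "Fix k a W x \<longleftrightarrow> rk (k $ a) (k $ W) (k $ x) = rk a W x"

lemma D_wfr [D_intros]: "DT x \<Longrightarrow> DT y \<Longrightarrow> D (\<lambda>e. wfr (x e) (y e))"
  by (erule (1) D_subst2) (unfold wfr_def, intro D_intros)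
lemma D_trw [D_intros]: "DT x \<Longrightarrow> DT y \<Longrightarrow> D (\<lambda>e. trw (x e) (y e))"
  by (erule (1) D_subst2) (unfold trw_def, intro D_intros)
lemma D_WO [D_intros]: "DT x \<Longrightarrow> DT y \<Longrightarrow> D (\<lambda>e. WO (x e) (y e))"
  by (erule (1) D_subst2) (unfold WO_def, intro D_intros)
lemma D_Fix [D_intros]: "DT x \<Longrightarrow> DT y \<Longrightarrow> DT z \<Longrightarrow> DT w \<Longrightarrow> D (\<lambda>e. Fix (x e) (y e) (z e) (w e))"
  by (erule (3) D_subst4) (unfold Fix_def, intro D_intros)

lemma bis_V:
  assumes "a \<E> V" "a' \<E> V" "isc a W d" "isc a' W' d'"
  obtains E where "E \<E> V" "bis a W a' W' E" "\<And>x y. x \<E> a \<Longrightarrow> y \<E> a' \<Longrightarrow> \<langle>x, y\<rangle> \<E> E \<longleftrightarrow> d $ x = d' $ y"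
proof -
  obtain E where E: "\<And>p. p \<E> E \<longleftrightarrow> p \<E> prod a a' \<and> (\<exists>x y. p = \<langle>x, y\<rangle> \<and> d $ x = d' $ y)"
    by (rule D_sepE[where P="\<lambda>p. \<exists>x y. p = \<langle>x, y\<rangle> \<and> d $ x = d' $ y" and a="prod a a'"], intro D_intros) blast
  have "E \<E> V" by (rule V_sub[OF V_prod[OF assms(1,2)]], rule subI) (simp only: E)
  moreover have *: "\<And>x y. x \<E> a \<Longrightarrow> y \<E> a' \<Longrightarrow> \<langle>x, y\<rangle> \<E> E \<longleftrightarrow> d $ x = d' $ y" by (auto simp: E)
  ultimately show thesis using that bis_ex[OF assms(3,4) *] by blast
qed

end

context embedding
begin

lemma k_bis: assumes "a \<E> V" "W \<E> V" "a' \<E> V" "W' \<E> V" "E \<E> V"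
  shows "bis a W a' W' E \<longleftrightarrow> bis (k $ a) (k $ W) (k $ a') (k $ W') (k $ E)"
  by (rule k_tr5[OF _ assms]) (unfold bis_def, intro bfo_intros)

text \<open>The quantifier over subsets of \<open>a\<close> is bounded by \<open>Pow a\<close>, and
  \<open>k\<close> preserves power sets.\<close>

lemma k_wfr: assumes "a \<E> V" "W \<E> V" "wfr a W" shows "wfr (k $ a) (k $ W)"
proof -
  define Q where "Q q W \<longleftrightarrow> (\<forall>b. b \<E> q \<longrightarrow> ((\<exists>z. z \<E> b \<and> z = z) \<longrightarrow> (\<exists>m. m \<E> b \<and> (\<forall>y. y \<E> b \<longrightarrow> \<not> \<langle>y, m\<rangle> \<E> W))))" for q W
  have Q: "Q (Pow a) W \<longleftrightarrow> wfr a W" for a W unfolding Q_def wfr_def mem_Pow eq_emp by blast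
  have "bfo (\<lambda>_ _. False) (\<lambda>e. Q (e 0) (e 1)) (\<lambda>e. Q (e 0) (e 1))" unfolding Q_def by (intro bfo_intros)
  then have "Q (Pow a) W \<longleftrightarrow> Q (k $ Pow a) (k $ W)" by (rule k_tr2[OF _ V_Pow[OF assms(1)] assms(2)])
  then show ?thesis using assms(3) unfolding k_Pow[OF assms(1)] Q by blast
qed

lemma k_WO: assumes "WO a W" shows "WO (k $ a) (k $ W)"
proof -
  have "trw a W \<longleftrightarrow> trw (k $ a) (k $ W)"
    by (rule k_tr2) (unfold trw_def, intro bfo_intros, use assms in \<open>simp_all add: WO_def\<close>)
  then show ?thesis using assms k_wfr unfolding WO_def by auto
qed

text \<open>A bisimulation in \<open>V\<close> witnesses that the ranks agree, and its image under
  \<open>k\<close> witnesses the same for the images.\<close>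

lemma k_rk:
  assumes "WO a W" "WO a' W'" "x \<E> a" "y \<E> a'" "rk a W x = rk a' W' y"
  shows "rk (k $ a) (k $ W) (k $ x) = rk (k $ a') (k $ W') (k $ y)"
proof -
  have w: "a \<E> V" "W \<E> V" "wfr a W" "a' \<E> V" "W' \<E> V" "wfr a' W'" using assms unfolding WO_def by auto
  have xy: "x \<E> V" "y \<E> V" using V_tran w assms by blast+
  obtain d d' where d: "isc a W d" "isc a' W' d'" using isc_ex[OF w(3)] isc_ex[OF w(6)] by blast
  obtain e e' where e: "isc (k $ a) (k $ W) e" "isc (k $ a') (k $ W') e'" using isc_ex[OF k_wfr[OF w(1-3)]] isc_ex[OF k_wfr[OF w(4-6)]] by blast
  obtain E where E: "E \<E> V" "bis a W a' W' E" "\<And>x y. x \<E> a \<Longrightarrow> y \<E> a' \<Longrightarrow> \<langle>x, y\<rangle> \<E> E \<longleftrightarrow> d $ x = d' $ y"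
    using bis_V[OF w(1,4) d] by blast
  have "\<langle>x, y\<rangle> \<E> E" using E(3)[OF assms(3,4)] assms(5) rk_eq[OF d(1) assms(3)] rk_eq[OF d(2) assms(4)] by simp
  then have "\<langle>k $ x, k $ y\<rangle> \<E> k $ E" using k_mem[of "\<langle>x, y\<rangle>" E] k_pair E(1) xy by simp
  moreover have "bis (k $ a) (k $ W) (k $ a') (k $ W') (k $ E)" using k_bis w E by blast
  moreover have kx: "k $ x \<E> k $ a" "k $ y \<E> k $ a'" using k_mem w xy assms by auto
  ultimately have "e $ (k $ x) = e' $ (k $ y)" using bis_unique[OF e] by blast
  then show ?thesis using rk_eq[OF e(1) kx(1)] rk_eq[OF e(2) kx(2)] by simp
qed

text \<open>The usual argument that an order-preserving map on ordinals never decreases, carried out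
  on representations.\<close>

lemma k_rk_sub: assumes "WO a W" "x \<E> a" shows "rk a W x \<sqsubseteq> rk (k $ a) (k $ W) (k $ x)"
proof -
  have w: "a \<E> V" "W \<E> V" "wfr a W" "trw a W" using assms unfolding WO_def by auto
  have w': "wfr (k $ a) (k $ W)" "trw (k $ a) (k $ W)" using k_WO[OF assms(1)] unfolding WO_def by auto
  show ?thesis
  proof (rule wfr_induct[OF w(3) _ _ assms(2), where P="\<lambda>x. rk a W x \<sqsubseteq> rk (k $ a) (k $ W) (k $ x)"])
    show "D (\<lambda>e. rk a W (e 0) \<sqsubseteq> rk (k $ a) (k $ W) (k $ e 0))" by (intro D_intros)
    fix x assume x: "x \<E> a" and IH: "\<And>y. y \<E> a \<Longrightarrow> \<langle>y, x\<rangle> \<E> W \<Longrightarrow> rk a W y \<sqsubseteq> rk (k $ a) (k $ W) (k $ y)"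
    show "rk a W x \<sqsubseteq> rk (k $ a) (k $ W) (k $ x)"
    proof (rule subI)
      fix z assume "z \<E> rk a W x"
      then obtain y where y: "y \<E> a" "\<langle>y, x\<rangle> \<E> W" "z = rk a W y" unfolding rk_mem[OF w(3) x] by blast
      have V: "x \<E> V" "y \<E> V" using V_tran w x y by blast+
      have m: "k $ x \<E> k $ a" "k $ y \<E> k $ a" "\<langle>k $ y, k $ x\<rangle> \<E> k $ W"
        using k_mem[of _ a] k_mem[of "\<langle>y, x\<rangle>" W] k_pair w V x y by auto
      have "rk (k $ a) (k $ W) (k $ y) \<E> rk (k $ a) (k $ W) (k $ x)" unfolding rk_mem[OF w'(1) m(1)] using m by blast
      moreover have "z = rk (k $ a) (k $ W) (k $ y) \<or> z \<E> rk (k $ a) (k $ W) (k $ y)"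
        using IH[OF y(1,2)] Ord_sub[OF rk_Ord[OF w(3,4) y(1)] rk_Ord[OF w' m(2)]] y(3) by blast
      ultimately show "z \<E> rk (k $ a) (k $ W) (k $ x)" using Ord_TranD[OF rk_Ord[OF w' m(1)]] by blast
    qed
  qed
qed

text \<open>The right side quantifies over \<open>V\<close> only, which makes the fixing of a rank
  first-order over \<open>V\<close> with \<open>k\<close> as a predicate.\<close>

lemma Fix_bis:
  assumes "WO a W" "x \<E> a"
  shows "Fix k a W x \<longleftrightarrow> (\<exists>E. E \<E> V \<and> bis (k $ a) (k $ W) a W E \<and> \<langle>k $ x, x\<rangle> \<E> E)"
proof -
  have w: "a \<E> V" "W \<E> V" "wfr a W" "k $ a \<E> V" "wfr (k $ a) (k $ W)"
    using assms k_wfr unfolding WO_def by auto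
  obtain d e where d: "isc (k $ a) (k $ W) e" "isc a W d" using isc_ex[OF w(3)] isc_ex[OF w(5)] by blast
  have kx: "k $ x \<E> k $ a" using k_mem w V_tran assms by blast
  have "Fix k a W x \<longleftrightarrow> e $ (k $ x) = d $ x" unfolding Fix_def rk_eq[OF d(2) assms(2)] rk_eq[OF d(1) kx] ..
  then show ?thesis using bis_unique[OF d _ kx assms(2)] bis_V[OF w(4,1) d] kx assms(2) by metis
qed

end

context limit_rank_om
begin

lemma dot_ap: assumes "Emb j" "Emb k" "x \<E> V" shows "dot j k $ (j $ x) = j $ (k $ x)"
proof -
  interpret J: embedding mem l j by unfold_locales (rule assms(1))
  interpret K: embedding mem l k by unfold_locales (rule assms(2))
  interpret L: embedding mem l "dot j k" by unfold_locales (rule Emb_dot[OF assms(1,2)])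
  have kV: "k \<sqsubseteq> V" using K.k_fn by (intro subI) (auto elim!: fn_memE)
  have "\<langle>x, k $ x\<rangle> \<E> k" using fn_ap[OF K.k_fn] assms by blast
  then have "\<langle>j $ x, j $ (k $ x)\<rangle> \<E> dot j k"
    using J.dot_elem[OF _ kV, of "\<langle>x, k $ x\<rangle>"] assms J.k_pair by simp
  then show ?thesis using fn_mem[OF L.k_fn] by simp
qed

text \<open>That \<open>k\<close> fixes the ranks of all points of \<open>b\<close> is a bounded
  statement about \<open>b\<close>, a restriction of \<open>k\<close> and one bisimulation. Its
  image under \<open>j\<close> speaks of \<open>j $ b\<close> and \<open>dot j k\<close>.\<close>

lemma Fix_step:
  assumes Emb: "Emb j" "Emb k" and W: "WO a W" and b: "b \<sqsubseteq> a" "\<And>y. y \<E> b \<Longrightarrow> Fix k a W y" and y: "y \<E> j $ b"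
  shows "Fix (dot j k) (j $ a) (j $ W) y"
proof -
  interpret J: embedding mem l j by unfold_locales (rule Emb(1))
  interpret K: embedding mem l k by unfold_locales (rule Emb(2))
  interpret L: embedding mem l "dot j k" by unfold_locales (rule Emb_dot[OF Emb])
  have w: "a \<E> V" "W \<E> V" "wfr a W" "k $ a \<E> V" "k $ W \<E> V" "wfr (k $ a) (k $ W)"
    using W K.k_wfr unfolding WO_def by auto
  have bV: "b \<E> V" using V_sub[OF w(1) b(1)] .
  obtain d e where d: "isc (k $ a) (k $ W) e" "isc a W d" using isc_ex[OF w(3)] isc_ex[OF w(6)] by blast
  obtain E where E: "E \<E> V" "bis (k $ a) (k $ W) a W E"
    "\<And>x y. x \<E> k $ a \<Longrightarrow> y \<E> a \<Longrightarrow> \<langle>x, y\<rangle> \<E> E \<longleftrightarrow> e $ x = d $ y"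
    using bis_V[OF w(4,1) d] by blast
  let ?f = "Rst k a"
  have f: "?f \<E> V" using Rst_V[OF Emb(2) w(1)] .
  define Q where "Q b f E \<longleftrightarrow> (\<forall>y. y \<E> b \<longrightarrow> (\<exists>p. p \<E> f \<and> (\<exists>u y'. p = \<langle>u, y'\<rangle> \<and> (u = y \<and> \<langle>y', y\<rangle> \<E> E))))" for b f E
  have "bfo (\<lambda>_ _. False) (\<lambda>e. Q (e 0) (e 1) (e 2)) (\<lambda>e. Q (e 0) (e 1) (e 2))" unfolding Q_def by (intro bfo_intros)
  then have "Q b ?f E \<longleftrightarrow> Q (j $ b) (j $ ?f) (j $ E)" by (rule J.k_tr3[OF _ bV f E(1)])
  moreover have "Q b ?f E" unfolding Q_def
  proof (intro allI impI)
    fix y assume y: "y \<E> b"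
    have ya: "y \<E> a" "y \<E> V" using y b(1) subD V_tran w(1) by blast+
    have ky: "k $ y \<E> k $ a" using K.k_mem w ya by blast
    have "\<langle>k $ y, y\<rangle> \<E> E" using b(2)[OF y] E(3)[OF ky ya(1)] unfolding Fix_def rk_eq[OF d(2) ya(1)] rk_eq[OF d(1) ky] by blast
    moreover have "\<langle>y, k $ y\<rangle> \<E> ?f" unfolding Rst_pair using fn_ap[OF K.k_fn ya(2)] ya by blast
    ultimately show "\<exists>p. p \<E> ?f \<and> (\<exists>u y'. p = \<langle>u, y'\<rangle> \<and> (u = y \<and> \<langle>y', y\<rangle> \<E> E))" by blast
  qed
  ultimately obtain y' where y': "\<langle>y, y'\<rangle> \<E> j $ ?f" "\<langle>y', y\<rangle> \<E> j $ E" using y unfolding Q_def by blast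
  have "\<langle>y, y'\<rangle> \<E> dot j k" unfolding mem_dot using y'(1) f Rst_sub V_tran J.k_V by blast
  then have y'': "y' = dot j k $ y" using fn_mem[OF L.k_fn] by blast
  have ja: "y \<E> j $ a" using y J.k_sub[OF bV w(1)] b(1) subD by blast
  have "bis (j $ (k $ a)) (j $ (k $ W)) (j $ a) (j $ W) (j $ E)" using J.k_bis[OF w(4,5,1,2) E(1)] E(2) by blast
  then have "bis (dot j k $ (j $ a)) (dot j k $ (j $ W)) (j $ a) (j $ W) (j $ E)"
    using dot_ap[OF Emb w(1)] dot_ap[OF Emb w(2)] by simp
  then show ?thesis
    using L.Fix_bis[OF J.k_WO[OF W] ja] y'(2) y'' J.k_V[OF E(1)] by blast
qed

text \<open>Take a counterexample of least rank \<beta>, represented by \<open>x\<close>. Since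
  \<open>j\<close> raises \<beta>, it is also the rank of some \<open>y\<close> in the image of the
  set of predecessors of \<open>x\<close>. By minimality that set is the union of \<open>om\<close>
  many parts, the \<open>n\<close>-th one consisting of points whose rank \<open>K $ n\<close>
  fixes. By \<open>k_om_union\<close> the point \<open>y\<close> lies in the image of one part, and
  by \<open>Fix_step\<close> its rank is fixed by \<open>K $ suc n\<close>.\<close>

lemma iterate_Fix:
  assumes j: "Emb j" and K: "K $ emp = j" "\<And>n. n \<E> om \<Longrightarrow> K $ suc n = dot j (K $ n)"
    and EK: "\<And>n. n \<E> om \<Longrightarrow> Emb (K $ n)" and W: "WO a0 W0" "x0 \<E> a0"
  shows "\<exists>n. n \<E> om \<and> Fix (K $ n) a0 W0 x0"
proof (rule ccontr)
  assume no: "\<not> ?thesis"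
  interpret J: embedding mem l j by unfold_locales (rule j)
  interpret J: embedding_om mem l j by unfold_locales
  \<comment> \<open>The quantifier over all representations makes this a property of the ordinal, to
    which Foundation can be applied.\<close>
  define bad where "bad \<beta> \<longleftrightarrow> (\<exists>a W x. WO a W \<and> x \<E> a \<and> rk a W x = \<beta> \<and> (\<forall>n. n \<E> om \<longrightarrow> \<not> Fix (K $ n) a W x))" for \<beta>
  have Db: "D (\<lambda>e. bad (e 0))" unfolding bad_def by (intro D_intros)
  let ?o = "rk a0 W0 x0"
  have oo: "Ord ?o" using W rk_Ord unfolding WO_def by blast
  obtain B where B: "\<And>\<beta>. \<beta> \<E> B \<longleftrightarrow> \<beta> \<E> suc ?o \<and> bad \<beta>" by (rule D_sepE[OF Db]) blast
  have "?o \<E> B" using B no W unfolding bad_def by auto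
  then obtain \<beta> where \<beta>: "\<beta> \<E> B" "\<not> (\<exists>z. z \<E> B \<and> z \<E> \<beta>)" using foundation by blast
  then obtain a W x where aW: "WO a W" "x \<E> a" "rk a W x = \<beta>" and bad: "\<And>n. n \<E> om \<Longrightarrow> \<not> Fix (K $ n) a W x"
    using B unfolding bad_def by blast
  have w: "a \<E> V" "W \<E> V" "wfr a W" "trw a W" using aW unfolding WO_def by auto
  have xV: "x \<E> V" using V_tran w aW by blast
  have below: "\<exists>n. n \<E> om \<and> Fix (K $ n) a W y" if y: "y \<E> a" "\<langle>y, x\<rangle> \<E> W" for y
  proof -
    have "rk a W y \<E> \<beta>" unfolding aW(3)[symmetric] rk_mem[OF w(3) aW(2)] using y by blast
    moreover from this have "rk a W y \<E> suc ?o" using \<beta>(1) B Ord_TranD[OF Ord_suc[OF oo]] by blast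
    ultimately have "\<not> bad (rk a W y)" using B \<beta>(2) by blast
    then show ?thesis using aW(1) y(1) unfolding bad_def by blast
  qed
  obtain R where R: "\<And>p. p \<E> R \<longleftrightarrow> p \<E> prod om a \<and> (\<exists>n y. p = \<langle>n, y\<rangle> \<and> \<langle>y, x\<rangle> \<E> W \<and> Fix (K $ n) a W y)"
    by (rule D_sepE[where P="\<lambda>p. \<exists>n y. p = \<langle>n, y\<rangle> \<and> \<langle>y, x\<rangle> \<E> W \<and> Fix (K $ n) a W y" and a="prod om a"], intro D_intros) blast
  have RV: "R \<E> V" by (rule V_sub[OF V_prod[OF V_om w(1)]], rule subI) (simp only: R)
  have Rp: "\<langle>n, y\<rangle> \<E> R \<longleftrightarrow> n \<E> om \<and> y \<E> a \<and> \<langle>y, x\<rangle> \<E> W \<and> Fix (K $ n) a W y" for n y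
    by (auto simp: R)
  have ran: "ran R = prd a W x" by (rule extensionality) (use below in \<open>auto simp: Rp\<close>)
  have pV: "prd a W x \<E> V" by (rule V_sub[OF w(1)]) (auto intro: subI)
  define Q where "Q p a W x \<longleftrightarrow> (\<forall>y. y \<E> a \<longrightarrow> (\<langle>y, x\<rangle> \<E> W \<longrightarrow> y \<E> p))" for p a W x
  have "bfo (\<lambda>_ _. False) (\<lambda>e. Q (e 0) (e 1) (e 2) (e 3)) (\<lambda>e. Q (e 0) (e 1) (e 2) (e 3))" unfolding Q_def by (intro bfo_intros)
  then have "Q (prd a W x) a W x \<longleftrightarrow> Q (j $ prd a W x) (j $ a) (j $ W) (j $ x)" by (rule J.k_tr4[OF _ pV w(1,2) xV])
  moreover have "Q (prd a W x) a W x" unfolding Q_def by simp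
  ultimately have jp: "y \<E> j $ prd a W x" if "y \<E> j $ a" "\<langle>y, j $ x\<rangle> \<E> j $ W" for y using that unfolding Q_def by blast
  have jw: "wfr (j $ a) (j $ W)" "trw (j $ a) (j $ W)" using J.k_WO[OF aW(1)] unfolding WO_def by auto
  have jx: "j $ x \<E> j $ a" using J.k_mem w xV aW by blast
  have "\<not> Fix j a W x" using bad[OF om_0] K(1) by simp
  then have "rk a W x \<E> rk (j $ a) (j $ W) (j $ x)"
    using J.k_rk_sub[OF aW(1,2)] Ord_sub[OF rk_Ord[OF w(3,4) aW(2)] rk_Ord[OF jw jx]] unfolding Fix_def by metis
  then obtain y where y: "y \<E> j $ a" "\<langle>y, j $ x\<rangle> \<E> j $ W" "rk a W x = rk (j $ a) (j $ W) y"
    unfolding rk_mem[OF jw(1) jx] by blast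
  have "y \<E> j $ ran R" using jp[OF y(1,2)] ran by simp
  then obtain n where n: "n \<E> om" "y \<E> j $ J.fib R n" using J.k_om_union[OF RV] R by fastforce
  have EKn: "Emb (K $ n)" "Emb (K $ suc n)" using EK n by auto
  interpret L: embedding mem l "K $ suc n" by unfold_locales (rule EKn(2))
  have "Fix (dot j (K $ n)) (j $ a) (j $ W) y"
    by (rule Fix_step[OF j EKn(1) aW(1) _ _ n(2)]) (auto intro!: subI simp: J.mem_fib Rp)
  then have "rk (K $ suc n $ (j $ a)) (K $ suc n $ (j $ W)) (K $ suc n $ y) = rk a W x"
    unfolding Fix_def K(2)[OF n(1)] using y(3) by simp
  \<comment> \<open>The points \<open>x\<close> and \<open>y\<close> represent the same ordinal, and
    \<open>k_rk\<close> passes from one to the other.\<close>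
  moreover have "rk (K $ suc n $ a) (K $ suc n $ W) (K $ suc n $ x) = rk (K $ suc n $ (j $ a)) (K $ suc n $ (j $ W)) (K $ suc n $ y)"
    by (rule L.k_rk[OF aW(1) J.k_WO[OF aW(1)] aW(2) y(1) y(3)])
  ultimately have "Fix (K $ suc n) a W x" unfolding Fix_def by simp
  then show False using bad[OF om_suc[OF n(1)]] by blast
qed

subsection \<open>Goodness from a fixed position\<close>

text \<open>One inclusion holds for every embedding, because \<open>k\<close> commutes with
  \<open>ran\<close> on sets. For the other it is enough to find a set \<open>d\<close> of witnesses
  for each single \<open>z\<close>, rather than one for all of \<open>k $ c\<close>.\<close>

lemma goodI:
  assumes "Emb k" "\<And>B c z. B \<sqsubseteq> V \<Longrightarrow> c \<E> V \<Longrightarrow> c \<sqsubseteq> ran B \<Longrightarrow> z \<E> k $ c \<Longrightarrow> \<exists>d. d \<E> V \<and> d \<sqsubseteq> B \<and> z \<E> ran (k $ d)"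
  shows "good k"
  unfolding good_def
proof (intro conjI allI impI assms(1))
  interpret K: embedding mem l k by unfold_locales (rule assms(1))
  fix B assume B: "B \<sqsubseteq> V"
  show "dot k (ran B) = ran (dot k B)"
  proof (rule sub_antisym; rule subI)
    fix z assume "z \<E> dot k (ran B)"
    then obtain c where c: "c \<E> V" "c \<sqsubseteq> ran B" "z \<E> k $ c" unfolding mem_dot by blast
    then obtain d where d: "d \<E> V" "d \<sqsubseteq> B" "z \<E> ran (k $ d)" using assms(2)[OF B] by blast
    have "k $ d \<sqsubseteq> dot k B" using K.dot_mono[OF d(2)] K.dot_set[OF d(1)] by simp
    then show "z \<E> ran (dot k B)" using d(3) unfolding mem_ran by (blast dest: subD)
  next
    fix z assume "z \<E> ran (dot k B)"
    then obtain u where "\<langle>u, z\<rangle> \<E> dot k B" unfolding mem_ran by blast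
    then obtain b where b: "b \<E> V" "b \<sqsubseteq> B" "\<langle>u, z\<rangle> \<E> k $ b" "\<langle>u, z\<rangle> \<E> V" unfolding mem_dot by blast
    have "z \<E> k $ ran b" using b K.k_ops(4)[OF b(1) V_emp] by auto
    moreover have "ran b \<sqsubseteq> ran B" using b(2) by (intro subI) (auto dest: subD)
    ultimately show "z \<E> dot k (ran B)" unfolding mem_dot using V_ran[OF b(1)] b(4) by auto
  qed
qed

text \<open>The part of \<open>B\<close> over \<open>c\<close> whose witnesses appear in
  \<open>Vs \<alpha>\<close>; an element of \<open>V\<close> even if \<open>B\<close> is a proper
  subclass.\<close>

definition cut :: "'a \<Rightarrow> 'a \<Rightarrow> 'a \<Rightarrow> 'a" where
  "cut B \<alpha> c = dif (prod (Vs \<alpha>) c) (dif (prod (Vs \<alpha>) c) B)"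

lemma cut_V: "\<alpha> \<E> l \<Longrightarrow> c \<E> V \<Longrightarrow> cut B \<alpha> c \<E> V"
  unfolding cut_def using V_dif V_prod Vs_V by blast

lemma cut_sub: "cut B \<alpha> c \<sqsubseteq> B"
  unfolding cut_def by (rule subI) (simp only: mem_dif, blast)

lemma mem_cut: "\<langle>u, t\<rangle> \<E> cut B \<alpha> c \<longleftrightarrow> u \<E> Vs \<alpha> \<and> t \<E> c \<and> \<langle>u, t\<rangle> \<E> B"
  unfolding cut_def by auto

text \<open>The domain is an arbitrary set rather than an ordinal: without choice it need not be
  well-orderable.\<close>

definition unb :: "'a \<Rightarrow> 'a \<Rightarrow> bool" where
  "unb a f \<longleftrightarrow> a \<E> V \<and> Maps f a l \<and> (\<forall>\<alpha>. \<alpha> \<E> l \<longrightarrow> (\<exists>w. w \<E> a \<and> \<not> f $ w \<E> \<alpha>))"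

text \<open>Sending each element of \<open>c\<close> to the least level at which it has a witness
  gives a map into \<open>l\<close>. As this map is bounded by some \<alpha>, the set
  \<open>cut B \<alpha> c\<close> contains witnesses for all of \<open>c\<close>.\<close>

lemma good_no_unb:
  assumes no: "\<And>a f. \<not> unb a f" and k: "Emb k"
  shows "good k"
proof (rule goodI[OF k])
  interpret K: embedding mem l k by unfold_locales (rule k)
  fix B c z assume B: "B \<sqsubseteq> V" and c: "c \<E> V" "c \<sqsubseteq> ran B" "z \<E> k $ c"
  define P where "P t \<alpha> \<longleftrightarrow> \<alpha> \<E> l \<and> (\<exists>u. u \<E> Vs \<alpha> \<and> \<langle>u, t\<rangle> \<E> B)" for t \<alpha>
  define M where "M t \<alpha> \<longleftrightarrow> P t \<alpha> \<and> (\<forall>\<beta>. \<beta> \<E> \<alpha> \<longrightarrow> \<not> P t \<beta>)" for t \<alpha>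
  have DP: "D (\<lambda>e. P (e 1) (e 0))" unfolding P_def by (intro D_intros)
  have DM: "D (\<lambda>e. M (e 1) (e 0))" unfolding M_def P_def by (intro D_intros)
  have ex: "\<exists>!\<alpha>. M t \<alpha>" if t: "t \<E> c" for t
  proof -
    obtain u where u: "\<langle>u, t\<rangle> \<E> B" using t c(2) subD by (meson mem_ran)
    then have "u \<E> V" using B subD V_pair by blast
    then obtain \<alpha> where a: "P t \<alpha>" using u mem_V unfolding P_def by blast
    have "D (\<lambda>e. P t (e 0))" unfolding P_def by (intro D_intros)
    then obtain S where S: "\<And>\<beta>. \<beta> \<E> S \<longleftrightarrow> \<beta> \<E> l \<and> P t \<beta>" by (rule D_sepE) blast
    then have "\<alpha> \<E> S" using a unfolding P_def by blast
    then obtain m where m: "m \<E> S" "\<not> (\<exists>z. z \<E> S \<and> z \<E> m)" using foundation by blast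
    have "M t m" unfolding M_def using m S unfolding P_def by blast
    moreover have "m' = m" if "M t m'" for m'
      using Ord_linear[of m m'] V_ord that \<open>M t m\<close> unfolding M_def P_def by blast
    ultimately show ?thesis by blast
  qed
  define f where "f = Coll (\<lambda>p. p \<E> prod c l \<and> (\<exists>t \<alpha>. p = \<langle>t, \<alpha>\<rangle> \<and> M t \<alpha>))"
  have f: "p \<E> f \<longleftrightarrow> p \<E> prod c l \<and> (\<exists>t \<alpha>. p = \<langle>t, \<alpha>\<rangle> \<and> M t \<alpha>)" for p
    unfolding f_def by (rule mem_sep) (intro D_intros D_subst2[OF _ _ DM])
  have fp: "\<langle>t, \<alpha>\<rangle> \<E> f \<longleftrightarrow> t \<E> c \<and> M t \<alpha>" for t \<alpha> unfolding f M_def P_def by auto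
  have fn: "fn f c" unfolding fn_def
  proof (intro conjI allI impI)
    show "\<exists>t \<alpha>. t \<E> c \<and> p = \<langle>t, \<alpha>\<rangle>" if "p \<E> f" for p using that f by auto
    show "\<exists>!\<alpha>. \<langle>t, \<alpha>\<rangle> \<E> f" if "t \<E> c" for t using ex[OF that] that unfolding fp by simp
  qed
  have "\<not> unb c f" by (rule no)
  moreover have "Maps f c l" unfolding Maps_fn using fn fn_ap[OF fn] unfolding fp M_def P_def by blast
  ultimately obtain \<alpha> where a: "\<alpha> \<E> l" "\<And>t. t \<E> c \<Longrightarrow> f $ t \<E> \<alpha>" using c(1) unfolding unb_def by blast
  let ?d = "cut B \<alpha> c"
  have d: "?d \<E> V" using cut_V a c by blast
  have "c \<sqsubseteq> ran ?d"
  proof (rule subI)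
    fix t assume t: "t \<E> c"
    then obtain u where "u \<E> Vs (f $ t)" "\<langle>u, t\<rangle> \<E> B" using fn_ap[OF fn t] unfolding fp M_def P_def by blast
    moreover have "Vs (f $ t) \<sqsubseteq> Vs \<alpha>" using Vs_mono[OF V_ord[OF a(1)] a(2)[OF t]] .
    ultimately show "t \<E> ran ?d" unfolding mem_ran mem_cut using t by (blast dest: subD)
  qed
  then have "k $ c \<sqsubseteq> ran (k $ ?d)" using K.k_sub[OF c(1) V_ran[OF d]] K.k_ops(4)[OF d V_emp] by simp
  then show "\<exists>d. d \<E> V \<and> d \<sqsubseteq> B \<and> z \<E> ran (k $ d)" using d cut_sub c(3) by (blast dest: subD)
qed

text \<open>\<open>W\<close> compares points of \<open>a\<close> by their values under
  \<open>f\<close>, and \<open>a\<close> itself is the point on top. If \<open>k\<close> fixes the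
  rank of the top, every point of \<open>k $ a\<close> has the rank of some \<open>w\<close> in
  \<open>a\<close>, which is at most the rank of \<open>k $ w\<close>. So the points
  \<open>k $ w\<close> are cofinal in \<open>k $ a\<close>, and \<open>z\<close> has a witness in
  the image of the cut at the level \<open>f $ w\<close> for some \<open>w\<close>.\<close>

lemma good_unb:
  assumes unb: "unb a f"
  shows "\<exists>b W x. WO b W \<and> x \<E> b \<and> (\<forall>k. Emb k \<and> Fix k b W x \<longrightarrow> good k)"
proof -
  have a: "a \<E> V" and fl: "\<And>w. w \<E> a \<Longrightarrow> f $ w \<E> l" and un: "\<And>\<alpha>. \<alpha> \<E> l \<Longrightarrow> \<exists>w. w \<E> a \<and> \<not> f $ w \<E> \<alpha>"
    using unb unfolding unb_def Maps_fn by auto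
  let ?b = "suc a"
  have bV: "?b \<E> V"
  proof -
    have "?b = cup a (sing a)" by (rule extensionality) auto
    then show ?thesis using a V_Uni V_up by simp
  qed
  obtain W where W: "\<And>p. p \<E> W \<longleftrightarrow> p \<E> prod ?b ?b \<and> (\<exists>u w. p = \<langle>u, w\<rangle> \<and> u \<E> a \<and> (w = a \<or> f $ u \<E> f $ w \<and> w \<E> a))"
    by (rule D_sepE[where P="\<lambda>p. \<exists>u w. p = \<langle>u, w\<rangle> \<and> u \<E> a \<and> (w = a \<or> f $ u \<E> f $ w \<and> w \<E> a)" and a="prod ?b ?b"], intro D_intros) blast
  have Wp: "\<langle>u, w\<rangle> \<E> W \<longleftrightarrow> u \<E> a \<and> (w = a \<or> f $ u \<E> f $ w \<and> w \<E> a)" for u w by (auto simp: W)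
  have WV: "W \<E> V" by (rule V_sub[OF V_prod[OF bV bV]], rule subI) (simp only: W)
  have wf: "wfr ?b W" unfolding wfr_def
  proof (intro allI impI)
    fix c assume c: "c \<sqsubseteq> ?b \<and> c \<noteq> emp"
    show "\<exists>m. m \<E> c \<and> (\<forall>y. y \<E> c \<longrightarrow> \<not> \<langle>y, m\<rangle> \<E> W)"
    proof (cases "\<exists>w. w \<E> c \<and> w \<E> a")
      case True
      let ?i = "Coll (\<lambda>y. \<exists>x. x \<E> dif c (dif c a) \<and> y = f $ x)"
      have i: "y \<E> ?i \<longleftrightarrow> (\<exists>x. x \<E> dif c (dif c a) \<and> y = f $ x)" for y by (rule image_coll) (intro D_intros)
      obtain w where "f $ w \<E> ?i" using True unfolding i by auto
      then obtain m where m: "m \<E> ?i" "\<not> (\<exists>z. z \<E> ?i \<and> z \<E> m)" using foundation by blast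
      then obtain w where w: "w \<E> c" "w \<E> a" "m = f $ w" unfolding i by auto
      have "\<not> \<langle>y, w\<rangle> \<E> W" if "y \<E> c" for y
      proof
        assume "\<langle>y, w\<rangle> \<E> W"
        then have "y \<E> a" "f $ y \<E> f $ w" using w(2) unfolding Wp by auto
        then show False using m(2) w(3) that unfolding i by auto
      qed
      then show ?thesis using w by blast
    next
      case False
      then obtain m where "m \<E> c" using c by (auto simp: eq_emp)
      then show ?thesis using False unfolding Wp by blast
    qed
  qed
  have tr: "trw ?b W" unfolding trw_def Wp
  proof (intro allI impI)
    fix x y z assume "x \<E> a \<and> (y = a \<or> f $ x \<E> f $ y \<and> y \<E> a)" "y \<E> a \<and> (z = a \<or> f $ y \<E> f $ z \<and> z \<E> a)"
    then show "x \<E> a \<and> (z = a \<or> f $ x \<E> f $ z \<and> z \<E> a)"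
      using Ord_TranD[OF V_ord[OF fl]] mem_irrefl by metis
  qed
  have WO: "WO ?b W" unfolding WO_def using bV WV wf tr by blast
  have "good k" if k: "Emb k" and F: "Fix k ?b W a" for k
  proof (rule goodI[OF k])
    interpret K: embedding mem l k by unfold_locales (rule k)
    fix B c z assume B: "B \<sqsubseteq> V" and c: "c \<E> V" "c \<sqsubseteq> ran B" "z \<E> k $ c"
    \<comment> \<open>\<open>H\<close> relates \<open>t\<close> to those points \<open>w\<close> for
      which a witness for \<open>t\<close> occurs in \<open>Vs (f $ w)\<close>.\<close>
    obtain H where H: "\<And>p. p \<E> H \<longleftrightarrow> p \<E> prod c a \<and> (\<exists>t w. p = \<langle>t, w\<rangle> \<and> (\<exists>u. u \<E> Vs (f $ w) \<and> \<langle>u, t\<rangle> \<E> B))"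
      by (rule D_sepE[where P="\<lambda>p. \<exists>t w. p = \<langle>t, w\<rangle> \<and> (\<exists>u. u \<E> Vs (f $ w) \<and> \<langle>u, t\<rangle> \<E> B)" and a="prod c a"], intro D_intros) blast
    have Hp: "\<langle>t, w\<rangle> \<E> H \<longleftrightarrow> t \<E> c \<and> w \<E> a \<and> (\<exists>u. u \<E> Vs (f $ w) \<and> \<langle>u, t\<rangle> \<E> B)" for t w by (auto simp: H)
    have HV: "H \<E> V" by (rule V_sub[OF V_prod[OF c(1) a]], rule subI) (simp only: H)
    \<comment> \<open>The middle clause is monotonicity of \<open>H\<close>: if \<open>w'\<close> is
      not strictly below \<open>w\<close>, then \<open>f $ w\<close> is at most
      \<open>f $ w'\<close>.\<close>
    define Q where "Q c a H W \<longleftrightarrow> (\<forall>t. t \<E> c \<longrightarrow> (\<exists>w. w \<E> a \<and> \<langle>t, w\<rangle> \<E> H)) \<and>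
       (\<forall>t. t \<E> c \<longrightarrow> (\<forall>w. w \<E> a \<longrightarrow> (\<forall>w'. w' \<E> a \<longrightarrow> (\<langle>t, w\<rangle> \<E> H \<and> \<not> \<langle>w', w\<rangle> \<E> W \<longrightarrow> \<langle>t, w'\<rangle> \<E> H)))) \<and> (\<forall>w. w \<E> a \<longrightarrow> \<langle>w, a\<rangle> \<E> W)" for c a H W
    have "bfo (\<lambda>_ _. False) (\<lambda>e. Q (e 0) (e 1) (e 2) (e 3)) (\<lambda>e. Q (e 0) (e 1) (e 2) (e 3))" unfolding Q_def by (intro bfo_intros)
    then have "Q c a H W \<longleftrightarrow> Q (k $ c) (k $ a) (k $ H) (k $ W)" by (rule K.k_tr4[OF _ c(1) a HV WV])
    moreover have "Q c a H W" unfolding Q_def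
    proof (intro conjI allI impI)
      fix t assume t: "t \<E> c"
      obtain u where u: "\<langle>u, t\<rangle> \<E> B" using t c(2) subD by (meson mem_ran)
      then have "u \<E> V" using B subD V_pair by blast
      then obtain \<alpha> where al: "\<alpha> \<E> l" "u \<E> Vs \<alpha>" using mem_V by blast
      obtain w where w: "w \<E> a" "\<not> f $ w \<E> \<alpha>" using un[OF al(1)] by blast
      then have "\<alpha> \<sqsubseteq> f $ w" using Ord_linear[OF V_ord[OF al(1)] V_ord[OF fl[OF w(1)]]]
          Ord_sub[OF V_ord[OF al(1)] V_ord[OF fl[OF w(1)]]] by blast
      then have "u \<E> Vs (f $ w)" using Vs_mono2[OF fl[OF w(1)] al(1)] al(2) by (blast dest: subD)
      then show "\<exists>w. w \<E> a \<and> \<langle>t, w\<rangle> \<E> H" unfolding Hp using t u w by blast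
    next
      fix t w w' assume "t \<E> c" and w: "w \<E> a" "w' \<E> a" "\<langle>t, w\<rangle> \<E> H \<and> \<not> \<langle>w', w\<rangle> \<E> W"
      then have "\<not> f $ w' \<E> f $ w" unfolding Wp by blast
      then have "f $ w \<sqsubseteq> f $ w'" using Ord_linear[OF V_ord[OF fl[OF w(1)]] V_ord[OF fl[OF w(2)]]]
          Ord_sub[OF V_ord[OF fl[OF w(1)]] V_ord[OF fl[OF w(2)]]] by blast
      then have "Vs (f $ w) \<sqsubseteq> Vs (f $ w')" using Vs_mono2 fl w by blast
      then show "\<langle>t, w'\<rangle> \<E> H" using w unfolding Hp by (blast dest: subD)
    next
      show "\<langle>w, a\<rangle> \<E> W" if "w \<E> a" for w unfolding Wp using that by blast
    qed
    ultimately have Qk: "Q (k $ c) (k $ a) (k $ H) (k $ W)" by blast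
    then obtain w' where w': "w' \<E> k $ a" "\<langle>z, w'\<rangle> \<E> k $ H" using c(3) unfolding Q_def by blast
    have w'a: "\<langle>w', k $ a\<rangle> \<E> k $ W" using Qk w'(1) unfolding Q_def by blast
    have kw: "wfr (k $ ?b) (k $ W)" "trw (k $ ?b) (k $ W)" using K.k_WO[OF WO] unfolding WO_def by auto
    have ka: "k $ a \<E> k $ ?b" using K.k_mem[OF a bV] by simp
    have "a \<sqsubseteq> ?b" by (rule subI) simp
    then have w'b: "w' \<E> k $ ?b" using K.k_sub[OF a bV] w'(1) by (blast dest: subD)
    have "rk (k $ ?b) (k $ W) w' \<E> rk (k $ ?b) (k $ W) (k $ a)" unfolding rk_mem[OF kw(1) ka] using w'b w'a by blast
    then have "rk (k $ ?b) (k $ W) w' \<E> rk ?b W a" using F unfolding Fix_def by simp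
    then obtain w where w: "w \<E> a" "w \<E> ?b" "rk (k $ ?b) (k $ W) w' = rk ?b W w"
      using rk_mem[OF wf, of a] unfolding Wp by auto
    have wV: "w \<E> V" using V_tran a w by blast
    have kwa: "k $ w \<E> k $ a" "k $ w \<E> k $ ?b" using K.k_mem[OF wV] a bV w by auto
    have "\<not> \<langle>k $ w, w'\<rangle> \<E> k $ W"
    proof
      assume "\<langle>k $ w, w'\<rangle> \<E> k $ W"
      then have "rk (k $ ?b) (k $ W) (k $ w) \<E> rk (k $ ?b) (k $ W) w'" unfolding rk_mem[OF kw(1) w'b] using kwa by blast
      then have "rk (k $ ?b) (k $ W) (k $ w) \<E> rk (k $ ?b) (k $ W) (k $ w)"
        using K.k_rk_sub[OF WO w(2)] w(3) by (auto dest: subD)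
      then show False by simp
    qed
    then have zH: "\<langle>z, k $ w\<rangle> \<E> k $ H" using Qk w' kwa(1) c(3) unfolding Q_def by blast
    let ?d = "cut B (f $ w) c"
    have d: "?d \<E> V" using cut_V fl[OF w(1)] c(1) by blast
    define R where "R c H w d \<longleftrightarrow> (\<forall>t. t \<E> c \<longrightarrow> (\<langle>t, w\<rangle> \<E> H \<longrightarrow> (\<exists>p. p \<E> d \<and> (\<exists>u v. p = \<langle>u, v\<rangle> \<and> v = t))))" for c H w d
    have "bfo (\<lambda>_ _. False) (\<lambda>e. R (e 0) (e 1) (e 2) (e 3)) (\<lambda>e. R (e 0) (e 1) (e 2) (e 3))" unfolding R_def by (intro bfo_intros)
    then have "R c H w ?d \<longleftrightarrow> R (k $ c) (k $ H) (k $ w) (k $ ?d)" by (rule K.k_tr4[OF _ c(1) HV wV d])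
    moreover have "R c H w ?d" unfolding R_def Hp using mem_cut by blast
    ultimately have "\<exists>u. \<langle>u, z\<rangle> \<E> k $ ?d" using zH c(3) unfolding R_def by blast
    then show "\<exists>d. d \<E> V \<and> d \<sqsubseteq> B \<and> z \<E> ran (k $ d)" unfolding mem_ran using d cut_sub by blast
  qed
  then show ?thesis using WO by (intro exI[of _ ?b] exI[of _ W] exI[of _ a]) auto
qed

text \<open>If there is no unbounded map, every embedding is good and an arbitrary position will
  do.\<close>

lemma good_position:
  obtains b W x where "WO b W" "x \<E> b" "\<And>k. Emb k \<Longrightarrow> Fix k b W x \<Longrightarrow> good k"
proof (cases "\<exists>a f. unb a f")
  case True
  then show thesis using good_unb that by blast
next
  case False
  have "WO (sing emp) emp" unfolding WO_def wfr_def trw_def by (auto simp: eq_emp)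
  then show thesis using that[of "sing emp" emp emp] good_no_unb False by auto
qed

end

context ZF
begin

subsection \<open>Coded formulas\<close>

abbreviation "num \<equiv> numeral_set mem"
abbreviation "cM \<equiv> code_Mem mem"
abbreviation "cE \<equiv> code_Eq mem"
abbreviation "cN \<equiv> code_Neg mem"
abbreviation "cC \<equiv> code_Conj mem"
abbreviation "cX \<equiv> code_Ex mem"
abbreviation "Formula \<equiv> formula mem"
abbreviation "Delta0 \<equiv> Delta0_formula mem"
abbreviation "Sigma1 \<equiv> Sigma1_formula mem"
abbreviation "Sat \<equiv> satisfies mem"
abbreviation "upd \<equiv> update mem"

lemma num_om [simp]: "num n \<E> om"
  by (induction n) auto

lemma suc_ne [simp]: "suc x \<noteq> emp" "emp \<noteq> suc x"
  by (auto simp: eq_emp eq_commute[of emp])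

lemma num_inj [simp]: "num m = num n \<longleftrightarrow> m = n"
proof (induction m arbitrary: n)
  case 0
  show ?case by (cases n) auto
next
  case (Suc m)
  show ?case by (cases n) (use Suc suc_inj in auto)
qed

lemmas code_defs = code_Mem_def code_Eq_def code_Neg_def code_Conj_def code_Ex_def

lemma code_simps [simp]:
  "cM i k = cM i' k' \<longleftrightarrow> i = i' \<and> k = k'" "cE i k = cE i' k' \<longleftrightarrow> i = i' \<and> k = k'" "cN p = cN p' \<longleftrightarrow> p = p'"
  "cC p q = cC p' q' \<longleftrightarrow> p = p' \<and> q = q'" "cX i p = cX i' p' \<longleftrightarrow> i = i' \<and> p = p'"
  "cM i k \<noteq> cE i' k'" "cM i k \<noteq> cN p" "cM i k \<noteq> cC p q" "cM i k \<noteq> cX i' p"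
  "cE i k \<noteq> cM i' k'" "cE i k \<noteq> cN p" "cE i k \<noteq> cC p q" "cE i k \<noteq> cX i' p"
  "cN p \<noteq> cM i k" "cN p \<noteq> cE i k" "cN p \<noteq> cC p' q" "cN p \<noteq> cX i p'"
  "cC p q \<noteq> cM i k" "cC p q \<noteq> cE i k" "cC p q \<noteq> cN p'" "cC p q \<noteq> cX i p'"
  "cX i p \<noteq> cM i' k'" "cX i p \<noteq> cE i' k'" "cX i p \<noteq> cN p'" "cX i p \<noteq> cC p' q"
  unfolding code_defs by (auto simp del: numeral_set.simps)

lemma DT_codes [D_intros]:
  "DT x \<Longrightarrow> DT y \<Longrightarrow> DT (\<lambda>e. cM (x e) (y e))"
  "DT x \<Longrightarrow> DT y \<Longrightarrow> DT (\<lambda>e. cE (x e) (y e))"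
  "DT x \<Longrightarrow> DT (\<lambda>e. cN (x e))"
  "DT x \<Longrightarrow> DT y \<Longrightarrow> DT (\<lambda>e. cC (x e) (y e))"
  "DT x \<Longrightarrow> DT y \<Longrightarrow> DT (\<lambda>e. cX (x e) (y e))"
  unfolding code_defs by (intro D_intros; assumption)+

lemma D_Formula [D_intros]: "DT x \<Longrightarrow> D (\<lambda>e. Formula (x e))"
  by (erule D_subst1) (unfold formula_def, intro D_intros)

lemma LO: "limit_rank mem om"
  by unfold_locales (rule limit_om)

lemma Vom_closed: "x \<E> Vs om \<Longrightarrow> y \<E> Vs om \<Longrightarrow> \<langle>x, y\<rangle> \<E> Vs om"
  using limit_rank.V_pair[OF LO] by blast

lemma om_sub_Vom: "n \<E> om \<Longrightarrow> n \<E> Vs om"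
  using Ord_sub_Vs[OF Ord_om] subD by blast

lemma codes_Vom:
  "i \<E> om \<Longrightarrow> k \<E> om \<Longrightarrow> cM i k \<E> Vs om" "i \<E> om \<Longrightarrow> k \<E> om \<Longrightarrow> cE i k \<E> Vs om"
  "p \<E> Vs om \<Longrightarrow> cN p \<E> Vs om" "p \<E> Vs om \<Longrightarrow> q \<E> Vs om \<Longrightarrow> cC p q \<E> Vs om"
  "i \<E> om \<Longrightarrow> p \<E> Vs om \<Longrightarrow> cX i p \<E> Vs om"
  unfolding code_defs by (simp_all add: Vom_closed om_sub_Vom del: numeral_set.simps)

definition fcl :: "'a \<Rightarrow> bool" where
  "fcl X \<longleftrightarrow> (\<forall>i k. i \<E> om \<and> k \<E> om \<longrightarrow> cM i k \<E> X \<and> cE i k \<E> X) \<and>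
     (\<forall>q. q \<E> X \<longrightarrow> cN q \<E> X) \<and> (\<forall>q r. q \<E> X \<and> r \<E> X \<longrightarrow> cC q r \<E> X) \<and>
     (\<forall>i q. i \<E> om \<and> q \<E> X \<longrightarrow> cX i q \<E> X)"

definition dcl :: "'a \<Rightarrow> bool" where
  "dcl X \<longleftrightarrow> (\<forall>i k. i \<E> om \<and> k \<E> om \<longrightarrow> cM i k \<E> X \<and> cE i k \<E> X) \<and>
     (\<forall>q. q \<E> X \<longrightarrow> cN q \<E> X) \<and> (\<forall>q r. q \<E> X \<and> r \<E> X \<longrightarrow> cC q r \<E> X) \<and>
     (\<forall>i k q. i \<E> om \<and> k \<E> om \<and> i \<noteq> k \<and> q \<E> X \<longrightarrow> cX i (cC (cM i k) q) \<E> X)"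

lemma Formula_alt: "Formula p \<longleftrightarrow> (\<forall>X. fcl X \<longrightarrow> p \<E> X)"
  unfolding formula_def fcl_def ..

lemma Delta0_alt: "Delta0 p \<longleftrightarrow> (\<forall>X. dcl X \<longrightarrow> p \<E> X)"
  unfolding Delta0_formula_def dcl_def ..

text \<open>\<open>Vs om\<close> is closed under the formation of codes; it is the bound that makes
  the formulas a set of the model.\<close>

lemma Formula_Vom: assumes "Formula p" shows "p \<E> Vs om"
proof -
  have "fcl (Vs om)" unfolding fcl_def using codes_Vom by auto
  then show ?thesis using assms unfolding Formula_alt by blast
qed

lemma Formula_intros:
  "i \<E> om \<Longrightarrow> k \<E> om \<Longrightarrow> Formula (cM i k)" "i \<E> om \<Longrightarrow> k \<E> om \<Longrightarrow> Formula (cE i k)"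
  "Formula p \<Longrightarrow> Formula (cN p)" "Formula p \<Longrightarrow> Formula q \<Longrightarrow> Formula (cC p q)"
  "i \<E> om \<Longrightarrow> Formula p \<Longrightarrow> Formula (cX i p)"
  unfolding Formula_alt by (simp_all add: fcl_def)

text \<open>Induction inside the model, which includes its non-standard formulas; therefore
  \<open>P\<close> has to be definable.\<close>

lemma Formula_induct [consumes 2, case_names Mem Eq Neg Conj Ex]:
  assumes "D (\<lambda>e. P (e 0))" "Formula p"
    and "\<And>i k. i \<E> om \<Longrightarrow> k \<E> om \<Longrightarrow> P (cM i k)" "\<And>i k. i \<E> om \<Longrightarrow> k \<E> om \<Longrightarrow> P (cE i k)"
    and "\<And>q. Formula q \<Longrightarrow> P q \<Longrightarrow> P (cN q)" "\<And>q r. Formula q \<Longrightarrow> Formula r \<Longrightarrow> P q \<Longrightarrow> P r \<Longrightarrow> P (cC q r)"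
    and "\<And>i q. i \<E> om \<Longrightarrow> Formula q \<Longrightarrow> P q \<Longrightarrow> P (cX i q)"
  shows "P p"
proof -
  have "D (\<lambda>e. Formula (e 0) \<and> P (e 0))" by (intro D_intros assms(1))
  then obtain X where X: "\<And>p. p \<E> X \<longleftrightarrow> p \<E> Vs om \<and> (Formula p \<and> P p)" by (rule D_sepE) blast
  have "p \<E> X"
    using assms(2) unfolding formula_def[of mem p]
  proof (rule spec[of _ X, THEN mp], intro conjI allI impI)
    fix i k assume "i \<E> om \<and> k \<E> om"
    then show "cM i k \<E> X" "cE i k \<E> X" unfolding X using codes_Vom Formula_intros assms(3,4) by auto
  next
    fix q assume "q \<E> X"
    then show "cN q \<E> X" unfolding X using codes_Vom Formula_intros assms(5) by auto
  next
    fix q r assume "q \<E> X \<and> r \<E> X"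
    then show "cC q r \<E> X" unfolding X using codes_Vom Formula_intros assms(6) by auto
  next
    fix i q assume "i \<E> om \<and> q \<E> X"
    then show "cX i q \<E> X" unfolding X using codes_Vom Formula_intros assms(7) by auto
  qed
  then show ?thesis using X by blast
qed

lemma Delta0_intros:
  "i \<E> om \<Longrightarrow> k \<E> om \<Longrightarrow> Delta0 (cM i k)" "i \<E> om \<Longrightarrow> k \<E> om \<Longrightarrow> Delta0 (cE i k)"
  "Delta0 p \<Longrightarrow> Delta0 (cN p)" "Delta0 p \<Longrightarrow> Delta0 q \<Longrightarrow> Delta0 (cC p q)"
  "i \<E> om \<Longrightarrow> k \<E> om \<Longrightarrow> i \<noteq> k \<Longrightarrow> Delta0 p \<Longrightarrow> Delta0 (cX i (cC (cM i k) p))"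
  unfolding Delta0_alt by (simp_all add: dcl_def)

lemma Delta0_induct:
  assumes "D (\<lambda>e. P (e 0))" "Delta0 p"
    and "\<And>i k. i \<E> om \<Longrightarrow> k \<E> om \<Longrightarrow> P (cM i k)" "\<And>i k. i \<E> om \<Longrightarrow> k \<E> om \<Longrightarrow> P (cE i k)"
    and "\<And>q. Formula q \<Longrightarrow> P q \<Longrightarrow> P (cN q)" "\<And>q r. Formula q \<Longrightarrow> Formula r \<Longrightarrow> P q \<Longrightarrow> P r \<Longrightarrow> P (cC q r)"
    and "\<And>i k q. i \<E> om \<Longrightarrow> k \<E> om \<Longrightarrow> i \<noteq> k \<Longrightarrow> Formula q \<Longrightarrow> P q \<Longrightarrow> P (cX i (cC (cM i k) q))"
  shows "Formula p \<and> P p"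
proof -
  have "D (\<lambda>e. Formula (e 0) \<and> P (e 0))" by (intro D_intros assms(1))
  then obtain X where X: "\<And>p. p \<E> X \<longleftrightarrow> p \<E> Vs om \<and> (Formula p \<and> P p)" by (rule D_sepE) blast
  have "p \<E> X"
    using assms(2) unfolding Delta0_formula_def[of mem p]
  proof (rule spec[of _ X, THEN mp], intro conjI allI impI)
    fix i k assume "i \<E> om \<and> k \<E> om"
    then show "cM i k \<E> X" "cE i k \<E> X" unfolding X using codes_Vom Formula_intros assms(3,4) by auto
  next
    fix q assume "q \<E> X"
    then show "cN q \<E> X" unfolding X using codes_Vom Formula_intros assms(5) by auto
  next
    fix q r assume "q \<E> X \<and> r \<E> X"
    then show "cC q r \<E> X" unfolding X using codes_Vom Formula_intros assms(6) by auto
  next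
    fix i k q assume "i \<E> om \<and> k \<E> om \<and> i \<noteq> k \<and> q \<E> X"
    then show "cX i (cC (cM i k) q) \<E> X" unfolding X using codes_Vom Formula_intros assms(7) by auto
  qed
  then show ?thesis using X by blast
qed

lemma Delta0_Formula: "Delta0 p \<Longrightarrow> Formula p"
  using Delta0_induct[of "\<lambda>_. True" p] fo_const by blast

lemma Sigma1_intros: "Delta0 p \<Longrightarrow> Sigma1 p" "i \<E> om \<Longrightarrow> Sigma1 p \<Longrightarrow> Sigma1 (cX i p)"
  unfolding Sigma1_formula_def by blast+

lemma Sigma1_induct:
  assumes "D (\<lambda>e. P (e 0))" "Sigma1 p" "\<And>q. Delta0 q \<Longrightarrow> P q" "\<And>i q. i \<E> om \<Longrightarrow> Formula q \<Longrightarrow> P q \<Longrightarrow> P (cX i q)"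
  shows "Formula p \<and> P p"
proof -
  have "D (\<lambda>e. Formula (e 0) \<and> P (e 0))" by (intro D_intros assms(1))
  then obtain X where X: "\<And>p. p \<E> X \<longleftrightarrow> p \<E> Vs om \<and> (Formula p \<and> P p)" by (rule D_sepE) blast
  have "p \<E> X"
    using assms(2) unfolding Sigma1_formula_def[of mem p]
  proof (rule spec[of _ X, THEN mp], intro conjI allI impI)
    fix q assume "Delta0 q"
    then show "q \<E> X" unfolding X using Delta0_Formula Formula_Vom assms(3) by blast
  next
    fix i q assume "i \<E> om \<and> q \<E> X"
    then show "cX i q \<E> X" unfolding X using codes_Vom Formula_intros assms(4) by auto
  qed
  then show ?thesis using X by blast
qed

definition Fm :: 'a where "Fm = Coll Formula"

lemma mem_Fm [simp]: "p \<E> Fm \<longleftrightarrow> Formula p"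
  unfolding Fm_def by (rule mem_collI[where a="Vs om"], intro D_intros) (rule Formula_Vom)

subsection \<open>Assignments\<close>

lemma mem_upd: "p \<E> upd f x y \<longleftrightarrow> (p \<E> f \<and> (\<forall>z. p \<noteq> \<langle>x, z\<rangle>)) \<or> p = \<langle>x, y\<rangle>"
  unfolding update_def
  by (rule mem_collI[where a="cup f (sing \<langle>x, y\<rangle>)"]) (intro D_intros, auto)

lemma DT_upd [D_intros]: "DT x \<Longrightarrow> DT y \<Longrightarrow> DT z \<Longrightarrow> DT (\<lambda>e. upd (x e) (y e) (z e))"
  by (erule (2) DT_subst3) (unfold update_def, intro D_intros)

lemma upd_fn: assumes "fn f a" "x \<E> a" shows "fn (upd f x y) a"
  by (rule fnI[where F="\<lambda>u. if u = x then y else f $ u"])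
    (use assms in \<open>auto simp: mem_upd fn_mem elim!: fn_memE\<close>)

lemma upd_ap: assumes "fn f a" "x \<E> a" "u \<E> a" shows "upd f x y $ u = (if u = x then y else f $ u)"
proof -
  have "\<langle>u, if u = x then y else f $ u\<rangle> \<E> upd f x y" using assms by (auto simp: mem_upd fn_mem)
  then show ?thesis using fn_mem[OF upd_fn[OF assms(1,2)]] by metis
qed

lemma upd_Maps: assumes "Maps s om A" "i \<E> om" "x \<E> A" shows "Maps (upd s i x) om A"
  using assms upd_fn upd_ap unfolding Maps_fn by auto

lemma Maps_mono: "Maps s a A \<Longrightarrow> A \<sqsubseteq> B \<Longrightarrow> Maps s a B"
  unfolding Maps_fn by (blast dest: subD)

subsection \<open>Satisfaction\<close>

definition srel :: "'a \<Rightarrow> 'a \<Rightarrow> bool" where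
  "srel A S \<longleftrightarrow> (\<forall>s. Maps s om A \<longrightarrow>
     (\<forall>i k. i \<E> om \<and> k \<E> om \<longrightarrow>
        (\<langle>cM i k, s\<rangle> \<E> S \<longleftrightarrow> s $ i \<E> s $ k) \<and>
        (\<langle>cE i k, s\<rangle> \<E> S \<longleftrightarrow> s $ i = s $ k)) \<and>
     (\<forall>p. Formula p \<longrightarrow> (\<langle>cN p, s\<rangle> \<E> S \<longleftrightarrow> \<not> \<langle>p, s\<rangle> \<E> S)) \<and>
     (\<forall>p q. Formula p \<and> Formula q \<longrightarrow>
        (\<langle>cC p q, s\<rangle> \<E> S \<longleftrightarrow> \<langle>p, s\<rangle> \<E> S \<and> \<langle>q, s\<rangle> \<E> S)) \<and>
     (\<forall>i p. i \<E> om \<and> Formula p \<longrightarrow>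
        (\<langle>cX i p, s\<rangle> \<E> S \<longleftrightarrow> (\<exists>a. a \<E> A \<and> \<langle>p, upd s i a\<rangle> \<E> S))))"

lemma srel_iff: "satisfaction_rel mem A S \<longleftrightarrow> srel A S"
proof -
  have "app mem s i = s $ i" if "Maps s om A" "i \<E> om" for s i
    using that app_ap unfolding Maps_fn by blast
  then show ?thesis unfolding satisfaction_rel_def srel_def by (intro all_cong1 imp_cong refl conj_cong) auto
qed

lemma Sat_iff: "Sat A p s \<longleftrightarrow> (\<exists>S. srel A S \<and> \<langle>p, s\<rangle> \<E> S)"
  unfolding satisfies_def srel_iff ..

lemma D_Sat [D_intros]: "DT x \<Longrightarrow> DT y \<Longrightarrow> DT z \<Longrightarrow> D (\<lambda>e. Sat (x e) (y e) (z e))"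
  by (erule (2) D_subst3) (unfold Sat_iff srel_def, intro D_intros)

text \<open>Recursion along the immediate subformula relation, where the value at a formula is the
  set of all assignments satisfying it.\<close>

lemma srel_ex: "\<exists>S. srel A S"
proof -
  obtain Sq where Sq: "\<And>s. s \<E> Sq \<longleftrightarrow> s \<E> Pow (prod om A) \<and> Maps s om A"
    by (rule D_sepE[where P="\<lambda>s. Maps s om A" and a="Pow (prod om A)"], intro D_intros) blast
  have Sq': "s \<E> Sq \<longleftrightarrow> Maps s om A" for s
    unfolding Sq maps_def by (auto intro!: subI)
  obtain W where W: "\<And>x. x \<E> W \<longleftrightarrow> x \<E> prod Fm Fm \<and> (\<exists>q p. x = \<langle>q, p\<rangle> \<and> (p = cN q \<or> (\<exists>r. p = cC q r \<or> p = cC r q) \<or> (\<exists>i. p = cX i q)))"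
    by (rule D_sepE[where P="\<lambda>x. \<exists>q p. x = \<langle>q, p\<rangle> \<and> (p = cN q \<or> (\<exists>r. p = cC q r \<or> p = cC r q) \<or> (\<exists>i. p = cX i q))" and a="prod Fm Fm"], intro D_intros) blast
  have Wp: "\<langle>q, p\<rangle> \<E> W \<longleftrightarrow> Formula q \<and> Formula p \<and> (p = cN q \<or> (\<exists>r. p = cC q r \<or> p = cC r q) \<or> (\<exists>i. p = cX i q))" for q p
    unfolding W by auto
  have wf: "wfr Fm W" unfolding wfr_def
  proof (intro allI impI)
    fix b assume b: "b \<sqsubseteq> Fm \<and> b \<noteq> emp"
    then obtain p where p: "p \<E> b" by (auto simp: eq_emp)
    define M where "M p \<longleftrightarrow> (p \<E> b \<longrightarrow> (\<exists>m. m \<E> b \<and> (\<forall>y. y \<E> b \<longrightarrow> \<not> \<langle>y, m\<rangle> \<E> W)))" for p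
    have "D (\<lambda>e. M (e 0))" unfolding M_def by (intro D_intros)
    moreover have "Formula p" using b p by (auto dest: subD)
    ultimately have "M p"
    proof (induction p rule: Formula_induct)
      case (Mem i k)
      show ?case unfolding M_def Wp by auto
    next
      case (Eq i k)
      show ?case unfolding M_def Wp by auto
    next
      case (Neg q)
      then show ?case unfolding M_def by (cases "q \<E> b") (auto simp: Wp)
    next
      case (Conj q r)
      then show ?case unfolding M_def by (cases "q \<E> b"; cases "r \<E> b") (auto simp: Wp)
    next
      case (Ex i q)
      then show ?case unfolding M_def by (cases "q \<E> b") (auto simp: Wp)
    qed
    then show "\<exists>m. m \<E> b \<and> (\<forall>y. y \<E> b \<longrightarrow> \<not> \<langle>y, m\<rangle> \<E> W)" using p unfolding M_def by blast
  qed
  define C where "C p g s \<longleftrightarrow> (\<exists>i k. p = cM i k \<and> s $ i \<E> s $ k) \<or> (\<exists>i k. p = cE i k \<and> s $ i = s $ k) \<or>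
     (\<exists>q. p = cN q \<and> \<not> s \<E> g $ q) \<or> (\<exists>q r. p = cC q r \<and> s \<E> g $ q \<and> s \<E> g $ r) \<or>
     (\<exists>i q. p = cX i q \<and> (\<exists>a. a \<E> A \<and> upd s i a \<E> g $ q))" for p g s
  have DC: "DT x \<Longrightarrow> DT y \<Longrightarrow> DT z \<Longrightarrow> D (\<lambda>e. C (x e) (y e) (z e))" for x y z
    by (erule (2) D_subst3) (unfold C_def, intro D_intros)
  define G where "G p g = Coll (\<lambda>s. s \<E> Sq \<and> C p g s)" for p g
  have mG: "s \<E> G p g \<longleftrightarrow> s \<E> Sq \<and> C p g s" for s p g unfolding G_def by (rule mem_sep) (intro D_intros DC)
  have "DT (\<lambda>e. G (e 1) (e 0))" unfolding G_def by (intro D_intros DC)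
  then obtain f where f: "fn f Fm" "\<And>p. p \<E> Fm \<Longrightarrow> f $ p = G p (lam (prd Fm W p) (\<lambda>y. f $ y))"
    by (rule wf_recursion[OF wf]) blast
  have l: "lam (prd Fm W p) (\<lambda>y. f $ y) $ q = f $ q" if "\<langle>q, p\<rangle> \<E> W" for p q
    by (rule lam_ap, intro D_intros) (use that in \<open>simp add: Wp\<close>)
  have F: "s \<E> f $ p \<longleftrightarrow> s \<E> Sq \<and> C p (lam (prd Fm W p) (\<lambda>y. f $ y)) s" if "Formula p" for p s
    using f(2)[of p] mG that by simp
  obtain S where S: "\<And>x. x \<E> S \<longleftrightarrow> x \<E> prod Fm Sq \<and> (\<exists>p s. x = \<langle>p, s\<rangle> \<and> s \<E> f $ p)"
    by (rule D_sepE[where P="\<lambda>x. \<exists>p s. x = \<langle>p, s\<rangle> \<and> s \<E> f $ p" and a="prod Fm Sq"], intro D_intros) blast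
  have Sp: "\<langle>p, s\<rangle> \<E> S \<longleftrightarrow> s \<E> f $ p" if "Formula p" for p s using that F[OF that] unfolding S by auto
  have "srel A S" unfolding srel_def
  proof (intro allI impI conjI)
    fix s i k assume "Maps s om A" "i \<E> om \<and> k \<E> om"
    then show "\<langle>cM i k, s\<rangle> \<E> S \<longleftrightarrow> s $ i \<E> s $ k" "\<langle>cE i k, s\<rangle> \<E> S \<longleftrightarrow> s $ i = s $ k"
      using Sp[OF Formula_intros(1)] Sp[OF Formula_intros(2)] F[OF Formula_intros(1)] F[OF Formula_intros(2)] Sq'
      unfolding C_def by simp_all
  next
    fix s p assume s: "Maps s om A" and p: "Formula p"
    have "\<langle>p, cN p\<rangle> \<E> W" unfolding Wp using p Formula_intros by blast
    then show "\<langle>cN p, s\<rangle> \<E> S \<longleftrightarrow> \<not> \<langle>p, s\<rangle> \<E> S"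
      unfolding Sp[OF p] Sp[OF Formula_intros(3)[OF p]] F[OF Formula_intros(3)[OF p]] using l s Sq' unfolding C_def by simp
  next
    fix s p q assume s: "Maps s om A" and "Formula p \<and> Formula q"
    then have p: "Formula p" "Formula q" by auto
    have "\<langle>p, cC p q\<rangle> \<E> W" "\<langle>q, cC p q\<rangle> \<E> W" unfolding Wp using p Formula_intros by blast+
    then show "\<langle>cC p q, s\<rangle> \<E> S \<longleftrightarrow> \<langle>p, s\<rangle> \<E> S \<and> \<langle>q, s\<rangle> \<E> S"
      unfolding Sp[OF p(1)] Sp[OF p(2)] Sp[OF Formula_intros(4)[OF p]] F[OF Formula_intros(4)[OF p]] using l s Sq' unfolding C_def by simp
  next
    fix s i p assume s: "Maps s om A" and "i \<E> om \<and> Formula p"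
    then have p: "i \<E> om" "Formula p" by auto
    have "\<langle>p, cX i p\<rangle> \<E> W" unfolding Wp using p Formula_intros by blast
    then show "\<langle>cX i p, s\<rangle> \<E> S \<longleftrightarrow> (\<exists>a. a \<E> A \<and> \<langle>p, upd s i a\<rangle> \<E> S)"
      unfolding Sp[OF p(2)] Sp[OF Formula_intros(5)[OF p]] F[OF Formula_intros(5)[OF p]] using l s Sq' unfolding C_def by simp
  qed
  then show ?thesis by blast
qed

lemma srel_unique:
  assumes S: "srel A S" "srel A S'" and p: "Formula p" and s: "Maps s om A"
  shows "\<langle>p, s\<rangle> \<E> S \<longleftrightarrow> \<langle>p, s\<rangle> \<E> S'"
proof -
  define P where "P p \<longleftrightarrow> (\<forall>s. Maps s om A \<longrightarrow> (\<langle>p, s\<rangle> \<E> S \<longleftrightarrow> \<langle>p, s\<rangle> \<E> S'))" for p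
  have "D (\<lambda>e. P (e 0))" unfolding P_def by (intro D_intros)
  from this p have "P p"
  proof (induction p rule: Formula_induct)
    case (Mem i k)
    then show ?case using S unfolding P_def by (simp add: srel_def)
  next
    case (Eq i k)
    then show ?case using S unfolding P_def by (simp add: srel_def)
  next
    case (Neg q)
    then show ?case using S unfolding P_def by (simp add: srel_def)
  next
    case (Conj q r)
    then show ?case using S unfolding P_def by (simp add: srel_def)
  next
    case (Ex i q)
    show ?case unfolding P_def
    proof (intro allI impI)
      fix s assume s: "Maps s om A"
      have "\<langle>cX i q, s\<rangle> \<E> S \<longleftrightarrow> (\<exists>a. a \<E> A \<and> \<langle>q, upd s i a\<rangle> \<E> S)" "\<langle>cX i q, s\<rangle> \<E> S' \<longleftrightarrow> (\<exists>a. a \<E> A \<and> \<langle>q, upd s i a\<rangle> \<E> S')"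
        using S s Ex by (simp_all add: srel_def)
      moreover have "\<langle>q, upd s i a\<rangle> \<E> S \<longleftrightarrow> \<langle>q, upd s i a\<rangle> \<E> S'" if "a \<E> A" for a
        using Ex(3) upd_Maps[OF s Ex(1) that] unfolding P_def by blast
      ultimately show "\<langle>cX i q, s\<rangle> \<E> S \<longleftrightarrow> \<langle>cX i q, s\<rangle> \<E> S'" by blast
    qed
  qed
  then show ?thesis using s unfolding P_def by blast
qed

lemma Sat_simps:
  assumes s: "Maps s om A"
  shows "i \<E> om \<Longrightarrow> k \<E> om \<Longrightarrow> Sat A (cM i k) s \<longleftrightarrow> s $ i \<E> s $ k"
    "i \<E> om \<Longrightarrow> k \<E> om \<Longrightarrow> Sat A (cE i k) s \<longleftrightarrow> s $ i = s $ k"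
    "Formula p \<Longrightarrow> Sat A (cN p) s \<longleftrightarrow> \<not> Sat A p s"
    "Formula p \<Longrightarrow> Formula q \<Longrightarrow> Sat A (cC p q) s \<longleftrightarrow> Sat A p s \<and> Sat A q s"
    "i \<E> om \<Longrightarrow> Formula p \<Longrightarrow> Sat A (cX i p) s \<longleftrightarrow> (\<exists>a. a \<E> A \<and> Sat A p (upd s i a))"
proof -
  obtain S where S: "srel A S" using srel_ex by blast
  have *: "Sat A p s \<longleftrightarrow> \<langle>p, s\<rangle> \<E> S" if "Formula p" "Maps s om A" for p s
    unfolding Sat_iff using S srel_unique[OF S _ that] by blast
  have S': "(\<forall>i k. i \<E> om \<and> k \<E> om \<longrightarrow>
        (\<langle>cM i k, s\<rangle> \<E> S \<longleftrightarrow> s $ i \<E> s $ k) \<and>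
        (\<langle>cE i k, s\<rangle> \<E> S \<longleftrightarrow> s $ i = s $ k))"
     "(\<forall>p. Formula p \<longrightarrow> (\<langle>cN p, s\<rangle> \<E> S \<longleftrightarrow> \<not> \<langle>p, s\<rangle> \<E> S))"
     "(\<forall>p q. Formula p \<and> Formula q \<longrightarrow>
        (\<langle>cC p q, s\<rangle> \<E> S \<longleftrightarrow> \<langle>p, s\<rangle> \<E> S \<and> \<langle>q, s\<rangle> \<E> S))"
     "(\<forall>i p. i \<E> om \<and> Formula p \<longrightarrow>
        (\<langle>cX i p, s\<rangle> \<E> S \<longleftrightarrow> (\<exists>a. a \<E> A \<and> \<langle>p, upd s i a\<rangle> \<E> S)))"
    using S s by (simp_all add: srel_def)
  show "Sat A (cM i k) s \<longleftrightarrow> s $ i \<E> s $ k" "Sat A (cE i k) s \<longleftrightarrow> s $ i = s $ k" if "i \<E> om" "k \<E> om"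
    using *[OF Formula_intros(1)[OF that] s] *[OF Formula_intros(2)[OF that] s] S'(1) that by blast+
  show "Sat A (cN p) s \<longleftrightarrow> \<not> Sat A p s" if "Formula p"
    using *[OF Formula_intros(3)[OF that] s] *[OF that s] S'(2) that by blast
  show "Sat A (cC p q) s \<longleftrightarrow> Sat A p s \<and> Sat A q s" if "Formula p" "Formula q"
    using *[OF Formula_intros(4)[OF that] s] *[OF that(1) s] *[OF that(2) s] S'(3) that by blast
  show "Sat A (cX i p) s \<longleftrightarrow> (\<exists>a. a \<E> A \<and> Sat A p (upd s i a))" if "i \<E> om" "Formula p"
  proof -
    have "Sat A p (upd s i a) \<longleftrightarrow> \<langle>p, upd s i a\<rangle> \<E> S" if "a \<E> A" for a
      using *[OF \<open>Formula p\<close> upd_Maps[OF s \<open>i \<E> om\<close> that]] .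
    then show ?thesis using *[OF Formula_intros(5)[OF that] s] S'(4) that by blast
  qed
qed

end

section \<open>Coding of bounded predicates, support of formulas, and absoluteness\<close>

context ZF
begin

text \<open>Place \<open>i\<close> is coded by the variable \<open>num (s i)\<close>, and a
  quantifier uses \<open>num N\<close>, which differs from all of these. Bounded quantifiers of the
  formula range over \<open>A\<close> only, but by transitivity they reach all elements of their
  bounds.\<close>

lemma bfo_code:
  assumes "bfo (\<lambda>_ _. False) P P'"
  shows "P = P' \<and> (\<forall>s N. (\<forall>i. s i < N) \<longrightarrow> (\<exists>p. Delta0 p \<and>
    (\<forall>A t. Tran A \<and> Maps t om A \<longrightarrow> (Sat A p t \<longleftrightarrow> P (\<lambda>i. t $ num (s i))))))"
  using assms
proof (induction rule: bfo.induct)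
  case (bfo_mem i k)
  show ?case
  proof (intro conjI refl allI impI)
    fix s :: "nat \<Rightarrow> nat" and N
    show "\<exists>p. Delta0 p \<and> (\<forall>A t. Tran A \<and> Maps t om A \<longrightarrow> (Sat A p t \<longleftrightarrow> t $ num (s i) \<E> t $ num (s k)))"
      by (rule exI[of _ "cM (num (s i)) (num (s k))"]) (simp add: Delta0_intros Sat_simps)
  qed
next
  case (bfo_pred u u' i)
  then show ?case by simp
next
  case (bfo_neg P P')
  show ?case
  proof (intro conjI allI impI)
    fix s :: "nat \<Rightarrow> nat" and N assume "\<forall>i. s i < N"
    then obtain p where p: "Delta0 p" "\<And>A t. Tran A \<and> Maps t om A \<Longrightarrow> (Sat A p t \<longleftrightarrow> P (\<lambda>i. t $ num (s i)))" using bfo_neg.IH by blast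
    show "\<exists>p. Delta0 p \<and> (\<forall>A t. Tran A \<and> Maps t om A \<longrightarrow> (Sat A p t \<longleftrightarrow> \<not> P (\<lambda>i. t $ num (s i))))"
      by (rule exI[of _ "cN p"]) (use p Delta0_Formula[OF p(1)] in \<open>simp add: Delta0_intros Sat_simps\<close>)
  qed (use bfo_neg in auto)
next
  case (bfo_conj P P' Q Q')
  show ?case
  proof (intro conjI allI impI)
    fix s :: "nat \<Rightarrow> nat" and N assume s: "\<forall>i. s i < N"
    obtain p where p: "Delta0 p" "\<And>A t. Tran A \<and> Maps t om A \<Longrightarrow> (Sat A p t \<longleftrightarrow> P (\<lambda>i. t $ num (s i)))" using bfo_conj.IH(1) s by blast
    obtain q where q: "Delta0 q" "\<And>A t. Tran A \<and> Maps t om A \<Longrightarrow> (Sat A q t \<longleftrightarrow> Q (\<lambda>i. t $ num (s i)))" using bfo_conj.IH(2) s by blast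
    show "\<exists>p. Delta0 p \<and> (\<forall>A t. Tran A \<and> Maps t om A \<longrightarrow> (Sat A p t \<longleftrightarrow> P (\<lambda>i. t $ num (s i)) \<and> Q (\<lambda>i. t $ num (s i))))"
      by (rule exI[of _ "cC p q"]) (use p q Delta0_Formula[OF p(1)] Delta0_Formula[OF q(1)] in \<open>simp add: Delta0_intros Sat_simps\<close>)
  qed (use bfo_conj in auto)
next
  case (bfo_bex0 P P' k)
  show ?case
  proof (intro conjI allI impI)
    fix s :: "nat \<Rightarrow> nat" and N assume s: "\<forall>i. s i < N"
    let ?s = "case_nat N s"
    have "\<forall>i. ?s i < Suc N" using s by (auto split: nat.split intro: less_SucI)
    then obtain p where p: "Delta0 p" "\<And>A t. Tran A \<and> Maps t om A \<Longrightarrow> (Sat A p t \<longleftrightarrow> P (\<lambda>i. t $ num (?s i)))" using bfo_bex0.IH by blast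
    have Nk: "N \<noteq> s k" using s less_irrefl by metis
    show "\<exists>p. Delta0 p \<and> (\<forall>A t. Tran A \<and> Maps t om A \<longrightarrow> (Sat A p t \<longleftrightarrow> (\<exists>x. x \<E> t $ num (s k) \<and> P (case_nat x (\<lambda>i. t $ num (s i))))))"
    proof (rule exI[of _ "cX (num N) (cC (cM (num N) (num (s k))) p)"], intro conjI allI impI)
      show "Delta0 (cX (num N) (cC (cM (num N) (num (s k))) p))" using p Nk by (intro Delta0_intros) auto
      fix A t assume "Tran A \<and> Maps t om A"
      then have A: "Tran A" and t: "Maps t om A" by auto
      have f: "fn t om" using t Maps_fn by blast
      have u: "upd t (num N) x $ num (s i) = t $ num (s i)" for i x
        using upd_ap[OF f, of "num N" "num (s i)" x] s less_irrefl by (metis num_inj num_om)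
      have uN: "upd t (num N) x $ num N = x" for x using upd_ap[OF f, of "num N" "num N" x] by simp
      have e: "(\<lambda>i. upd t (num N) x $ num (?s i)) = case_nat x (\<lambda>i. t $ num (s i))" for x
        by (rule ext) (auto split: nat.split simp: u uN)
      have fm: "Formula p" "Formula (cM (num N) (num (s k)))" using Delta0_Formula[OF p(1)] Formula_intros by auto
      have "Sat A (cX (num N) (cC (cM (num N) (num (s k))) p)) t \<longleftrightarrow> (\<exists>x. x \<E> A \<and> Sat A (cC (cM (num N) (num (s k))) p) (upd t (num N) x))"
        using Sat_simps(5)[OF t num_om Formula_intros(4)[OF fm(2,1)]] .
      also have "\<dots> \<longleftrightarrow> (\<exists>x. x \<E> A \<and> x \<E> t $ num (s k) \<and> P (case_nat x (\<lambda>i. t $ num (s i))))"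
      proof (intro ex_cong1 conj_cong refl)
        fix x assume x: "x \<E> A"
        have m: "Maps (upd t (num N) x) om A" using upd_Maps[OF t num_om x] .
        show "Sat A (cC (cM (num N) (num (s k))) p) (upd t (num N) x) \<longleftrightarrow> x \<E> t $ num (s k) \<and> P (case_nat x (\<lambda>i. t $ num (s i)))"
          using Sat_simps(4)[OF m fm(2,1)] Sat_simps(1)[OF m num_om num_om] p(2)[of A "upd t (num N) x"] A m u uN e by simp
      qed
      also have "\<dots> \<longleftrightarrow> (\<exists>x. x \<E> t $ num (s k) \<and> P (case_nat x (\<lambda>i. t $ num (s i))))"
        using TranD[OF A] t unfolding Maps_fn by (metis num_om)
      finally show "Sat A (cX (num N) (cC (cM (num N) (num (s k))) p)) t \<longleftrightarrow> (\<exists>x. x \<E> t $ num (s k) \<and> P (case_nat x (\<lambda>i. t $ num (s i))))" .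
    qed
  qed (use bfo_bex0 in auto)
qed

lemma bfo_codeE:
  assumes "bfo (\<lambda>_ _. False) P P'" "\<forall>i. s i < N"
  obtains p where "Delta0 p" "\<And>A t. Tran A \<and> Maps t om A \<Longrightarrow> (Sat A p t \<longleftrightarrow> P (\<lambda>i. t $ num (s i)))"
  using bfo_code[OF assms(1), THEN conjunct2, THEN spec, THEN spec, THEN mp, OF assms(2)] by blast

lemma assignment_list:
  assumes "c \<E> A" "\<forall>x\<in>set xs. x \<E> A"
  shows "\<exists>s. Maps s om A \<and> (\<forall>i. s $ num i = (if i < length xs then xs ! i else c))"
  using assms(2)
proof (induction xs rule: rev_induct)
  case Nil
  have "Maps (lam om (\<lambda>_. c)) om A" "\<And>i. lam om (\<lambda>_. c) $ num i = c"
    using assms(1) fn_lam[of "\<lambda>_. c"] lam_ap[of "\<lambda>_. c"] DT_const unfolding Maps_fn by auto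
  then show ?case by auto
next
  case (snoc x xs)
  then obtain s where s: "Maps s om A" "\<And>i. s $ num i = (if i < length xs then xs ! i else c)" by auto
  have f: "fn s om" using s Maps_fn by blast
  have "Maps (upd s (num (length xs)) x) om A" using upd_Maps[OF s(1) num_om] snoc.prems by simp
  moreover have "upd s (num (length xs)) x $ num i = (if i < length (xs @ [x]) then (xs @ [x]) ! i else c)" for i
    using upd_ap[OF f num_om num_om, where y=x] s(2) by (auto simp: nth_append)
  ultimately show ?case by blast
qed

lemma compose_ap:
  assumes "Maps s om A" "Maps j A B"
  shows "Maps (compose mem j s) om B" "n \<E> om \<Longrightarrow> compose mem j s $ n = j $ (s $ n)"
proof -
  have s: "fn s om" "\<And>n. n \<E> om \<Longrightarrow> s $ n \<E> A" and j: "fn j A" "\<And>x. x \<E> A \<Longrightarrow> j $ x \<E> B" using assms unfolding Maps_fn by auto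
  have DT: "DT (\<lambda>e. j $ (s $ e 0))" by (intro D_intros)
  have "(\<lambda>p. \<exists>x y. \<langle>x, y\<rangle> \<E> s \<and> p = \<langle>x, app mem j y\<rangle>) = (\<lambda>p. \<exists>x. x \<E> om \<and> p = \<langle>x, j $ (s $ x)\<rangle>)"
    using fn_mem[OF s(1)] s(2) app_ap[OF j(1)] by auto
  then have eq: "compose mem j s = lam om (\<lambda>x. j $ (s $ x))" unfolding compose_def lam_def by simp
  show 1: "compose mem j s $ n = j $ (s $ n)" if "n \<E> om" for n unfolding eq using lam_ap[OF DT that] .
  show "Maps (compose mem j s) om B" unfolding Maps_fn using 1 s(2) j(2) fn_lam[OF DT] eq by simp
qed

lemma om_max: assumes "m \<E> om" "n \<E> om" shows "\<exists>r. r \<E> om \<and> m \<sqsubseteq> r \<and> n \<sqsubseteq> r"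
proof -
  have o: "Ord m" "Ord n" using om_Ord assms by auto
  then have "m \<sqsubseteq> n \<or> n \<sqsubseteq> m" using Ord_linear[OF o] Ord_sub[OF o] Ord_sub[OF o(2,1)] by blast
  then show ?thesis using assms sub_refl by blast
qed

text \<open>The formula may be non-standard, so the bound for the variables it depends on is a
  natural number of the model.\<close>

lemma Formula_support:
  assumes "Formula p"
  shows "\<exists>n. n \<E> om \<and> (\<forall>A s s'. Maps s om A \<and> Maps s' om A \<and> (\<forall>i. i \<E> n \<longrightarrow> s $ i = s' $ i) \<longrightarrow> (Sat A p s \<longleftrightarrow> Sat A p s'))"
proof -
  define Q where "Q n p \<longleftrightarrow> (\<forall>A s s'. Maps s om A \<and> Maps s' om A \<and> (\<forall>i. i \<E> n \<longrightarrow> s $ i = s' $ i) \<longrightarrow> (Sat A p s \<longleftrightarrow> Sat A p s'))" for n p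
  have Qm: "Q n p \<Longrightarrow> n \<sqsubseteq> r \<Longrightarrow> Q r p" for n r p unfolding Q_def by (blast dest: subD)
  define P where "P p \<longleftrightarrow> (\<exists>n. n \<E> om \<and> Q n p)" for p
  have "D (\<lambda>e. P (e 0))" unfolding P_def Q_def by (intro D_intros)
  from this assms have "P p"
  proof (induction p rule: Formula_induct)
    case (Mem i k)
    obtain r where r: "r \<E> om" "suc i \<sqsubseteq> r" "suc k \<sqsubseteq> r" using om_max Mem by (meson om_suc)
    then have "i \<E> r" "k \<E> r" using subD[of "suc i" r i] subD[of "suc k" r k] by auto
    then show ?case unfolding P_def Q_def using r Mem by (auto simp: Sat_simps)
  next
    case (Eq i k)
    obtain r where r: "r \<E> om" "suc i \<sqsubseteq> r" "suc k \<sqsubseteq> r" using om_max Eq by (meson om_suc)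
    then have "i \<E> r" "k \<E> r" using subD[of "suc i" r i] subD[of "suc k" r k] by auto
    then show ?case unfolding P_def Q_def using r Eq by (auto simp: Sat_simps)
  next
    case (Neg q)
    then show ?case unfolding P_def Q_def by (auto simp: Sat_simps)
  next
    case (Conj q r)
    then obtain m n where mn: "m \<E> om" "Q m q" "n \<E> om" "Q n r" unfolding P_def by blast
    obtain t where t: "t \<E> om" "m \<sqsubseteq> t" "n \<sqsubseteq> t" using om_max[OF mn(1,3)] by blast
    then have "Q t q" "Q t r" using Qm mn by blast+
    have "Q t (cC q r)" unfolding Q_def
    proof (intro allI impI, elim conjE)
      fix A s s' assume s: "Maps s om A" "Maps s' om A" "\<forall>i. i \<E> t \<longrightarrow> s $ i = s' $ i"
      then have "Sat A q s \<longleftrightarrow> Sat A q s'" "Sat A r s \<longleftrightarrow> Sat A r s'" using \<open>Q t q\<close> \<open>Q t r\<close> unfolding Q_def by blast+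
      then show "Sat A (cC q r) s \<longleftrightarrow> Sat A (cC q r) s'" using Sat_simps(4)[OF s(1) Conj(1,2)] Sat_simps(4)[OF s(2) Conj(1,2)] by blast
    qed
    with t(1) show ?case unfolding P_def by blast
  next
    case (Ex i q)
    then obtain n where n: "n \<E> om" "Q n q" unfolding P_def by blast
    have "Q n (cX i q)" unfolding Q_def
    proof (intro allI impI, elim conjE)
      fix A s s' assume s: "Maps s om A" "Maps s' om A" "\<forall>i. i \<E> n \<longrightarrow> s $ i = s' $ i"
      have no: "k \<E> om" if "k \<E> n" for k using that n(1) Ord_TranD[OF Ord_om] by blast
      have "Sat A q (upd s i a) \<longleftrightarrow> Sat A q (upd s' i a)" if a: "a \<E> A" for a
      proof -
        have "upd s i a $ k = upd s' i a $ k" if "k \<E> n" for k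
          using upd_ap[of s om i k a] upd_ap[of s' om i k a] s no[OF that] that Ex(1) unfolding Maps_fn by simp
        then show ?thesis using n(2) upd_Maps[OF s(1) Ex(1) a] upd_Maps[OF s(2) Ex(1) a] unfolding Q_def by blast
      qed
      then show "Sat A (cX i q) s \<longleftrightarrow> Sat A (cX i q) s'"
        using Sat_simps(5)[OF s(1) Ex(1,2)] Sat_simps(5)[OF s(2) Ex(1,2)] by blast
    qed
    then show ?case unfolding P_def using n by blast
  qed
  then show ?thesis unfolding P_def Q_def .
qed

lemma Delta0_absolute:
  assumes p: "Delta0 p" and AB: "Tran A" "Tran B" "A \<sqsubseteq> B" and s: "Maps s om A"
  shows "Sat A p s \<longleftrightarrow> Sat B p s"
proof -
  define P where "P p \<longleftrightarrow> (\<forall>s. Maps s om A \<longrightarrow> (Sat A p s \<longleftrightarrow> Sat B p s))" for p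
  have "D (\<lambda>e. P (e 0))" unfolding P_def by (intro D_intros)
  from Delta0_induct[OF this p] have "P p"
  proof -
    have B: "Maps s om A \<Longrightarrow> Maps s om B" for s using Maps_mono AB(3) by blast
    have 1: "P (cM i k)" if "i \<E> om" "k \<E> om" for i k unfolding P_def using that B by (simp add: Sat_simps)
    have 2: "P (cE i k)" if "i \<E> om" "k \<E> om" for i k unfolding P_def using that B by (simp add: Sat_simps)
    have 3: "P (cN q)" if "Formula q" "P q" for q using that B unfolding P_def by (simp add: Sat_simps)
    have 4: "P (cC q r)" if "Formula q" "Formula r" "P q" "P r" for q r using that B unfolding P_def by (simp add: Sat_simps)
    have 5: "P (cX i (cC (cM i k) q))" if ik: "i \<E> om" "k \<E> om" "i \<noteq> k" and q: "Formula q" "P q" for i k q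
      unfolding P_def
    proof (intro allI impI)
      fix s assume s: "Maps s om A"
      let ?c = "cC (cM i k) q"
      have fm: "Formula (cM i k)" "Formula ?c" using Formula_intros ik q by auto
      have sk: "s $ k \<E> A" using s ik unfolding Maps_fn by blast
      have u: "upd s i x $ i = x" "upd s i x $ k = s $ k" for x
        using upd_ap[of s om i] s ik unfolding Maps_fn by auto
      have e: "Sat C ?c (upd s i x) \<longleftrightarrow> x \<E> s $ k \<and> Sat C q (upd s i x)" if "Maps (upd s i x) om C" for C x
        using Sat_simps(4)[OF that fm(1) q(1)] Sat_simps(1)[OF that ik(1,2)] u by simp
      have "Sat A (cX i ?c) s \<longleftrightarrow> (\<exists>x. x \<E> A \<and> (x \<E> s $ k \<and> Sat A q (upd s i x)))"
        unfolding Sat_simps(5)[OF s ik(1) fm(2)] using e upd_Maps[OF s ik(1)] by blast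
      also have "\<dots> \<longleftrightarrow> (\<exists>x. x \<E> A \<and> (x \<E> s $ k \<and> Sat B q (upd s i x)))"
        using q(2) upd_Maps[OF s ik(1)] unfolding P_def by blast
      also have "\<dots> \<longleftrightarrow> (\<exists>x. x \<E> B \<and> (x \<E> s $ k \<and> Sat B q (upd s i x)))"
        using TranD[OF AB(1) sk] AB(3) by (blast dest: subD)
      also have "\<dots> \<longleftrightarrow> Sat B (cX i ?c) s"
        unfolding Sat_simps(5)[OF B[OF s] ik(1) fm(2)] using e upd_Maps[OF B[OF s] ik(1)] by blast
      finally show "Sat A (cX i ?c) s \<longleftrightarrow> Sat B (cX i ?c) s" .
    qed
    show ?thesis using Delta0_induct[OF \<open>D (\<lambda>e. P (e 0))\<close> p 1 2 3 4 5] by blast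
  qed
  then show ?thesis using s unfolding P_def by blast
qed

text \<open>Reduces satisfaction in the rudimentary closure to satisfaction in its levels: witnesses
  appear at some level, and Delta_0 formulas are absolute between the levels and their
  union.\<close>

lemma Sigma1_union:
  assumes p: "Sigma1 p" and a: "\<And>n. n \<E> om \<Longrightarrow> Tran (a $ n)" and mono: "\<And>m n. m \<E> om \<Longrightarrow> n \<E> om \<Longrightarrow> m \<sqsubseteq> n \<Longrightarrow> a $ m \<sqsubseteq> a $ n"
    and N: "\<And>x. x \<E> N \<longleftrightarrow> (\<exists>n. n \<E> om \<and> x \<E> a $ n)" and m: "m \<E> om" and s: "Maps s om (a $ m)"
  shows "Sat N p s \<longleftrightarrow> (\<exists>n. n \<E> om \<and> m \<sqsubseteq> n \<and> Sat (a $ n) p s)"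
proof -
  define P where "P p \<longleftrightarrow> (\<forall>m s. m \<E> om \<and> Maps s om (a $ m) \<longrightarrow> (Sat N p s \<longleftrightarrow> (\<exists>n. n \<E> om \<and> m \<sqsubseteq> n \<and> Sat (a $ n) p s)))" for p
  have DP: "D (\<lambda>e. P (e 0))" unfolding P_def by (intro D_intros)
  have sub: "a $ n \<sqsubseteq> N" if "n \<E> om" for n using N that by (intro subI) blast
  have TN: "Tran N" by (rule TranI) (use N a TranD in blast)
  have 1: "P q" if q: "Delta0 q" for q unfolding P_def
  proof (intro allI impI, elim conjE)
    fix m s assume m: "m \<E> om" and s: "Maps s om (a $ m)"
    have "Sat N q s \<longleftrightarrow> Sat (a $ n) q s" if "n \<E> om" "m \<sqsubseteq> n" for n
      using Delta0_absolute[OF q a[OF that(1)] TN sub[OF that(1)]] Maps_mono[OF s mono[OF m that]] by blast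
    then show "Sat N q s \<longleftrightarrow> (\<exists>n. n \<E> om \<and> m \<sqsubseteq> n \<and> Sat (a $ n) q s)" using m sub_refl by blast
  qed
  have 2: "P (cX i q)" if i: "i \<E> om" and q: "Formula q" "P q" for i q unfolding P_def
  proof (intro allI impI, elim conjE)
    fix m s assume m: "m \<E> om" and s: "Maps s om (a $ m)"
    have sN: "Maps s om N" using Maps_mono[OF s sub[OF m]] .
    show "Sat N (cX i q) s \<longleftrightarrow> (\<exists>n. n \<E> om \<and> m \<sqsubseteq> n \<and> Sat (a $ n) (cX i q) s)"
    proof
      assume "Sat N (cX i q) s"
      then obtain x where x: "x \<E> N" "Sat N q (upd s i x)" using Sat_simps(5)[OF sN i q(1)] by blast
      then obtain m' where m': "m' \<E> om" "x \<E> a $ m'" using N by blast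
      obtain r where r: "r \<E> om" "m \<sqsubseteq> r" "m' \<sqsubseteq> r" using om_max m m' by blast
      have xr: "x \<E> a $ r" using mono[OF m'(1) r(1,3)] m'(2) by (rule subD)
      have "Maps (upd s i x) om (a $ r)" using upd_Maps[OF Maps_mono[OF s mono[OF m r(1,2)]] i xr] .
      then obtain n where n: "n \<E> om" "r \<sqsubseteq> n" "Sat (a $ n) q (upd s i x)" using q(2) x(2) r(1) unfolding P_def by blast
      have mn: "m \<sqsubseteq> n" using sub_trans[OF r(2) n(2)] .
      have "x \<E> a $ n" using mono[OF r(1) n(1,2)] xr by (rule subD)
      then have "Sat (a $ n) (cX i q) s" using Sat_simps(5)[OF Maps_mono[OF s mono[OF m n(1) mn]] i q(1)] n(3) by blast
      then show "\<exists>n. n \<E> om \<and> m \<sqsubseteq> n \<and> Sat (a $ n) (cX i q) s" using n(1) mn by blast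
    next
      assume "\<exists>n. n \<E> om \<and> m \<sqsubseteq> n \<and> Sat (a $ n) (cX i q) s"
      then obtain n where n: "n \<E> om" "m \<sqsubseteq> n" "Sat (a $ n) (cX i q) s" by blast
      have sn: "Maps s om (a $ n)" using Maps_mono[OF s mono[OF m n(1,2)]] .
      then obtain x where x: "x \<E> a $ n" "Sat (a $ n) q (upd s i x)" using Sat_simps(5)[OF _ i q(1)] n(3) by blast
      have "Sat N q (upd s i x)" using q(2) upd_Maps[OF sn i x(1)] x(2) n(1) sub_refl[of n] unfolding P_def by blast
      then show "Sat N (cX i q) s" using Sat_simps(5)[OF sN i q(1)] x(1) n(1) N by blast
    qed
  qed
  show ?thesis using Sigma1_induct[OF DP p 1 2] m s unfolding P_def by blast
qed

end

section \<open>Sigma_1-elementary maps are embeddings\<close>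

context limit_rank
begin

text \<open>Transfer of Delta_0 formulas yields everything except that \<open>j $ Pow x\<close>
  contains all subsets of \<open>j $ x\<close>. That no subset of \<open>x\<close> is missing from
  \<open>Pow x\<close> is the negation of a Sigma_1 statement, hence preserved as well.\<close>

lemma Sigma1_Emb:
  assumes el: "Sigma1_elementary mem V V j"
  shows "Emb j"
proof -
  have jm: "Maps j V V" using el unfolding Sigma1_elementary_def by blast
  then have jV: "\<And>x. x \<E> V \<Longrightarrow> j $ x \<E> V" unfolding Maps_fn by blast
  have sat: "Sat V p s \<longleftrightarrow> Sat V p (compose mem j s)" if "Sigma1 p" "Maps s om V" for p s
    using el that unfolding Sigma1_elementary_def by blast
  have tr: "P (\<lambda>i. if i < length xs then xs ! i else emp) \<longleftrightarrow> P (\<lambda>i. j $ (if i < length xs then xs ! i else emp))"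
    if P: "bfo (\<lambda>_ _. False) P P" and xs: "\<forall>x\<in>set xs. x \<E> V" for P xs
  proof -
    let ?n = "length xs" and ?s = "\<lambda>i. min i (length xs)"
    obtain s where s: "Maps s om V" "\<And>i. s $ num i = (if i < ?n then xs ! i else emp)"
      using assignment_list[OF V_emp xs] by blast
    have "\<forall>i. ?s i < Suc ?n" by auto
    then obtain p where p: "Delta0 p" "\<And>A t. Tran A \<and> Maps t om A \<Longrightarrow> (Sat A p t \<longleftrightarrow> P (\<lambda>i. t $ num (?s i)))"
      by (rule bfo_codeE[OF P]) blast
    have c: "Maps (compose mem j s) om V" "\<And>n. n \<E> om \<Longrightarrow> compose mem j s $ n = j $ (s $ n)" using compose_ap[OF s(1) jm] by auto
    have "Sat V p s \<longleftrightarrow> P (\<lambda>i. s $ num (?s i))" using p(2) Tran_V s(1) by blast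
    moreover have "Sat V p (compose mem j s) \<longleftrightarrow> P (\<lambda>i. compose mem j s $ num (?s i))" using p(2) Tran_V c(1) by blast
    moreover have "(\<lambda>i. s $ num (?s i)) = (\<lambda>i. if i < ?n then xs ! i else emp)" using s(2) by (auto simp: min_def)
    moreover have "(\<lambda>i. compose mem j s $ num (?s i)) = (\<lambda>i. j $ (if i < ?n then xs ! i else emp))"
      using s(2) c(2)[OF num_om] by (auto simp: min_def)
    ultimately show ?thesis using sat[OF Sigma1_intros(1)[OF p(1)] s(1)] by simp
  qed
  have tr2: "Q x y \<longleftrightarrow> Q (j $ x) (j $ y)" if "bfo (\<lambda>_ _. False) (\<lambda>e. Q (e 0) (e 1)) (\<lambda>e. Q (e 0) (e 1))" "x \<E> V" "y \<E> V" for Q x y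
    using tr[OF that(1), of "[x, y]"] that(2,3) by simp
  have tr3: "Q x y z \<longleftrightarrow> Q (j $ x) (j $ y) (j $ z)" if "bfo (\<lambda>_ _. False) (\<lambda>e. Q (e 0) (e 1) (e 2)) (\<lambda>e. Q (e 0) (e 1) (e 2))" "x \<E> V" "y \<E> V" "z \<E> V" for Q x y z
    using tr[OF that(1), of "[x, y, z]"] that(2-) by simp
  have op: "j $ f x y = f (j $ x) (j $ y)" if "f \<in> ops" "x \<E> V" "y \<E> V" for f x y
    using tr3[of "\<lambda>x y z. z = f x y" x y "f x y"] bfo_op[OF that(1), of _ 2 0 1] that V_op by blast
  have Pow: "j $ Pow x = Pow (j $ x)" if x: "x \<E> V" for x
  proof (rule sub_antisym)
    have px: "Pow x \<E> V" using V_Pow[OF x] .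
    define Q where "Q x y \<longleftrightarrow> (\<forall>z. z \<E> y \<longrightarrow> (\<forall>u. u \<E> z \<longrightarrow> u \<E> x))" for x y
    have "bfo (\<lambda>_ _. False) (\<lambda>e. Q (e 0) (e 1)) (\<lambda>e. Q (e 0) (e 1))" unfolding Q_def by (intro bfo_intros)
    then have "Q x (Pow x) \<longleftrightarrow> Q (j $ x) (j $ Pow x)" using tr2 x px by blast
    moreover have "Q x (Pow x)" unfolding Q_def by (auto dest: subD)
    ultimately show "j $ Pow x \<sqsubseteq> Pow (j $ x)" unfolding Q_def by (auto intro!: subI)
    \<comment> \<open>The places 0, 1, 2 stand for a subset \<open>z\<close>, for \<open>x\<close>
      and for \<open>Pow x\<close>. The renaming \<open>?s\<close> below gives \<open>z\<close> the
      variable \<open>num 2\<close>, which is the one quantified in \<open>?q\<close>.\<close>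
    define R where "R e \<longleftrightarrow> (\<forall>u. u \<E> e 0 \<longrightarrow> u \<E> e 1) \<and> \<not> e 0 \<E> e 2" for e :: "nat \<Rightarrow> 'a"
    have R: "bfo (\<lambda>_ _. False) R R" unfolding R_def by (intro bfo_intros)
    let ?s = "case_nat 2 (case_nat 0 (\<lambda>_. 1))"
    have "\<forall>i. ?s i < (3::nat)" by (auto split: nat.split)
    then obtain p where p: "Delta0 p" "\<And>A t. Tran A \<and> Maps t om A \<Longrightarrow> (Sat A p t \<longleftrightarrow> R (\<lambda>i. t $ num (?s i)))"
      by (rule bfo_codeE[OF R]) blast
    let ?q = "cX (num 2) p"
    have q: "Sigma1 ?q" using Sigma1_intros p by simp
    have qs: "Sat V ?q t \<longleftrightarrow> (\<exists>z. z \<E> V \<and> z \<sqsubseteq> t $ num 0 \<and> \<not> z \<E> t $ num 1)" if t: "Maps t om V" for t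
    proof -
      have f: "fn t om" using t Maps_fn by blast
      have "Sat V p (upd t (num 2) z) \<longleftrightarrow> z \<sqsubseteq> t $ num 0 \<and> \<not> z \<E> t $ num 1" if z: "z \<E> V" for z
      proof -
        have "Sat V p (upd t (num 2) z) \<longleftrightarrow> R (\<lambda>i. upd t (num 2) z $ num (?s i))" using p(2) Tran_V upd_Maps[OF t num_om z] by blast
        moreover have "upd t (num 2) z $ num 2 = z" "upd t (num 2) z $ num 0 = t $ num 0" "upd t (num 2) z $ num 1 = t $ num 1"
          using upd_ap[OF f num_om num_om, where y=z] num_inj by (simp_all del: numeral_set.simps)
        ultimately show ?thesis unfolding R_def subset_def by (simp add: numeral_2_eq_2 del: numeral_set.simps)
      qed
      then show ?thesis using Sat_simps(5)[OF t num_om Delta0_Formula[OF p(1)]] by blast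
    qed
    obtain s where s: "Maps s om V" "\<And>i. s $ num i = (if i < length [x, Pow x] then [x, Pow x] ! i else emp)"
      using assignment_list[OF V_emp, of "[x, Pow x]"] x px by auto
    have s01: "s $ num 0 = x" "s $ num 1 = Pow x" using s(2)[of 0] s(2)[of 1] by auto
    have c: "Maps (compose mem j s) om V" "compose mem j s $ num 0 = j $ x" "compose mem j s $ num 1 = j $ Pow x"
      using compose_ap[OF s(1) jm] s01 num_om by metis+
    have "\<not> Sat V ?q s" unfolding qs[OF s(1)] s01 by simp
    then have "\<not> Sat V ?q (compose mem j s)" using sat[OF q s(1)] by blast
    then have no: "\<not> (\<exists>z. z \<E> V \<and> z \<sqsubseteq> j $ x \<and> \<not> z \<E> j $ Pow x)" unfolding qs[OF c(1)] c(2,3) .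
    show "Pow (j $ x) \<sqsubseteq> j $ Pow x"
    proof (rule subI)
      fix z assume "z \<E> Pow (j $ x)"
      then have "z \<sqsubseteq> j $ x" by simp
      then show "z \<E> j $ Pow x" using no V_sub[OF jV[OF x]] by blast
    qed
  qed
  have "x \<E> y \<longleftrightarrow> j $ x \<E> j $ y" if "x \<E> V" "y \<E> V" for x y
    by (rule tr2[OF _ that]) (rule bfo_mem)
  then show ?thesis unfolding Emb_def using jm op Pow by blast
qed

end

named_theorems Rd_intros

context ZF
begin

subsection \<open>Rudimentary functions\<close>

text \<open>Rudimentary functions of assignments instead of lists: the arity is hidden, so that
  terms can be composed as for \<open>DT\<close>.\<close>

definition Rd :: "((nat \<Rightarrow> 'a) \<Rightarrow> 'a) \<Rightarrow> bool" where
  "Rd F \<longleftrightarrow> (\<exists>n F'. rudimentary mem n F' \<and> (\<forall>e. F e = F' (map e [0..<n])))"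

lemma Rd_at:
  assumes "Rd F"
  obtains n where "\<And>m. n \<le> m \<Longrightarrow> \<exists>F'. rudimentary mem m F' \<and> (\<forall>e. F e = F' (map e [0..<m]))"
proof -
  obtain n F' where F: "rudimentary mem n F'" "\<And>e. F e = F' (map e [0..<n])" using assms unfolding Rd_def by blast
  show thesis
  proof (rule that[of n])
    fix m assume m: "n \<le> m"
    let ?Hs = "map (\<lambda>i xs. xs ! i) [0..<n] :: ('a list \<Rightarrow> 'a) list"
    have 1: "rudimentary mem m (\<lambda>xs. F' (map (\<lambda>H. H xs) ?Hs))"
      by (rule rudimentary.comp) (use F m in \<open>auto intro: rudimentary.proj\<close>)
    have 2: "map (\<lambda>H. H (map e [0..<m])) ?Hs = map e [0..<n]" for e
      using m by (auto intro!: map_cong)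
    show "\<exists>F'. rudimentary mem m F' \<and> (\<forall>e. F e = F' (map e [0..<m]))"
      by (rule exI, rule conjI[OF 1]) (simp only: 2 F(2), blast)
  qed
qed

lemma Rd_var [Rd_intros]: "Rd (\<lambda>e. e i)"
proof -
  have "rudimentary mem (Suc i) (\<lambda>xs. xs ! i)" by (rule rudimentary.proj) simp
  moreover have "e i = map e [0..<Suc i] ! i" for e :: "nat \<Rightarrow> 'a" by (simp del: upt_Suc)
  ultimately show ?thesis unfolding Rd_def by blast
qed

lemma Rd_binary:
  assumes "rudimentary mem 2 (\<lambda>xs. f (xs ! 0) (xs ! 1))" "Rd F" "Rd G"
  shows "Rd (\<lambda>e. f (F e) (G e))"
proof -
  obtain n m where n: "\<And>k. n \<le> k \<Longrightarrow> \<exists>F'. rudimentary mem k F' \<and> (\<forall>e. F e = F' (map e [0..<k]))"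
    and m: "\<And>k. m \<le> k \<Longrightarrow> \<exists>F'. rudimentary mem k F' \<and> (\<forall>e. G e = F' (map e [0..<k]))"
    using Rd_at[OF assms(2)] Rd_at[OF assms(3)] by metis
  let ?k = "max n m"
  obtain F' G' where F: "rudimentary mem ?k F'" "\<And>e. F e = F' (map e [0..<?k])" and G: "rudimentary mem ?k G'" "\<And>e. G e = G' (map e [0..<?k])"
    using n[of ?k] m[of ?k] by auto
  have "rudimentary mem ?k (\<lambda>xs. (\<lambda>xs. f (xs ! 0) (xs ! 1)) (map (\<lambda>H. H xs) [F', G']))"
    by (rule rudimentary.comp) (use assms(1) F G in \<open>auto simp: numeral_2_eq_2\<close>)
  then show ?thesis unfolding Rd_def using F(2) G(2)
    by (intro exI[of _ ?k] exI[of _ "\<lambda>xs. f (F' xs) (G' xs)"]) simp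
qed

lemma Rd_up [Rd_intros]: "Rd F \<Longrightarrow> Rd G \<Longrightarrow> Rd (\<lambda>e. up (F e) (G e))"
  by (rule Rd_binary[where f=up]) (rule rudimentary.upair, auto)

lemma Rd_dif [Rd_intros]: "Rd F \<Longrightarrow> Rd G \<Longrightarrow> Rd (\<lambda>e. dif (F e) (G e))"
  by (rule Rd_binary[where f=dif]) (rule rudimentary.diff, auto)

lemma Rd_bigU [Rd_intros]:
  assumes f: "Rd f" and g: "Rd (\<lambda>e. g (\<lambda>n. e (Suc n)) (e 0))"
  shows "Rd (\<lambda>e. bigU (f e) (g e))"
proof -
  obtain n m where n: "\<And>k. n \<le> k \<Longrightarrow> \<exists>F'. rudimentary mem k F' \<and> (\<forall>e. f e = F' (map e [0..<k]))"
    and m: "\<And>k. m \<le> k \<Longrightarrow> \<exists>F'. rudimentary mem k F' \<and> (\<forall>e. g (\<lambda>n. e (Suc n)) (e 0) = F' (map e [0..<k]))"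
    using Rd_at[OF f] Rd_at[OF g] by metis
  let ?k = "max n m"
  obtain F' where F: "rudimentary mem ?k F'" "\<And>e. f e = F' (map e [0..<?k])" using n[of ?k] by auto
  obtain G' where G: "rudimentary mem (Suc ?k) G'" "\<And>e. g (\<lambda>n. e (Suc n)) (e 0) = G' (map e [0..<Suc ?k])"
    using m[of "Suc ?k"] by (metis le_SucI max.cobounded2)
  let ?U = "\<lambda>xs. coll mem (\<lambda>w. \<exists>z. z \<E> hd xs \<and> w \<E> G' (z # tl xs))"
  let ?Hs = "F' # map (\<lambda>i xs. xs ! i) [0..<?k]"
  have "rudimentary mem ?k (\<lambda>xs. ?U (map (\<lambda>H. H xs) ?Hs))"
  proof (rule rudimentary.comp)
    show "rudimentary mem (length ?Hs) ?U" using rudimentary.union[OF G(1)] by simp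
    show "rudimentary mem ?k H" if "H \<in> set ?Hs" for H using that F(1) by (auto intro: rudimentary.proj)
  qed
  moreover have "bigU (f e) (g e) = ?U (map (\<lambda>H. H (map e [0..<?k])) ?Hs)" for e
  proof -
    have 1: "map (\<lambda>H. H (map e [0..<?k])) ?Hs = f e # map e [0..<?k]" using F(2) by (auto intro!: map_cong)
    have 2: "G' (z # map e [0..<?k]) = g e z" for z
    proof -
      have "map (case_nat z e) [0..<Suc ?k] = z # map e [0..<?k]" by (simp add: map_upt_Suc del: upt_Suc)
      then show ?thesis using G(2)[of "case_nat z e"] by simp
    qed
    show ?thesis unfolding bigU_def by (simp only: 1 2 list.sel)
  qed
  ultimately show ?thesis unfolding Rd_def by blast
qed

lemma Rd_ops [Rd_intros]:
  "Rd x \<Longrightarrow> Rd y \<Longrightarrow> Rd (\<lambda>e. \<langle>x e, y e\<rangle>)"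
  unfolding kpair_def by (intro Rd_intros)

lemma Rd_weaken: "Rd F \<Longrightarrow> Rd (\<lambda>e. F (\<lambda>n. e (s n)))"
proof -
  assume "Rd F"
  then obtain n F' where F: "rudimentary mem n F'" "\<And>e. F e = F' (map e [0..<n])" unfolding Rd_def by blast
  let ?m = "Suc (Max (insert 0 (s ` {0..<n})))"
  let ?Hs = "map (\<lambda>i xs. xs ! s i) [0..<n] :: ('a list \<Rightarrow> 'a) list"
  have sm: "s i < ?m" if "i < n" for i using that by (simp add: less_Suc_eq_le)
  have 1: "rudimentary mem ?m (\<lambda>xs. F' (map (\<lambda>H. H xs) ?Hs))"
    by (rule rudimentary.comp) (use F sm in \<open>auto intro: rudimentary.proj\<close>)
  have 2: "map (\<lambda>H. H (map e [0..<?m])) ?Hs = map (\<lambda>i. e (s i)) [0..<n]" for e :: "nat \<Rightarrow> 'a"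
    using sm by (auto intro!: map_cong simp del: upt_Suc)
  show ?thesis unfolding Rd_def
    by (rule exI, rule exI, rule conjI[OF 1]) (simp only: 2 F(2), blast)
qed

lemma Rd_subst1: assumes "Rd x" "Rd (\<lambda>e. f (e 0))" shows "Rd (\<lambda>e. f (x e))"
proof -
  \<comment> \<open>The union over a singleton acts as a substitution.\<close>
  have "Rd (\<lambda>e. bigU (sing (x e)) (\<lambda>z. f z))"
    by (intro Rd_intros assms)
  moreover have "bigU (sing y) f = f y" for y
    unfolding bigU_def by (rule coll_eq) auto
  ultimately show ?thesis by simp
qed

lemma Rd_subst2: assumes "Rd x" "Rd y" "Rd (\<lambda>e. f (e 1) (e 0))" shows "Rd (\<lambda>e. f (x e) (y e))"
proof -
  have "Rd (\<lambda>e. bigU (sing (x e)) (\<lambda>z. bigU (sing (y e)) (\<lambda>w. f z w)))"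
    using assms(3) by (intro Rd_intros assms(1) Rd_weaken[OF assms(2)]) simp
  moreover have "bigU (sing y) f = f y" for y f
    unfolding bigU_def by (rule coll_eq) auto
  ultimately show ?thesis by simp
qed

lemma Rd_subst3: assumes "Rd x" "Rd y" "Rd z" "Rd (\<lambda>e. f (e 2) (e 1) (e 0))" shows "Rd (\<lambda>e. f (x e) (y e) (z e))"
proof -
  have "Rd (\<lambda>e. bigU (sing (x e)) (\<lambda>u. bigU (sing (y e)) (\<lambda>v. bigU (sing (z e)) (\<lambda>w. f u v w))))"
    using assms(4) by (intro Rd_intros assms(1) Rd_weaken[OF assms(2)] Rd_weaken[OF Rd_weaken[OF assms(3)], of Suc Suc, simplified]) (simp add: numeral_2_eq_2)
  moreover have "bigU (sing y) f = f y" for y f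
    unfolding bigU_def by (rule coll_eq) auto
  ultimately show ?thesis by simp
qed

lemma Rd_ifin [Rd_intros]: "Rd x \<Longrightarrow> Rd y \<Longrightarrow> Rd z \<Longrightarrow> Rd (\<lambda>e. ifin (x e) (y e) (z e))"
  by (erule (2) Rd_subst3) (unfold ifin_def, intro Rd_intros)

lemma Rd_ops2 [Rd_intros]:
  "Rd x \<Longrightarrow> Rd y \<Longrightarrow> Rd (\<lambda>e. prod (x e) (y e))"
  "Rd x \<Longrightarrow> Rd (\<lambda>e. ran (x e))"
  "Rd x \<Longrightarrow> Rd y \<Longrightarrow> Rd (\<lambda>e. memx (x e) (y e))"
  "Rd x \<Longrightarrow> Rd y \<Longrightarrow> Rd (\<lambda>e. ins (x e) (y e))"
  "Rd x \<Longrightarrow> Rd y \<Longrightarrow> Rd (\<lambda>e. img (x e) (y e))"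
  subgoal by (erule (1) Rd_subst2) (unfold prod_def, intro Rd_intros)
  subgoal by (erule Rd_subst1) (unfold ran_def, intro Rd_intros)
  subgoal by (erule (1) Rd_subst2) (unfold memx_def, intro Rd_intros)
  subgoal by (erule (1) Rd_subst2) (unfold ins_def, intro Rd_intros)
  subgoal by (erule (1) Rd_subst2) (unfold img_def, intro Rd_intros)
  done

lemma Rd_imgs [Rd_intros]: "Rd x \<Longrightarrow> Rd y \<Longrightarrow> Rd (\<lambda>e. imgs (x e) (y e))"
  by (erule (1) Rd_subst2) (unfold imgs_def, intro Rd_intros)

primrec fset :: "'a list \<Rightarrow> 'a" where
  "fset [] = emp"
| "fset (t # ts) = cup (sing t) (fset ts)"

lemma mem_fset: "w \<E> fset ts \<longleftrightarrow> w \<in> set ts"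
  by (induction ts) auto

text \<open>Besides the operations needed for definability, the list contains the elements of their
  values: unordered pairs for the ordered pairs and triples, and \<open>img\<close> for
  \<open>imgs\<close>. This keeps the levels transitive (\<open>Sop_Tran\<close>).\<close>

definition basis :: "'a \<Rightarrow> 'a \<Rightarrow> 'a \<Rightarrow> 'a list" where
  "basis x y z = [x, up x y, \<langle>x, y\<rangle>, up x \<langle>y, z\<rangle>, \<langle>x, \<langle>y, z\<rangle>\<rangle>, dif x y, prod x y, ran x, memx x y, ins x y, img x y, imgs x y]"

definition bset :: "'a \<Rightarrow> 'a \<Rightarrow> 'a \<Rightarrow> 'a" where
  "bset x y z = fset (basis x y z)"

text \<open>The step from one level to the next. Adding \<open>a\<close> itself makes every level an
  element of the next one.\<close>

definition Sop :: "'a \<Rightarrow> 'a" where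
  "Sop a = cup (sing a) (bigU a (\<lambda>x. bigU a (\<lambda>y. bigU a (\<lambda>z. bset x y z))))"

lemma DT_bset [D_intros]: "DT x \<Longrightarrow> DT y \<Longrightarrow> DT z \<Longrightarrow> DT (\<lambda>e. bset (x e) (y e) (z e))"
  unfolding bset_def basis_def fset.simps by (intro D_intros)

lemma DT_Sop [D_intros]: "DT x \<Longrightarrow> DT (\<lambda>e. Sop (x e))"
  by (erule DT_subst1) (unfold Sop_def, intro D_intros)

lemma Rd_emp [Rd_intros]: "Rd (\<lambda>e. emp)"
proof -
  have "Rd (\<lambda>e. dif (e 0) (e 0))" by (intro Rd_intros)
  moreover have "dif x x = emp" for x by (simp add: eq_emp)
  ultimately show ?thesis by simp
qed

lemma Rd_bset [Rd_intros]: "Rd x \<Longrightarrow> Rd y \<Longrightarrow> Rd z \<Longrightarrow> Rd (\<lambda>e. bset (x e) (y e) (z e))"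
  unfolding bset_def basis_def fset.simps by (intro Rd_intros)

lemma Rd_Sop: "Rd (\<lambda>e. Sop (e 0))"
  unfolding Sop_def by (intro Rd_intros)

lemma mem_Sop: "w \<E> Sop a \<longleftrightarrow> w = a \<or> (\<exists>x y z. x \<E> a \<and> y \<E> a \<and> z \<E> a \<and> w \<in> set (basis x y z))"
proof -
  have "w \<E> bigU a (\<lambda>z. bset x y z) \<longleftrightarrow> (\<exists>z. z \<E> a \<and> w \<E> bset x y z)" for x y by (rule mem_bigU) (intro D_intros)
  moreover have "w \<E> bigU a (\<lambda>y. bigU a (\<lambda>z. bset x y z)) \<longleftrightarrow> (\<exists>y. y \<E> a \<and> w \<E> bigU a (\<lambda>z. bset x y z))" for x by (rule mem_bigU) (intro D_intros)
  moreover have "w \<E> bigU a (\<lambda>x. bigU a (\<lambda>y. bigU a (\<lambda>z. bset x y z))) \<longleftrightarrow> (\<exists>x. x \<E> a \<and> w \<E> bigU a (\<lambda>y. bigU a (\<lambda>z. bset x y z)))" by (rule mem_bigU) (intro D_intros)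
  ultimately have "w \<E> bigU a (\<lambda>x. bigU a (\<lambda>y. bigU a (\<lambda>z. bset x y z))) \<longleftrightarrow> (\<exists>x y z. x \<E> a \<and> y \<E> a \<and> z \<E> a \<and> w \<in> set (basis x y z))"
    unfolding bset_def mem_fset by blast
  then show ?thesis unfolding Sop_def by auto
qed

lemma Tran_pair: "Tran a \<Longrightarrow> \<langle>x, y\<rangle> \<E> a \<Longrightarrow> x \<E> a \<and> y \<E> a"
  by (metis TranD kpair_def mem_up)

lemma Sop_Tran: assumes a: "Tran a" shows "Tran (Sop a)"
proof (rule TranI)
  fix w v assume w: "w \<E> Sop a" and v: "v \<E> w"
  have base: "u \<E> Sop a" if "u \<E> a" for u unfolding mem_Sop using that unfolding basis_def by auto
  have I: "u \<E> Sop a" if "x \<E> a" "y \<E> a" "z \<E> a" "u \<in> set (basis x y z)" for u x y z unfolding mem_Sop using that by blast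
  have k2: "up x y \<E> Sop a" "\<langle>x, y\<rangle> \<E> Sop a" if "x \<E> a" "y \<E> a" for x y
    using that I[OF that that(1)] unfolding basis_def by auto
  have k3: "up x \<langle>y, z\<rangle> \<E> Sop a" "\<langle>x, \<langle>y, z\<rangle>\<rangle> \<E> Sop a" if "x \<E> a" "y \<E> a" "z \<E> a" for x y z
    using I[OF that] unfolding basis_def by auto
  have im: "img x z \<E> Sop a" if "x \<E> a" "z \<E> a" for x z using I[OF that that(1)] unfolding basis_def by auto
  have pm: "u \<E> a \<and> t \<E> a" if "\<langle>u, t\<rangle> \<E> x" "x \<E> a" for u t x using Tran_pair[OF a] TranD[OF a that(2,1)] by blast
  have tr: "u \<E> a" if "u \<E> x" "x \<E> a" for u x using TranD[OF a] that by blast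
  consider "w = a" | x y z where "x \<E> a" "y \<E> a" "z \<E> a" "w \<in> set (basis x y z)" using w unfolding mem_Sop by blast
  then show "v \<E> Sop a"
  proof cases
    case 1
    then show ?thesis using v base by blast
  next
    case (2 x y z)
    have d: "v \<E> Sop a" if "w = dif x y" using that v 2 tr base by auto
    have p: "v \<E> Sop a" if "w = prod x y" using that v 2 tr k2 by auto
    have r: "v \<E> Sop a" if "w = ran x" using that v 2 pm base by auto
    have m: "v \<E> Sop a" if "w = memx x y" using that v 2 tr k3 by auto
    have i: "v \<E> Sop a" if "w = ins x y" using that v 2 pm tr k3 by auto
    have g: "v \<E> Sop a" if "w = img x y" using that v 2 pm base by auto
    have s: "v \<E> Sop a" if "w = imgs x y" using that v 2 tr im by auto
    have "v \<E> Sop a" if "w = x \<or> w = up x y \<or> w = \<langle>x, y\<rangle> \<or> w = up x \<langle>y, z\<rangle> \<or> w = \<langle>x, \<langle>y, z\<rangle>\<rangle>"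
      using that v 2 tr base k2 k3 by (auto simp: kpair_def)
    then show ?thesis using 2(4) d p r m i g s unfolding basis_def by (simp del: mem_dif) blast
  qed
qed

lemma Sop_sub: "a \<sqsubseteq> Sop a"
  by (rule subI) (unfold mem_Sop basis_def, auto)

end

context limit_rank
begin

subsection \<open>The rudimentary closure\<close>

definition aseq :: 'a where
  "aseq = (SOME f. fn f om \<and> f $ emp = V \<and> (\<forall>n. n \<E> om \<longrightarrow> f $ suc n = Sop (f $ n)))"

lemma aseq: "fn aseq om" "aseq $ emp = V" "n \<E> om \<Longrightarrow> aseq $ suc n = Sop (aseq $ n)"
proof -
  obtain f where "fn f om" "f $ emp = V" "\<And>n. n \<E> om \<Longrightarrow> f $ suc n = Sop (f $ n)"
    by (rule nat_rec[of Sop V], intro D_intros) blast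
  then have "\<exists>f. fn f om \<and> f $ emp = V \<and> (\<forall>n. n \<E> om \<longrightarrow> f $ suc n = Sop (f $ n))" by blast
  from someI_ex[OF this] show "fn aseq om" "aseq $ emp = V" "n \<E> om \<Longrightarrow> aseq $ suc n = Sop (aseq $ n)"
    unfolding aseq_def by blast+
qed

abbreviation lev :: "'a \<Rightarrow> 'a" where "lev n \<equiv> aseq $ n"

definition NN :: 'a where "NN = Uni (ran aseq)"

lemma mem_NN: "x \<E> NN \<longleftrightarrow> (\<exists>n. n \<E> om \<and> x \<E> lev n)"
  unfolding NN_def by (auto simp: fn_mem[OF aseq(1)])

lemma lev_Tran: "n \<E> om \<Longrightarrow> Tran (lev n)"
  by (rule om_induct[where P="\<lambda>n. Tran (lev n)"]) (intro D_intros, auto simp: aseq Tran_V Sop_Tran)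

lemma lev_mono: assumes "m \<E> om" "n \<E> om" "m \<sqsubseteq> n" shows "lev m \<sqsubseteq> lev n"
proof -
  have "m \<sqsubseteq> n \<longrightarrow> lev m \<sqsubseteq> lev n"
  proof (rule om_induct[where P="\<lambda>n. m \<sqsubseteq> n \<longrightarrow> lev m \<sqsubseteq> lev n", OF _ _ _ assms(2)])
    show "D (\<lambda>e. m \<sqsubseteq> e 0 \<longrightarrow> lev m \<sqsubseteq> lev (e 0))" by (intro D_intros)
    show "m \<sqsubseteq> emp \<longrightarrow> lev m \<sqsubseteq> lev emp"
    proof
      assume "m \<sqsubseteq> emp"
      then have "m = emp" unfolding eq_emp by (auto dest: subD)
      then show "lev m \<sqsubseteq> lev emp" by simp
    qed
    fix n assume n: "n \<E> om" and IH: "m \<sqsubseteq> n \<longrightarrow> lev m \<sqsubseteq> lev n"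
    have o: "Ord m" "Ord n" using om_Ord assms n by auto
    show "m \<sqsubseteq> suc n \<longrightarrow> lev m \<sqsubseteq> lev (suc n)"
    proof
      assume "m \<sqsubseteq> suc n"
      then have "m \<E> suc n \<or> m = suc n" using Ord_sub[OF o(1) Ord_suc[OF o(2)]] by blast
      then have "m \<sqsubseteq> n \<or> m = suc n" using Ord_sub[OF o] by auto
      then show "lev m \<sqsubseteq> lev (suc n)" using IH Sop_sub[of "lev n"] aseq(3)[OF n] sub_trans by auto
    qed
  qed
  then show ?thesis using assms by blast
qed

lemma lev_mem: "n \<E> om \<Longrightarrow> lev n \<E> lev (suc n)"
  by (simp add: aseq mem_Sop)

lemma V_lev: "n \<E> om \<Longrightarrow> V \<sqsubseteq> lev n"
  using lev_mono[of emp n] aseq(2) by (simp add: subset_def)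

lemma lev_basis: "n \<E> om \<Longrightarrow> x \<E> lev n \<Longrightarrow> y \<E> lev n \<Longrightarrow> z \<E> lev n \<Longrightarrow> w \<in> set (basis x y z) \<Longrightarrow> w \<E> lev (suc n)"
  unfolding aseq(3) mem_Sop by blast

lemma lev_list: "\<forall>x\<in>set xs. x \<E> NN \<Longrightarrow> \<exists>n. n \<E> om \<and> (\<forall>x\<in>set xs. x \<E> lev n)"
proof (induction xs)
  case Nil
  show ?case by (rule exI[of _ emp]) simp
next
  case (Cons x xs)
  then obtain n m where nm: "n \<E> om" "\<forall>x\<in>set xs. x \<E> lev n" "m \<E> om" "x \<E> lev m" using mem_NN by auto
  obtain r where r: "r \<E> om" "n \<sqsubseteq> r" "m \<sqsubseteq> r" using om_max[OF nm(1,3)] by blast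
  have "lev n \<sqsubseteq> lev r" "lev m \<sqsubseteq> lev r" using lev_mono nm r by auto
  then show ?case using nm r by (intro exI[of _ r]) (auto dest: subD)
qed

lemma NN_basis: assumes "x \<E> NN" "y \<E> NN" "z \<E> NN" "w \<in> set (basis x y z)" shows "w \<E> NN"
proof -
  obtain n where "n \<E> om" "x \<E> lev n" "y \<E> lev n" "z \<E> lev n" using lev_list[of "[x, y, z]"] assms by auto
  then have "w \<E> lev (suc n)" using lev_basis assms(4) by blast
  then show ?thesis unfolding mem_NN using om_suc[OF \<open>n \<E> om\<close>] by blast
qed

lemma NN_ops:
  assumes "x \<E> NN" "y \<E> NN"
  shows "up x y \<E> NN" "\<langle>x, y\<rangle> \<E> NN" "dif x y \<E> NN" "prod x y \<E> NN" "ran x \<E> NN" "memx x y \<E> NN" "ins x y \<E> NN" "img x y \<E> NN" "imgs x y \<E> NN"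
  using NN_basis[OF assms assms(1)] unfolding basis_def by auto

lemma V_NN: "x \<E> V \<Longrightarrow> x \<E> NN"
  using aseq(2) mem_NN om_0 by metis

lemma lev_NN: "n \<E> om \<Longrightarrow> lev n \<E> NN"
  using lev_mem mem_NN om_suc by blast

abbreviation FY :: "'a \<Rightarrow> 'a \<Rightarrow> bool" where "FY R R' \<equiv> R \<E> NN \<and> R' = R"

lemma relalg_NN: assumes "n \<E> om" shows "relalg mem (lev n) (lev n) FY"
  by unfold_locales (use assms lev_Tran lev_NN NN_ops V_NN in auto)

lemma NN_fo:
  assumes n: "n \<E> om" and P: "fo (\<lambda>x. x \<E> lev n) (\<lambda>x. x \<E> lev n) FY P P" and B: "\<And>x. x \<E> B \<longleftrightarrow> x \<E> lev n \<and> P (\<lambda>_. x)"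
  shows "B \<E> NN"
proof -
  interpret R: relalg mem "lev n" "lev n" FY by (rule relalg_NN[OF n])
  obtain C C' where C: "\<And>x. x \<E> C \<longleftrightarrow> x \<E> lev n \<and> P (\<lambda>_. x)" "FY (prod C (sing emp)) (prod C' (sing emp))"
    by (rule R.fo_unary[OF P]) (rule that, assumption+)
  have "C = B" by (rule extensionality) (simp only: C(1) B)
  moreover have "img (prod C (sing emp)) emp = C" by (rule extensionality) auto
  moreover have "img (prod C (sing emp)) emp \<E> NN" by (rule NN_ops(8)[OF conjunct1[OF C(2)] V_NN[OF V_emp]])
  ultimately show ?thesis by simp
qed

text \<open>Closure of \<open>NN\<close> under a rudimentary function \<open>F\<close> is proved via \<open>{\<langle>y, xs\<rangle> : y \<E> F xs}\<close>, restricted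
  to \<open>xs\<close> from a level.\<close>

definition hat :: "nat \<Rightarrow> ('a list \<Rightarrow> 'a) \<Rightarrow> 'a \<Rightarrow> 'a \<Rightarrow> bool" where
  "hat n F m G \<longleftrightarrow> G \<E> NN \<and> (\<forall>xs. length xs = n \<longrightarrow> (\<forall>x\<in>set xs. x \<E> lev m) \<longrightarrow> (\<forall>y. \<langle>y, tup xs\<rangle> \<E> G \<longleftrightarrow> y \<E> F xs))"

lemma pw_NN: "m \<E> om \<Longrightarrow> pw (lev m) n \<E> NN"
  by (induction n) (auto intro: NN_ops V_NN lev_NN)

lemma tup_NN: "\<forall>x\<in>set xs. x \<E> NN \<Longrightarrow> tup xs \<E> NN"
  by (induction xs) (auto intro: NN_ops V_NN)

text \<open>The set coding \<open>F\<close> is defined over a level high enough for the tuples and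
  the values; subsets that are first-order definable over a level belong to \<open>NN\<close> by
  \<open>NN_fo\<close>.\<close>

lemma hatI:
  assumes m: "m \<E> om" and M0: "M0 \<E> om"
    and fo: "\<And>M. M \<E> om \<Longrightarrow> M0 \<sqsubseteq> M \<Longrightarrow> fo (\<lambda>x. x \<E> lev M) (\<lambda>x. x \<E> lev M) FY (\<lambda>e. \<Phi> M (e 1) (e 0)) (\<lambda>e. \<Phi> M (e 1) (e 0))"
    and bd: "\<And>xs y. length xs = n \<Longrightarrow> \<forall>x\<in>set xs. x \<E> lev m \<Longrightarrow> y \<E> F xs \<Longrightarrow> y \<E> lev M0"
    and \<Phi>: "\<And>M xs y. M \<E> om \<Longrightarrow> M0 \<sqsubseteq> M \<Longrightarrow> length xs = n \<Longrightarrow> \<forall>x\<in>set xs. x \<E> lev m \<Longrightarrow> tup xs \<E> lev M \<Longrightarrow> y \<E> lev M \<Longrightarrow> \<Phi> M y (tup xs) \<longleftrightarrow> y \<E> F xs"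
  shows "\<exists>G. hat n F m G"
proof -
  let ?p = "pw (lev m) n"
  obtain M1 where M1: "M1 \<E> om" "?p \<E> lev M1" using pw_NN[OF m] mem_NN by blast
  obtain M2 where M2: "M2 \<E> om" "M0 \<sqsubseteq> M2" "M1 \<sqsubseteq> M2" using om_max[OF M0 M1(1)] by blast
  \<comment> \<open>One level above the one that contains values and tuples, so that it contains the
    pairs formed of them.\<close>
  let ?M = "suc M2"
  have M: "?M \<E> om" "M0 \<sqsubseteq> ?M" "M2 \<sqsubseteq> ?M" using M2 sub_trans[OF M2(2), of "suc M2"] by (auto simp: subset_def)
  have pM: "?p \<E> lev M2" using lev_mono[OF M1(1) M2(1,3)] M1(2) by (rule subD)
  have M02: "lev M0 \<sqsubseteq> lev M2" "lev M2 \<sqsubseteq> lev ?M" using lev_mono M0 M2 M by auto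
  define P where "P e \<longleftrightarrow> (\<exists>y. y \<E> lev ?M \<and> (\<exists>t. t \<E> lev ?M \<and> (e (0::nat) = \<langle>y, t\<rangle> \<and> inn ?p t \<and> \<Phi> ?M y t)))" for e
  have T: "tra (\<lambda>x. x \<E> lev ?M)" using lev_Tran[OF M(1)] unfolding tra_def by (blast dest: TranD)
  have "fo (\<lambda>x. x \<E> lev ?M) (\<lambda>x. x \<E> lev ?M) FY P P" unfolding P_def
    apply (intro fo_ex fo_conj)
    subgoal by (rule bfo_fo0[OF bfo_pair T T])
    subgoal by (rule fo_inn[OF foT_var[OF T T]]) (simp add: pw_NN[OF m])
    subgoal using fo[OF M(1,2)] by simp
    done
  moreover obtain G where G: "\<And>x. x \<E> G \<longleftrightarrow> x \<E> lev ?M \<and> P (\<lambda>_. x)"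
  proof -
    interpret R: relalg mem "lev ?M" "lev ?M" FY by (rule relalg_NN[OF M(1)])
    show thesis by (rule R.fo_unary[OF calculation]) (rule that, assumption)
  qed
  ultimately have GN: "G \<E> NN" using NN_fo[OF M(1)] by blast
  have "\<langle>y, tup xs\<rangle> \<E> G \<longleftrightarrow> y \<E> F xs" if xs: "length xs = n" "\<forall>x\<in>set xs. x \<E> lev m" for xs y
  proof -
    have tp: "tup xs \<E> ?p" unfolding mem_pw using xs by blast
    then have t2: "tup xs \<E> lev M2" using TranD[OF lev_Tran[OF M2(1)] pM] by blast
    then have tM: "tup xs \<E> lev ?M" using M02 by (blast dest: subD)
    have "\<langle>y, tup xs\<rangle> \<E> G \<longleftrightarrow> \<langle>y, tup xs\<rangle> \<E> lev ?M \<and> y \<E> lev ?M \<and> \<Phi> ?M y (tup xs)"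
      unfolding G P_def inn_def using tp tM by auto
    also have "\<dots> \<longleftrightarrow> \<langle>y, tup xs\<rangle> \<E> lev ?M \<and> y \<E> lev ?M \<and> y \<E> F xs" using \<Phi>[OF M(1,2) xs tM] by blast
    also have "\<dots> \<longleftrightarrow> y \<E> F xs"
    proof -
      have "\<langle>y, tup xs\<rangle> \<E> lev ?M \<and> y \<E> lev ?M" if "y \<E> F xs"
      proof -
        have "y \<E> lev M2" using bd[OF xs that] M02 by (blast dest: subD)
        then show ?thesis using lev_basis[OF M2(1) _ t2 t2, of y] M02 unfolding basis_def by (auto dest: subD)
      qed
      then show ?thesis by blast
    qed
    finally show ?thesis .
  qed
  then show ?thesis unfolding hat_def using GN by blast
qed

primrec cmp :: "'a \<Rightarrow> nat \<Rightarrow> 'a \<Rightarrow> 'a \<Rightarrow> bool" where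
  "cmp A 0 t x \<longleftrightarrow> (\<exists>r. r \<E> A \<and> t = \<langle>x, r\<rangle>)"
| "cmp A (Suc i) t x \<longleftrightarrow> (\<exists>h. h \<E> A \<and> (\<exists>r. r \<E> A \<and> (t = \<langle>h, r\<rangle> \<and> cmp A i r x)))"

lemma fo_cmp: assumes T: "tra (\<lambda>x. x \<E> A)" shows "fo (\<lambda>x. x \<E> A) (\<lambda>x. x \<E> A) U (\<lambda>e. cmp A i (e a) (e b)) (\<lambda>e. cmp A i (e a) (e b))"
proof (induction i arbitrary: a b)
  case 0
  show ?case unfolding cmp.simps by (intro fo_ex bfo_fo0[OF bfo_pair T T])
next
  case (Suc i)
  show ?case unfolding cmp.simps by (intro fo_ex fo_conj bfo_fo0[OF bfo_pair T T] Suc.IH)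
qed

lemma cmp_tup: "Tran A \<Longrightarrow> tup xs \<E> A \<Longrightarrow> i < length xs \<Longrightarrow> cmp A i (tup xs) x \<longleftrightarrow> x = xs ! i"
proof (induction xs arbitrary: i)
  case (Cons y xs)
  then have "y \<E> A" "tup xs \<E> A" using Tran_pair[of A y "tup xs"] by auto
  then show ?case using Cons by (cases i) auto
qed simp

text \<open>Common to the three initial functions: the elements of a value are definable from at
  most two arguments and do not leave \<open>lev m\<close>.\<close>

lemma hat_base:
  assumes m: "m \<E> om" and ik: "i < n" "k < n"
    and \<Psi>: "\<And>A. tra (\<lambda>x. x \<E> A) \<Longrightarrow> fo (\<lambda>x. x \<E> A) (\<lambda>x. x \<E> A) FY (\<lambda>e. \<Psi> (e 3) (e 1) (e 0)) (\<lambda>e. \<Psi> (e 3) (e 1) (e 0))"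
    and F: "\<And>xs y. length xs = n \<Longrightarrow> y \<E> F xs \<longleftrightarrow> \<Psi> y (xs ! i) (xs ! k)"
    and bd: "\<And>x z y. x \<E> lev m \<Longrightarrow> z \<E> lev m \<Longrightarrow> \<Psi> y x z \<Longrightarrow> y \<E> lev m"
  shows "\<exists>G. hat n F m G"
proof (rule hatI[OF m m, where \<Phi>="\<lambda>M y t. \<exists>x. x \<E> lev M \<and> (\<exists>z. z \<E> lev M \<and> (cmp (lev M) i t x \<and> cmp (lev M) k t z \<and> \<Psi> y x z))"])
  fix M assume M: "M \<E> om"
  have T: "tra (\<lambda>x. x \<E> lev M)" using lev_Tran[OF M] unfolding tra_def by (blast dest: TranD)
  show "fo (\<lambda>x. x \<E> lev M) (\<lambda>x. x \<E> lev M) FY (\<lambda>e. \<exists>x. x \<E> lev M \<and> (\<exists>z. z \<E> lev M \<and> (cmp (lev M) i (e 0) x \<and> cmp (lev M) k (e 0) z \<and> \<Psi> (e 1) x z)))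
     (\<lambda>e. \<exists>x. x \<E> lev M \<and> (\<exists>z. z \<E> lev M \<and> (cmp (lev M) i (e 0) x \<and> cmp (lev M) k (e 0) z \<and> \<Psi> (e 1) x z)))"
    using \<Psi>[OF T] by (intro fo_ex fo_conj fo_cmp[OF T]) (simp add: numeral_3_eq_3)
next
  fix xs y assume xs: "length xs = n" "\<forall>x\<in>set xs. x \<E> lev m" and y: "y \<E> F xs"
  show "y \<E> lev m" using bd[of "xs ! i" "xs ! k" y] F[OF xs(1)] xs ik y by auto
next
  fix M xs y assume M: "M \<E> om" "m \<sqsubseteq> M" and xs: "length xs = n" "\<forall>x\<in>set xs. x \<E> lev m" and t: "tup xs \<E> lev M"
  have "xs ! i \<E> lev M" "xs ! k \<E> lev M" using xs ik lev_mono[OF m M] by (auto dest: subD)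
  then show "(\<exists>x. x \<E> lev M \<and> (\<exists>z. z \<E> lev M \<and> (cmp (lev M) i (tup xs) x \<and> cmp (lev M) k (tup xs) z \<and> \<Psi> y x z))) \<longleftrightarrow> y \<E> F xs"
    using cmp_tup[OF lev_Tran[OF M(1)] t] xs(1) ik F[OF xs(1)] by simp
qed

text \<open>The values are sections of \<open>G\<close>. \<open>imgs\<close> collects them in one
  set, and the level of this set bounds them all.\<close>

lemma hat_val:
  assumes "m \<E> om" "hat n F m G"
  shows "\<exists>M. M \<E> om \<and> (\<forall>xs. length xs = n \<longrightarrow> (\<forall>x\<in>set xs. x \<E> lev m) \<longrightarrow> F xs \<E> lev M)"
proof -
  have G: "G \<E> NN" using assms unfolding hat_def by blast
  obtain M where M: "M \<E> om" "imgs G (pw (lev m) n) \<E> lev M" using NN_ops(9)[OF G pw_NN[OF assms(1)]] mem_NN by blast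
  have "F xs \<E> lev M" if xs: "length xs = n" "\<forall>x\<in>set xs. x \<E> lev m" for xs
  proof -
    have "F xs = img G (tup xs)" by (rule extensionality) (use assms(2) xs in \<open>simp add: hat_def\<close>)
    moreover have "tup xs \<E> pw (lev m) n" unfolding mem_pw using xs by blast
    ultimately have "F xs \<E> imgs G (pw (lev m) n)" unfolding mem_imgs by blast
    then show ?thesis using TranD[OF lev_Tran[OF M(1)] M(2)] by blast
  qed
  then show ?thesis using M by blast
qed

text \<open>Expresses that \<open>t'\<close> is the tuple of the sections at \<open>t\<close> of the
  relations in the list. If these code the inner functions of a composition and \<open>t\<close> is
  the tuple of arguments, then \<open>t'\<close> is the tuple passed to the outer function.\<close>

primrec trel :: "'a \<Rightarrow> 'a list \<Rightarrow> 'a \<Rightarrow> 'a \<Rightarrow> bool" where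
  "trel A [] t t' \<longleftrightarrow> \<not> (\<exists>u. u \<E> A \<and> u \<E> t')"
| "trel A (E # Es) t t' \<longleftrightarrow> (\<exists>h. h \<E> A \<and> (\<exists>r. r \<E> A \<and> (t' = \<langle>h, r\<rangle> \<and>
     (\<forall>y. y \<E> A \<longrightarrow> (y \<E> h \<longleftrightarrow> (\<exists>q. q \<E> A \<and> (q = \<langle>y, t\<rangle> \<and> inn E q)))) \<and> trel A Es t r)))"

lemma fo_trel: assumes T: "tra (\<lambda>x. x \<E> A)" and "\<forall>E\<in>set Es. E \<E> NN"
  shows "fo (\<lambda>x. x \<E> A) (\<lambda>x. x \<E> A) FY (\<lambda>e. trel A Es (e a) (e b)) (\<lambda>e. trel A Es (e a) (e b))"
  using assms(2)
proof (induction Es arbitrary: a b)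
  case Nil
  show ?case unfolding trel.simps by (intro fo_neg fo_ex fo_mem)
next
  case (Cons E Es)
  then have E: "E \<E> NN" by simp
  have "fo (\<lambda>x. x \<E> A) (\<lambda>x. x \<E> A) FY (\<lambda>e. inn E (e i)) (\<lambda>e. inn E (e i))" for i
    by (rule fo_inn[OF foT_var[OF T T]]) (simp add: E)
  then show ?case unfolding trel.simps using Cons
    by (intro fo_ex fo_conj fo_all fo_iff fo_mem bfo_fo0[OF bfo_pair T T]) auto
qed

lemma trel_tup:
  assumes "Tran A" "t \<E> A" "list_all2 (\<lambda>H E. E \<E> A \<and> H \<E> A \<and> (\<forall>y. \<langle>y, t\<rangle> \<E> E \<longleftrightarrow> y \<E> H)) Hs Es" "t' \<E> A"
  shows "trel A Es t t' \<longleftrightarrow> t' = tup Hs"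
  using assms(3,4)
proof (induction arbitrary: t' rule: list_all2_induct)
  case Nil
  then show ?case using TranD[OF assms(1)] by (auto simp: eq_emp)
next
  case (Cons H Hs E Es)
  have HE: "E \<E> A" "H \<E> A" "\<And>y. \<langle>y, t\<rangle> \<E> E \<longleftrightarrow> y \<E> H" using Cons.hyps by auto
  have "(\<forall>y. y \<E> A \<longrightarrow> (y \<E> h \<longleftrightarrow> (\<exists>q. q \<E> A \<and> (q = \<langle>y, t\<rangle> \<and> inn E q)))) \<longleftrightarrow> h = H" if h: "h \<E> A" for h
  proof -
    have "(\<exists>q. q \<E> A \<and> (q = \<langle>y, t\<rangle> \<and> inn E q)) \<longleftrightarrow> y \<E> H" for y
      unfolding inn_def using HE(3) TranD[OF assms(1) HE(1)] by blast
    then show ?thesis using TranD[OF assms(1) h] TranD[OF assms(1) HE(2)] ext_iff[of h H] by blast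
  qed
  then have "trel A (E # Es) t t' \<longleftrightarrow> (\<exists>h. h \<E> A \<and> (\<exists>r. r \<E> A \<and> (t' = \<langle>h, r\<rangle> \<and> h = H \<and> trel A Es t r)))"
    unfolding trel.simps by blast
  also have "\<dots> \<longleftrightarrow> (\<exists>h. h \<E> A \<and> (\<exists>r. r \<E> A \<and> (t' = \<langle>h, r\<rangle> \<and> h = H \<and> r = tup Hs)))" using Cons.IH by blast
  also have "\<dots> \<longleftrightarrow> t' = tup (H # Hs)" using Tran_pair[OF assms(1), of H "tup Hs"] Cons.prems by auto
  finally show ?case .
qed

lemma rud_hat: "rudimentary mem n F \<Longrightarrow> m \<E> om \<Longrightarrow> \<exists>G. hat n F m G"
proof (induction arbitrary: m rule: rudimentary.induct)
  case (proj i n)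
  show ?case
    by (rule hat_base[OF proj(2,1,1), where \<Psi>="\<lambda>y x z. y \<E> x"]) (use TranD[OF lev_Tran[OF proj(2)]] in \<open>auto intro: fo_mem\<close>)
next
  case (diff i n k)
  show ?case
    by (rule hat_base[OF diff(3,1,2), where \<Psi>="\<lambda>y x z. y \<E> x \<and> \<not> y \<E> z"])
      (intro fo_mem fo_conj fo_neg | (use TranD[OF lev_Tran[OF diff(3)]] in auto))+
next
  case (upair i n k)
  show ?case
    by (rule hat_base[OF upair(3,1,2), where \<Psi>="\<lambda>y x z. y = x \<or> y = z"])
      (auto intro: fo_eq fo_disj)
next
  case (union n G)
  let ?F = "\<lambda>xs. Coll (\<lambda>w. \<exists>z. z \<E> hd xs \<and> w \<E> G (z # tl xs))"
  obtain E where E: "hat (Suc n) G m E" using union by blast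
  then have EN: "E \<E> NN" and Em: "\<And>xs y. length xs = Suc n \<Longrightarrow> \<forall>x\<in>set xs. x \<E> lev m \<Longrightarrow> \<langle>y, tup xs\<rangle> \<E> E \<longleftrightarrow> y \<E> G xs"
    unfolding hat_def by blast+
  obtain M1 where M1: "M1 \<E> om" "E \<E> lev M1" using EN mem_NN by blast
  obtain M0 where M0: "M0 \<E> om" "m \<sqsubseteq> M0" "M1 \<sqsubseteq> M0" using om_max[OF union.prems M1(1)] by blast
  have E0: "E \<E> lev M0" using lev_mono[OF M1(1) M0(1,3)] M1(2) by (rule subD)
  have Fx: "w \<E> ?F (x # xs) \<longleftrightarrow> (\<exists>z. z \<E> x \<and> \<langle>w, \<langle>z, tup xs\<rangle>\<rangle> \<E> E)"
    if xs: "length xs = n" "x \<E> lev m" "\<forall>x\<in>set xs. x \<E> lev m" for x xs w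
  proof -
    have z: "w \<E> G (z # xs) \<longleftrightarrow> \<langle>w, \<langle>z, tup xs\<rangle>\<rangle> \<E> E" if "z \<E> x" for z w
      using Em[of "z # xs" w] xs that TranD[OF lev_Tran[OF union.prems] xs(2)] by simp
    have "(\<lambda>w. \<exists>z. z \<E> hd (x # xs) \<and> w \<E> G (z # tl (x # xs))) = (\<lambda>w. \<exists>z. z \<E> x \<and> \<langle>w, \<langle>z, tup xs\<rangle>\<rangle> \<E> E)"
      using z by auto
    then have "w \<E> ?F (x # xs) \<longleftrightarrow> w \<E> Coll (\<lambda>w. \<exists>z. z \<E> x \<and> \<langle>w, \<langle>z, tup xs\<rangle>\<rangle> \<E> E)" by simp
    also have "\<dots> \<longleftrightarrow> (\<exists>z. z \<E> x \<and> \<langle>w, \<langle>z, tup xs\<rangle>\<rangle> \<E> E)"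
      by (rule mem_collI[where a="UU E"], intro D_intros) (elim exE conjE, drule pair_mem_Uni, erule conjunct1)
    finally show ?thesis .
  qed
  show ?case
  proof (rule hatI[OF union.prems M0(1), where \<Phi>="\<lambda>M w t. \<exists>x. x \<E> lev M \<and> (\<exists>r. r \<E> lev M \<and> (t = \<langle>x, r\<rangle> \<and> (\<exists>z. z \<E> lev M \<and> (z \<E> x \<and> (\<exists>s. s \<E> lev M \<and> (s = \<langle>z, r\<rangle> \<and> (\<exists>q. q \<E> lev M \<and> (q = \<langle>w, s\<rangle> \<and> inn E q))))))))"])
    fix M assume M: "M \<E> om"
    have T: "tra (\<lambda>x. x \<E> lev M)" using lev_Tran[OF M] unfolding tra_def by (blast dest: TranD)
    have "fo (\<lambda>x. x \<E> lev M) (\<lambda>x. x \<E> lev M) FY (\<lambda>e. inn E (e i)) (\<lambda>e. inn E (e i))" for i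
      by (rule fo_inn[OF foT_var[OF T T]]) (simp add: EN)
    then show "fo (\<lambda>x. x \<E> lev M) (\<lambda>x. x \<E> lev M) FY (\<lambda>e. \<exists>x. x \<E> lev M \<and> (\<exists>r. r \<E> lev M \<and> (e 0 = \<langle>x, r\<rangle> \<and> (\<exists>z. z \<E> lev M \<and> (z \<E> x \<and> (\<exists>s. s \<E> lev M \<and> (s = \<langle>z, r\<rangle> \<and> (\<exists>q. q \<E> lev M \<and> (q = \<langle>e 1, s\<rangle> \<and> inn E q)))))))))
      (\<lambda>e. \<exists>x. x \<E> lev M \<and> (\<exists>r. r \<E> lev M \<and> (e 0 = \<langle>x, r\<rangle> \<and> (\<exists>z. z \<E> lev M \<and> (z \<E> x \<and> (\<exists>s. s \<E> lev M \<and> (s = \<langle>z, r\<rangle> \<and> (\<exists>q. q \<E> lev M \<and> (q = \<langle>e 1, s\<rangle> \<and> inn E q)))))))))"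
      by (intro fo_ex fo_conj fo_mem bfo_fo0[OF bfo_pair T T])
  next
    fix xs y assume xs: "length xs = Suc n" "\<forall>x\<in>set xs. x \<E> lev m" and y: "y \<E> ?F xs"
    then obtain x ys where xy: "xs = x # ys" by (cases xs) auto
    then obtain z where "\<langle>y, \<langle>z, tup ys\<rangle>\<rangle> \<E> E" using Fx[of ys x y] xs y by auto
    from TranD[OF lev_Tran[OF M0(1)] E0 this] show "y \<E> lev M0" using Tran_pair[OF lev_Tran[OF M0(1)]] by blast
  next
    fix M xs y assume M: "M \<E> om" "M0 \<sqsubseteq> M" and xs: "length xs = Suc n" "\<forall>x\<in>set xs. x \<E> lev m" and t: "tup xs \<E> lev M"
    obtain x ys where xy: "xs = x # ys" using xs by (cases xs) auto
    have TM: "Tran (lev M)" using lev_Tran[OF M(1)] .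
    have EM: "E \<E> lev M" using lev_mono[OF M0(1) M] E0 by (rule subD)
    have xM: "x \<E> lev M" "tup ys \<E> lev M" using Tran_pair[OF TM, of x "tup ys"] t xy by simp_all
    have q: "\<langle>y, \<langle>z, tup ys\<rangle>\<rangle> \<E> lev M \<and> \<langle>z, tup ys\<rangle> \<E> lev M \<and> z \<E> lev M" if "\<langle>y, \<langle>z, tup ys\<rangle>\<rangle> \<E> E" for z
      using TranD[OF TM EM that] Tran_pair[OF TM, of y "\<langle>z, tup ys\<rangle>"] Tran_pair[OF TM, of z "tup ys"] by blast
    have "(\<exists>x. x \<E> lev M \<and> (\<exists>r. r \<E> lev M \<and> (tup xs = \<langle>x, r\<rangle> \<and> (\<exists>z. z \<E> lev M \<and> (z \<E> x \<and> (\<exists>s. s \<E> lev M \<and> (s = \<langle>z, r\<rangle> \<and> (\<exists>q. q \<E> lev M \<and> (q = \<langle>y, s\<rangle> \<and> inn E q)))))))))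
       \<longleftrightarrow> (\<exists>z. z \<E> lev M \<and> (z \<E> x \<and> (\<langle>z, tup ys\<rangle> \<E> lev M \<and> (\<langle>y, \<langle>z, tup ys\<rangle>\<rangle> \<E> lev M \<and> \<langle>y, \<langle>z, tup ys\<rangle>\<rangle> \<E> E))))"
      unfolding inn_def xy using xM by auto
    also have "\<dots> \<longleftrightarrow> (\<exists>z. z \<E> x \<and> \<langle>y, \<langle>z, tup ys\<rangle>\<rangle> \<E> E)" using q by blast
    also have "\<dots> \<longleftrightarrow> y \<E> ?F xs" using Fx[of ys x y] xs unfolding xy by simp
    finally show "(\<exists>x. x \<E> lev M \<and> (\<exists>r. r \<E> lev M \<and> (tup xs = \<langle>x, r\<rangle> \<and> (\<exists>z. z \<E> lev M \<and> (z \<E> x \<and> (\<exists>s. s \<E> lev M \<and> (s = \<langle>z, r\<rangle> \<and> (\<exists>q. q \<E> lev M \<and> (q = \<langle>y, s\<rangle> \<and> inn E q))))))))) \<longleftrightarrow> y \<E> ?F xs" .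
  qed
next
  case (comp Hs G n)
  \<comment> \<open>The list of inner functions is finite in HOL, so one level contains all their
    codes and all their values on \<open>lev m\<close>. The outer function is then coded on that
    level.\<close>
  have "\<exists>Es M. length Es = length Hs' \<and> M \<E> om \<and> list_all2 (\<lambda>H E. E \<E> lev M \<and> hat n H m E \<and> (\<forall>xs. length xs = n \<longrightarrow> (\<forall>x\<in>set xs. x \<E> lev m) \<longrightarrow> H xs \<E> lev M)) Hs' Es"
    if "set Hs' \<subseteq> set Hs" for Hs'
    using that
  proof (induction Hs')
    case Nil
    show ?case by (intro exI[of _ "[]"] exI[of _ emp]) simp
  next
    case (Cons H Hs')
    then obtain Es M1 where Es: "length Es = length Hs'" "M1 \<E> om"
      "list_all2 (\<lambda>H E. E \<E> lev M1 \<and> hat n H m E \<and> (\<forall>xs. length xs = n \<longrightarrow> (\<forall>x\<in>set xs. x \<E> lev m) \<longrightarrow> H xs \<E> lev M1)) Hs' Es" by auto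
    obtain E where E: "hat n H m E" using comp.IH(2)[of H m] comp.prems Cons.prems by auto
    obtain M2 where M2: "M2 \<E> om" "\<And>xs. length xs = n \<Longrightarrow> (\<forall>x\<in>set xs. x \<E> lev m) \<Longrightarrow> H xs \<E> lev M2" using hat_val[OF comp.prems E] by blast
    obtain M3 where M3: "M3 \<E> om" "E \<E> lev M3" using E mem_NN unfolding hat_def by blast
    obtain M4 where M4: "M4 \<E> om" "M2 \<sqsubseteq> M4" "M3 \<sqsubseteq> M4" using om_max[OF M2(1) M3(1)] by blast
    obtain M where M: "M \<E> om" "M1 \<sqsubseteq> M" "M4 \<sqsubseteq> M" using om_max[OF Es(2) M4(1)] by blast
    have l: "x \<E> lev M1 \<Longrightarrow> x \<E> lev M" "x \<E> lev M2 \<Longrightarrow> x \<E> lev M" "x \<E> lev M3 \<Longrightarrow> x \<E> lev M" for x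
      using lev_mono[OF Es(2) M(1,2)] lev_mono[OF M2(1) M(1) sub_trans[OF M4(2) M(3)]] lev_mono[OF M3(1) M(1) sub_trans[OF M4(3) M(3)]]
      by (blast dest: subD)+
    have "list_all2 (\<lambda>H E. E \<E> lev M \<and> hat n H m E \<and> (\<forall>xs. length xs = n \<longrightarrow> (\<forall>x\<in>set xs. x \<E> lev m) \<longrightarrow> H xs \<E> lev M)) Hs' Es"
      using Es(3) by (rule list_all2_mono) (use l in blast)
    then show ?case using M(1) Es(1) E M2(2) M3(2) l by (intro exI[of _ "E # Es"] exI[of _ M]) auto
  qed
  from this[of Hs] obtain Es M1 where Es: "M1 \<E> om" "list_all2 (\<lambda>H E. E \<E> lev M1 \<and> hat n H m E \<and> (\<forall>xs. length xs = n \<longrightarrow> (\<forall>x\<in>set xs. x \<E> lev m) \<longrightarrow> H xs \<E> lev M1)) Hs Es" by blast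
  let ?v = "\<lambda>xs. map (\<lambda>H. H xs) Hs"
  have v: "\<forall>y\<in>set (?v xs). y \<E> lev M1" if "length xs = n" "\<forall>x\<in>set xs. x \<E> lev m" for xs
    using Es(2) that by (auto simp: list_all2_conv_all_nth in_set_conv_nth)
  obtain E where E: "hat (length Hs) G M1 E" using comp.IH(1)[OF Es(1)] by blast
  then have EN: "E \<E> NN" and Em: "\<And>xs y. length xs = length Hs \<Longrightarrow> \<forall>x\<in>set xs. x \<E> lev M1 \<Longrightarrow> \<langle>y, tup xs\<rangle> \<E> E \<longleftrightarrow> y \<E> G xs"
    unfolding hat_def by blast+
  obtain M2 where M2: "M2 \<E> om" "E \<E> lev M2" using EN mem_NN by blast
  obtain M0 where M0: "M0 \<E> om" "M1 \<sqsubseteq> M0" "M2 \<sqsubseteq> M0" using om_max[OF Es(1) M2(1)] by blast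
  have E0: "E \<E> lev M0" using lev_mono[OF M2(1) M0(1,3)] M2(2) by (rule subD)
  have EsN: "\<forall>E\<in>set Es. E \<E> NN" using Es(2) unfolding hat_def by (auto simp: list_all2_conv_all_nth in_set_conv_nth)
  show ?case
  proof (rule hatI[OF comp.prems M0(1), where \<Phi>="\<lambda>M y t. \<exists>t'. t' \<E> lev M \<and> (\<exists>q. q \<E> lev M \<and> (trel (lev M) Es t t' \<and> q = \<langle>y, t'\<rangle> \<and> inn E q))"])
    fix M assume M: "M \<E> om"
    have T: "tra (\<lambda>x. x \<E> lev M)" using lev_Tran[OF M] unfolding tra_def by (blast dest: TranD)
    have "fo (\<lambda>x. x \<E> lev M) (\<lambda>x. x \<E> lev M) FY (\<lambda>e. inn E (e i)) (\<lambda>e. inn E (e i))" for i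
      by (rule fo_inn[OF foT_var[OF T T]]) (simp add: EN)
    then show "fo (\<lambda>x. x \<E> lev M) (\<lambda>x. x \<E> lev M) FY (\<lambda>e. \<exists>t'. t' \<E> lev M \<and> (\<exists>q. q \<E> lev M \<and> (trel (lev M) Es (e 0) t' \<and> q = \<langle>e 1, t'\<rangle> \<and> inn E q)))
      (\<lambda>e. \<exists>t'. t' \<E> lev M \<and> (\<exists>q. q \<E> lev M \<and> (trel (lev M) Es (e 0) t' \<and> q = \<langle>e 1, t'\<rangle> \<and> inn E q)))"
      by (intro fo_ex fo_conj fo_trel[OF T EsN] bfo_fo0[OF bfo_pair T T])
  next
    fix xs y assume xs: "length xs = n" "\<forall>x\<in>set xs. x \<E> lev m" and y: "y \<E> G (?v xs)"
    then have "\<langle>y, tup (?v xs)\<rangle> \<E> E" using Em[of "?v xs" y] v[OF xs] by simp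
    then show "y \<E> lev M0" using TranD[OF lev_Tran[OF M0(1)] E0] Tran_pair[OF lev_Tran[OF M0(1)]] by blast
  next
    fix M xs y assume M: "M \<E> om" "M0 \<sqsubseteq> M" and xs: "length xs = n" "\<forall>x\<in>set xs. x \<E> lev m" and t: "tup xs \<E> lev M"
    have TM: "Tran (lev M)" using lev_Tran[OF M(1)] .
    have EM: "E \<E> lev M" using lev_mono[OF M0(1) M] E0 by (rule subD)
    have 1: "x \<E> lev M1 \<Longrightarrow> x \<E> lev M" for x using lev_mono[OF Es(1) M(1) sub_trans[OF M0(2) M(2)]] by (blast dest: subD)
    have l2: "list_all2 (\<lambda>H E. E \<E> lev M \<and> H \<E> lev M \<and> (\<forall>y. \<langle>y, tup xs\<rangle> \<E> E \<longleftrightarrow> y \<E> H)) (?v xs) Es"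
      unfolding list_all2_map1 using Es(2) by (rule list_all2_mono) (use xs 1 in \<open>simp add: hat_def\<close>)
    have "(\<exists>t'. t' \<E> lev M \<and> (\<exists>q. q \<E> lev M \<and> (trel (lev M) Es (tup xs) t' \<and> q = \<langle>y, t'\<rangle> \<and> inn E q)))
       \<longleftrightarrow> (\<exists>t'. t' \<E> lev M \<and> (\<exists>q. q \<E> lev M \<and> (t' = tup (?v xs) \<and> q = \<langle>y, t'\<rangle> \<and> inn E q)))"
      using trel_tup[OF TM t l2] by blast
    also have "\<dots> \<longleftrightarrow> \<langle>y, tup (?v xs)\<rangle> \<E> E"
      unfolding inn_def using TranD[OF TM EM] Tran_pair[OF TM] by blast
    also have "\<dots> \<longleftrightarrow> y \<E> G (?v xs)" using Em[of "?v xs" y] v[OF xs] by simp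
    finally show "(\<exists>t'. t' \<E> lev M \<and> (\<exists>q. q \<E> lev M \<and> (trel (lev M) Es (tup xs) t' \<and> q = \<langle>y, t'\<rangle> \<and> inn E q))) \<longleftrightarrow> y \<E> G (?v xs)" .
  qed
qed

lemma NN_rud_closed: "rud_closed mem NN"
  unfolding rud_closed_def
proof (intro allI impI, elim conjE)
  fix n F and xs :: "'a list" assume F: "rudimentary mem n F" and xs: "length xs = n" "\<forall>x\<in>set xs. x \<E> NN"
  obtain m where m: "m \<E> om" "\<forall>x\<in>set xs. x \<E> lev m" using lev_list[OF xs(2)] by blast
  obtain G where G: "hat n F m G" using rud_hat[OF F m(1)] by blast
  have "F xs = img G (tup xs)" by (rule extensionality) (use G xs m in \<open>simp add: hat_def\<close>)
  then show "F xs \<E> NN" using G NN_ops(8) tup_NN[OF xs(2)] unfolding hat_def by simp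
qed

text \<open>For minimality, \<open>Sop\<close> is itself rudimentary; by induction a rudimentarily
  closed set has every level both as a subset and as an element.\<close>

lemma J_eq: "J mem V = NN"
proof -
  have sub: "suc V \<sqsubseteq> NN" by (rule subI) (use V_NN lev_NN[OF om_0] aseq(2) in auto)
  have least: "NN \<sqsubseteq> Z" if Z: "suc V \<sqsubseteq> Z" "rud_closed mem Z" for Z
  proof -
    have cl: "F e \<E> Z" if F: "Rd F" and e: "\<And>i. e i \<E> Z" for F e
    proof -
      obtain n F' where "rudimentary mem n F'" "\<And>e. F e = F' (map e [0..<n])" using F unfolding Rd_def by blast
      then show ?thesis using Z(2) e unfolding rud_closed_def by auto
    qed
    have bas: "w \<E> Z" if xyz: "x \<E> Z" "y \<E> Z" "z \<E> Z" and w: "w \<in> set (basis x y z)" for x y z w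
    proof -
      let ?e = "\<lambda>i::nat. if i = 0 then x else if i = 1 then y else z"
      have e: "\<And>i. ?e i \<E> Z" using xyz by auto
      have "\<forall>f\<in>set [\<lambda>e. e 0, \<lambda>e. up (e 0) (e 1), \<lambda>e. \<langle>e 0, e 1\<rangle>, \<lambda>e. up (e 0) \<langle>e 1, e 2\<rangle>, \<lambda>e. \<langle>e 0, \<langle>e 1, e 2\<rangle>\<rangle>, \<lambda>e. dif (e 0) (e 1),
          \<lambda>e. prod (e 0) (e 1), \<lambda>e. ran (e 0), \<lambda>e. memx (e 0) (e 1), \<lambda>e. ins (e 0) (e 1), \<lambda>e. img (e 0) (e 1), \<lambda>e. imgs (e 0) (e 1)]. Rd f"
        by (simp add: Rd_intros)
      then have "\<forall>f\<in>set [\<lambda>e. e 0, \<lambda>e. up (e 0) (e 1), \<lambda>e. \<langle>e 0, e 1\<rangle>, \<lambda>e. up (e 0) \<langle>e 1, e 2\<rangle>, \<lambda>e. \<langle>e 0, \<langle>e 1, e 2\<rangle>\<rangle>, \<lambda>e. dif (e 0) (e 1),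
          \<lambda>e. prod (e 0) (e 1), \<lambda>e. ran (e 0), \<lambda>e. memx (e 0) (e 1), \<lambda>e. ins (e 0) (e 1), \<lambda>e. img (e 0) (e 1), \<lambda>e. imgs (e 0) (e 1)]. f ?e \<E> Z"
        by (intro ballI cl[OF _ e]) (drule bspec, assumption+)
      then show ?thesis using w unfolding basis_def by auto
    qed
    have "lev n \<sqsubseteq> Z \<and> lev n \<E> Z" if "n \<E> om" for n
    proof (rule om_induct[where P="\<lambda>n. lev n \<sqsubseteq> Z \<and> lev n \<E> Z", OF _ _ _ that])
      show "D (\<lambda>e. lev (e 0) \<sqsubseteq> Z \<and> lev (e 0) \<E> Z)" by (intro D_intros)
      show "lev emp \<sqsubseteq> Z \<and> lev emp \<E> Z" unfolding aseq(2) using Z(1) by (auto intro!: subI dest: subD)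
      fix n assume n: "n \<E> om" and IH: "lev n \<sqsubseteq> Z \<and> lev n \<E> Z"
      have "Sop (lev n) \<E> Z" using cl[OF Rd_Sop, of "\<lambda>_. lev n"] IH by blast
      moreover have "Sop (lev n) \<sqsubseteq> Z"
        by (rule subI) (unfold mem_Sop, use IH bas in \<open>blast dest: subD\<close>)
      ultimately show "lev (suc n) \<sqsubseteq> Z \<and> lev (suc n) \<E> Z" unfolding aseq(3)[OF n] by blast
    qed
    then show ?thesis by (intro subI) (auto simp: mem_NN dest: subD)
  qed
  show ?thesis unfolding J_def rud_closure_def
    by (rule the_equality) (use sub NN_rud_closed least sub_antisym in blast)+
qed

end

context limit_rank
begin

lemma Inv_V [simp]: "Inv V"
  unfolding Inv_def good_def using embedding.dot_V[OF embedding.intro[OF limit_rank_axioms embedding_axioms.intro]] by simp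

subsection \<open>Invariant codings\<close>

definition rl :: "'a \<Rightarrow> 'a \<Rightarrow> 'a" where
  "rl d d' = Coll (\<lambda>z. z \<E> V \<and> (\<exists>x y. z = \<langle>x, y\<rangle> \<and> d $ x = d' $ y))"

definition ml :: "'a \<Rightarrow> 'a" where
  "ml d = Coll (\<lambda>z. z \<E> V \<and> (\<exists>x y. z = \<langle>x, y\<rangle> \<and> d $ x \<E> d $ y))"

definition pb :: "'a \<Rightarrow> 'a \<Rightarrow> 'a" where
  "pb d B = Coll (\<lambda>c. c \<E> V \<and> d $ c \<E> B)"

text \<open>\<open>d\<close> assigns to the elements of \<open>V\<close>, regarded as codes, the elements of a transitive set, such that
  equality and membership of the coded elements are invariant relations.\<close>

definition Cd :: "'a \<Rightarrow> bool" where
  "Cd d \<longleftrightarrow> fn d V \<and> (\<forall>x w. x \<E> V \<longrightarrow> w \<E> d $ x \<longrightarrow> (\<exists>y. y \<E> V \<and> w = d $ y)) \<and> Inv (rl d d) \<and> Inv (ml d)"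

text \<open>The invariance of the translation between codes is what carries invariant predicates
  from one coding to the other (\<open>Lk_pb\<close>).\<close>

definition Lk :: "'a \<Rightarrow> 'a \<Rightarrow> bool" where
  "Lk d d' \<longleftrightarrow> (\<forall>x. x \<E> V \<longrightarrow> (\<exists>y. y \<E> V \<and> d $ x = d' $ y)) \<and> Inv (rl d d')"

definition rg :: "'a \<Rightarrow> 'a \<Rightarrow> bool" where
  "rg d w \<longleftrightarrow> (\<exists>c. c \<E> V \<and> w = d $ c)"

lemma DT_rl [D_intros]: "DT x \<Longrightarrow> DT y \<Longrightarrow> DT (\<lambda>e. rl (x e) (y e))"
  by (erule (1) DT_subst2) (unfold rl_def, intro D_intros)

lemma DT_ml [D_intros]: "DT x \<Longrightarrow> DT (\<lambda>e. ml (x e))"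
  by (erule DT_subst1) (unfold ml_def, intro D_intros)

lemma DT_pb [D_intros]: "DT x \<Longrightarrow> DT y \<Longrightarrow> DT (\<lambda>e. pb (x e) (y e))"
  by (erule (1) DT_subst2) (unfold pb_def, intro D_intros)

lemma D_Cd [D_intros]: "DT x \<Longrightarrow> D (\<lambda>e. Cd (x e))"
  by (erule D_subst1) (unfold Cd_def, intro D_intros)

lemma D_Lk [D_intros]: "DT x \<Longrightarrow> DT y \<Longrightarrow> D (\<lambda>e. Lk (x e) (y e))"
  by (erule (1) D_subst2) (unfold Lk_def, intro D_intros)

lemma D_rg [D_intros]: "DT x \<Longrightarrow> DT y \<Longrightarrow> D (\<lambda>e. rg (x e) (y e))"
  by (erule (1) D_subst2) (unfold rg_def, intro D_intros)

lemma mem_rl: "z \<E> rl d d' \<longleftrightarrow> (\<exists>x y. x \<E> V \<and> y \<E> V \<and> z = \<langle>x, y\<rangle> \<and> d $ x = d' $ y)"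
  unfolding rl_def by (subst mem_sep, intro D_intros) auto

lemma mem_ml: "z \<E> ml d \<longleftrightarrow> (\<exists>x y. x \<E> V \<and> y \<E> V \<and> z = \<langle>x, y\<rangle> \<and> d $ x \<E> d $ y)"
  unfolding ml_def by (subst mem_sep, intro D_intros) auto

lemma mem_pb [simp]: "c \<E> pb d B \<longleftrightarrow> c \<E> V \<and> d $ c \<E> B"
  unfolding pb_def by (rule mem_sep) (intro D_intros)

lemma Inv_fo2:
  assumes P: "foI (\<lambda>e. P (e 1) (e 0))" and B: "\<And>z. z \<E> B \<longleftrightarrow> (\<exists>x y. x \<E> V \<and> y \<E> V \<and> z = \<langle>x, y\<rangle> \<and> P x y)"
  shows "Inv B"
proof (rule Inv_fo)
  show "foI (\<lambda>e. \<exists>x. x \<E> V \<and> (\<exists>y. y \<E> V \<and> (e 0 = \<langle>x, y\<rangle> \<and> P x y)))"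
    by (intro fo_ex fo_conj fo_eqT foT_V_var foT_V_pair tra_V) (use P in simp)
  show "x \<E> B \<longleftrightarrow> x \<E> V \<and> (\<exists>xa. xa \<E> V \<and> (\<exists>y. y \<E> V \<and> (x = \<langle>xa, y\<rangle> \<and> P xa y)))" for x
    unfolding B by auto
qed

lemma foI_inn2: "Inv B \<Longrightarrow> foI (\<lambda>e. inn B \<langle>e a, e b\<rangle>)"
  by (intro fo_inn foT_V_var foT_V_pair) simp

lemma foI_eq: assumes "Inv (rl d d')" shows "foI (\<lambda>e. d $ e a = d' $ e b)"
  by (rule fo_cong[OF foI_inn2[OF assms, of a b]]) (auto simp: inn_def mem_rl)

lemma foI_mem: assumes "Inv (ml d)" shows "foI (\<lambda>e. d $ e a \<E> d $ e b)"
  by (rule fo_cong[OF foI_inn2[OF assms, of a b]]) (auto simp: inn_def mem_ml)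

lemma Inv_rl: "foI (\<lambda>e. d $ e 1 = d' $ e 0) \<Longrightarrow> Inv (rl d d')"
  by (erule Inv_fo2[where P="\<lambda>x y. d $ x = d' $ y"]) (rule mem_rl)

lemma Inv_ml: "foI (\<lambda>e. d $ e 1 \<E> d $ e 0) \<Longrightarrow> Inv (ml d)"
  by (erule Inv_fo2[where P="\<lambda>x y. d $ x \<E> d $ y"]) (rule mem_ml)

lemma Cd_Inv: "Cd d \<Longrightarrow> Inv (rl d d)" "Cd d \<Longrightarrow> Inv (ml d)"
  by (simp_all add: Cd_def)

lemma Cd_tra: "Cd d \<Longrightarrow> tra (rg d)"
  unfolding Cd_def tra_def rg_def by blast

lemma rgI: "c \<E> V \<Longrightarrow> rg d (d $ c)" unfolding rg_def by blast

lemma rg_mem: "Cd d \<Longrightarrow> rg d x \<Longrightarrow> w \<E> x \<Longrightarrow> rg d w"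
  using Cd_tra unfolding tra_def by blast

lemma Lk_rg: "Lk d d' \<Longrightarrow> rg d w \<Longrightarrow> rg d' w"
  unfolding Lk_def rg_def by blast

lemma Lk_refl: "Cd d \<Longrightarrow> Lk d d" unfolding Cd_def Lk_def by blast

lemma Lk_trans: assumes "Lk d d'" "Lk d' d''" shows "Lk d d''"
proof -
  have I: "Inv (rl d d')" "Inv (rl d' d'')" using assms by (simp_all add: Lk_def)
  have "foI (\<lambda>e. \<exists>y. y \<E> V \<and> (d $ e 1 = d' $ y \<and> d' $ y = d'' $ e 0))"
    using foI_eq[OF I(1), of 2 0] foI_eq[OF I(2), of 0 1] by (intro fo_ex fo_conj) (simp_all add: numeral_2_eq_2)
  then have "foI (\<lambda>e. d $ e 1 = d'' $ e 0)"
    by (rule fo_cong) (use assms in \<open>unfold Lk_def, metis\<close>)+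
  then have "Inv (rl d d'')" by (rule Inv_rl)
  then show ?thesis using assms unfolding Lk_def by metis
qed

abbreviation PB :: "'a \<Rightarrow> 'a \<Rightarrow> 'a \<Rightarrow> bool" where "PB d u u' \<equiv> Inv (pb d u) \<and> u' = u"

text \<open>Elements are replaced by codes, and quantifiers over the coded set become quantifiers
  over \<open>V\<close>.\<close>

lemma pull:
  assumes d: "Cd d" and P: "fo (rg d) (rg d) (PB d) P P'"
  shows "foI (\<lambda>e. P (\<lambda>i. d $ e i))"
  using P
proof induction
  case (fo_mem i k)
  show ?case by (rule foI_mem[OF Cd_Inv(2)[OF d]])
next
  case (fo_pred u u' i)
  have "foI (\<lambda>e. inn (pb d u) (e i))" by (intro fo_inn foT_V_var) (use fo_pred in simp)
  then show ?case by (rule fo_cong) (simp_all add: inn_def)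
next
  case (fo_ex0 P P')
  have 1: "foI (\<lambda>e. \<exists>c. c \<E> V \<and> P (\<lambda>i. d $ case_nat c e i))"
    by (rule fo_ex) (use fo_ex0.IH in simp)
  have 2: "(\<lambda>i. d $ case_nat c e i) = case_nat (d $ c) (\<lambda>i. d $ e i)" for c e
    by (rule ext) (simp split: nat.split)
  have "(\<exists>x. rg d x \<and> P (case_nat x (\<lambda>i. d $ e i))) \<longleftrightarrow> (\<exists>c. c \<E> V \<and> P (\<lambda>i. d $ case_nat c e i))" for e
    unfolding rg_def 2 by blast
  then show ?case using 1 by (simp only:)
next
  case (fo_cong P P' Q Q')
  show ?case by (rule fo.fo_cong[OF fo_cong.IH]) (rule fo_cong.hyps(2), rule rgI, simp)+
next
  case (fo_neg P P')
  show ?case by (rule fo.fo_neg[OF fo_neg.IH])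
next
  case (fo_conj P P' Q Q')
  show ?case by (rule fo.fo_conj[OF fo_conj.IH])
qed

text \<open>Adjoins to the coded set all of its subsets that are defined by \<open>\<Psi>\<close>: the element coded by \<open>c\<close>
  becomes \<open>{d w : \<langle>w, c\<rangle> \<E> K}\<close>, where \<open>\<langle>{\<emptyset>}, \<langle>x, \<langle>y, z\<rangle>\<rangle>\<rangle>\<close> codes a new set with parameters \<open>x\<close>, \<open>y\<close>, \<open>z\<close>.\<close>

lemma adj:
  assumes d: "Cd d" and \<Psi>: "fo (rg d) (rg d) (PB d) (\<lambda>e. \<Psi> (e 3) (e 2) (e 1) (e 0)) (\<lambda>e. \<Psi> (e 3) (e 2) (e 1) (e 0))"
  obtains d' where "Cd d'" "Lk d d'"
    "\<And>x y z. rg d x \<Longrightarrow> rg d y \<Longrightarrow> rg d z \<Longrightarrow> \<exists>v. rg d' v \<and> (\<forall>w. w \<E> v \<longleftrightarrow> rg d w \<and> \<Psi> w x y z)"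
proof -
  let ?k = "\<lambda>w c. (\<exists>x. x \<E> V \<and> (c = \<langle>emp, x\<rangle> \<and> d $ w \<E> d $ x)) \<or>
     (\<exists>x. x \<E> V \<and> (\<exists>y. y \<E> V \<and> (\<exists>z. z \<E> V \<and> (c = \<langle>sing emp, \<langle>x, \<langle>y, z\<rangle>\<rangle>\<rangle> \<and> \<Psi> (d $ w) (d $ x) (d $ y) (d $ z)))))"
  have 0: "Inv (sing emp)" "Inv (sing (sing emp))"
    unfolding Inv_def good_def
    using embedding.dot_set[OF embedding.intro[OF limit_rank_axioms embedding_axioms.intro]]
      embedding.k_ops(2)[OF embedding.intro[OF limit_rank_axioms embedding_axioms.intro]]
      embedding.k_emp[OF embedding.intro[OF limit_rank_axioms embedding_axioms.intro]] by (simp_all add: V_subV)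
  have c: "foT inV inV IU (\<lambda>e. emp) (\<lambda>e. emp)" "foT inV inV IU (\<lambda>e. sing emp) (\<lambda>e. sing emp)"
    by (rule foT_V_const; use 0 in simp)+
  have psi: "foI (\<lambda>e. \<Psi> (d $ e 3) (d $ e 2) (d $ e 1) (d $ e 0))" using pull[OF d \<Psi>] by simp
  have psi': "foI (\<lambda>e. \<Psi> (d $ e a) (d $ e 2) (d $ e 1) (d $ e 0))" for a
    using fo_rename[OF psi, of "\<lambda>i. if i = 3 then a else i"] by simp
  have fk: "foI (\<lambda>e. ?k (e 1) (e 0))"
    apply (intro fo_disj fo_ex fo_conj fo_eqT foT_V_var foT_V_pair tra_V c)
    subgoal using foI_mem[OF Cd_Inv(2)[OF d], of 2 0] by (simp add: numeral_2_eq_2)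
    subgoal using psi'[of 4] by (simp add: numeral_2_eq_2 eval_nat_numeral)
    done
  define K where "K = Coll (\<lambda>z. z \<E> V \<and> (\<exists>w. w \<E> V \<and> (\<exists>c. c \<E> V \<and> (z = \<langle>w, c\<rangle> \<and> ?k w c))))"
  have "foI (\<lambda>e. \<exists>w. w \<E> V \<and> (\<exists>c. c \<E> V \<and> (e 0 = \<langle>w, c\<rangle> \<and> ?k w c)))"
    by (intro fo_ex fo_conj[OF fo_eqT] foT_V_var foT_V_pair tra_V) (use fk in simp)
  from fo_coll[OF this] Inv_fo_coll[OF this] have IK: "Inv K" and K: "\<langle>w, c\<rangle> \<E> K \<longleftrightarrow> w \<E> V \<and> c \<E> V \<and> ?k w c" for w c
    unfolding K_def by auto
  define d' where "d' = lam V (\<lambda>c. Coll (\<lambda>z. \<exists>w. w \<E> prd V K c \<and> z = d $ w))"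
  have fd': "fn d' V" unfolding d'_def by (rule fn_lam) (intro D_intros)
  have m: "z \<E> d' $ c \<longleftrightarrow> (\<exists>w. w \<E> V \<and> inn K \<langle>w, c\<rangle> \<and> z = d $ w)" if "c \<E> V" for z c
  proof -
    have "d' $ c = Coll (\<lambda>z. \<exists>w. w \<E> prd V K c \<and> z = d $ w)" unfolding d'_def by (rule lam_ap[OF _ that]) (intro D_intros)
    moreover have "z \<E> Coll (\<lambda>z. \<exists>w. w \<E> prd V K c \<and> z = d $ w) \<longleftrightarrow> (\<exists>w. w \<E> prd V K c \<and> z = d $ w)"
      by (rule image_coll) (intro D_intros)
    ultimately show ?thesis by (auto simp: inn_def)
  qed
  have old: "d' $ \<langle>emp, x\<rangle> = d $ x" if x: "x \<E> V" for x
  proof (rule extensionality)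
    fix z
    have "emp \<noteq> sing emp" by (simp add: eq_emp[of "sing emp"] eq_commute[of emp])
    then have "inn K \<langle>w, \<langle>emp, x\<rangle>\<rangle> \<longleftrightarrow> w \<E> V \<and> d $ w \<E> d $ x" for w unfolding inn_def K using x by auto
    then have "z \<E> d' $ \<langle>emp, x\<rangle> \<longleftrightarrow> (\<exists>w. w \<E> V \<and> d $ w \<E> d $ x \<and> z = d $ w)" using m[of "\<langle>emp, x\<rangle>" z] x by auto
    also have "\<dots> \<longleftrightarrow> z \<E> d $ x" using d x unfolding Cd_def by metis
    finally show "z \<E> d' $ \<langle>emp, x\<rangle> \<longleftrightarrow> z \<E> d $ x" .
  qed
  have md: "z \<E> d $ x \<longleftrightarrow> (\<exists>w. w \<E> V \<and> inn (ml d) \<langle>w, x\<rangle> \<and> z = d $ w)" if "x \<E> V" for x z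
    unfolding inn_def mem_ml using d that unfolding Cd_def by auto
  \<comment> \<open>The elements of new sets are old, so equality of coded sets, old or new, reduces
    to equality of old codes. \<open>S\<close> and \<open>S'\<close> will be \<open>K\<close> for
    new and \<open>ml d\<close> for old sets.\<close>
  have eq: "f $ x = g $ y \<longleftrightarrow> (\<forall>w. w \<E> V \<longrightarrow> (inn S \<langle>w, x\<rangle> \<longrightarrow> (\<exists>v. v \<E> V \<and> (inn S' \<langle>v, y\<rangle> \<and> d $ w = d $ v)))) \<and>
     (\<forall>v. v \<E> V \<longrightarrow> (inn S' \<langle>v, y\<rangle> \<longrightarrow> (\<exists>w. w \<E> V \<and> (inn S \<langle>w, x\<rangle> \<and> d $ w = d $ v))))"
    if "\<And>z. z \<E> f $ x \<longleftrightarrow> (\<exists>w. w \<E> V \<and> inn S \<langle>w, x\<rangle> \<and> z = d $ w)" "\<And>z. z \<E> g $ y \<longleftrightarrow> (\<exists>w. w \<E> V \<and> inn S' \<langle>w, y\<rangle> \<and> z = d $ w)" for f g x y S S'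
    unfolding ext_iff[of "f $ x" "g $ y"] that by (rule image_sub)
  have feq: "foI (\<lambda>e. (\<forall>w. w \<E> V \<longrightarrow> (inn S \<langle>w, e 1\<rangle> \<longrightarrow> (\<exists>v. v \<E> V \<and> (inn S' \<langle>v, e 0\<rangle> \<and> d $ w = d $ v)))) \<and>
     (\<forall>v. v \<E> V \<longrightarrow> (inn S' \<langle>v, e 0\<rangle> \<longrightarrow> (\<exists>w. w \<E> V \<and> (inn S \<langle>w, e 1\<rangle> \<and> d $ w = d $ v)))))" if "Inv S" "Inv S'" for S S'
    by (intro fo_all fo_ex fo_conj fo_imp fo_inn foT_V_var foT_V_pair foI_eq Cd_Inv[OF d]) (use that in simp_all)
  have "foI (\<lambda>e. d' $ e 1 = d' $ e 0)" by (rule fo_cong[OF feq[OF IK IK]]) (rule eq[symmetric]; rule m; simp)+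
  then have rl': "Inv (rl d' d')" by (rule Inv_rl)
  have "foI (\<lambda>e. d $ e 1 = d' $ e 0)" by (rule fo_cong[OF feq[OF Cd_Inv(2)[OF d] IK]]) (rule eq[symmetric]; (rule m | rule md); simp)+
  then have rl: "Inv (rl d d')" by (rule Inv_rl)
  have "foI (\<lambda>e. \<exists>w. w \<E> V \<and> (inn K \<langle>w, e 0\<rangle> \<and> inn (rl d d') \<langle>w, e 1\<rangle>))"
    by (intro fo_ex fo_conj fo_inn foT_V_var foT_V_pair) (simp_all add: IK rl)
  moreover have "(\<exists>w. w \<E> V \<and> (inn K \<langle>w, c\<rangle> \<and> inn (rl d d') \<langle>w, c'\<rangle>)) \<longleftrightarrow> d' $ c' \<E> d' $ c" if "c \<E> V" "c' \<E> V" for c c'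
    unfolding m[OF that(1)] using that(2) by (auto simp: inn_def mem_rl)
  ultimately have "foI (\<lambda>e. d' $ e 1 \<E> d' $ e 0)" by (elim fo_cong) simp_all
  then have ml': "Inv (ml d')" by (rule Inv_ml)
  have "Cd d'" unfolding Cd_def
  proof (intro conjI allI impI fd' rl' ml')
    fix x w assume x: "x \<E> V" and w: "w \<E> d' $ x"
    then obtain v where v: "v \<E> V" "w = d $ v" using m[OF x] by blast
    then show "\<exists>y. y \<E> V \<and> w = d' $ y" using old[OF v(1)] by (intro exI[of _ "\<langle>emp, v\<rangle>"]) simp
  qed
  moreover have "Lk d d'" unfolding Lk_def
    using rl old by (intro conjI allI impI) (rule exI[of _ "\<langle>emp, x\<rangle>" for x], auto)
  moreover have "\<exists>v. rg d' v \<and> (\<forall>w. w \<E> v \<longleftrightarrow> rg d w \<and> \<Psi> w x y z)" if r: "rg d x" "rg d y" "rg d z" for x y z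
  proof -
    obtain a b c where abc: "a \<E> V" "b \<E> V" "c \<E> V" "x = d $ a" "y = d $ b" "z = d $ c" using r unfolding rg_def by blast
    let ?c = "\<langle>sing emp, \<langle>a, \<langle>b, c\<rangle>\<rangle>\<rangle>"
    have "sing emp \<noteq> emp" by (simp add: eq_emp[of "sing emp"])
    then have "inn K \<langle>w, ?c\<rangle> \<longleftrightarrow> w \<E> V \<and> \<Psi> (d $ w) x y z" for w unfolding inn_def K using abc by auto
    then have "w \<E> d' $ ?c \<longleftrightarrow> rg d w \<and> \<Psi> w x y z" for w using m[of ?c w] abc unfolding rg_def by auto
    moreover have "rg d' (d' $ ?c)" using abc by (intro rgI) simp
    ultimately show ?thesis by blast
  qed
  ultimately show thesis by (rule that)
qed

definition Sys :: "'a \<Rightarrow> ('a \<Rightarrow> 'a \<Rightarrow> 'a \<Rightarrow> 'a) set \<Rightarrow> 'a \<Rightarrow> bool" where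
  "Sys d0 S d \<longleftrightarrow> Cd d \<and> Lk d0 d \<and> (\<forall>f\<in>S. \<forall>x y z. rg d0 x \<longrightarrow> rg d0 y \<longrightarrow> rg d0 z \<longrightarrow> rg d (f x y z))"

text \<open>\<open>adj\<close> only forms sets of elements that are already coded, whence the
  premise on the elements of the values of \<open>f\<close>.\<close>

lemma Sys_insert:
  assumes S: "\<exists>d. Sys d0 S d"
    and f: "\<And>U. bfo U (\<lambda>e. e 3 \<E> f (e 2) (e 1) (e 0)) (\<lambda>e. e 3 \<E> f (e 2) (e 1) (e 0))"
    and cl: "\<And>d x y z w. Sys d0 S d \<Longrightarrow> rg d0 x \<Longrightarrow> rg d0 y \<Longrightarrow> rg d0 z \<Longrightarrow> w \<E> f x y z \<Longrightarrow> rg d w"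
  shows "\<exists>d. Sys d0 (insert f S) d"
proof -
  obtain d where d: "Sys d0 S d" using S by blast
  then have d2: "Cd d" "Lk d0 d" by (simp_all add: Sys_def)
  note T = Cd_tra[OF d2(1)]
  obtain d' where d': "Cd d'" "Lk d d'" "\<And>x y z. rg d x \<Longrightarrow> rg d y \<Longrightarrow> rg d z \<Longrightarrow> \<exists>v. rg d' v \<and> (\<forall>w. w \<E> v \<longleftrightarrow> rg d w \<and> w \<E> f x y z)"
    by (rule adj[OF d2(1) bfo_fo0[OF f T T]]) (rule that)
  have "rg d' (f x y z)" if r: "rg d0 x" "rg d0 y" "rg d0 z" for x y z
  proof -
    obtain v where v: "rg d' v" "\<And>w. w \<E> v \<longleftrightarrow> rg d w \<and> w \<E> f x y z" using d'(3)[OF r[THEN Lk_rg[OF d2(2)]]] by blast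
    have "v = f x y z" by (rule extensionality) (use v(2) cl[OF d r] in blast)
    then show ?thesis using v(1) by simp
  qed
  then have "Sys d0 (insert f S) d'" using d Lk_trans[OF d2(2) d'(2)] d'(1) Lk_rg[OF d'(2)] unfolding Sys_def by simp
  then show ?thesis by blast
qed

lemma Sys_rg: "Sys d0 S d \<Longrightarrow> rg d0 x \<Longrightarrow> rg d x"
  unfolding Sys_def using Lk_rg by blast

lemma SysD: "Sys d0 S d \<Longrightarrow> f \<in> S \<Longrightarrow> rg d0 x \<Longrightarrow> rg d0 y \<Longrightarrow> rg d0 z \<Longrightarrow> rg d (f x y z)"
  unfolding Sys_def by blast

text \<open>The functions of \<open>basis\<close>, ordered such that the elements of a value are
  themselves arguments, their elements, or values of functions further down the list:
  \<open>Sys_FL\<close> inserts from the end.\<close>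

definition FL :: "('a \<Rightarrow> 'a \<Rightarrow> 'a \<Rightarrow> 'a) list" where
  "FL = [\<lambda>x y z. imgs x y, \<lambda>x y z. img x y, \<lambda>x y z. ins x y, \<lambda>x y z. memx x y, \<lambda>x y z. ran x, \<lambda>x y z. prod x y, \<lambda>x y z. dif x y,
    \<lambda>x y z. \<langle>x, \<langle>y, z\<rangle>\<rangle>, \<lambda>x y z. up x \<langle>y, z\<rangle>, \<lambda>x y z. \<langle>x, y\<rangle>, \<lambda>x y z. up x y, \<lambda>x y z. x]"

lemma basis_FL: "w \<in> set (basis x y z) \<longleftrightarrow> (\<exists>f\<in>set FL. w = f x y z)"
  unfolding basis_def FL_def by auto

lemma rg_pair: assumes "Cd d" "rg d p" "\<langle>u, v\<rangle> \<E> p" shows "rg d u" "rg d v"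
proof -
  have "rg d \<langle>u, v\<rangle>" using rg_mem[OF assms] .
  then have "rg d (up u v)" using rg_mem[OF assms(1), of "\<langle>u, v\<rangle>" "up u v"] by (simp add: kpair_def)
  then show "rg d u" "rg d v" using rg_mem[OF assms(1), of "up u v"] by simp_all
qed

lemma bfo_FL:
  assumes "f \<in> set FL"
  shows "bfo U (\<lambda>e. e 3 \<E> f (e 2) (e 1) (e 0)) (\<lambda>e. e 3 \<E> f (e 2) (e 1) (e 0))"
proof -
  have 1: "w \<E> \<langle>x, y\<rangle> \<longleftrightarrow> w = up x x \<or> w = up x y" for w x y by (simp add: kpair_def)
  have 2: "w \<E> ins x y \<longleftrightarrow> (\<exists>p. p \<E> x \<and> (\<exists>u t. p = \<langle>u, t\<rangle> \<and> (\<exists>z. z \<E> y \<and> w = \<langle>u, \<langle>z, t\<rangle>\<rangle>)))" for w x y unfolding mem_ins by blast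
  have 3: "w \<E> memx x y \<longleftrightarrow> (\<exists>u. u \<E> x \<and> (\<exists>v. v \<E> x \<and> (\<exists>t. t \<E> y \<and> (u \<E> v \<and> w = \<langle>u, \<langle>v, t\<rangle>\<rangle>))))" for w x y unfolding mem_memx by blast
  have 4: "w \<E> ran x \<longleftrightarrow> (\<exists>p. p \<E> x \<and> (\<exists>u t. p = \<langle>u, t\<rangle> \<and> t = w))" for w x unfolding mem_ran by blast
  have 5: "w \<E> prod x y \<longleftrightarrow> (\<exists>u. u \<E> x \<and> (\<exists>v. v \<E> y \<and> w = \<langle>u, v\<rangle>))" for w x y unfolding mem_prod by blast
  have 6: "w = up x \<langle>y, z\<rangle> \<longleftrightarrow> x \<E> w \<and> (\<exists>v. v \<E> w \<and> v = \<langle>y, z\<rangle>) \<and> (\<forall>v. v \<E> w \<longrightarrow> v = x \<or> v = \<langle>y, z\<rangle>)" for w x y z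
    unfolding ext_iff[of w] by auto
  have 7: "w \<E> imgs x y \<longleftrightarrow> (\<exists>z. z \<E> y \<and> ((\<forall>v. v \<E> w \<longrightarrow> \<langle>v, z\<rangle> \<E> x) \<and> (\<forall>p. p \<E> x \<longrightarrow> \<not> (\<exists>u t. p = \<langle>u, t\<rangle> \<and> (t = z \<and> \<not> u \<E> w)))))" for w x y
    unfolding mem_imgs ext_iff[of w] mem_img by blast
  show ?thesis using assms unfolding FL_def list.set insert_iff empty_iff
    apply (elim disjE FalseE; hypsubst)
               apply (unfold 1 2 3 4 5 6 7 mem_img mem_dif mem_up)
               apply (intro bfo_intros)+
    done
qed

lemma Sys_FL: assumes d0: "Cd d0" shows "\<exists>d. Sys d0 (set FL) d"
proof -
  have "\<exists>d. Sys d0 {} d" using d0 Lk_refl unfolding Sys_def by blast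
  note rgs = rg_mem[OF d0] rg_pair[OF d0]
  show ?thesis unfolding FL_def list.set
    apply (rule Sys_insert[OF _ bfo_FL], rule Sys_insert[OF _ bfo_FL], rule Sys_insert[OF _ bfo_FL], rule Sys_insert[OF _ bfo_FL],
      rule Sys_insert[OF _ bfo_FL], rule Sys_insert[OF _ bfo_FL], rule Sys_insert[OF _ bfo_FL], rule Sys_insert[OF _ bfo_FL],
      rule Sys_insert[OF _ bfo_FL], rule Sys_insert[OF _ bfo_FL], rule Sys_insert[OF _ bfo_FL], rule Sys_insert[OF _ bfo_FL], fact)
    subgoal by (simp add: FL_def)
    subgoal for d x y z w using rgs(1) Sys_rg by blast
    subgoal by (simp add: FL_def)
    subgoal for d x y z w using Sys_rg by auto
    subgoal by (simp add: FL_def)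
    subgoal for d x y z w using SysD[of d0 _ d "\<lambda>x y z. up x y" x x z] SysD[of d0 _ d "\<lambda>x y z. up x y" x y z] by (auto simp: kpair_def)
    subgoal by (simp add: FL_def)
    subgoal for d x y z w using SysD[of d0 _ d "\<lambda>x y z. \<langle>x, y\<rangle>" y z z] Sys_rg by auto
    subgoal by (simp add: FL_def)
    subgoal for d x y z w using SysD[of d0 _ d "\<lambda>x y z. up x y" x x z] SysD[of d0 _ d "\<lambda>x y z. up x \<langle>y, z\<rangle>" x y z] by (auto simp: kpair_def[of _ x])
    subgoal by (simp add: FL_def)
    subgoal for d x y z w using rgs(1)[of x w] Sys_rg by auto
    subgoal by (simp add: FL_def)
    subgoal for d x y z w by (unfold mem_prod, elim exE conjE, hypsubst, rule SysD[where f="\<lambda>x y z. \<langle>x, y\<rangle>" and z=x], assumption, simp) (erule (1) rgs(1))+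
    subgoal by (simp add: FL_def)
    subgoal for d x y z w by (unfold mem_ran, elim exE, rule Sys_rg, assumption, rule rgs(3))
    subgoal by (simp add: FL_def)
    subgoal for d x y z w by (unfold mem_memx, elim exE conjE, hypsubst, rule SysD[where f="\<lambda>x y z. \<langle>x, \<langle>y, z\<rangle>\<rangle>"], assumption, simp) (rule rgs(1), assumption+)+
    subgoal by (simp add: FL_def)
    subgoal for d x y z w by (unfold mem_ins, elim exE conjE, hypsubst, rule SysD[where f="\<lambda>x y z. \<langle>x, \<langle>y, z\<rangle>\<rangle>"], assumption, simp) (rule rgs, assumption, assumption)+
    subgoal by (simp add: FL_def)
    subgoal for d x y z w by (unfold mem_img, rule Sys_rg, assumption, rule rgs(2))
    subgoal by (simp add: FL_def)
    subgoal for d x y z w by (unfold mem_imgs, elim exE conjE, hypsubst, rule SysD[where f="\<lambda>x y z. img x y" and z=x], assumption, simp) (assumption | rule rgs(1))+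
    done
qed

end

section \<open>Codings of the levels of the rudimentary closure\<close>

context limit_rank
begin

lemma Lk_pb:
  assumes L: "Lk d d'" and u: "\<And>w. w \<E> u \<Longrightarrow> rg d w" and I: "Inv (pb d u)"
  shows "Inv (pb d' u)"
proof (rule Inv_fo)
  have "Inv (rl d d')" using L by (simp add: Lk_def)
  then show "foI (\<lambda>e. \<exists>x. x \<E> V \<and> (inn (pb d u) x \<and> inn (rl d d') \<langle>x, e 0\<rangle>))"
    by (intro fo_ex fo_conj fo_inn foT_V_var foT_V_pair) (simp_all add: I)
  show "c \<E> pb d' u \<longleftrightarrow> c \<E> V \<and> (\<exists>x. x \<E> V \<and> (inn (pb d u) x \<and> inn (rl d d') \<langle>x, c\<rangle>))" for c
    using u[of "d' $ c"] unfolding inn_def mem_rl rg_def mem_pb by (auto; metis)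
qed

text \<open>First the values of \<open>FL\<close> on the coded elements are adjoined, then
  \<open>u\<close> itself, which is an element of \<open>Sop u\<close>. The invariance of the class
  of codes for \<open>Sop u\<close> is read off from a first-order definition over the final
  coding.\<close>

lemma Cd_Sop:
  assumes d0: "Cd d0" and u: "\<And>w. w \<E> u \<Longrightarrow> rg d0 w" and I: "Inv (pb d0 u)"
  shows "\<exists>d. Cd d \<and> Lk d0 d \<and> (\<forall>w. w \<E> Sop u \<longrightarrow> rg d w) \<and> Inv (pb d (Sop u))"
proof -
  obtain d1 where d1: "Sys d0 (set FL) d1" using Sys_FL[OF d0] by blast
  then have C1: "Cd d1" "Lk d0 d1" by (simp_all add: Sys_def)
  have I1: "Inv (pb d1 u)" by (rule Lk_pb[OF C1(2) u I])
  note T1 = Cd_tra[OF C1(1)]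
  have "fo (rg d1) (rg d1) (PB d1) (\<lambda>e. inn u (e 3)) (\<lambda>e. inn u (e 3))"
    by (intro fo_inn foT_var T1) (simp add: I1)
  then obtain d where d: "Cd d" "Lk d1 d" "\<And>x. rg d1 x \<Longrightarrow> \<exists>v. rg d v \<and> (\<forall>w. w \<E> v \<longleftrightarrow> rg d1 w \<and> inn u w)"
    by (rule adj[OF C1(1), where \<Psi>="\<lambda>w x y z. inn u w"]) blast
  have L: "Lk d0 d" by (rule Lk_trans[OF C1(2) d(2)])
  have u1: "w \<E> u \<Longrightarrow> rg d1 w" for w using Lk_rg[OF C1(2) u] .
  obtain v where v: "rg d v" "\<And>w. w \<E> v \<longleftrightarrow> rg d1 w \<and> inn u w" using d(3)[OF rgI[OF V_emp]] by blast
  have "v = u" by (rule extensionality) (use v(2) u1 in \<open>auto simp: inn_def\<close>)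
  then have ru: "rg d u" using v(1) by simp
  have Id: "Inv (pb d u)" by (rule Lk_pb[OF d(2) u1 I1])
  have rf: "rg d (f x y z)" if "f \<in> set FL" "x \<E> u" "y \<E> u" "z \<E> u" for f x y z
    by (rule Lk_rg[OF d(2) SysD[OF d1 that(1) u[OF that(2)] u[OF that(3)] u[OF that(4)]]])
  note T = Cd_tra[OF d(1)]
  \<comment> \<open>The equation \<open>b = f x y z\<close> in elementwise form, because
    \<open>bfo_FL\<close> only provides membership in the value.\<close>
  define Q where "Q f b \<longleftrightarrow> (\<exists>x. rg d x \<and> (inn u x \<and> (\<exists>y. rg d y \<and> (inn u y \<and> (\<exists>z. rg d z \<and> (inn u z \<and> (\<forall>w. rg d w \<longrightarrow> (w \<E> b \<longleftrightarrow> w \<E> f x y z))))))))" for f b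
  have fq: "fo (rg d) (rg d) (PB d) (\<lambda>e. Q f (e 0)) (\<lambda>e. Q f (e 0))" if f: "f \<in> set FL" for f
  proof -
    have "fo (rg d) (rg d) (PB d) (\<lambda>e. e 0 \<E> f (e (Suc (Suc (Suc 0)))) (e (Suc (Suc 0))) (e (Suc 0))) (\<lambda>e. e 0 \<E> f (e (Suc (Suc (Suc 0)))) (e (Suc (Suc 0))) (e (Suc 0)))"
      using bfo_rename[OF bfo_FL[OF f], of _ "\<lambda>i. if i = 3 then 0 else Suc i"] by (intro bfo_fo0[OF _ T T]) (simp add: eval_nat_numeral)
    then show ?thesis unfolding Q_def by (intro fo_ex fo_all fo_conj fo_iff fo_inn foT_var T fo_mem) (simp_all add: Id)
  qed
  have eqI: "(\<forall>w. rg d w \<longrightarrow> (w \<E> b \<longleftrightarrow> w \<E> c)) \<longleftrightarrow> b = c" if "rg d b" "rg d c" for b c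
    using rg_mem[OF d(1) that(1)] rg_mem[OF d(1) that(2)] extensionality[of b c] by metis
  have Qf: "Q f b \<longleftrightarrow> (\<exists>x y z. x \<E> u \<and> y \<E> u \<and> z \<E> u \<and> b = f x y z)" if "f \<in> set FL" "rg d b" for f b
  proof -
    have "Q f b \<longleftrightarrow> (\<exists>x. rg d x \<and> (x \<E> u \<and> (\<exists>y. rg d y \<and> (y \<E> u \<and> (\<exists>z. rg d z \<and> (z \<E> u \<and> b = f x y z))))))"
      unfolding Q_def inn_def using eqI[OF that(2) rf[OF that(1)]] by (intro iff_exI conj_cong refl) blast
    then show ?thesis using Lk_rg[OF d(2) u1] by blast
  qed
  have "fo (rg d) (rg d) (PB d) (\<lambda>e. (\<forall>v. rg d v \<longrightarrow> (v \<E> e 0 \<longleftrightarrow> inn u v)) \<or> \<not> (\<forall>f\<in>set FL. \<not> Q f (e 0)))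
     (\<lambda>e. (\<forall>v. rg d v \<longrightarrow> (v \<E> e 0 \<longleftrightarrow> inn u v)) \<or> \<not> (\<forall>f\<in>set FL. \<not> Q f (e 0)))"
    by (intro fo_disj fo_all fo_iff fo_mem fo_inn foT_var T fo_neg fo_Ball fq) (simp_all add: Id)
  from pull[OF d(1) this] have fI: "foI (\<lambda>e. (\<forall>v. rg d v \<longrightarrow> (v \<E> d $ e 0 \<longleftrightarrow> inn u v)) \<or> \<not> (\<forall>f\<in>set FL. \<not> Q f (d $ e 0)))" .
  have S: "b \<E> Sop u \<longleftrightarrow> (\<forall>v. rg d v \<longrightarrow> (v \<E> b \<longleftrightarrow> inn u v)) \<or> \<not> (\<forall>f\<in>set FL. \<not> Q f b)" if b: "rg d b" for b
  proof -
    have "(\<exists>x y z. x \<E> u \<and> y \<E> u \<and> z \<E> u \<and> b \<in> set (basis x y z)) \<longleftrightarrow> (\<exists>f\<in>set FL. Q f b)"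
      unfolding basis_FL using Qf[OF _ b] by blast
    then show ?thesis unfolding mem_Sop inn_def eqI[OF b ru] by blast
  qed
  have "rg d w" if "w \<E> Sop u" for w
    using that unfolding mem_Sop basis_FL using ru rf by blast
  moreover have "Inv (pb d (Sop u))"
    by (rule Inv_fo[OF fI], unfold mem_pb, rule conj_cong[OF refl], rule S, erule rgI)
  ultimately show ?thesis using d(1) L by blast
qed

definition idV :: 'a where "idV = lam V (\<lambda>x. x)"

lemma idV: "fn idV V" "x \<E> V \<Longrightarrow> idV $ x = x"
  unfolding idV_def by (rule fn_lam, intro D_intros) (rule lam_ap, intro D_intros)

lemma Cd_idV: "Cd idV"
  unfolding Cd_def
proof (intro conjI allI impI idV(1))
  show "\<exists>y. y \<E> V \<and> w = idV $ y" if "x \<E> V" "w \<E> idV $ x" for x w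
    using that V_tran[of x w] idV(2)[of w] idV(2)[of x] by (intro exI[of _ w]) simp
  have "foI (\<lambda>e. e 1 = e 0)" by (rule fo_eq[OF tra_V tra_V])
  then have "foI (\<lambda>e. idV $ e 1 = idV $ e 0)" by (rule fo_cong) (simp_all add: idV(2))
  then show "Inv (rl idV idV)" by (rule Inv_rl)
  have "foI (\<lambda>e. e 1 \<E> e 0)" by (rule fo_mem)
  then have "foI (\<lambda>e. idV $ e 1 \<E> idV $ e 0)" by (rule fo_cong) (simp_all add: idV(2))
  then show "Inv (ml idV)" by (rule Inv_ml)
qed

definition Lev :: "'a \<Rightarrow> 'a \<Rightarrow> bool" where
  "Lev n d \<longleftrightarrow> Cd d \<and> (\<forall>w. w \<E> lev n \<longrightarrow> rg d w) \<and> Inv (pb d (lev n))"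

lemma D_Lev [D_intros]: "DT x \<Longrightarrow> DT y \<Longrightarrow> D (\<lambda>e. Lev (x e) (y e))"
  by (erule (1) D_subst2) (unfold Lev_def, intro D_intros)

text \<open>Codings of the levels are only shown to exist, and no coherent sequence of them is
  chosen. Hence the link to the given \<open>dm\<close> is part of the induction, which effectively
  starts at \<open>m\<close>.\<close>

lemma Lev_above:
  assumes m: "m \<E> om" and dm: "Lev m dm" and n: "n \<E> om"
  shows "n \<E> m \<or> (\<exists>d. Lev n d \<and> Lk dm d)"
proof (rule om_induct[where P="\<lambda>n. n \<E> m \<or> (\<exists>d. Lev n d \<and> Lk dm d)", OF _ _ _ n])
  have r: "Lk dm dm" using dm Lk_refl by (simp add: Lev_def)
  have mn: "n \<E> m \<or> n = m \<or> m \<E> n" if "n \<E> om" for n by (rule Ord_linear[OF om_Ord[OF that] om_Ord[OF m]])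
  show "D (\<lambda>e. e 0 \<E> m \<or> (\<exists>d. Lev (e 0) d \<and> Lk dm d))" by (intro D_intros)
  show "emp \<E> m \<or> (\<exists>d. Lev emp d \<and> Lk dm d)" using mn[OF om_0] dm r by auto
  fix n assume n: "n \<E> om" and IH: "n \<E> m \<or> (\<exists>d. Lev n d \<and> Lk dm d)"
  show "suc n \<E> m \<or> (\<exists>d. Lev (suc n) d \<and> Lk dm d)"
  proof (cases "n \<E> m")
    case True
    then have "suc n \<E> m \<or> suc n = m" using mn[OF om_suc[OF n]] mem_asym[of n m] by auto
    then show ?thesis using dm r by auto
  next
    case False
    then obtain d where d: "Lev n d" "Lk dm d" using IH by blast
    have "\<exists>d'. Cd d' \<and> Lk d d' \<and> (\<forall>w. w \<E> Sop (lev n) \<longrightarrow> rg d' w) \<and> Inv (pb d' (Sop (lev n)))"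
      by (rule Cd_Sop) (use d(1) in \<open>simp_all add: Lev_def\<close>)
    then show ?thesis unfolding Lev_def aseq(3)[OF n] using Lk_trans[OF d(2)] by blast
  qed
qed

lemma Lev_emp: "Lev emp idV"
proof -
  have "pb idV V = V" by (rule extensionality) (auto simp: idV(2))
  then show ?thesis unfolding Lev_def aseq(2) using Cd_idV idV(2) by (auto simp: rg_def)
qed

text \<open>Implicit definability suffices: by elementarity of \<open>k\<close>, the class
  \<open>dot k T\<close> satisfies the same condition as \<open>T\<close>.\<close>

lemma Inv_unique:
  assumes T: "T \<sqsubseteq> V" "G T" and fo: "\<And>k. good k \<Longrightarrow> fo inV inV (DK k) (\<lambda>_. G T) (\<lambda>_. G (dot k T))"
    and un: "\<And>T'. T' \<sqsubseteq> V \<Longrightarrow> G T' \<Longrightarrow> T' = T"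
  shows "Inv T"
  unfolding Inv_def
proof (intro conjI allI impI T(1))
  fix k assume k: "good k"
  have "G T \<longleftrightarrow> G (dot k T)" using good_elem[OF k fo[OF k], of "\<lambda>_. emp"] by simp
  then show "dot k T = T" using un[OF dot_sub] T(2) by blast
qed

subsection \<open>Invariance of satisfaction\<close>

definition co :: "'a \<Rightarrow> 'a \<Rightarrow> 'a" where "co d t = lam om (\<lambda>i. d $ (t $ i))"

lemma DT_co [D_intros]: "DT x \<Longrightarrow> DT y \<Longrightarrow> DT (\<lambda>e. co (x e) (y e))"
  by (erule (1) DT_subst2) (unfold co_def, intro D_intros)

lemma co: "fn (co d t) om" "i \<E> om \<Longrightarrow> co d t $ i = d $ (t $ i)"
  unfolding co_def by (rule fn_lam, intro D_intros) (rule lam_ap, intro D_intros)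

lemma co_Maps: "Maps t om (pb d u) \<Longrightarrow> Maps (co d t) om u"
  by (simp add: Maps_fn co)

lemma co_upd:
  assumes i: "i \<E> om" and n: "\<And>n. n \<E> om \<Longrightarrow> n \<noteq> i \<Longrightarrow> t' $ n = t $ n"
  shows "co d t' = upd (co d t) i (d $ (t' $ i))"
proof (rule fn_ext[OF co(1) upd_fn[OF co(1) i]])
  show "co d t' $ x = upd (co d t) i (d $ (t' $ i)) $ x" if "x \<E> om" for x
    using that n[of x] by (simp add: upd_ap[OF co(1) i that] co(2))
qed

lemma upd_V: assumes "t \<E> V" "x \<E> V" "y \<E> V" shows "upd t x y \<E> V"
proof (rule V_sub)
  show "cup t (sing \<langle>x, y\<rangle>) \<E> V" using assms by simp
  show "upd t x y \<sqsubseteq> cup t (sing \<langle>x, y\<rangle>)" by (rule subI) (auto simp: mem_upd)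
qed

end

context limit_rank_om
begin

lemma Inv_Vom: assumes "B \<sqsubseteq> Vom" shows "Inv B"
proof -
  have B: "B \<E> V" by (rule V_sub[OF V_Vom assms])
  have "dot k B = B" if "good k" for k
  proof -
    interpret embedding_om mem l k using that by unfold_locales (simp_all add: good_def oml)
    show ?thesis using dot_set[OF B] k_sub_Vom[OF assms] by simp
  qed
  then show ?thesis unfolding Inv_def using V_subV[OF B] by blast
qed

lemma Inv_om: "Inv om" using Inv_Vom om_Vom subI by blast

lemma Inv_nat: "n \<E> om \<Longrightarrow> Inv n"
  using Inv_Vom subI om_Vom Ord_TranD[OF Ord_om] by blast

definition asg :: "'a \<Rightarrow> 'a" where "asg Q = Coll (\<lambda>t. t \<E> V \<and> Maps t om Q)"

lemma mem_asg [simp]: "t \<E> asg Q \<longleftrightarrow> t \<E> V \<and> Maps t om Q"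
  unfolding asg_def by (rule mem_sep) (intro D_intros)

lemma Inv_asg: assumes "Inv Q" shows "Inv (asg Q)"
proof (rule Inv_fo)
  show "foI (\<lambda>e. (\<forall>p. p \<E> V \<longrightarrow> (p \<E> e 0 \<longrightarrow> (\<exists>x. x \<E> V \<and> (\<exists>y. y \<E> V \<and> (inn om x \<and> (inn Q y \<and> p = \<langle>x, y\<rangle>)))))) \<and>
     (\<forall>x. x \<E> V \<longrightarrow> (inn om x \<longrightarrow> (\<exists>y. y \<E> V \<and> (\<langle>x, y\<rangle> \<E> e 0 \<and> (\<forall>z. z \<E> V \<longrightarrow> (\<langle>x, z\<rangle> \<E> e 0 \<longrightarrow> z = y)))))))"
    by (intro fo_intros) (simp_all add: Inv_om assms)
  fix t
  have *: "Maps t om Q \<longleftrightarrow> (\<forall>p. p \<E> V \<longrightarrow> (p \<E> t \<longrightarrow> (\<exists>x. x \<E> V \<and> (\<exists>y. y \<E> V \<and> (inn om x \<and> (inn Q y \<and> p = \<langle>x, y\<rangle>)))))) \<and>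
     (\<forall>x. x \<E> V \<longrightarrow> (inn om x \<longrightarrow> (\<exists>y. y \<E> V \<and> (\<langle>x, y\<rangle> \<E> t \<and> (\<forall>z. z \<E> V \<longrightarrow> (\<langle>x, z\<rangle> \<E> t \<longrightarrow> z = y))))))" (is "_ \<longleftrightarrow> ?A \<and> ?B") if t: "t \<E> V"
  proof -
    have pV: "p \<E> t \<Longrightarrow> p \<E> V" for p by (rule V_tran[OF t])
    then have p2: "\<langle>x, y\<rangle> \<E> t \<Longrightarrow> x \<E> V \<and> y \<E> V" for x y using V_pair by blast
    have "?A \<longleftrightarrow> (\<forall>p. p \<E> t \<longrightarrow> (\<exists>x y. x \<E> om \<and> y \<E> Q \<and> p = \<langle>x, y\<rangle>))" unfolding inn_def using pV p2 by metis
    moreover have "?B \<longleftrightarrow> (\<forall>x. x \<E> om \<longrightarrow> (\<exists>!y. \<langle>x, y\<rangle> \<E> t))" unfolding inn_def Ex1_def using p2 V_nat by metis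
    ultimately show ?thesis unfolding maps_def by simp
  qed
  show "t \<E> asg Q \<longleftrightarrow> t \<E> V \<and> ((\<forall>p. p \<E> V \<longrightarrow> (p \<E> t \<longrightarrow> (\<exists>x. x \<E> V \<and> (\<exists>y. y \<E> V \<and> (inn om x \<and> (inn Q y \<and> p = \<langle>x, y\<rangle>)))))) \<and>
     (\<forall>x. x \<E> V \<longrightarrow> (inn om x \<longrightarrow> (\<exists>y. y \<E> V \<and> (\<langle>x, y\<rangle> \<E> t \<and> (\<forall>z. z \<E> V \<longrightarrow> (\<langle>x, z\<rangle> \<E> t \<longrightarrow> z = y)))))))"
    unfolding mem_asg by (rule conj_cong[OF refl *])
qed

text \<open>As \<open>p\<close> may be non-standard, \<open>Sat u p\<close> cannot be unfolded into
  an \<open>fo\<close> predicate. So the whole satisfaction relation, read on codes, is treated at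
  once; its section at \<open>p\<close> is invariant because embeddings fix
  \<open>p\<close>.\<close>

lemma sat_Inv:
  assumes d: "Cd d" and u: "\<And>w. w \<E> u \<Longrightarrow> rg d w" and I: "Inv (pb d u)" and p: "Formula p"
  shows "\<exists>B. Inv B \<and> (\<forall>t. t \<E> B \<longleftrightarrow> t \<E> asg (pb d u) \<and> Sat u p (co d t))"
proof -
  define A where "A = asg (pb d u)"
  have At: "t \<E> A \<longleftrightarrow> t \<E> V \<and> Maps t om (pb d u)" for t unfolding A_def by simp
  have IA: "Inv A" unfolding A_def by (rule Inv_asg[OF I])
  \<comment> \<open>The syntactic operations enter as relations on \<open>Vom\<close>, since all
    subsets of \<open>Vom\<close> are invariant.\<close>
  define GM where "GM = Coll (\<lambda>z. z \<E> Vom \<and> (\<exists>i k. i \<E> om \<and> k \<E> om \<and> z = \<langle>cM i k, \<langle>i, k\<rangle>\<rangle>))"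
  define GE where "GE = Coll (\<lambda>z. z \<E> Vom \<and> (\<exists>i k. i \<E> om \<and> k \<E> om \<and> z = \<langle>cE i k, \<langle>i, k\<rangle>\<rangle>))"
  define GN where "GN = Coll (\<lambda>z. z \<E> Vom \<and> (\<exists>q. Formula q \<and> z = \<langle>cN q, q\<rangle>))"
  define GC where "GC = Coll (\<lambda>z. z \<E> Vom \<and> (\<exists>q r. Formula q \<and> Formula r \<and> z = \<langle>cC q r, \<langle>q, r\<rangle>\<rangle>))"
  define GX where "GX = Coll (\<lambda>z. z \<E> Vom \<and> (\<exists>i q. i \<E> om \<and> Formula q \<and> z = \<langle>cX i q, \<langle>i, q\<rangle>\<rangle>))"
  have G0: "z \<E> GM \<longleftrightarrow> z \<E> Vom \<and> (\<exists>i k. i \<E> om \<and> k \<E> om \<and> z = \<langle>cM i k, \<langle>i, k\<rangle>\<rangle>)"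
    "z \<E> GE \<longleftrightarrow> z \<E> Vom \<and> (\<exists>i k. i \<E> om \<and> k \<E> om \<and> z = \<langle>cE i k, \<langle>i, k\<rangle>\<rangle>)"
    "z \<E> GN \<longleftrightarrow> z \<E> Vom \<and> (\<exists>q. Formula q \<and> z = \<langle>cN q, q\<rangle>)"
    "z \<E> GC \<longleftrightarrow> z \<E> Vom \<and> (\<exists>q r. Formula q \<and> Formula r \<and> z = \<langle>cC q r, \<langle>q, r\<rangle>\<rangle>)"
    "z \<E> GX \<longleftrightarrow> z \<E> Vom \<and> (\<exists>i q. i \<E> om \<and> Formula q \<and> z = \<langle>cX i q, \<langle>i, q\<rangle>\<rangle>)" for z
    unfolding GM_def GE_def GN_def GC_def GX_def by (rule mem_sep, intro D_intros)+
  note VV = Vom_pair om_Vom codes_Vom Formula_Vom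
  have G: "\<langle>p, \<langle>i, k\<rangle>\<rangle> \<E> GM \<longleftrightarrow> i \<E> om \<and> k \<E> om \<and> p = cM i k" "\<langle>p, \<langle>i, k\<rangle>\<rangle> \<E> GE \<longleftrightarrow> i \<E> om \<and> k \<E> om \<and> p = cE i k"
    "\<langle>p, q\<rangle> \<E> GN \<longleftrightarrow> Formula q \<and> p = cN q" "\<langle>p, \<langle>q, r\<rangle>\<rangle> \<E> GC \<longleftrightarrow> Formula q \<and> Formula r \<and> p = cC q r"
    "\<langle>p, \<langle>i, q\<rangle>\<rangle> \<E> GX \<longleftrightarrow> i \<E> om \<and> Formula q \<and> p = cX i q" for p q r i k
    unfolding G0 using VV by auto
  have "GM \<sqsubseteq> Vom" "GE \<sqsubseteq> Vom" "GN \<sqsubseteq> Vom" "GC \<sqsubseteq> Vom" "GX \<sqsubseteq> Vom"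
    by (rule subI, unfold G0, blast)+
  then have IG: "Inv GM" "Inv GE" "Inv GN" "Inv GC" "Inv GX" by (simp_all add: Inv_Vom)
  have IF: "Inv Fm" by (rule Inv_Vom, rule subI) (simp add: Formula_Vom)
  \<comment> \<open>The first conjunct confines \<open>T\<close> to pairs of formulas and
    assignments, for the sake of uniqueness. In the last clause, a new value at \<open>i\<close> is
    given by an assignment \<open>t'\<close> of codes that agrees with \<open>t\<close>
    elsewhere.\<close>
  define Cl where "Cl T \<longleftrightarrow> (\<forall>z. z \<E> V \<longrightarrow> (inn T z \<longrightarrow> (\<exists>p. p \<E> V \<and> (\<exists>t. t \<E> V \<and> (z = \<langle>p, t\<rangle> \<and> (inn Fm p \<and> inn A t)))))) \<and>
    (\<forall>t. t \<E> V \<longrightarrow> (inn A t \<longrightarrow>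
      (\<forall>p. p \<E> V \<longrightarrow> (\<forall>i. i \<E> V \<longrightarrow> (\<forall>k. k \<E> V \<longrightarrow> (inn GM \<langle>p, \<langle>i, k\<rangle>\<rangle> \<longrightarrow> (inn T \<langle>p, t\<rangle> \<longleftrightarrow> (\<exists>a. a \<E> V \<and> (\<exists>b. b \<E> V \<and> (\<langle>i, a\<rangle> \<E> t \<and> (\<langle>k, b\<rangle> \<E> t \<and> inn (ml d) \<langle>a, b\<rangle>))))))))) \<and>
      (\<forall>p. p \<E> V \<longrightarrow> (\<forall>i. i \<E> V \<longrightarrow> (\<forall>k. k \<E> V \<longrightarrow> (inn GE \<langle>p, \<langle>i, k\<rangle>\<rangle> \<longrightarrow> (inn T \<langle>p, t\<rangle> \<longleftrightarrow> (\<exists>a. a \<E> V \<and> (\<exists>b. b \<E> V \<and> (\<langle>i, a\<rangle> \<E> t \<and> (\<langle>k, b\<rangle> \<E> t \<and> inn (rl d d) \<langle>a, b\<rangle>))))))))) \<and>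
      (\<forall>p. p \<E> V \<longrightarrow> (\<forall>q. q \<E> V \<longrightarrow> (inn GN \<langle>p, q\<rangle> \<longrightarrow> (inn T \<langle>p, t\<rangle> \<longleftrightarrow> \<not> inn T \<langle>q, t\<rangle>)))) \<and>
      (\<forall>p. p \<E> V \<longrightarrow> (\<forall>q. q \<E> V \<longrightarrow> (\<forall>r. r \<E> V \<longrightarrow> (inn GC \<langle>p, \<langle>q, r\<rangle>\<rangle> \<longrightarrow> (inn T \<langle>p, t\<rangle> \<longleftrightarrow> inn T \<langle>q, t\<rangle> \<and> inn T \<langle>r, t\<rangle>))))) \<and>
      (\<forall>p. p \<E> V \<longrightarrow> (\<forall>i. i \<E> V \<longrightarrow> (\<forall>q. q \<E> V \<longrightarrow> (inn GX \<langle>p, \<langle>i, q\<rangle>\<rangle> \<longrightarrow> (inn T \<langle>p, t\<rangle> \<longleftrightarrow> (\<exists>t'. t' \<E> V \<and> (inn A t' \<and>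
         ((\<forall>n. n \<E> V \<longrightarrow> (inn om n \<longrightarrow> (\<not> n = i \<longrightarrow> (\<forall>c. c \<E> V \<longrightarrow> (\<langle>n, c\<rangle> \<E> t' \<longleftrightarrow> \<langle>n, c\<rangle> \<E> t))))) \<and> inn T \<langle>q, t'\<rangle>))))))))))" for T
  have fo: "fo inV inV (DK k) (\<lambda>_. Cl T) (\<lambda>_. Cl (dot k T))" if T: "T \<sqsubseteq> V" and k: "good k" for T k
  proof -
    have DKI: "Inv R \<Longrightarrow> DK k R R" for R using k unfolding Inv_def by simp
    show ?thesis unfolding Cl_def
      by (intro fo_intros) (simp_all only: T DKI IG IF IA Inv_om Cd_Inv[OF d])
  qed
  have tn: "\<langle>n, c\<rangle> \<E> t \<longleftrightarrow> n \<E> om \<and> c = t $ n" if "t \<E> A" for t n c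
    using fn_mem[of t om n c] that unfolding At Maps_fn by blast
  have tV: "t $ n \<E> V" if "t \<E> A" "n \<E> om" for t n using that unfolding At Maps_fn by simp
  have agr: "(\<forall>n. n \<E> V \<longrightarrow> (inn om n \<longrightarrow> (\<not> n = i \<longrightarrow> (\<forall>c. c \<E> V \<longrightarrow> (\<langle>n, c\<rangle> \<E> t' \<longleftrightarrow> \<langle>n, c\<rangle> \<E> t))))) \<longleftrightarrow> (\<forall>n. n \<E> om \<longrightarrow> n \<noteq> i \<longrightarrow> t' $ n = t $ n)"
    if "t \<E> A" "t' \<E> A" for t t' i
    unfolding inn_def tn[OF that(1)] tn[OF that(2)] using tV[OF that(1)] tV[OF that(2)] V_nat by metis
  have ab: "(\<exists>a. a \<E> V \<and> (\<exists>b. b \<E> V \<and> (\<langle>i, a\<rangle> \<E> t \<and> (\<langle>k, b\<rangle> \<E> t \<and> inn S \<langle>a, b\<rangle>)))) \<longleftrightarrow> inn S \<langle>t $ i, t $ k\<rangle>"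
    if "t \<E> A" "i \<E> om" "k \<E> om" for t i k S
    unfolding tn[OF that(1)] using tV[OF that(1)] that by auto
  define T where "T = Coll (\<lambda>z. z \<E> V \<and> (\<exists>p t. z = \<langle>p, t\<rangle> \<and> Formula p \<and> t \<E> A \<and> Sat u p (co d t)))"
  have TT: "z \<E> T \<longleftrightarrow> z \<E> V \<and> (\<exists>p t. z = \<langle>p, t\<rangle> \<and> Formula p \<and> t \<E> A \<and> Sat u p (co d t))" for z
    unfolding T_def by (rule mem_sep) (intro D_intros)
  have FV: "Formula p \<Longrightarrow> p \<E> V" for p using Formula_Vom V_tran[OF V_Vom] by blast
  have T2: "inn T \<langle>p, t\<rangle> \<longleftrightarrow> Formula p \<and> t \<E> A \<and> Sat u p (co d t)" for p t unfolding inn_def TT At using FV by auto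
  have TV: "T \<sqsubseteq> V" by (rule subI) (simp add: TT)
  have cM: "Maps (co d t) om u" if "t \<E> A" for t using that co_Maps unfolding At by blast
  have ClT: "Cl T" unfolding Cl_def
  proof (intro conjI allI impI, goal_cases)
    case (1 z)
    then show ?case unfolding inn_def TT by auto
  next
    case (2 t p i k)
    then have *: "t \<E> A" "i \<E> om" "k \<E> om" "p = cM i k" by (auto simp: inn_def G)
    then show ?case unfolding T2 ab[OF *(1-3)] using Sat_simps(1)[OF cM[OF *(1)] *(2,3)] tV[OF *(1)] Formula_intros(1) by (simp add: inn_def mem_ml co)
  next
    case (3 t p i k)
    then have *: "t \<E> A" "i \<E> om" "k \<E> om" "p = cE i k" by (auto simp: inn_def G)
    then show ?case unfolding T2 ab[OF *(1-3)] using Sat_simps(2)[OF cM[OF *(1)] *(2,3)] tV[OF *(1)] Formula_intros(2) by (simp add: inn_def mem_rl co)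
  next
    case (4 t p q)
    then have *: "t \<E> A" "Formula q" "p = cN q" by (auto simp: inn_def G)
    then show ?case unfolding T2 using Sat_simps(3)[OF cM[OF *(1)] *(2)] Formula_intros(3) by simp
  next
    case (5 t p q r)
    then have *: "t \<E> A" "Formula q" "Formula r" "p = cC q r" by (auto simp: inn_def G)
    then show ?case unfolding T2 using Sat_simps(4)[OF cM[OF *(1)] *(2,3)] Formula_intros(4) by simp
  next
    case (6 t p i q)
    then have *: "t \<E> A" "i \<E> om" "Formula q" "p = cX i q" by (auto simp: inn_def G)
    have "(\<exists>a. a \<E> u \<and> Sat u q (upd (co d t) i a)) \<longleftrightarrow> (\<exists>t'. t' \<E> A \<and> (\<forall>n. n \<E> om \<longrightarrow> n \<noteq> i \<longrightarrow> t' $ n = t $ n) \<and> Sat u q (co d t'))" (is "?L \<longleftrightarrow> ?R")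
    proof
      assume ?L
      then obtain a where a: "a \<E> u" "Sat u q (upd (co d t) i a)" by blast
      obtain c where c: "c \<E> V" "a = d $ c" using u[OF a(1)] unfolding rg_def by blast
      have ft: "fn t om" using *(1) unfolding At Maps_fn by blast
      have ap: "upd t i c $ n = (if n = i then c else t $ n)" if "n \<E> om" for n by (rule upd_ap[OF ft *(2) that])
      have tA: "upd t i c \<E> A" unfolding At using *(1) c a(1) upd_V[OF _ V_nat[OF *(2)] c(1), of t] upd_Maps[OF _ *(2), of t "pb d u" c] unfolding At by simp
      have "co d (upd t i c) = upd (co d t) i a" using co_upd[OF *(2), of "upd t i c" t d] ap *(2) c(2) by simp
      then show ?R using tA ap a(2) by (intro exI[of _ "upd t i c"]) simp
    next
      assume ?R
      then obtain t' where t': "t' \<E> A" "\<And>n. n \<E> om \<Longrightarrow> n \<noteq> i \<Longrightarrow> t' $ n = t $ n" "Sat u q (co d t')" by blast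
      have "d $ (t' $ i) \<E> u" using t'(1) *(2) unfolding At Maps_fn by simp
      then show ?L using t'(3) co_upd[OF *(2) t'(2), of d] by auto
    qed
    moreover have "(\<exists>t'. t' \<E> V \<and> (inn A t' \<and> ((\<forall>n. n \<E> V \<longrightarrow> (inn om n \<longrightarrow> (\<not> n = i \<longrightarrow> (\<forall>c. c \<E> V \<longrightarrow> (\<langle>n, c\<rangle> \<E> t' \<longleftrightarrow> \<langle>n, c\<rangle> \<E> t))))) \<and> inn T \<langle>q, t'\<rangle>))) \<longleftrightarrow>
      (\<exists>t'. t' \<E> A \<and> (\<forall>n. n \<E> om \<longrightarrow> n \<noteq> i \<longrightarrow> t' $ n = t $ n) \<and> Sat u q (co d t'))"
    proof (rule iff_exI)
      fix t'
      have "t' \<E> A \<Longrightarrow> t' \<E> V" unfolding At by blast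
      then show "(t' \<E> V \<and> (inn A t' \<and> ((\<forall>n. n \<E> V \<longrightarrow> (inn om n \<longrightarrow> (\<not> n = i \<longrightarrow> (\<forall>c. c \<E> V \<longrightarrow> (\<langle>n, c\<rangle> \<E> t' \<longleftrightarrow> \<langle>n, c\<rangle> \<E> t))))) \<and> inn T \<langle>q, t'\<rangle>))) \<longleftrightarrow>
        (t' \<E> A \<and> (\<forall>n. n \<E> om \<longrightarrow> n \<noteq> i \<longrightarrow> t' $ n = t $ n) \<and> Sat u q (co d t'))"
        using agr[OF *(1), of t' i] unfolding T2 inn_def[of A] using *(3) by blast
    qed
    ultimately show ?case using Sat_simps(5)[OF cM[OF *(1)] *(2,3)] Formula_intros(5)[OF *(2,3)] *(1,4) unfolding T2[of p] by simp
  qed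
  have un: "T' = T" if T': "T' \<sqsubseteq> V" "Cl T'" for T'
  proof -
    note C = T'(2)[unfolded Cl_def]
    note C1 = C[THEN conjunct1, rule_format] and C2 = C[THEN conjunct2, rule_format]
    note D1 = ClT[unfolded Cl_def, THEN conjunct2, rule_format]
    have "\<forall>t. t \<E> A \<longrightarrow> (\<langle>p, t\<rangle> \<E> T' \<longleftrightarrow> \<langle>p, t\<rangle> \<E> T)" if "Formula p" for p
    proof (rule Formula_induct[where P="\<lambda>p. \<forall>t. t \<E> A \<longrightarrow> (\<langle>p, t\<rangle> \<E> T' \<longleftrightarrow> \<langle>p, t\<rangle> \<E> T)", OF _ that])
      show "D (\<lambda>e. \<forall>t. t \<E> A \<longrightarrow> (\<langle>e 0, t\<rangle> \<E> T' \<longleftrightarrow> \<langle>e 0, t\<rangle> \<E> T))" by (intro D_intros)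
      have AV: "t \<E> A \<Longrightarrow> t \<E> V" for t unfolding At by blast
      note F = C2[OF AV, unfolded inn_def] D1[OF AV, unfolded inn_def]
      show "\<forall>t. t \<E> A \<longrightarrow> (\<langle>cM i k, t\<rangle> \<E> T' \<longleftrightarrow> \<langle>cM i k, t\<rangle> \<E> T)" if "i \<E> om" "k \<E> om" for i k
      proof (intro allI impI)
        fix t assume t: "t \<E> A"
        show "\<langle>cM i k, t\<rangle> \<E> T' \<longleftrightarrow> \<langle>cM i k, t\<rangle> \<E> T"
          using F(1)[OF t t, THEN conjunct1, rule_format, of "cM i k" i k] F(2)[OF t t, THEN conjunct1, rule_format, of "cM i k" i k] that V_nat FV[OF Formula_intros(1)[OF that]] by (simp add: G)
      qed
      show "\<forall>t. t \<E> A \<longrightarrow> (\<langle>cE i k, t\<rangle> \<E> T' \<longleftrightarrow> \<langle>cE i k, t\<rangle> \<E> T)" if "i \<E> om" "k \<E> om" for i k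
      proof (intro allI impI)
        fix t assume t: "t \<E> A"
        show "\<langle>cE i k, t\<rangle> \<E> T' \<longleftrightarrow> \<langle>cE i k, t\<rangle> \<E> T"
          using F(1)[OF t t, THEN conjunct2, THEN conjunct1, rule_format, of "cE i k" i k] F(2)[OF t t, THEN conjunct2, THEN conjunct1, rule_format, of "cE i k" i k] that V_nat FV[OF Formula_intros(2)[OF that]] by (simp add: G)
      qed
      show "\<forall>t. t \<E> A \<longrightarrow> (\<langle>cN q, t\<rangle> \<E> T' \<longleftrightarrow> \<langle>cN q, t\<rangle> \<E> T)"
        if q: "Formula q" "\<forall>t. t \<E> A \<longrightarrow> (\<langle>q, t\<rangle> \<E> T' \<longleftrightarrow> \<langle>q, t\<rangle> \<E> T)" for q
      proof (intro allI impI)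
        fix t assume t: "t \<E> A"
        show "\<langle>cN q, t\<rangle> \<E> T' \<longleftrightarrow> \<langle>cN q, t\<rangle> \<E> T"
          using F(1)[OF t t, THEN conjunct2, THEN conjunct2, THEN conjunct1, rule_format, of "cN q" q] F(2)[OF t t, THEN conjunct2, THEN conjunct2, THEN conjunct1, rule_format, of "cN q" q]
            q t FV[OF Formula_intros(3)[OF q(1)]] FV[OF q(1)] by (simp add: G)
      qed
      show "\<forall>t. t \<E> A \<longrightarrow> (\<langle>cC q r, t\<rangle> \<E> T' \<longleftrightarrow> \<langle>cC q r, t\<rangle> \<E> T)"
        if q: "Formula q" "Formula r" "\<forall>t. t \<E> A \<longrightarrow> (\<langle>q, t\<rangle> \<E> T' \<longleftrightarrow> \<langle>q, t\<rangle> \<E> T)" "\<forall>t. t \<E> A \<longrightarrow> (\<langle>r, t\<rangle> \<E> T' \<longleftrightarrow> \<langle>r, t\<rangle> \<E> T)" for q r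
      proof (intro allI impI)
        fix t assume t: "t \<E> A"
        show "\<langle>cC q r, t\<rangle> \<E> T' \<longleftrightarrow> \<langle>cC q r, t\<rangle> \<E> T"
          using F(1)[OF t t, THEN conjunct2, THEN conjunct2, THEN conjunct2, THEN conjunct1, rule_format, of "cC q r" q r] F(2)[OF t t, THEN conjunct2, THEN conjunct2, THEN conjunct2, THEN conjunct1, rule_format, of "cC q r" q r]
            q t FV[OF Formula_intros(4)[OF q(1,2)]] FV[OF q(1)] FV[OF q(2)] by (simp add: G)
      qed
      show "\<forall>t. t \<E> A \<longrightarrow> (\<langle>cX i q, t\<rangle> \<E> T' \<longleftrightarrow> \<langle>cX i q, t\<rangle> \<E> T)"
        if q: "i \<E> om" "Formula q" "\<forall>t. t \<E> A \<longrightarrow> (\<langle>q, t\<rangle> \<E> T' \<longleftrightarrow> \<langle>q, t\<rangle> \<E> T)" for i q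
      proof (intro allI impI)
        fix t assume t: "t \<E> A"
        have *: "(\<exists>t'. t' \<E> V \<and> (t' \<E> A \<and> (H t' \<and> \<langle>q, t'\<rangle> \<E> T'))) \<longleftrightarrow> (\<exists>t'. t' \<E> V \<and> (t' \<E> A \<and> (H t' \<and> \<langle>q, t'\<rangle> \<E> T)))" for H
          using q(3) by blast
        have "cX i q \<E> V" "i \<E> V" "q \<E> V" "\<langle>cX i q, \<langle>i, q\<rangle>\<rangle> \<E> GX" using FV[OF Formula_intros(5)[OF q(1,2)]] FV[OF q(2)] V_nat q by (simp_all add: G)
        note H = F(1)[OF t t, THEN conjunct2, THEN conjunct2, THEN conjunct2, THEN conjunct2, rule_format, OF this] F(2)[OF t t, THEN conjunct2, THEN conjunct2, THEN conjunct2, THEN conjunct2, rule_format, OF this]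
        show "\<langle>cX i q, t\<rangle> \<E> T' \<longleftrightarrow> \<langle>cX i q, t\<rangle> \<E> T" unfolding H * ..
      qed
    qed
    moreover have "\<exists>p t. z = \<langle>p, t\<rangle> \<and> Formula p \<and> t \<E> A" if "z \<E> T'" for z
      using C1[of z] subD[OF T'(1) that] that unfolding inn_def mem_Fm by blast
    moreover have "\<exists>p t. z = \<langle>p, t\<rangle> \<and> Formula p \<and> t \<E> A" if "z \<E> T" for z
      using that unfolding TT by blast
    ultimately have "z \<E> T' \<longleftrightarrow> z \<E> T" for z by blast
    then show "T' = T" by (rule extensionality)
  qed
  have IT: "Inv T" by (rule Inv_unique[where G=Cl, OF TV ClT fo[OF TV] un])
  have pV: "sing p \<sqsubseteq> Vom" by (rule subI) (simp add: Formula_Vom[OF p])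
  obtain B where B: "\<And>t. t \<E> B \<longleftrightarrow> t \<E> V \<and> (t \<E> A \<and> Sat u p (co d t))"
    by (rule D_sepE[where P="\<lambda>t. t \<E> A \<and> Sat u p (co d t)" and a=V], intro D_intros) blast
  have "Inv B"
  proof (rule Inv_fo)
    show "foI (\<lambda>e. inn T \<langle>p, e 0\<rangle>)"
      by (intro fo_inn foT_V_pair foT_V_var foT_V_const) (simp_all add: IT Inv_Vom[OF pV] FV[OF p])
    show "t \<E> B \<longleftrightarrow> t \<E> V \<and> inn T \<langle>p, t\<rangle>" for t unfolding B T2 using p by blast
  qed
  then show ?thesis using B unfolding A_def by (intro exI[of _ B]) auto
qed

end

section \<open>Sigma_1-definable subsets of \<open>V\<close> as sections of invariant
  classes\<close>

context limit_rank_om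
begin

text \<open>The induction takes place in the model, whose natural numbers need not be standard.\<close>

lemma finite_choice:
  assumes n: "n \<E> om" and \<Phi>: "D (\<lambda>e. \<Phi> (e 1) (e 0))" and Q: "Q \<sqsubseteq> V" "c \<E> Q" and ex: "\<And>i. i \<E> n \<Longrightarrow> \<exists>y. y \<E> Q \<and> \<Phi> i y"
  shows "\<exists>t. t \<E> asg Q \<and> (\<forall>i. i \<E> n \<longrightarrow> \<Phi> i (t $ i))"
proof -
  have DP: "D (\<lambda>e. \<Phi> (x e) (y e))" if "DT x" "DT y" for x y by (rule D_subst2[OF that \<Phi>])
  let ?P = "\<lambda>m. (\<forall>i. i \<E> m \<longrightarrow> (\<exists>y. y \<E> Q \<and> \<Phi> i y)) \<longrightarrow> (\<exists>t. t \<E> asg Q \<and> (\<forall>i. i \<E> m \<longrightarrow> \<Phi> i (t $ i)))"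
  have "?P n"
  proof (rule om_induct[where P="?P", OF _ _ _ n])
    show "D (\<lambda>e. ?P (e 0))" by (intro D_intros DP)
    have ft: "fn (prod om (sing c)) om" by (rule fnI[where F="\<lambda>_. c"]) auto
    have "prod om (sing c) $ i = c" if "i \<E> om" for i using fn_ap[OF ft that] by auto
    then have "Maps (prod om (sing c)) om Q" unfolding Maps_fn using ft Q(2) by auto
    moreover have "prod om (sing c) \<E> V" using subD[OF Q] by (intro V_prod) auto
    ultimately show "?P emp" by auto
    fix m assume m: "m \<E> om" and IH: "?P m"
    show "?P (suc m)"
    proof (intro impI)
      assume *: "\<forall>i. i \<E> suc m \<longrightarrow> (\<exists>y. y \<E> Q \<and> \<Phi> i y)"
      then obtain t where t: "t \<E> asg Q" "\<And>i. i \<E> m \<Longrightarrow> \<Phi> i (t $ i)" using IH by auto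
      obtain y where y: "y \<E> Q" "\<Phi> m y" using * by auto
      have ft: "fn t om" using t(1) by (simp add: Maps_fn)
      have "upd t m y \<E> asg Q" using t(1) upd_V[OF _ V_nat[OF m] subD[OF Q(1) y(1)], of t] upd_Maps[OF _ m y(1), of t] by simp
      moreover have "\<Phi> i (upd t m y $ i)" if i: "i \<E> suc m" for i
      proof (cases "i = m")
        case True
        then show ?thesis using upd_ap[OF ft m m, of y] y(2) by simp
      next
        case False
        then have "i \<E> m" using i by simp
        moreover have "i \<E> om" using Ord_TranD[OF Ord_om m \<open>i \<E> m\<close>] .
        ultimately show ?thesis using upd_ap[OF ft m, of i y] t(2) False by simp
      qed
      ultimately show "\<exists>t. t \<E> asg Q \<and> (\<forall>i. i \<E> suc m \<longrightarrow> \<Phi> i (t $ i))" by blast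
    qed
  qed
  then show ?thesis using ex by blast
qed

text \<open>Only the single sections of \<open>R\<close> are known to be invariant, with
  \<open>n\<close> fixed. As \<open>k\<close> fixes \<open>om\<close> and its elements,
  \<open>dot k R\<close> has the same sections as \<open>R\<close> and none at other indices. So
  \<open>R\<close> is fixed, and goodness passes on to \<open>ran R\<close>.\<close>

lemma Inv_om_union:
  assumes R: "R \<sqsubseteq> V" "\<And>z. z \<E> R \<Longrightarrow> \<exists>n y. n \<E> om \<and> z = \<langle>n, y\<rangle>" and C: "\<And>n. n \<E> om \<Longrightarrow> \<exists>C. Inv C \<and> (\<forall>y. y \<E> C \<longleftrightarrow> \<langle>n, y\<rangle> \<E> R)"
  shows "Inv (ran R)"
  unfolding Inv_def
proof (intro conjI allI impI)
  show "ran R \<sqsubseteq> V" using sub_ops(3)[OF R(1) R(1)] .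
  fix k assume k: "good k"
  interpret embedding_om mem l k using k by unfold_locales (simp_all add: good_def oml)
  have "R \<sqsubseteq> prod om V"
  proof (rule subI)
    fix z assume z: "z \<E> R"
    then obtain n y where "n \<E> om" "z = \<langle>n, y\<rangle>" using R(2) by blast
    then show "z \<E> prod om V" using subD[OF R(1) z] by simp
  qed
  from dot_mono[OF this] have "dot k R \<sqsubseteq> prod om V"
    using dot_ops(1)[OF V_subV[OF V_om] sub_refl] dot_set[OF V_om] k_om dot_V by simp
  note kR = subD[OF this]
  have sec: "\<langle>n, y\<rangle> \<E> dot k R \<longleftrightarrow> \<langle>n, y\<rangle> \<E> R" if n: "n \<E> om" for n y
  proof -
    obtain C where I: "Inv C" "\<And>y. y \<E> C \<longleftrightarrow> \<langle>n, y\<rangle> \<E> R" using C[OF n] by blast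
    have nV: "n \<E> V" using V_nat[OF n] .
    have s: "DK k (sing n) (sing n)" using dot_set[OF V_up[OF nV nV]] k_ops(2)[OF nV nV] k_nat[OF n] V_subV[OF V_up[OF nV nV]] by simp
    have "fo inV inV (DK k) (\<lambda>e. inn R \<langle>n, e 0\<rangle>) (\<lambda>e. inn (dot k R) \<langle>n, e 0\<rangle>)"
      by (intro fo_inn foT_V_pair foT_V_var foT_V_const s nV) (simp add: R(1))
    moreover have "y \<E> C \<longleftrightarrow> y \<E> V \<and> inn R \<langle>n, y\<rangle>" for y unfolding I(2) inn_def using subD[OF R(1), of "\<langle>n, y\<rangle>"] by auto
    ultimately have "y \<E> dot k C \<longleftrightarrow> y \<E> V \<and> inn (dot k R) \<langle>n, y\<rangle>" by (rule good_fo[OF k])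
    moreover have "dot k C = C" using I(1) k unfolding Inv_def by blast
    ultimately show ?thesis unfolding inn_def using I(2)[of y] subD[OF R(1), of "\<langle>n, y\<rangle>"] kR[of "\<langle>n, y\<rangle>"] by auto
  qed
  have "dot k R = R"
  proof (rule extensionality)
    fix z show "z \<E> dot k R \<longleftrightarrow> z \<E> R" using kR[of z] R(2)[of z] sec by auto
  qed
  then show "dot k (ran R) = ran R" using k R(1) unfolding good_def by simp
qed

text \<open>The parameter is kept apart from the invariant class, since the final argument ranges
  over all sections of the same \<open>C\<close>.\<close>

definition ID :: "'a \<Rightarrow> bool" where
  "ID X \<longleftrightarrow> (\<exists>C q. Inv C \<and> q \<E> V \<and> X = img C q)"

lemma D_ID [D_intros]: "DT x \<Longrightarrow> D (\<lambda>e. ID (x e))"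
  by (erule D_subst1) (unfold ID_def, intro D_intros)

text \<open>The relevant parameters lie in one level \<open>m\<close>, and an assignment
  \<open>q\<close> of codes for them is an element of \<open>V\<close>. For each level from
  \<open>m\<close> on, satisfaction is an invariant relation of \<open>x\<close> and
  \<open>q\<close> by \<open>sat_Inv\<close>; \<open>Sigma1_union\<close> and
  \<open>Inv_om_union\<close> assemble the levels.\<close>

lemma Sigma1_ID:
  assumes X: "X \<sqsubseteq> V" and def: "Sigma1_definable_from_parameters mem NN X"
  shows "ID X"
proof -
  obtain p s where p: "Sigma1 p" and s: "Maps s om NN" and Xp: "\<And>x. x \<E> X \<longleftrightarrow> x \<E> NN \<and> Sat NN p (upd s emp x)"
    using def unfolding Sigma1_definable_from_parameters_def by blast
  have "Formula p \<and> True" by (rule Sigma1_induct[where P="\<lambda>_. True", OF _ p]) (simp_all add: fo_const)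
  then have Fp: "Formula p" ..
  obtain n0 where n0: "n0 \<E> om" and sup: "\<And>A s s'. Maps s om A \<Longrightarrow> Maps s' om A \<Longrightarrow> (\<And>i. i \<E> n0 \<Longrightarrow> s $ i = s' $ i) \<Longrightarrow> Sat A p s \<longleftrightarrow> Sat A p s'"
    using Formula_support[OF Fp] by blast
  have n0om: "i \<E> n0 \<Longrightarrow> i \<E> om" for i using Ord_TranD[OF Ord_om n0] .
  have "\<exists>m. m \<E> om \<and> (\<forall>i. i \<E> n0 \<longrightarrow> s $ i \<E> lev m)"
  proof (rule om_induct[where P="\<lambda>n. \<exists>m. m \<E> om \<and> (\<forall>i. i \<E> n \<longrightarrow> s $ i \<E> lev m)", OF _ _ _ n0])
    show "D (\<lambda>e. \<exists>m. m \<E> om \<and> (\<forall>i. i \<E> e 0 \<longrightarrow> s $ i \<E> lev m))" by (intro D_intros)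
    show "\<exists>m. m \<E> om \<and> (\<forall>i. i \<E> emp \<longrightarrow> s $ i \<E> lev m)" by (rule exI[of _ emp]) simp
    fix n assume n: "n \<E> om" and "\<exists>m. m \<E> om \<and> (\<forall>i. i \<E> n \<longrightarrow> s $ i \<E> lev m)"
    then obtain m where m: "m \<E> om" "\<And>i. i \<E> n \<Longrightarrow> s $ i \<E> lev m" by blast
    have "s $ n \<E> NN" using s n by (simp add: Maps_fn)
    then obtain m' where m': "m' \<E> om" "s $ n \<E> lev m'" unfolding mem_NN by blast
    obtain r where r: "r \<E> om" "m \<sqsubseteq> r" "m' \<sqsubseteq> r" using om_max[OF m(1) m'(1)] by blast
    show "\<exists>m. m \<E> om \<and> (\<forall>i. i \<E> suc n \<longrightarrow> s $ i \<E> lev m)"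
      using r(1) m(2) m'(2) subD[OF lev_mono[OF m(1) r(1,2)]] subD[OF lev_mono[OF m'(1) r(1,3)]] by (intro exI[of _ r]) auto
  qed
  then obtain m where m: "m \<E> om" "\<And>i. i \<E> n0 \<Longrightarrow> s $ i \<E> lev m" by blast
  obtain dm where dm: "Lev m dm" "Lk idV dm" using Lev_above[OF om_0 Lev_emp m(1)] by auto
  define Q where "Q = pb dm (lev m)"
  have QV: "Q \<sqsubseteq> V" unfolding Q_def by (rule subI) simp
  have IQ: "Inv Q" using dm(1) unfolding Lev_def Q_def by blast
  have code: "\<exists>y. y \<E> pb d (lev n) \<and> d $ y = w" if "Lev n d" "w \<E> lev n" for n d w
    using that unfolding Lev_def rg_def by auto
  have elev: "emp \<E> lev n" if "n \<E> om" for n using subD[OF V_lev[OF that] V_emp] .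
  obtain c0 where c0: "c0 \<E> Q" using code[OF dm(1) elev[OF m(1)]] unfolding Q_def by blast
  have "\<exists>q. q \<E> asg Q \<and> (\<forall>i. i \<E> n0 \<longrightarrow> dm $ (q $ i) = s $ i)"
    by (rule finite_choice[where \<Phi>="\<lambda>i y. dm $ y = s $ i", OF n0 _ QV c0], intro D_intros) (unfold Q_def, rule code[OF dm(1) m(2)])
  then obtain q where q: "q \<E> asg Q" "\<And>i. i \<E> n0 \<Longrightarrow> dm $ (q $ i) = s $ i" by blast
  have qm: "Maps (upd (co dm q) emp x) om (lev m)" if "q \<E> asg Q" "x \<E> V" for q x
    using upd_Maps[OF co_Maps om_0 subD[OF V_lev[OF m(1)] that(2)], of q dm] that(1) unfolding Q_def by simp
  define R where "R = Coll (\<lambda>z. z \<E> V \<and> (\<exists>n x q. z = \<langle>n, \<langle>x, q\<rangle>\<rangle> \<and> n \<E> om \<and> m \<sqsubseteq> n \<and> q \<E> asg Q \<and> Sat (lev n) p (upd (co dm q) emp x)))"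
  have RR: "z \<E> R \<longleftrightarrow> z \<E> V \<and> (\<exists>n x q. z = \<langle>n, \<langle>x, q\<rangle>\<rangle> \<and> n \<E> om \<and> m \<sqsubseteq> n \<and> q \<E> asg Q \<and> Sat (lev n) p (upd (co dm q) emp x))" for z
    unfolding R_def by (rule mem_sep) (intro D_intros)
  have IR: "Inv (ran R)"
  proof (rule Inv_om_union)
    show "R \<sqsubseteq> V" by (rule subI) (simp add: RR)
    show "\<exists>n y. n \<E> om \<and> z = \<langle>n, y\<rangle>" if "z \<E> R" for z using that unfolding RR by blast
    fix n assume n: "n \<E> om"
    show "\<exists>C. Inv C \<and> (\<forall>y. y \<E> C \<longleftrightarrow> \<langle>n, y\<rangle> \<E> R)"
    proof (cases "m \<sqsubseteq> n")
      case False
      have "Inv emp" using Inv_nat[OF om_0] .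
      moreover have "\<not> \<langle>n, y\<rangle> \<E> R" for y unfolding RR using False by simp
      ultimately show ?thesis by (intro exI[of _ emp]) simp
    next
      case True
      have "\<not> n \<E> m" using subD[OF True, of n] mem_irrefl by blast
      then obtain d where d: "Lev n d" "Lk dm d" using Lev_above[OF m(1) dm(1) n] by blast
      have d3: "Cd d" "\<And>w. w \<E> lev n \<Longrightarrow> rg d w" "Inv (pb d (lev n))" using d(1) by (simp_all add: Lev_def)
      obtain S where S: "Inv S" "\<And>t. t \<E> S \<longleftrightarrow> t \<E> asg (pb d (lev n)) \<and> Sat (lev n) p (co d t)" using sat_Inv[OF d3 Fp] by blast
      have rl: "Inv (rl dm d)" "Inv (rl idV d)" using d(2) Lk_trans[OF dm(2) d(2)] by (simp_all add: Lk_def)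
      \<comment> \<open>\<open>t\<close> assigns codes for level \<open>n\<close> which, below
        \<open>n0\<close>, denote the same elements as the codes in \<open>q\<close>, with variable
        0 changed to \<open>x\<close>. The number 0 of the model is \<open>emp\<close>.\<close>
      define H where "H x q t \<longleftrightarrow> (\<forall>i. i \<E> V \<longrightarrow> (inn n0 i \<longrightarrow> (\<exists>c. c \<E> V \<and> (\<langle>i, c\<rangle> \<E> t \<and>
          ((i = emp \<and> inn (rl idV d) \<langle>x, c\<rangle>) \<or> (\<not> i = emp \<and> (\<exists>a. a \<E> V \<and> (\<langle>i, a\<rangle> \<E> q \<and> inn (rl dm d) \<langle>a, c\<rangle>))))))))" for x q t
      have H: "H x q t \<longleftrightarrow> (\<forall>i. i \<E> n0 \<longrightarrow> d $ (t $ i) = upd (co dm q) emp x $ i)"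
        if "x \<E> V" "q \<E> asg Q" "t \<E> asg (pb d (lev n))" for x q t
      proof -
        have f: "fn t om" "fn q om" using that by (simp_all add: Maps_fn)
        have V: "i \<E> om \<Longrightarrow> t $ i \<E> V" "i \<E> om \<Longrightarrow> q $ i \<E> V" for i using that by (simp_all add: Maps_fn Q_def)
        have "(\<exists>c. c \<E> V \<and> (\<langle>i, c\<rangle> \<E> t \<and> ((i = emp \<and> inn (rl idV d) \<langle>x, c\<rangle>) \<or> (\<not> i = emp \<and> (\<exists>a. a \<E> V \<and> (\<langle>i, a\<rangle> \<E> q \<and> inn (rl dm d) \<langle>a, c\<rangle>))))))
          \<longleftrightarrow> d $ (t $ i) = upd (co dm q) emp x $ i" if i: "i \<E> om" for i
          unfolding upd_ap[OF co(1) om_0 i] co(2)[OF i] inn_def mem_rl fn_mem[OF f(1)] fn_mem[OF f(2)]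
          using V[OF i] i idV(2)[OF \<open>x \<E> V\<close>] \<open>x \<E> V\<close> by auto
        then show ?thesis unfolding H_def inn_def[of n0] using n0om V_nat by meson
      qed
      have ind: "Sat (lev n) p (upd (co dm q) emp x) \<longleftrightarrow> (\<exists>t. t \<E> V \<and> (inn S t \<and> H x q t))" if xq: "x \<E> V" "q \<E> asg Q" for x q
      proof
        have um: "Maps (upd (co dm q) emp x) om (lev n)" by (rule Maps_mono[OF qm[OF xq(2,1)] lev_mono[OF m(1) n True]])
        have su: "Sat (lev n) p (co d t) \<longleftrightarrow> Sat (lev n) p (upd (co dm q) emp x)" if "t \<E> asg (pb d (lev n))" "H x q t" for t
          using sup[OF co_Maps um, of t d] that H[OF xq that(1)] by (simp add: co n0om)
        show "\<exists>t. t \<E> V \<and> (inn S t \<and> H x q t)" if sat: "Sat (lev n) p (upd (co dm q) emp x)"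
        proof -
          obtain c where c: "c \<E> pb d (lev n)" using code[OF d(1) elev[OF n]] by blast
          have "\<exists>t. t \<E> asg (pb d (lev n)) \<and> (\<forall>i. i \<E> n0 \<longrightarrow> d $ (t $ i) = upd (co dm q) emp x $ i)"
            by (rule finite_choice[where \<Phi>="\<lambda>i y. d $ y = upd (co dm q) emp x $ i", OF n0 _ _ c], intro D_intros)
              (rule subI, simp, rule code[OF d(1)], use um n0om in \<open>simp add: Maps_fn\<close>)
          then obtain t where t: "t \<E> asg (pb d (lev n))" "H x q t" using H[OF xq] by blast
          then show ?thesis unfolding inn_def S(2) using su[OF t] sat by auto
        qed
        show "Sat (lev n) p (upd (co dm q) emp x)" if "\<exists>t. t \<E> V \<and> (inn S t \<and> H x q t)"
          using that su unfolding inn_def S(2) by blast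
      qed
      have "Inv (sing emp)" by (rule Inv_Vom, rule subI) (simp add: om_Vom)
      then have e: "foT inV inV IU (\<lambda>e. emp) (\<lambda>e. emp)" by (intro foT_V_const) simp_all
      have fo: "foI (\<lambda>e. inn (asg Q) (e 0) \<and> (\<exists>t. t \<E> V \<and> (inn S t \<and> H (e 1) (e 0) t)))"
        unfolding H_def by (intro fo_intros e) (simp_all only: Inv_asg[OF IQ] S(1) rl Inv_nat[OF n0])
      obtain C where C: "\<And>y. y \<E> C \<longleftrightarrow> y \<E> V \<and> \<langle>n, y\<rangle> \<E> R" by (rule D_sepE[where P="\<lambda>y. \<langle>n, y\<rangle> \<E> R" and a=V], intro D_intros) blast
      have CR: "\<langle>n, y\<rangle> \<E> R \<Longrightarrow> y \<E> V" for y unfolding RR by simp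
      have "Inv C"
      proof (rule Inv_fo2[OF fo])
        fix z
        have "z \<E> C \<longleftrightarrow> (\<exists>x q. x \<E> V \<and> q \<E> V \<and> z = \<langle>x, q\<rangle> \<and> (q \<E> asg Q \<and> Sat (lev n) p (upd (co dm q) emp x)))"
          unfolding C RR using n True V_nat[OF n] by auto
        also have "\<dots> \<longleftrightarrow> (\<exists>x q. x \<E> V \<and> q \<E> V \<and> z = \<langle>x, q\<rangle> \<and> (inn (asg Q) q \<and> (\<exists>t. t \<E> V \<and> (inn S t \<and> H x q t))))"
          unfolding inn_def[of "asg Q"] using ind by blast
        finally show "z \<E> C \<longleftrightarrow> (\<exists>x y. x \<E> V \<and> y \<E> V \<and> z = \<langle>x, y\<rangle> \<and> (inn (asg Q) y \<and> (\<exists>t. t \<E> V \<and> (inn S t \<and> H x y t))))" .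
      qed
      then show ?thesis using C CR by (intro exI[of _ C]) blast
    qed
  qed
  have qV: "q \<E> V" using q(1) by simp
  have key: "x \<E> X \<longleftrightarrow> \<langle>x, q\<rangle> \<E> ran R" for x
  proof (cases "x \<E> V")
    case False
    then show ?thesis using subD[OF X, of x] unfolding mem_ran RR by auto
  next
    case True
    let ?s = "upd (co dm q) emp x"
    have mN: "lev m \<sqsubseteq> NN" by (rule subI) (use mem_NN m(1) in blast)
    have xN: "x \<E> NN" by (rule V_NN[OF True])
    have "Sat NN p (upd s emp x) \<longleftrightarrow> Sat NN p ?s"
    proof (rule sup[OF upd_Maps[OF s om_0 xN] Maps_mono[OF qm[OF q(1) True] mN]])
      fix i assume i: "i \<E> n0"
      have fs: "fn s om" using s by (simp add: Maps_fn)
      show "upd s emp x $ i = ?s $ i" using upd_ap[OF fs om_0 n0om[OF i]] upd_ap[OF co(1) om_0 n0om[OF i]] q(2)[OF i] co(2)[OF n0om[OF i]] by simp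
    qed
    also have "\<dots> \<longleftrightarrow> (\<exists>n. n \<E> om \<and> m \<sqsubseteq> n \<and> Sat (lev n) p ?s)"
      by (rule Sigma1_union[OF p lev_Tran lev_mono mem_NN m(1) qm[OF q(1) True]])
    also have "\<dots> \<longleftrightarrow> \<langle>x, q\<rangle> \<E> ran R" unfolding mem_ran RR using q(1) True qV V_nat by auto
    finally show ?thesis using Xp xN by simp
  qed
  have "X = img (ran R) q" by (rule extensionality) (simp only: mem_img key)
  then show ?thesis unfolding ID_def using IR qV by blast
qed

text \<open>Applied to the set of restrictions, whose union is \<open>j\<close>.\<close>

lemma ID_Uni: assumes "ID X" shows "ID (Coll (\<lambda>z. z \<E> V \<and> (\<exists>y. y \<E> X \<and> z \<E> y)))"
proof -
  obtain C q where C: "Inv C" "q \<E> V" "X = img C q" using assms unfolding ID_def by blast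
  have CV: "C \<sqsubseteq> V" by (rule Inv_sub[OF C(1)])
  obtain B where B: "\<And>z. z \<E> B \<longleftrightarrow> z \<E> V \<and> (\<exists>x p y. z = \<langle>x, p\<rangle> \<and> \<langle>y, p\<rangle> \<E> C \<and> x \<E> y)"
    by (rule D_sepE[where P="\<lambda>z. \<exists>x p y. z = \<langle>x, p\<rangle> \<and> \<langle>y, p\<rangle> \<E> C \<and> x \<E> y" and a=V], intro D_intros) blast
  have "Inv B"
  proof (rule Inv_fo2)
    show "foI (\<lambda>e. \<exists>y. y \<E> V \<and> (inn C \<langle>y, e 0\<rangle> \<and> e 1 \<E> y))" by (intro fo_intros) (simp add: C(1))
    show "z \<E> B \<longleftrightarrow> (\<exists>x p. x \<E> V \<and> p \<E> V \<and> z = \<langle>x, p\<rangle> \<and> (\<exists>y. y \<E> V \<and> (inn C \<langle>y, p\<rangle> \<and> x \<E> y)))" for z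
      unfolding B inn_def using subD[OF CV] by fastforce
  qed
  moreover have "Coll (\<lambda>z. z \<E> V \<and> (\<exists>y. y \<E> X \<and> z \<E> y)) = img B q"
    by (rule coll_eq) (use C(2) in \<open>auto simp: B C(3)\<close>)
  ultimately show ?thesis unfolding ID_def using C(2) by blast
qed

text \<open>The action is first-order in \<open>k\<close> and \<open>X\<close>, because it
  quantifies over elements of \<open>V\<close> only; the two parameters are joined in a
  pair.\<close>

lemma ID_dot: assumes k: "fn k V" "ID k" and X: "ID X" shows "ID (dot k X)"
proof -
  obtain C q where C: "Inv C" "q \<E> V" "k = img C q" using k unfolding ID_def by blast
  obtain E r where E: "Inv E" "r \<E> V" "X = img E r" using X unfolding ID_def by blast
  have CV: "C \<sqsubseteq> V" by (rule Inv_sub[OF C(1)])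
  define \<Phi> where "\<Phi> z q r \<longleftrightarrow> (\<exists>b. b \<E> V \<and> (\<exists>c. c \<E> V \<and> ((\<forall>w. w \<E> V \<longrightarrow> (w \<E> b \<longrightarrow> inn E \<langle>w, r\<rangle>)) \<and> (inn C \<langle>\<langle>b, c\<rangle>, q\<rangle> \<and> z \<E> c))))" for z q r
  have fo: "foI (\<lambda>e. \<exists>q. q \<E> V \<and> (\<exists>r. r \<E> V \<and> (e 0 = \<langle>q, r\<rangle> \<and> \<Phi> (e 1) q r)))"
    unfolding \<Phi>_def by (intro fo_intros) (simp_all add: C(1) E(1))
  let ?P = "\<lambda>x p. \<exists>q. q \<E> V \<and> (\<exists>r. r \<E> V \<and> (p = \<langle>q, r\<rangle> \<and> \<Phi> x q r))"
  obtain B where B: "\<And>z. z \<E> B \<longleftrightarrow> z \<E> V \<and> (\<exists>x p. z = \<langle>x, p\<rangle> \<and> ?P x p)"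
    by (rule D_sepE[where P="\<lambda>z. \<exists>x p. z = \<langle>x, p\<rangle> \<and> ?P x p" and a=V], unfold \<Phi>_def inn_def, intro D_intros) blast
  have "Inv B" by (rule Inv_fo2[where P="?P", OF fo]) (auto simp: B)
  moreover have "dot k X = img B \<langle>q, r\<rangle>"
  proof (rule extensionality)
    fix z
    have "(\<exists>b. b \<E> V \<and> b \<sqsubseteq> X \<and> z \<E> k $ b) \<longleftrightarrow> \<Phi> z q r"
    proof -
      have "\<langle>\<langle>b, c\<rangle>, q\<rangle> \<E> C \<longleftrightarrow> b \<E> V \<and> c = k $ b" for b c using fn_mem[OF k(1), of b c] unfolding C(3) by simp
      moreover have "b \<E> V \<Longrightarrow> k $ b \<E> V" for b using fn_ap[OF k(1), of b] subD[OF CV, of "\<langle>\<langle>b, k $ b\<rangle>, q\<rangle>"] unfolding C(3) by simp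
      moreover have "b \<E> V \<Longrightarrow> b \<sqsubseteq> X \<longleftrightarrow> (\<forall>w. w \<E> V \<longrightarrow> (w \<E> b \<longrightarrow> \<langle>w, r\<rangle> \<E> E))" for b
        unfolding subset_def E(3) mem_img using V_tran by blast
      ultimately show ?thesis unfolding \<Phi>_def inn_def by auto
    qed
    then show "z \<E> dot k X \<longleftrightarrow> z \<E> img B \<langle>q, r\<rangle>" unfolding mem_dot mem_img B using C(2) E(2) by auto
  qed
  ultimately show ?thesis unfolding ID_def using C(2) E(2) V_pair by blast
qed

subsection \<open>The contradiction\<close>

text \<open>\<open>Emb (img C q)\<close> with \<open>C\<close> as a predicate and \<open>q\<close>
  as a variable, so that one can quantify over the embeddings among the sections of
  \<open>C\<close>.\<close>

definition EmbR :: "'a \<Rightarrow> 'a \<Rightarrow> bool" where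
  "EmbR C q \<longleftrightarrow> (\<forall>z. z \<E> V \<longrightarrow> (inn C \<langle>z, q\<rangle> \<longrightarrow> (\<exists>x. x \<E> V \<and> (\<exists>y. y \<E> V \<and> z = \<langle>x, y\<rangle>)))) \<and>
     (\<forall>x. x \<E> V \<longrightarrow> (\<exists>y. y \<E> V \<and> (inn C \<langle>\<langle>x, y\<rangle>, q\<rangle> \<and> (\<forall>z. z \<E> V \<longrightarrow> (inn C \<langle>\<langle>x, z\<rangle>, q\<rangle> \<longrightarrow> z = y))))) \<and>
     (\<forall>x. x \<E> V \<longrightarrow> (\<forall>y. y \<E> V \<longrightarrow> (\<forall>x'. x' \<E> V \<longrightarrow> (\<forall>y'. y' \<E> V \<longrightarrow> (inn C \<langle>\<langle>x, x'\<rangle>, q\<rangle> \<longrightarrow> (inn C \<langle>\<langle>y, y'\<rangle>, q\<rangle> \<longrightarrow>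
       ((x \<E> y \<longleftrightarrow> x' \<E> y') \<and> ((\<forall>f\<in>ops. inn C \<langle>\<langle>f x y, f x' y'\<rangle>, q\<rangle>) \<and> inn C \<langle>\<langle>Pow x, Pow x'\<rangle>, q\<rangle>))))))))"

lemma fo_EmbR: assumes "Inv C" shows "foI (\<lambda>e. EmbR C (e a))"
  unfolding EmbR_def 
  by (intro fo_intros fo_Ball[OF finite_ops]) (erule foT_V_op[OF _ foT_V_var foT_V_var] | simp add: assms)+

lemma EmbR_iff: assumes "C \<sqsubseteq> V" shows "EmbR C q \<longleftrightarrow> Emb (img C q)"
proof -
  define k where "k = img C q"
  have kV: "z \<E> k \<Longrightarrow> z \<E> V" for z using subD[OF assms, of "\<langle>z, q\<rangle>"] unfolding k_def by simp
  have k2: "\<langle>x, y\<rangle> \<E> k \<Longrightarrow> x \<E> V \<and> y \<E> V" for x y using kV[of "\<langle>x, y\<rangle>"] by simp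
  have i: "inn C \<langle>z, q\<rangle> \<longleftrightarrow> z \<E> k" for z unfolding k_def inn_def by simp
  have M: "Maps k V V \<longleftrightarrow> (\<forall>z. z \<E> V \<longrightarrow> (z \<E> k \<longrightarrow> (\<exists>x. x \<E> V \<and> (\<exists>y. y \<E> V \<and> z = \<langle>x, y\<rangle>)))) \<and>
     (\<forall>x. x \<E> V \<longrightarrow> (\<exists>y. y \<E> V \<and> (\<langle>x, y\<rangle> \<E> k \<and> (\<forall>z. z \<E> V \<longrightarrow> (\<langle>x, z\<rangle> \<E> k \<longrightarrow> z = y)))))" (is "_ \<longleftrightarrow> ?A \<and> ?B")
  proof -
    have "?A \<longleftrightarrow> (\<forall>p. p \<E> k \<longrightarrow> (\<exists>x y. x \<E> V \<and> y \<E> V \<and> p = \<langle>x, y\<rangle>))" using kV by blast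
    moreover have "?B \<longleftrightarrow> (\<forall>x. x \<E> V \<longrightarrow> (\<exists>!y. \<langle>x, y\<rangle> \<E> k))" unfolding Ex1_def using k2 by metis
    ultimately show ?thesis unfolding maps_def by simp
  qed
  define L where "L \<longleftrightarrow> (\<forall>x. x \<E> V \<longrightarrow> (\<forall>y. y \<E> V \<longrightarrow> (\<forall>x'. x' \<E> V \<longrightarrow> (\<forall>y'. y' \<E> V \<longrightarrow> (\<langle>x, x'\<rangle> \<E> k \<longrightarrow> (\<langle>y, y'\<rangle> \<E> k \<longrightarrow>
       ((x \<E> y \<longleftrightarrow> x' \<E> y') \<and> ((\<forall>f\<in>ops. \<langle>f x y, f x' y'\<rangle> \<E> k) \<and> \<langle>Pow x, Pow x'\<rangle> \<E> k))))))))"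
  have "L \<longleftrightarrow>
     (\<forall>x y. x \<E> V \<longrightarrow> y \<E> V \<longrightarrow> (x \<E> y \<longleftrightarrow> k $ x \<E> k $ y)) \<and>
     (\<forall>f\<in>ops. \<forall>x y. x \<E> V \<longrightarrow> y \<E> V \<longrightarrow> k $ f x y = f (k $ x) (k $ y)) \<and> (\<forall>x. x \<E> V \<longrightarrow> k $ Pow x = Pow (k $ x))" (is "_ \<longleftrightarrow> ?R")
    if k: "Maps k V V"
  proof -
    have f: "fn k V" and v: "x \<E> V \<Longrightarrow> k $ x \<E> V" for x using k by (simp_all add: Maps_fn)
    have "L \<longleftrightarrow> (\<forall>x. x \<E> V \<longrightarrow> (\<forall>y. y \<E> V \<longrightarrow> ((x \<E> y \<longleftrightarrow> k $ x \<E> k $ y) \<and> ((\<forall>f\<in>ops. \<langle>f x y, f (k $ x) (k $ y)\<rangle> \<E> k) \<and> \<langle>Pow x, Pow (k $ x)\<rangle> \<E> k))))"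
      unfolding L_def fn_mem[OF f] using v by auto
    also have "\<dots> \<longleftrightarrow> (\<forall>x. x \<E> V \<longrightarrow> (\<forall>y. y \<E> V \<longrightarrow> ((x \<E> y \<longleftrightarrow> k $ x \<E> k $ y) \<and> ((\<forall>f\<in>ops. k $ f x y = f (k $ x) (k $ y)) \<and> k $ Pow x = Pow (k $ x)))))"
      unfolding fn_mem[OF f] using V_op V_Pow by (simp add: eq_commute)
    also have "\<dots> \<longleftrightarrow> ?R" by blast
    finally show ?thesis .
  qed
  moreover have "EmbR C q \<longleftrightarrow> Maps k V V \<and> L" unfolding EmbR_def i M L_def by (simp only: conj_assoc)
  ultimately show ?thesis unfolding Emb_def k_def[symmetric] by blast
qed

text \<open>The corresponding form of \<open>Fix\<close>, where ranks are compared by a bisimulation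
  as in \<open>Fix_bis\<close>.\<close>

definition FixR :: "'a \<Rightarrow> 'a \<Rightarrow> 'a \<Rightarrow> 'a \<Rightarrow> 'a \<Rightarrow> bool" where
  "FixR C q b W x \<longleftrightarrow> (\<exists>b'. b' \<E> V \<and> (\<exists>W'. W' \<E> V \<and> (\<exists>x'. x' \<E> V \<and> (\<exists>E. E \<E> V \<and> (inn C \<langle>\<langle>b, b'\<rangle>, q\<rangle> \<and> (inn C \<langle>\<langle>W, W'\<rangle>, q\<rangle> \<and>
     (inn C \<langle>\<langle>x, x'\<rangle>, q\<rangle> \<and> (bis b' W' b W E \<and> \<langle>x', x\<rangle> \<E> E))))))))"

lemma fo_FixR: assumes "Inv C" shows "foI (\<lambda>e. FixR C (e a1) (e a2) (e a3) (e a4))"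
proof -
  have "foI (\<lambda>e. bis (e c1) (e c2) (e c3) (e c4) (e c5))" for c1 c2 c3 c4 c5
    by (rule bfo_fo0[OF _ tra_V tra_V]) (unfold bis_def, intro bfo_intros)
  then show ?thesis unfolding FixR_def by (intro fo_ex fo_conj fo_inn fo_memT foT_V_var foT_V_pair) (simp_all add: assms)
qed

lemma FixR_iff:
  assumes "C \<sqsubseteq> V" "Emb (img C q)" "WO b W" "x \<E> b"
  shows "FixR C q b W x \<longleftrightarrow> Fix (img C q) b W x"
proof -
  interpret embedding mem l "img C q" using assms(2) by unfold_locales
  have V: "b \<E> V" "W \<E> V" "x \<E> V" using assms(3,4) V_tran unfolding WO_def by blast+
  have i: "inn C \<langle>\<langle>z, z'\<rangle>, q\<rangle> \<longleftrightarrow> z \<E> V \<and> z' = img C q $ z" for z z' using fn_mem[OF k_fn, of z z'] unfolding inn_def by simp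
  show ?thesis unfolding Fix_bis[OF assms(3,4)]
  proof
    assume "\<exists>E. E \<E> V \<and> bis (img C q $ b) (img C q $ W) b W E \<and> \<langle>img C q $ x, x\<rangle> \<E> E"
    then show "FixR C q b W x" unfolding FixR_def i using V k_V[OF V(1)] k_V[OF V(2)] k_V[OF V(3)]
      by (elim exE) (rule exI[of _ "img C q $ b"], rule conjI, simp, rule exI[of _ "img C q $ W"], rule conjI, simp, rule exI[of _ "img C q $ x"], auto)
  qed (auto simp: FixR_def i)
qed

lemma no_ID_embedding:
  assumes j: "Emb j" "ID j" and x0: "x0 \<E> V" "j $ x0 \<noteq> x0"
  shows False
proof -
  obtain K where K: "fn K om" "K $ emp = j" "\<And>n. n \<E> om \<Longrightarrow> K $ suc n = dot j (K $ n)"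
    by (rule nat_rec[where H="\<lambda>k. dot j k" and c=j], intro D_intros) blast
  have KE: "Emb (K $ n) \<and> ID (K $ n) \<and> (\<exists>x. x \<E> V \<and> K $ n $ x \<noteq> x)" if "n \<E> om" for n
  proof (rule om_induct[where P="\<lambda>n. Emb (K $ n) \<and> ID (K $ n) \<and> (\<exists>x. x \<E> V \<and> K $ n $ x \<noteq> x)", OF _ _ _ that])
    show "D (\<lambda>e. Emb (K $ e 0) \<and> ID (K $ e 0) \<and> (\<exists>x. x \<E> V \<and> K $ e 0 $ x \<noteq> x))" by (intro D_intros)
    show "Emb (K $ emp) \<and> ID (K $ emp) \<and> (\<exists>x. x \<E> V \<and> K $ emp $ x \<noteq> x)" unfolding K(2) using j x0 by blast
    fix n assume n: "n \<E> om" and IH: "Emb (K $ n) \<and> ID (K $ n) \<and> (\<exists>x. x \<E> V \<and> K $ n $ x \<noteq> x)"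
    then obtain x where x: "x \<E> V" "K $ n $ x \<noteq> x" by blast
    interpret J: embedding mem l j using j(1) by unfold_locales
    interpret Kn: embedding mem l "K $ n" using IH by unfold_locales blast
    have "dot j (K $ n) $ (j $ x) \<noteq> j $ x" using dot_ap[OF j(1) Kn.emb x(1)] J.k_inj[of "K $ n $ x" x] x by simp
    then show "Emb (K $ suc n) \<and> ID (K $ suc n) \<and> (\<exists>x. x \<E> V \<and> K $ suc n $ x \<noteq> x)"
      unfolding K(3)[OF n] using Emb_dot[OF j(1) Kn.emb] ID_dot[OF J.k_fn j(2)] IH J.k_V[OF x(1)] by blast
  qed
  obtain b W x where W: "WO b W" "x \<E> b" and good: "\<And>k. Emb k \<Longrightarrow> Fix k b W x \<Longrightarrow> good k" by (rule good_position) blast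
  obtain n where n: "n \<E> om" "Fix (K $ n) b W x" using iterate_Fix[OF j(1) K(2,3) _ W] KE by blast
  obtain C q0 where C: "Inv C" "q0 \<E> V" "K $ n = img C q0" using KE[OF n(1)] unfolding ID_def by blast
  have CV: "C \<sqsubseteq> V" by (rule Inv_sub[OF C(1)])
  have V3: "b \<E> V" "W \<E> V" "x \<E> V" using W V_tran unfolding WO_def by blast+
  define Mv where "Mv z b W x \<longleftrightarrow> (\<exists>q. q \<E> V \<and> (EmbR C q \<and> (FixR C q b W x \<and> \<not> inn C \<langle>\<langle>z, z\<rangle>, q\<rangle>)))" for z b W x
  have Mv: "Mv z b W x \<longleftrightarrow> (\<exists>q. q \<E> V \<and> Emb (img C q) \<and> Fix (img C q) b W x \<and> img C q $ z \<noteq> z)" if "WO b W" "x \<E> b" "z \<E> V" for z b W x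
  proof -
    have "EmbR C q \<and> (FixR C q b W x \<and> \<not> inn C \<langle>\<langle>z, z\<rangle>, q\<rangle>) \<longleftrightarrow> Emb (img C q) \<and> Fix (img C q) b W x \<and> img C q $ z \<noteq> z" for q
    proof (cases "Emb (img C q)")
      case True
      interpret embedding mem l "img C q" using True by unfold_locales
      have "inn C \<langle>\<langle>z, z\<rangle>, q\<rangle> \<longleftrightarrow> img C q $ z = z" using fn_mem[OF k_fn, of z z] that(3) unfolding inn_def by auto
      then show ?thesis using True FixR_iff[OF CV True that(1,2)] EmbR_iff[OF CV, of q] by simp
    next
      case False
      then show ?thesis using EmbR_iff[OF CV, of q] by simp
    qed
    then show ?thesis unfolding Mv_def by simp
  qed
  \<comment> \<open>The position is made a variable because embeddings may move \<open>b\<close>,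
    \<open>W\<close> and \<open>x\<close>. Then \<open>Z3\<close> is invariant, and \<open>Z\<close>
    is its section at the position.\<close>
  define Q where "Q c z \<longleftrightarrow> (\<exists>b. b \<E> V \<and> (\<exists>W. W \<E> V \<and> (\<exists>x. x \<E> V \<and> (c = \<langle>b, \<langle>W, x\<rangle>\<rangle> \<and> Mv z b W x))))" for c z
  have fo: "foI (\<lambda>e. Q (e 1) (e 0))" unfolding Q_def Mv_def
    by (intro fo_ex fo_conj fo_neg fo_inn fo_eqT foT_V_var foT_V_pair tra_V fo_EmbR[OF C(1)] fo_FixR[OF C(1)]) (simp add: C(1))
  have "foI (\<lambda>e. \<exists>c. c \<E> V \<and> (\<exists>z. z \<E> V \<and> (e 0 = \<langle>c, z\<rangle> \<and> Q c z)))"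
    by (intro fo_ex fo_conj[OF fo_eqT] foT_V_var foT_V_pair tra_V) (use fo in simp)
  from Inv_fo_coll[OF this] fo_coll[OF this] obtain Z3 where
    Z3: "Inv Z3" "\<And>y. y \<E> Z3 \<longleftrightarrow> y \<E> V \<and> (\<exists>c. c \<E> V \<and> (\<exists>z. z \<E> V \<and> (y = \<langle>c, z\<rangle> \<and> Q c z)))" by blast
  have Z3m: "inn Z3 \<langle>\<langle>b, \<langle>W, x\<rangle>\<rangle>, z\<rangle> \<longleftrightarrow> Mv z b W x" if "b \<E> V" "W \<E> V" "x \<E> V" "z \<E> V" for b W x z
    unfolding inn_def Z3(2) Q_def using that by auto
  let ?c = "\<langle>b, \<langle>W, x\<rangle>\<rangle>"
  obtain Z where Z: "\<And>z. z \<E> Z \<longleftrightarrow> z \<E> V \<and> inn Z3 \<langle>?c, z\<rangle>"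
    by (rule D_sepE[where P="\<lambda>z. inn Z3 \<langle>?c, z\<rangle>" and a=V], unfold inn_def, intro D_intros) blast
  have Z': "z \<E> Z \<longleftrightarrow> z \<E> V \<and> (\<exists>q. q \<E> V \<and> Emb (img C q) \<and> Fix (img C q) b W x \<and> img C q $ z \<noteq> z)" for z
    unfolding Z using Z3m[OF V3, of z] Mv[OF W, of z] by blast
  obtain z0 where "z0 \<E> V" "K $ n $ z0 \<noteq> z0" using KE[OF n(1)] by blast
  then have "z0 \<E> Z" unfolding Z' using C(2,3) KE[OF n(1)] n(2) by auto
  then obtain z where z: "z \<E> Z" "\<And>y. y \<E> z \<Longrightarrow> \<not> y \<E> Z" using foundation by blast
  obtain q where q: "q \<E> V" "Emb (img C q)" "Fix (img C q) b W x" "img C q $ z \<noteq> z" and zV: "z \<E> V" using z(1) unfolding Z' by blast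
  define i where "i = img C q"
  note q' = q[folded i_def]
  interpret I: embedding mem l i using q'(2) by unfold_locales
  have gi: "good i" by (rule good[OF q'(2,3)])
  have fixed: "i $ y = y" if "y \<E> V" "\<not> y \<E> Z" for y using that q'(1-3) q(1) unfolding Z' i_def by blast
  have W': "WO (i $ b) (i $ W)" "i $ x \<E> i $ b" using I.k_WO[OF W(1)] I.k_mem[OF V3(3,1)] W(2) by simp_all
  \<comment> \<open>\<open>i\<close> may move the representation but not the rank. Hence the image
    of \<open>Z\<close>, being the section of \<open>Z3\<close> at the image of the position, has
    the same elements as \<open>Z\<close>.\<close>
  have Fixi: "Fix k (i $ b) (i $ W) (i $ x) \<longleftrightarrow> Fix k b W x" if "Emb k" for k
  proof -
    interpret k: embedding mem l k using that by unfold_locales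
    have "rk (i $ b) (i $ W) (i $ x) = rk b W x" using q'(3) unfolding Fix_def .
    then show ?thesis unfolding Fix_def using k.k_rk[OF W'(1) W(1) W'(2) W(2)] by simp
  qed
  have dZ: "dot i Z = Z"
  proof (rule extensionality)
    fix y
    have cV: "?c \<E> V" using V3 by simp
    have s: "DK i (sing ?c) (sing (i $ ?c))" using I.dot_set[OF V_up[OF cV cV]] I.k_ops(2)[OF cV cV] V_subV[OF V_up[OF cV cV]] by simp
    have "DK i Z3 Z3" using Z3(1) gi unfolding Inv_def by simp
    then have "fo inV inV (DK i) (\<lambda>e. inn Z3 \<langle>?c, e 0\<rangle>) (\<lambda>e. inn Z3 \<langle>i $ ?c, e 0\<rangle>)"
      by (intro fo_inn foT_V_pair[OF foT_V_const] foT_V_var s cV I.k_V)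
    then have "y \<E> dot i Z \<longleftrightarrow> y \<E> V \<and> inn Z3 \<langle>i $ ?c, y\<rangle>" by (rule good_fo[OF gi]) (rule Z)
    also have "\<dots> \<longleftrightarrow> y \<E> V \<and> Mv y (i $ b) (i $ W) (i $ x)"
      using I.k_pair[OF V3(1)] I.k_pair[OF V3(2,3)] V3 Z3m[of "i $ b" "i $ W" "i $ x" y] by auto
    also have "\<dots> \<longleftrightarrow> y \<E> Z" unfolding Z' using Mv[OF W', of y] Fixi by blast
    finally show "y \<E> dot i Z \<longleftrightarrow> y \<E> Z" .
  qed
  have "i $ z = z"
  proof (rule extensionality)
    fix y
    show "y \<E> i $ z \<longleftrightarrow> y \<E> z"
    proof
      assume y: "y \<E> z"
      have yV: "y \<E> V" by (rule V_tran[OF zV y])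
      show "y \<E> i $ z" using I.k_mem[OF yV zV] y fixed[OF yV z(2)[OF y]] by simp
    next
      assume y: "y \<E> i $ z"
      have yV: "y \<E> V" by (rule V_tran[OF I.k_V[OF zV] y])
      \<comment> \<open>The trace of \<open>Z\<close> on \<open>z\<close> is empty, so by
        \<open>dot_local\<close> the image of \<open>Z\<close> has no element in
        \<open>i $ z\<close>.\<close>
      have "dif z (dif z Z) = emp" unfolding eq_emp using z(2) by auto
      then have "\<not> y \<E> dot i Z" using I.dot_local[OF zV y, of Z] by simp
      then have "i $ y = y" using fixed[OF yV] dZ by simp
      then show "y \<E> z" using y I.k_mem[OF yV zV] by simp
    qed
  qed
  then show False using q'(4) by blast
qed

end

theorem theorem3p3:
  fixes mem :: "'a \<Rightarrow> 'a \<Rightarrow> bool" and l j :: 'a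
  assumes "ZF mem"
    and "limit_ordinal mem l"
    and "Sigma1_elementary mem (vset mem l) (vset mem l) j"
    and nontrivial: "\<exists>x. mem x (vset mem l) \<and> app mem j x \<noteq> x"
  shows "\<not> Sigma1_definable_from_parameters mem (J mem (vset mem l)) (restrictions mem l j)"
proof
  interpret ZF mem by fact
  interpret limit_rank mem l by unfold_locales fact
  assume def: "Sigma1_definable_from_parameters mem (J mem (vset mem l)) (restrictions mem l j)"
  have V: "vset mem l = V" by (rule vset_Vs[OF Ord_l])
  have j: "Emb j" using Sigma1_Emb assms(3) unfolding V by blast
  interpret K: embedding mem l j using j by unfold_locales
  obtain x where x: "mem x V" "j $ x \<noteq> x" using nontrivial app_ap[OF K.k_fn] unfolding V by auto
  interpret limit_rank_om mem l by unfold_locales (rule K.nontrivial_om[OF x])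
  have r: "mem y (restrictions mem l j) \<longleftrightarrow> (\<exists>\<alpha>. mem \<alpha> l \<and> y = Rst j (Vs \<alpha>))" for y
  proof -
    have "restrictions mem l j = Coll (\<lambda>y. \<exists>\<alpha>. mem \<alpha> l \<and> y = Rst j (Vs \<alpha>))"
      unfolding restrictions_def using vset_Vs[OF V_ord] by (metis (no_types, lifting))
    moreover have "mem y (Coll (\<lambda>y. \<exists>\<alpha>. mem \<alpha> l \<and> y = Rst j (Vs \<alpha>))) \<longleftrightarrow> (\<exists>\<alpha>. mem \<alpha> l \<and> y = Rst j (Vs \<alpha>))"
      by (rule image_coll) (unfold restr_def, intro D_intros)
    ultimately show ?thesis by simp
  qed
  \<comment> \<open>\<open>Sigma1_ID\<close> concerns subsets of \<open>V\<close>; the restrictions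
    belong to \<open>V\<close> because their domains do.\<close>
  have "restrictions mem l j \<sqsubseteq> V" by (rule subI) (use r Rst_V[OF j Vs_V] in auto)
  from ID_Uni[OF Sigma1_ID[OF this]] def have "ID (Coll (\<lambda>z. mem z V \<and> (\<exists>y. mem y (restrictions mem l j) \<and> mem z y)))"
    unfolding V J_eq by blast
  moreover have "Coll (\<lambda>z. mem z V \<and> (\<exists>y. mem y (restrictions mem l j) \<and> mem z y)) = j"
  proof (rule coll_eq)
    fix z
    show "mem z j \<longleftrightarrow> mem z V \<and> (\<exists>y. mem y (restrictions mem l j) \<and> mem z y)"
    proof
      assume z: "mem z j"
      then obtain u where u: "mem u V" "z = \<langle>u, j $ u\<rangle>" by (rule fn_memE[OF K.k_fn])
      obtain \<alpha> where "mem \<alpha> l" "mem u (Vs \<alpha>)" using u(1) unfolding mem_V by blast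
      then show "mem z V \<and> (\<exists>y. mem y (restrictions mem l j) \<and> mem z y)"
        using u z K.k_V[OF u(1)] unfolding r by (auto simp: Rst_pair)
    next
      assume "mem z V \<and> (\<exists>y. mem y (restrictions mem l j) \<and> mem z y)"
      then show "mem z j" unfolding r using Rst_sub subD by blast
    qed
  qed
  ultimately show False using no_ID_embedding[OF j _ x] by simp
qed

end
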